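(* Let $R>A$ and $\varepsilon\in(0,A)$. Let $U^*\in H^3_N(\Omega)$ satisfy $L(U^* )=0$ in $\Omega$ together with the boundary conditions $U^*=\varphi_0^*$, $\partial_nU^*=\varphi_1^*$ on $S_{bsc}$, $\partial_nU^*=0$ on the lateral faces $\{|x|=A\text{ or }|y|=A,\ z\in(-A,A)\}$ of $\Omega$ and on $S_{tr}$ (exact solution with noiseless data $\varphi_0^*,\varphi_1^*$), and let $F_1^*\in H^3_N(\Omega)$ be a vector function satisfying these same boundary conditions. For $\delta\in(0,1)$ let $F_1\in H^3_N(\Omega)$ satisfy the boundary conditions with noisy data, $F_1=\varphi_0$, $\partial_nF_1=\varphi_1$ on $S_{bsc}$, $\partial_nF_1=0$ on the lateral faces of $\Omega$ and on $S_{tr}$, and assume $$\|F_1-F_1^*\|_{H^2_N(\Omega)}\le\delta .$$ Set $\gamma=\gamma(\delta)=\delta^2$, let $V_{\min,\delta}\in H^3_{0,bsc,N}(\Omega)$ be the (existing and unique) minimizer on $H^3_{0,bsc,N}(\Omega)$ of $$J_{\delta^2}(V)=\int_\Omega|L(V+F_1)|^2\,d\mathbf x+\delta^2\|V\|^2_{H^3_N(\Omega)},$$ and denote $U_{\min,\delta}=V_{\min,\delta}+F_1$. Then there exist a sufficiently small number $\delta_0\in(0,1)$ and a number $\alpha\in(0,1/2)$ such that for all $\delta\in(0,\delta_0)$ $$\|U_{\min,\delta}-U^*\|_{H^2_N(\Omega_\varepsilon)}\le B\left(1+\|U^*\|_{H^3_N(\Omega)}+\|F_1^*\|_{H^3_N(\Omega)}\right)\delta^\alpha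 ,$$ where $\Omega_\varepsilon=\{(x,y,z):-A<x,y<A,\ z\in(-A,A-\varepsilon)\}$ and the constant $B>0$ depends only on $A$, $R$ and the maximum of the $C_{N^2}(\overline\Omega)$-norms of the coefficient matrices of $L$.
   Context: All functions are real valued. Let $A,b,d>0$, let $N>1$ be an integer, and $\Omega=\{\mathbf x=(x,y,z)\in\mathbb R^3:-A<x,y,z<A\}$. Put $S_{bsc}=\{-A<x,y<A,\ z=-A\}$, $S_{tr}=\{-A<x,y<A,\ z=A\}$, $\partial_1\Omega=\partial\Omega\setminus\{z=A\}$; $n$ is the unit normal on the boundary. For a Banach space $Z$, $Z_m$ denotes the space of $m$-vectors $D=(D_1,\dots,D_m)$ with entries in $Z$ and norm $\|D\|_{Z_m}=(\sum_j\|D_j\|_Z^2)^{1/2}$; thus $H^k_N(\Omega)$ is the space of $N$-vector functions with components in $H^k(\Omega)$, and $C_{N^2}(\overline\Omega)$ is the space of $N\times N$ matrix functions with entries in $C(\overline\Omega)$. $$H^3_{0,bsc}(\Omega)=\{u\in H^3(\Omega): u|_{S_{bsc}}=0,\ \partial_nu|_{\partial_1\Omega}=0\},$$ and $H^3_{0,bsc,N}(\Omega)$ is the corresponding space of $N$-vector functions. The operator $L$: let $\Psi_1,\dots,\Psi_N$ be the first $N$ functions obtained by Gram–Schmidt orthonormalization in $L_2(-d,d)$ of the sequence $e^{x_0},x_0e^{x_0},x_0^2e^{x_0},\dots$. The $N\times N$ matrix $M_N=(a_{mn})$, $a_{mn}=\int_{-d}^d\Psi_n'\Psi_m\,dx_0$,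 is invertible. For $\mathbf x\in\overline\Omega$, $x_0\in(-d,d)$ let $\mathbf x_0=(x_0,0,-A-b)$ and $r=(r_1,r_2,r_3)=\mathbf x-\mathbf x_0=(x-x_0,\,y,\,z+A+b)$. Define $N\times N$ matrices $D_j(\mathbf x)$ with entries $$(D_j)_{mn}=-\int_{-d}^d\partial_{x_0}\!\left[\frac{2r_j\Psi_n(x_0)}{|r|^2}\right]\Psi_m(x_0)\,dx_0\ (j=1,2,3),\qquad (D_0)_{mn}=\int_{-d}^d\partial_{x_0}\!\left[\frac{4\Psi_n(x_0)}{|r|^2}\right]\Psi_m(x_0)\,dx_0,$$ and $A_j=M_N^{-1}D_j$, $j=0,1,2,3$; these belong to $C_{N^2}(\overline\Omega)$. For an $N$-vector function $U$, $$L(U)=\Delta U+A_1(\mathbf x)U_x+A_2(\mathbf x)U_y+A_3(\mathbf x)U_z+A_0(\mathbf x)U.$$ *)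

theory Defs
  imports "HOL-Analysis.Analysis" "Jordan_Normal_Form.Gauss_Jordan_Elimination"
begin

no_notation vec_index (infixl "$" 100)

section \<open>Sobolev spaces on subsets of three-dimensional space\<close>

text \<open>Functions on a set \<^term>\<open>S\<close> are represented by total functions whose values outside
  \<^term>\<open>S\<close> are irrelevant. Multi-indices are functions of type \<^typ>\<open>3 \<Rightarrow> nat\<close>; in the type
  \<^typ>\<open>3\<close> the numeral 3 denotes the third coordinate (and equals 0).\<close>

definition partial :: "3 \<Rightarrow> (real^3 \<Rightarrow> real) \<Rightarrow> real^3 \<Rightarrow> real" where
  "partial i f x = deriv (\<lambda>t. f (x + t *\<^sub>R axis i 1)) 0"

fun Ck :: "nat \<Rightarrow> (real^3 \<Rightarrow> real) \<Rightarrow> bool" where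
  "Ck 0 f \<longleftrightarrow> continuous_on UNIV f"
| "Ck (Suc k) f \<longleftrightarrow> f differentiable_on UNIV \<and> (\<forall>i. Ck k (partial i f))"

definition smooth :: "(real^3 \<Rightarrow> real) \<Rightarrow> bool" where
  "smooth f \<longleftrightarrow> (\<forall>k. Ck k f)"

definition order_of :: "(3 \<Rightarrow> nat) \<Rightarrow> nat" where
  "order_of \<alpha> = (\<Sum>i\<in>UNIV. \<alpha> i)"

definition mpartial :: "(3 \<Rightarrow> nat) \<Rightarrow> (real^3 \<Rightarrow> real) \<Rightarrow> real^3 \<Rightarrow> real" where
  "mpartial \<alpha> f = (partial 1 ^^ \<alpha> 1) ((partial 2 ^^ \<alpha> 2) ((partial 3 ^^ \<alpha> 3) f))"

definition test_function :: "(real^3) set \<Rightarrow> (real^3 \<Rightarrow> real) \<Rightarrow> bool" where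
  "test_function S \<phi> \<longleftrightarrow>
     smooth \<phi> \<and> (\<exists>K. compact K \<and> K \<subseteq> S \<and> (\<forall>x. x \<notin> K \<longrightarrow> \<phi> x = 0))"

definition locally_integrable :: "(real^3) set \<Rightarrow> (real^3 \<Rightarrow> real) \<Rightarrow> bool" where
  "locally_integrable S u \<longleftrightarrow> (\<forall>K. compact K \<and> K \<subseteq> S \<longrightarrow> integrable (lebesgue_on K) u)"

definition has_weak_derivative ::
  "(real^3) set \<Rightarrow> (3 \<Rightarrow> nat) \<Rightarrow> (real^3 \<Rightarrow> real) \<Rightarrow> (real^3 \<Rightarrow> real) \<Rightarrow> bool" where
  "has_weak_derivative S \<alpha> u v \<longleftrightarrow>
     locally_integrable S u \<and> locally_integrable S v \<and>
     (\<forall>\<phi>. test_function S \<phi> \<longrightarrow>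
        (LINT x|lebesgue_on S. u x * mpartial \<alpha> \<phi> x) =
        (-1) ^ order_of \<alpha> * (LINT x|lebesgue_on S. v x * \<phi> x))"

text \<open>A representative of the weak derivative, which is unique up to null sets if it exists
  (for open \<^term>\<open>S\<close>).\<close>

definition wderiv ::
  "(real^3) set \<Rightarrow> (3 \<Rightarrow> nat) \<Rightarrow> (real^3 \<Rightarrow> real) \<Rightarrow> real^3 \<Rightarrow> real" where
  "wderiv S \<alpha> u = (SOME v. has_weak_derivative S \<alpha> u v)"

definition dir :: "3 \<Rightarrow> 3 \<Rightarrow> nat" where
  "dir i = (\<lambda>j. if j = i then 1 else 0)"

definition dir2 :: "3 \<Rightarrow> 3 \<Rightarrow> nat" where
  "dir2 i = (\<lambda>j. if j = i then 2 else 0)"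

definition square_integrable :: "'a measure \<Rightarrow> ('a \<Rightarrow> real) \<Rightarrow> bool" where
  "square_integrable M u \<longleftrightarrow> u \<in> borel_measurable M \<and> integrable M (\<lambda>x. (u x)\<^sup>2)"

definition in_H :: "nat \<Rightarrow> (real^3) set \<Rightarrow> (real^3 \<Rightarrow> real) \<Rightarrow> bool" where
  "in_H k S u \<longleftrightarrow> (\<forall>\<alpha>. order_of \<alpha> \<le> k \<longrightarrow>
     (\<exists>v. has_weak_derivative S \<alpha> u v \<and> square_integrable (lebesgue_on S) v))"

definition normH :: "nat \<Rightarrow> (real^3) set \<Rightarrow> (real^3 \<Rightarrow> real) \<Rightarrow> real" where
  "normH k S u = sqrt (\<Sum>\<alpha> | order_of \<alpha> \<le> k. LINT x|lebesgue_on S. (wderiv S \<alpha> u x)\<^sup>2)"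

text \<open>An \<open>N\<close>-vector function is a family of scalar functions with indices below \<open>N\<close>.\<close>

type_synonym vfun = "nat \<Rightarrow> real^3 \<Rightarrow> real"

definition in_HN :: "nat \<Rightarrow> nat \<Rightarrow> (real^3) set \<Rightarrow> vfun \<Rightarrow> bool" where
  "in_HN N k S U \<longleftrightarrow> (\<forall>m<N. in_H k S (U m))"

definition normHN :: "nat \<Rightarrow> nat \<Rightarrow> (real^3) set \<Rightarrow> vfun \<Rightarrow> real" where
  "normHN N k S U = sqrt (\<Sum>m<N. (normH k S (U m))\<^sup>2)"

section \<open>The cube, its faces and traces\<close>

definition cube :: "real \<Rightarrow> (real^3) set" where
  "cube A = {x. \<forall>i. - A < x $ i \<and> x $ i < A}"

definition subcube :: "real \<Rightarrow> real \<Rightarrow> (real^3) set" where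
  "subcube A \<epsilon> = {x \<in> cube A. x $ 3 < A - \<epsilon>}"

definition square :: "real \<Rightarrow> (real^2) set" where
  "square A = {p. \<forall>i. - A < p $ i \<and> p $ i < A}"

text \<open>The pair \<open>(i, s)\<close> with \<open>s = \<plusminus>1\<close> stands for the open face of the cube with outward unit
  normal \<open>s e\<^sub>i\<close>. It is parametrized isometrically by \<^term>\<open>square A\<close>, so that surface measure
  becomes plane Lebesgue measure (indices are added modulo 3). Edges are null sets and play no
  role for traces.\<close>

type_synonym face = "3 \<times> real"

definition face_point :: "real \<Rightarrow> face \<Rightarrow> real^2 \<Rightarrow> real^3" where
  "face_point A F p = (\<chi> j. if j = fst F then snd F * A
     else if j = fst F + 1 then p $ 1 else p $ 2)"

definition S_bsc :: face where "S_bsc = (3, -1)"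
definition S_tr :: face where "S_tr = (3, 1)"
definition lateral :: "face set" where "lateral = {1, 2} \<times> {-1, 1}"

text \<open>The trace operator is the extension by continuity, from smooth functions on the closed cube
  to \<open>H\<^sup>1\<close>, of the restriction to the face with values in \<open>L\<^sup>2\<close> of the face.\<close>

definition has_trace :: "real \<Rightarrow> (real^3 \<Rightarrow> real) \<Rightarrow> face \<Rightarrow> (real^3 \<Rightarrow> real) \<Rightarrow> bool" where
  "has_trace A u F g \<longleftrightarrow>
     in_H 1 (cube A) u \<and>
     square_integrable (lebesgue_on (square A)) (\<lambda>p. g (face_point A F p)) \<and>
     (\<exists>\<phi> :: nat \<Rightarrow> real^3 \<Rightarrow> real. (\<forall>k. smooth (\<phi> k)) \<and>
        (\<lambda>k. normH 1 (cube A) (\<lambda>x. \<phi> k x - u x)) \<longlonglongrightarrow> 0 \<and>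
        (\<lambda>k. LINT p|lebesgue_on (square A).
               (\<phi> k (face_point A F p) - g (face_point A F p))\<^sup>2) \<longlonglongrightarrow> 0)"

definition has_normal_trace ::
  "real \<Rightarrow> (real^3 \<Rightarrow> real) \<Rightarrow> face \<Rightarrow> (real^3 \<Rightarrow> real) \<Rightarrow> bool" where
  "has_normal_trace A u F g \<longleftrightarrow>
     has_trace A (\<lambda>x. snd F * wderiv (cube A) (dir (fst F)) u x) F g"

definition in_H30bsc :: "real \<Rightarrow> (real^3 \<Rightarrow> real) \<Rightarrow> bool" where
  "in_H30bsc A u \<longleftrightarrow> in_H 3 (cube A) u \<and> has_trace A u S_bsc (\<lambda>_. 0) \<and>
     (\<forall>F \<in> insert S_bsc lateral. has_normal_trace A u F (\<lambda>_. 0))"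

definition in_H30bscN :: "real \<Rightarrow> nat \<Rightarrow> vfun \<Rightarrow> bool" where
  "in_H30bscN A N V \<longleftrightarrow> (\<forall>m<N. in_H30bsc A (V m))"

definition boundary_conditions :: "real \<Rightarrow> nat \<Rightarrow> vfun \<Rightarrow> vfun \<Rightarrow> vfun \<Rightarrow> bool" where
  "boundary_conditions A N U \<phi>0 \<phi>1 \<longleftrightarrow> (\<forall>m<N.
     has_trace A (U m) S_bsc (\<phi>0 m) \<and> has_normal_trace A (U m) S_bsc (\<phi>1 m) \<and>
     (\<forall>F \<in> insert S_tr lateral. has_normal_trace A (U m) F (\<lambda>_. 0)))"

section \<open>The operator L\<close>

text \<open>Indices of the orthonormal functions, of vectors and of matrices start from 0.\<close>

definition L2_inner :: "real \<Rightarrow> (real \<Rightarrow> real) \<Rightarrow> (real \<Rightarrow> real) \<Rightarrow> real" where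
  "L2_inner d f g = (LBINT t:{-d<..<d}. f t * g t)"

function Psi :: "real \<Rightarrow> nat \<Rightarrow> real \<Rightarrow> real" where
  "Psi d n =
     (let w = (\<lambda>t. t ^ n * exp t -
                 (\<Sum>k<n. L2_inner d (\<lambda>s. s ^ n * exp s) (Psi d k) * Psi d k t))
      in (\<lambda>t. w t / sqrt (L2_inner d w w)))"
  by pat_completeness auto
termination by (relation "Wellfounded.measure snd") auto

declare Psi.simps [simp del]

definition M_mat :: "real \<Rightarrow> nat \<Rightarrow> real mat" where
  "M_mat d N = Matrix.mat N N (\<lambda>(m, n). LBINT t:{-d<..<d}. deriv (Psi d n) t * Psi d m t)"

definition rvec :: "real \<Rightarrow> real \<Rightarrow> real^3 \<Rightarrow> real \<Rightarrow> real^3" where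
  "rvec A b x t = x - vector [t, 0, - A - b]"

definition D_coeff :: "real \<Rightarrow> real \<Rightarrow> real \<Rightarrow> 3 \<Rightarrow> nat \<Rightarrow> nat \<Rightarrow> real^3 \<Rightarrow> real" where
  "D_coeff A b d j m n x = - (LBINT t:{-d<..<d}.
     deriv (\<lambda>s. 2 * (rvec A b x s $ j) * Psi d n s / (norm (rvec A b x s))\<^sup>2) t * Psi d m t)"

definition D0_coeff :: "real \<Rightarrow> real \<Rightarrow> real \<Rightarrow> nat \<Rightarrow> nat \<Rightarrow> real^3 \<Rightarrow> real" where
  "D0_coeff A b d m n x = (LBINT t:{-d<..<d}.
     deriv (\<lambda>s. 4 * Psi d n s / (norm (rvec A b x s))\<^sup>2) t * Psi d m t)"

definition A_coeff :: "real \<Rightarrow> real \<Rightarrow> real \<Rightarrow> nat \<Rightarrow> 3 \<Rightarrow> nat \<Rightarrow> nat \<Rightarrow> real^3 \<Rightarrow> real" where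
  "A_coeff A b d N j m n x =
     (\<Sum>k<N. the (mat_inverse (M_mat d N)) $$ (m, k) * D_coeff A b d j k n x)"

definition A0_coeff :: "real \<Rightarrow> real \<Rightarrow> real \<Rightarrow> nat \<Rightarrow> nat \<Rightarrow> nat \<Rightarrow> real^3 \<Rightarrow> real" where
  "A0_coeff A b d N m n x =
     (\<Sum>k<N. the (mat_inverse (M_mat d N)) $$ (m, k) * D0_coeff A b d k n x)"

definition L_op :: "real \<Rightarrow> real \<Rightarrow> real \<Rightarrow> nat \<Rightarrow> vfun \<Rightarrow> vfun" where
  "L_op A b d N U m x =
     (\<Sum>i\<in>UNIV. wderiv (cube A) (dir2 i) (U m) x) +
     (\<Sum>j\<in>UNIV. \<Sum>n<N. A_coeff A b d N j m n x * wderiv (cube A) (dir j) (U n) x) +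
     (\<Sum>n<N. A0_coeff A b d N m n x * U n x)"

definition normC_mat ::
  "real \<Rightarrow> nat \<Rightarrow> (nat \<Rightarrow> nat \<Rightarrow> real^3 \<Rightarrow> real) \<Rightarrow> real" where
  "normC_mat A N a = sqrt (\<Sum>m<N. \<Sum>n<N. (SUP x\<in>closure (cube A). \<bar>a m n x\<bar>)\<^sup>2)"

definition coeff_norm :: "real \<Rightarrow> real \<Rightarrow> real \<Rightarrow> nat \<Rightarrow> real" where
  "coeff_norm A b d N = Max (insert (normC_mat A N (A0_coeff A b d N))
     (range (\<lambda>j::3. normC_mat A N (A_coeff A b d N j))))"

definition J_fun :: "real \<Rightarrow> real \<Rightarrow> real \<Rightarrow> nat \<Rightarrow> vfun \<Rightarrow> real \<Rightarrow> vfun \<Rightarrow> real" where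
  "J_fun A b d N F \<gamma> V =
     (LINT x|lebesgue_on (cube A). (\<Sum>m<N. (L_op A b d N (\<lambda>n y. V n y + F n y) m x)\<^sup>2)) +
     \<gamma> * (normHN N 3 (cube A) V)\<^sup>2"

end

theory Submission
  imports Defs
begin

text \<open>The theorem is a quantitative form of unique continuation: data on the bottom face control the
  solution of an elliptic system away from the top face, with a Hoelder modulus.

  The function \<open>V\<^sup>* = U\<^sup>* - F\<^sup>*\<close> is an admissible competitor of the minimizer. Since
  \<open>V\<^sup>* + F = U\<^sup>* + (F - F\<^sup>*)\<close> and \<open>L U\<^sup>* = 0\<close>, its residual \<open>L (V\<^sup>* + F)\<close> is of order \<open>\<delta>\<close>, so the functional with
  the parameter \<open>\<delta>\<^sup>2\<close> is of order \<open>\<delta>\<^sup>2\<close> at \<open>V\<^sup>*\<close> and hence at the minimizer. Both therefore have a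
  residual of order \<open>\<delta>\<close> and a bounded \<open>H\<^sup>3\<close> norm. The difference \<open>q\<close> of the minimizer and \<open>V\<^sup>*\<close> inherits
  the homogeneous boundary conditions on the bottom and the lateral faces, and satisfies \<open>\<parallel>L q\<parallel> = O(\<delta>)\<close>
  and \<open>\<parallel>q\<parallel> = O(1)\<close> in \<open>H\<^sup>3\<close> (\<open>minimizer_error\<close>).

  Such a \<open>q\<close> is estimated by a Carleman inequality for the Laplacian with the weight
  \<open>exp (2\<lambda>\<psi>)\<close>, \<open>\<psi> = z\<^sup>2/2 - 2Az\<close> (\<open>carleman_estimate\<close>). The weight is largest on the bottom face. The
  inequality is proved for \<open>(A - z)\<^sup>2 q\<close> instead of \<open>q\<close>: this factor makes all boundary terms on the top
  face vanish, where \<open>q\<close> satisfies no condition. The inequality is summed over the components, and for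
  large \<open>\<lambda>\<close> the lower order terms of \<open>L\<close> are absorbed where \<open>z\<close> stays away from \<open>A\<close>; in the remaining layer
  the weight is small and the \<open>H\<^sup>3\<close> bound suffices (\<open>system_carleman\<close>). For \<open>\<lambda>\<close> proportional to
  \<open>ln (1/\<delta>)\<close> this bounds the \<open>H\<^sup>1\<close> norm of \<open>q\<close> on a subcube by a power of \<open>\<delta>\<close>.

  The Carleman inequality does not contain second derivatives. They are interpolated between the
  small first and the bounded third derivatives on a slightly smaller subcube
  (\<open>H2_subcube_le_H1\<close>). Since \<open>\<delta>\<^sub>0\<close> and \<open>\<alpha>\<close> may depend on everything but the noisy data, decreasing the
  exponent and \<open>\<delta>\<^sub>0\<close> absorbs all constants (\<open>rate_choice\<close>), so that the estimate holds with \<open>B = 1\<close>.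

  Integration by parts for functions in \<open>H\<^sup>3\<close> is derived from the divergence theorem for smooth
  functions on the cube (\<open>cube_FTC\<close>) and the smooth approximations that the definition of traces
  provides.\<close>

section \<open>Calculus of smooth functions\<close>

lemma partial_eq:
  assumes "(f has_derivative D) (at x)"
  shows "partial i f x = D (axis i 1)"
proof -
  have "((\<lambda>t. f (x + t *\<^sub>R axis i 1)) has_derivative (\<lambda>t. D (t *\<^sub>R axis i 1))) (at 0)"
    by (rule has_derivative_compose[of "\<lambda>t. x + t *\<^sub>R axis i 1" _ 0 UNIV f D, simplified])
       (auto intro!: derivative_eq_intros assms)
  moreover have "D (t *\<^sub>R axis i 1) = D (axis i 1) * t" for t
    using has_derivative_bounded_linear[OF assms] linear_simps(5)[of D t "axis i 1"] by auto
  ultimately have "((\<lambda>t. f (x + t *\<^sub>R axis i 1)) has_real_derivative D (axis i 1)) (at 0)"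
    by (simp add: has_field_derivative_def)
  then show ?thesis unfolding partial_def by (rule DERIV_imp_deriv)
qed

lemma partial_has_real_derivative:
  assumes "\<And>y. f differentiable (at y)"
  shows "((\<lambda>t. f (x + t *\<^sub>R axis i 1)) has_real_derivative partial i f (x + s *\<^sub>R axis i 1)) (at s)"
proof -
  let ?y = "x + s *\<^sub>R axis i 1"
  obtain D where D: "(f has_derivative D) (at ?y)" using assms differentiable_def by blast
  have "((\<lambda>t. f (x + t *\<^sub>R axis i 1)) has_derivative (\<lambda>t. D (t *\<^sub>R axis i 1))) (at s)"
    by (rule has_derivative_compose[of "\<lambda>t. x + t *\<^sub>R axis i 1" _ s UNIV f D, simplified])
       (auto intro!: derivative_eq_intros D)
  moreover have "D (t *\<^sub>R axis i 1) = D (axis i 1) * t" for t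
    using has_derivative_bounded_linear[OF D] linear_simps(5)[of D t "axis i 1"] by auto
  ultimately show ?thesis
    by (simp add: has_field_derivative_def partial_eq[OF D])
qed

lemma partial_const [simp]: "partial i (\<lambda>x. c) = (\<lambda>x. 0)"
  by (rule ext, subst partial_eq[where D = "\<lambda>_. 0"]) auto

lemma partial_add:
  assumes "\<And>x. f differentiable (at x)" "\<And>x. g differentiable (at x)"
  shows "partial i (\<lambda>x. f x + g x) = (\<lambda>x. partial i f x + partial i g x)"
proof
  fix x
  obtain F G where FG: "(f has_derivative F) (at x)" "(g has_derivative G) (at x)"
    using assms differentiable_def by blast
  show "partial i (\<lambda>x. f x + g x) x = partial i f x + partial i g x"
    using partial_eq[OF has_derivative_add[OF FG], of i] partial_eq[OF FG(1), of i]
      partial_eq[OF FG(2), of i] by simp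
qed

lemma partial_mult:
  assumes "\<And>x. f differentiable (at x)" "\<And>x. g differentiable (at x)"
  shows "partial i (\<lambda>x. f x * g x) = (\<lambda>x. partial i f x * g x + f x * partial i g x)"
proof
  fix x
  obtain F G where FG: "(f has_derivative F) (at x)" "(g has_derivative G) (at x)"
    using assms differentiable_def by blast
  show "partial i (\<lambda>x. f x * g x) x = partial i f x * g x + f x * partial i g x"
    using partial_eq[OF has_derivative_mult[OF FG], of i] partial_eq[OF FG(1), of i]
      partial_eq[OF FG(2), of i] by simp
qed

lemma partial_coord: "partial i (\<lambda>x. x $ j) = (\<lambda>x. if j = i then 1 else 0)"
  by (rule ext, subst partial_eq[where D = "\<lambda>x. x $ j"])
     (auto intro!: bounded_linear_imp_has_derivative bounded_linear_vec_nth simp: axis_def)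

lemma Ck_Suc_D: "Ck (Suc k) f \<Longrightarrow> f differentiable (at x)"
  by (simp add: differentiable_on_def)

lemma Ck_mono: "Ck (Suc k) f \<Longrightarrow> Ck k f"
proof (induction k arbitrary: f)
  case 0
  then show ?case by (auto simp: differentiable_imp_continuous_on)
next
  case (Suc k)
  then show ?case by (metis Ck.simps(2))
qed

lemma Ck_const: "Ck k (\<lambda>x. c)"
proof (induction k arbitrary: c)
  case (Suc k)
  then show ?case by (simp)
qed simp

lemma Ck_add: "Ck k f \<Longrightarrow> Ck k g \<Longrightarrow> Ck k (\<lambda>x. f x + g x)"
proof (induction k arbitrary: f g)
  case 0
  then show ?case by (auto intro: continuous_intros)
next
  case (Suc k)
  have eq: "partial i (\<lambda>x. f x + g x) = (\<lambda>x. partial i f x + partial i g x)" for i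
    using Suc.prems by (intro partial_add) (auto intro: Ck_Suc_D simp del: Ck.simps)
  moreover have "Ck k (\<lambda>x. partial i f x + partial i g x)" for i
    using Suc.prems by (intro Suc.IH) auto
  ultimately show ?case using Suc.prems unfolding Ck.simps(2) eq
    by (blast intro: differentiable_on_add)
qed

lemma Ck_mult: "Ck k f \<Longrightarrow> Ck k g \<Longrightarrow> Ck k (\<lambda>x. f x * g x)"
proof (induction k arbitrary: f g)
  case 0
  then show ?case by (auto intro: continuous_intros)
next
  case (Suc k)
  have eq: "partial i (\<lambda>x. f x * g x) = (\<lambda>x. partial i f x * g x + f x * partial i g x)" for i
    using Suc.prems by (intro partial_mult) (auto intro: Ck_Suc_D simp del: Ck.simps)
  moreover have "Ck k (\<lambda>x. partial i f x * g x + f x * partial i g x)" for i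
    using Suc.prems Ck_mono[of k f] Ck_mono[of k g] by (intro Ck_add Suc.IH) auto
  ultimately show ?case using Suc.prems unfolding Ck.simps(2) eq
    by (blast intro: differentiable_on_mult)
qed

lemma smooth_const [intro!, simp]: "smooth (\<lambda>x. c)"
  by (simp add: smooth_def Ck_const)

lemma smooth_add [intro!]: "smooth f \<Longrightarrow> smooth g \<Longrightarrow> smooth (\<lambda>x. f x + g x)"
  by (simp add: smooth_def Ck_add)

lemma smooth_mult [intro!]: "smooth f \<Longrightarrow> smooth g \<Longrightarrow> smooth (\<lambda>x. f x * g x)"
  by (simp add: smooth_def Ck_mult)

lemma smooth_minus [intro!]: "smooth f \<Longrightarrow> smooth (\<lambda>x. - f x)"
  using smooth_mult[OF smooth_const[of "-1"]] by simp

lemma smooth_diff [intro!]: "smooth f \<Longrightarrow> smooth g \<Longrightarrow> smooth (\<lambda>x. f x - g x)"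
  using smooth_add[OF _ smooth_minus] by fastforce

lemma smooth_power [intro!]: "smooth f \<Longrightarrow> smooth (\<lambda>x. f x ^ n)"
  by (induction n) auto

lemma smooth_prod: "(\<And>i. i \<in> I \<Longrightarrow> smooth (f i)) \<Longrightarrow> smooth (\<lambda>x. \<Prod>i\<in>I. f i x)"
  by (induction I rule: infinite_finite_induct) auto

lemma smooth_partial [intro!]: "smooth f \<Longrightarrow> smooth (partial i f)"
  unfolding smooth_def by (metis Ck.simps(2))

lemma smooth_differentiable: "smooth f \<Longrightarrow> f differentiable (at x)"
  unfolding smooth_def using Ck_Suc_D by blast

lemma smooth_continuous: "smooth f \<Longrightarrow> continuous_on S f"
  unfolding smooth_def by (metis Ck.simps(1) continuous_on_subset subset_UNIV)

lemma smooth_measurable [intro!]: "smooth f \<Longrightarrow> f \<in> borel_measurable borel"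
  by (intro borel_measurable_continuous_onI smooth_continuous)

lemma smooth_linear: "bounded_linear f \<Longrightarrow> smooth f"
  unfolding smooth_def
proof
  fix k assume f: "bounded_linear f"
  have "partial i f = (\<lambda>_. f (axis i 1))" for i
    by (rule ext, rule partial_eq) (rule bounded_linear_imp_has_derivative[OF f])
  with f show "Ck k f"
    by (cases k) (auto simp: Ck_const linear_continuous_on bounded_linear_imp_differentiable_on)
qed

lemma smooth_coord [intro!, simp]: "smooth (\<lambda>x. x $ j)"
  by (intro smooth_linear bounded_linear_vec_nth)

lemma partial_scale: "smooth f \<Longrightarrow> partial i (\<lambda>x. c * f x) = (\<lambda>x. c * partial i f x)"
  using partial_mult[of "\<lambda>x. c" f] by (simp add: smooth_differentiable)

lemma partial_smooth_add: "smooth f \<Longrightarrow> smooth g \<Longrightarrow> partial i (\<lambda>x. f x + g x) = (\<lambda>x. partial i f x + partial i g x)"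
  by (intro partial_add smooth_differentiable)

lemma partial_smooth_mult: "smooth f \<Longrightarrow> smooth g \<Longrightarrow>
  partial i (\<lambda>x. f x * g x) = (\<lambda>x. partial i f x * g x + f x * partial i g x)"
  by (intro partial_mult smooth_differentiable)

lemma partial_smooth_diff: "smooth f \<Longrightarrow> smooth g \<Longrightarrow> partial i (\<lambda>x. f x - g x) = (\<lambda>x. partial i f x - partial i g x)"
  using partial_smooth_add[of f "\<lambda>x. - 1 * g x" i] partial_scale[of g i "- 1"]
  by (auto simp: smooth_minus)

lemma partial_compose:
  assumes "\<And>t. (F has_real_derivative F' t) (at t)" "smooth f"
  shows "partial i (\<lambda>x. F (f x)) = (\<lambda>x. F' (f x) * partial i f x)"
proof
  fix x
  obtain D where D: "(f has_derivative D) (at x)" 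
    using smooth_differentiable[OF assms(2)] differentiable_def by blast
  show "partial i (\<lambda>x. F (f x)) x = F' (f x) * partial i f x"
    using has_derivative_compose[OF D assms(1)[unfolded has_field_derivative_def]]
    by (simp add: partial_eq partial_eq[OF D])
qed

lemma smooth_compose:
  assumes F: "\<And>n t. (F n has_real_derivative F (Suc n) t) (at t)" and f: "smooth f"
  shows "smooth (\<lambda>x. F n (f x))"
  unfolding smooth_def
proof
  fix k show "Ck k (\<lambda>x. F n (f x))"
  proof (induction k arbitrary: n)
    case 0
    have "continuous_on UNIV (F n)" using F DERIV_isCont continuous_at_imp_continuous_on by blast
    then show ?case using continuous_on_compose2[OF _ smooth_continuous[OF f], of UNIV "F n" UNIV] by simp
  next
    case (Suc k)
    have "partial i (\<lambda>x. F n (f x)) = (\<lambda>x. F (Suc n) (f x) * partial i f x)" for i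
      by (rule partial_compose[OF F f])
    moreover have "Ck k (\<lambda>x. F (Suc n) (f x) * partial i f x)" for i
      using smooth_partial[OF f] by (intro Ck_mult Suc) (simp add: smooth_def)
    moreover have "(\<lambda>x. F n (f x)) differentiable (at x)" for x
      using differentiable_compose[OF _ smooth_differentiable[OF f], of "F n"] F
      by (meson field_differentiable_def field_differentiable_imp_differentiable real_differentiable_def)
    ultimately show ?case by (simp add: differentiable_on_def)
  qed
qed

lemma smooth_exp [intro!]: "smooth f \<Longrightarrow> smooth (\<lambda>x. exp (f x))"
  by (rule smooth_compose[where F = "\<lambda>n. exp"]) auto

lemma smooth_real_polynomial_function: "real_polynomial_function f \<Longrightarrow> smooth f"
  by (induction rule: real_polynomial_function.induct) (auto intro: smooth_linear)

lemma partial_translate: "partial i (\<lambda>x. f (x + a)) = (\<lambda>x. partial i f (x + a))"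
  by (auto simp: partial_def add_ac)

lemma smooth_translate: "smooth f \<Longrightarrow> smooth (\<lambda>x. f (x + a))"
  unfolding smooth_def
proof
  fix k assume "\<forall>k. Ck k f"
  then have "Ck k f" by blast
  then show "Ck k (\<lambda>x. f (x + a))"
  proof (induction k arbitrary: f)
    case 0
    then show ?case by (auto intro!: continuous_on_compose2[of UNIV f] continuous_intros)
  next
    case (Suc k)
    then have "(\<lambda>x. f (x + a)) differentiable (at x)" for x
      by (intro differentiable_compose[of f "\<lambda>x. x + a"] Ck_Suc_D[of k]) auto
    with Suc show ?case by (auto simp: partial_translate differentiable_on_def)
  qed
qed

text \<open>Both mixed derivatives are the limit of the same second difference quotient, by two
  applications of the mean value theorem in either order.\<close>

lemma second_difference:
  assumes f: "smooth f" and h: "h > (0::real)"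
  shows "\<exists>s\<in>{0..h}. \<exists>t\<in>{0..h}.
    f (x + h *\<^sub>R axis i 1 + h *\<^sub>R axis j 1) - f (x + h *\<^sub>R axis i 1) - f (x + h *\<^sub>R axis j 1) + f x
    = h\<^sup>2 * partial j (partial i f) (x + s *\<^sub>R axis i 1 + t *\<^sub>R axis j 1)"
proof -
  define g where "g y = f (y + h *\<^sub>R axis j 1) - f y" for y
  have g: "smooth g" unfolding g_def using smooth_translate[OF f] f by auto
  have pg: "partial i g y = partial i f (y + h *\<^sub>R axis j 1) - partial i f y" for y
    unfolding g_def using smooth_translate[OF f] f by (subst partial_smooth_diff) (auto simp: partial_translate)
  have "\<exists>s. 0 < s \<and> s < h \<and> g (x + h *\<^sub>R axis i 1) - g (x + 0 *\<^sub>R axis i 1)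
      = (h - 0) * partial i g (x + s *\<^sub>R axis i 1)"
    by (rule MVT2[OF h]) (rule partial_has_real_derivative[OF smooth_differentiable[OF g]])
  then obtain s where s: "0 < s" "s < h" "g (x + h *\<^sub>R axis i 1) - g x = h * partial i g (x + s *\<^sub>R axis i 1)"
    by auto
  let ?y = "x + s *\<^sub>R axis i 1"
  have "\<exists>t. 0 < t \<and> t < h \<and> partial i f (?y + h *\<^sub>R axis j 1) - partial i f (?y + 0 *\<^sub>R axis j 1)
      = (h - 0) * partial j (partial i f) (?y + t *\<^sub>R axis j 1)"
    by (rule MVT2[OF h]) (rule partial_has_real_derivative[OF smooth_differentiable[OF smooth_partial[OF f]]])
  then obtain t where t: "0 < t" "t < h" "partial i g ?y = h * partial j (partial i f) (?y + t *\<^sub>R axis j 1)"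
    by (auto simp: pg)
  have "g (x + h *\<^sub>R axis i 1) - g x = h\<^sup>2 * partial j (partial i f) (?y + t *\<^sub>R axis j 1)"
    using s t by (simp add: power2_eq_square)
  with s t show ?thesis unfolding g_def by (intro bexI[of _ s] bexI[of _ t]) (auto simp: algebra_simps)
qed

lemma second_difference_limit:
  assumes f: "smooth f"
  shows "((\<lambda>h. (f (x + h *\<^sub>R axis i 1 + h *\<^sub>R axis j 1) - f (x + h *\<^sub>R axis i 1)
     - f (x + h *\<^sub>R axis j 1) + f x) / h\<^sup>2) \<longlongrightarrow> partial j (partial i f) x) (at_right 0)"
  (is "(?Q \<longlongrightarrow> _) _")
proof (rule tendstoI)
  fix e :: real assume e: "e > 0"
  have "isCont (partial j (partial i f)) x"
    using smooth_continuous[of "partial j (partial i f)" UNIV] f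
    by (auto simp: continuous_on_eq_continuous_at)
  then obtain d where d: "d > 0" "\<And>y. dist y x < d \<Longrightarrow> dist (partial j (partial i f) y) (partial j (partial i f) x) < e"
    using e unfolding continuous_at_eps_delta by blast
  have "dist (?Q h) (partial j (partial i f) x) < e" if h: "0 < h" "h < d/2" for h
  proof -
    obtain s t where st: "s \<in> {0..h}" "t \<in> {0..h}"
      "f (x + h *\<^sub>R axis i 1 + h *\<^sub>R axis j 1) - f (x + h *\<^sub>R axis i 1) - f (x + h *\<^sub>R axis j 1) + f x
    = h\<^sup>2 * partial j (partial i f) (x + s *\<^sub>R axis i 1 + t *\<^sub>R axis j 1)"
      using second_difference[OF f h(1)] by blast
    have "norm (s *\<^sub>R axis i 1 + t *\<^sub>R axis j (1::real) :: real^3) \<le> s + t"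
      using norm_triangle_ineq[of "s *\<^sub>R axis i (1::real) :: real^3" "t *\<^sub>R axis j 1"] st by simp
    then have "dist (x + s *\<^sub>R axis i 1 + t *\<^sub>R axis j 1) x < d"
      using st h by (simp add: dist_norm add.assoc)
    from d(2)[OF this] show ?thesis using st h by simp
  qed
  then show "\<forall>\<^sub>F h in at_right 0. dist (?Q h) (partial j (partial i f) x) < e"
    unfolding eventually_at_right_field by (intro exI[of _ "d/2"]) (use d in auto)
qed

lemma partial_commute:
  assumes f: "smooth f"
  shows "partial i (partial j f) = partial j (partial i f)"
proof
  fix x
  have "((\<lambda>h. (f (x + h *\<^sub>R axis i 1 + h *\<^sub>R axis j 1) - f (x + h *\<^sub>R axis i 1)
     - f (x + h *\<^sub>R axis j 1) + f x) / h\<^sup>2) \<longlongrightarrow> partial i (partial j f) x) (at_right 0)"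
    using second_difference_limit[OF f, of x j i] by (simp add: algebra_simps)
  then show "partial i (partial j f) x = partial j (partial i f) x"
    using second_difference_limit[OF f, of x i j] tendsto_unique[OF trivial_limit_at_right_real] by blast
qed

lemma smooth_funpow_partial: "smooth f \<Longrightarrow> smooth ((partial i ^^ n) f)"
  by (induction n) auto

lemma funpow_partial_commute: "smooth f \<Longrightarrow> (partial i ^^ n) (partial j f) = partial j ((partial i ^^ n) f)"
  by (induction n) (auto simp: partial_commute smooth_funpow_partial)

lemma mpartial_zero [simp]: "mpartial (\<lambda>_. 0) f = f"
  by (simp add: mpartial_def)

lemma mpartial_upd:
  assumes "smooth f"
  shows "mpartial (\<alpha>(i := Suc (\<alpha> i))) f = mpartial \<alpha> (partial i f)"
  using exhaust_3[of i] assms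
  by (auto simp: mpartial_def funpow_partial_commute smooth_funpow_partial)

lemma order_of_upd: "order_of (\<alpha>(i := Suc (\<alpha> i))) = Suc (order_of \<alpha>)"
proof -
  have "order_of (\<alpha>(i := Suc (\<alpha> i))) = (\<Sum>j\<in>UNIV. \<alpha> j + (if j = i then 1 else 0))"
    unfolding order_of_def by (rule sum.cong) auto
  then show ?thesis by (simp add: sum.distrib order_of_def)
qed

lemma order_of_zero [simp]: "order_of (\<lambda>_. 0) = 0"
  by (simp add: order_of_def)

lemma dir_upd: "dir i = (\<lambda>_. 0)(i := Suc 0)"
  by (auto simp: dir_def)

lemma dir2_upd: "dir2 i = (dir i)(i := Suc (dir i i))"
  by (auto simp: dir_def dir2_def)

lemma order_dir [simp]: "order_of (dir i) = 1" "order_of (dir2 i) = 2"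
  using order_of_upd[of "\<lambda>_. 0" i] order_of_upd[of "dir i" i] by (simp_all add: dir_upd[symmetric] dir2_upd)

lemma mpartial_dir: "smooth f \<Longrightarrow> mpartial (dir i) f = partial i f"
  using mpartial_upd[of f "\<lambda>_. 0" i] by (simp add: dir_upd)

lemma order_0_iff: "order_of \<alpha> = 0 \<longleftrightarrow> \<alpha> = (\<lambda>_. 0)"
  by (auto simp: order_of_def)

lemma order_Suc_cases:
  assumes "order_of \<alpha> = Suc n"
  obtains i \<beta> where "\<alpha> = \<beta>(i := Suc (\<beta> i))" "order_of \<beta> = n"
proof -
  have "\<alpha> \<noteq> (\<lambda>_. 0)" using assms by auto
  then obtain i where i: "\<alpha> i \<noteq> 0" by auto
  define \<beta> where "\<beta> = \<alpha>(i := \<alpha> i - 1)"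
  have a: "\<alpha> = \<beta>(i := Suc (\<beta> i))" using i by (auto simp: \<beta>_def)
  then have "order_of \<beta> = n" using order_of_upd[of \<beta> i] assms by simp
  with a that show ?thesis by blast
qed

lemma finite_orders [simp]: "finite {\<alpha>. order_of \<alpha> \<le> k}"
proof (rule finite_subset)
  show "{\<alpha>. order_of \<alpha> \<le> k} \<subseteq> Pi\<^sub>E UNIV (\<lambda>_. {..k})"
    by (auto simp: order_of_def PiE_UNIV_domain) (metis (no_types, lifting) UNIV_I finite le_trans member_le_sum zero_le)
  show "finite (Pi\<^sub>E (UNIV::3 set) (\<lambda>_. {..k}))" by (intro finite_PiE) auto
qed

section \<open>Square integrable functions\<close>

lemma sqi_measurable: "square_integrable M f \<Longrightarrow> f \<in> borel_measurable M"
  and sqi_integrable: "square_integrable M f \<Longrightarrow> integrable M (\<lambda>x. (f x)\<^sup>2)"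
  by (auto simp: square_integrable_def)

lemma sqi_mult:
  assumes "square_integrable M f" "square_integrable M g"
  shows "integrable M (\<lambda>x. f x * g x)"
proof (rule Bochner_Integration.integrable_bound)
  show "integrable M (\<lambda>x. (f x)\<^sup>2 + (g x)\<^sup>2)" using assms by (auto simp: square_integrable_def)
  show "(\<lambda>x. f x * g x) \<in> borel_measurable M" using assms by (auto simp: square_integrable_def)
  have "\<bar>u * v\<bar> \<le> u\<^sup>2 + v\<^sup>2" for u v :: real
    using sum_squares_bound[of "\<bar>u\<bar>" "\<bar>v\<bar>"] mult_nonneg_nonneg[of "\<bar>u\<bar>" "\<bar>v\<bar>"]
    unfolding abs_mult by (simp only: power2_abs) linarith
  then show "AE x in M. norm (f x * g x) \<le> norm ((f x)\<^sup>2 + (g x)\<^sup>2)" by (intro AE_I2) (auto simp: order_trans[OF _ abs_ge_self])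
qed

lemma sqi_cmult: "square_integrable M f \<Longrightarrow> square_integrable M (\<lambda>x. c * f x)"
  by (auto simp: square_integrable_def power_mult_distrib)

lemma sqi_add:
  assumes "square_integrable M f" "square_integrable M g"
  shows "square_integrable M (\<lambda>x. f x + g x)"
  using sqi_mult[OF assms] assms by (auto simp: square_integrable_def power2_sum mult.assoc)

lemma sqi_minus: "square_integrable M f \<Longrightarrow> square_integrable M (\<lambda>x. - f x)"
  using sqi_cmult[of M f "-1"] by simp

lemma sqi_diff:
  "square_integrable M f \<Longrightarrow> square_integrable M g \<Longrightarrow> square_integrable M (\<lambda>x. f x - g x)"
  using sqi_add[OF _ sqi_minus] by fastforce

lemma sqi_zero [simp]: "square_integrable M (\<lambda>x. 0)"
  by (simp add: square_integrable_def)

lemma sqi_sum: "(\<And>i. i \<in> I \<Longrightarrow> square_integrable M (f i)) \<Longrightarrow> square_integrable M (\<lambda>x. \<Sum>i\<in>I. f i x)"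
  by (induction I rule: infinite_finite_induct) (auto intro: sqi_add)

lemma sqi_bounded_mult:
  assumes f: "square_integrable M f" and h: "h \<in> borel_measurable M" "\<And>x. x \<in> space M \<Longrightarrow> \<bar>h x\<bar> \<le> C"
  shows "square_integrable M (\<lambda>x. h x * f x)"
  unfolding square_integrable_def
proof
  show "(\<lambda>x. h x * f x) \<in> borel_measurable M" using f h by (auto simp: square_integrable_def)
  show "integrable M (\<lambda>x. (h x * f x)\<^sup>2)"
  proof (rule Bochner_Integration.integrable_bound)
    show "integrable M (\<lambda>x. C\<^sup>2 * (f x)\<^sup>2)" using f by (auto simp: square_integrable_def)
    have "(h x * f x)\<^sup>2 \<le> C\<^sup>2 * (f x)\<^sup>2" if "x \<in> space M" for x
      using power_mono[OF h(2)[OF that], of 2] by (auto simp: power_mult_distrib intro: mult_right_mono)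
    then show "AE x in M. norm ((h x * f x)\<^sup>2) \<le> norm (C\<^sup>2 * (f x)\<^sup>2)" by (intro AE_I2) auto
  qed (use f h in \<open>auto simp: square_integrable_def\<close>)
qed

lemma sqi_AE_cong:
  assumes "AE x in M. f x = g x" "g \<in> borel_measurable M" "square_integrable M f"
  shows "square_integrable M g" "(LINT x|M. (g x)\<^sup>2) = (LINT x|M. (f x)\<^sup>2)"
proof -
  have ae: "AE x in M. (f x)\<^sup>2 = (g x)\<^sup>2" using assms(1) by eventually_elim simp
  show "(LINT x|M. (g x)\<^sup>2) = (LINT x|M. (f x)\<^sup>2)"
    using assms ae by (intro integral_cong_AE) (auto simp: square_integrable_def)
  show "square_integrable M g"
    using assms ae integrable_cong_AE[of "\<lambda>x. (f x)\<^sup>2" M "\<lambda>x. (g x)\<^sup>2"]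
    by (auto simp: square_integrable_def)
qed

lemma sqi_norm_add:
  assumes "square_integrable M f" "square_integrable M g"
  shows "(LINT x|M. (f x + g x)\<^sup>2) \<le> 2 * (LINT x|M. (f x)\<^sup>2) + 2 * (LINT x|M. (g x)\<^sup>2)"
proof -
  have "(LINT x|M. (f x + g x)\<^sup>2) \<le> (LINT x|M. 2 * (f x)\<^sup>2 + 2 * (g x)\<^sup>2)"
  proof (rule integral_mono)
    show "integrable M (\<lambda>x. (f x + g x)\<^sup>2)" using sqi_add[OF assms] by (rule sqi_integrable)
    show "integrable M (\<lambda>x. 2 * (f x)\<^sup>2 + 2 * (g x)\<^sup>2)" using assms by (auto simp: square_integrable_def)
    show "(f x + g x)\<^sup>2 \<le> 2 * (f x)\<^sup>2 + 2 * (g x)\<^sup>2" for x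
      using sum_squares_bound[of "f x" "g x"] by (simp add: power2_sum)
  qed
  then show ?thesis using assms by (simp add: square_integrable_def)
qed

lemma sqi_Cauchy_Schwarz:
  assumes f: "square_integrable M f" and g: "square_integrable M g"
  shows "\<bar>LINT x|M. f x * g x\<bar> \<le> sqrt (LINT x|M. (f x)\<^sup>2) * sqrt (LINT x|M. (g x)\<^sup>2)"
proof -
  let ?a = "LINT x|M. (f x)\<^sup>2" and ?b = "LINT x|M. f x * g x" and ?c = "LINT x|M. (g x)\<^sup>2"
  note I = sqi_mult[OF f g] sqi_integrable[OF f] sqi_integrable[OF g]
  have nn: "?a \<ge> 0" "?c \<ge> 0" by auto
  \<comment> \<open>The quadratic polynomial \<open>t \<mapsto> \<integral> (t f + g)\<^sup>2\<close> is nonnegative.\<close>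
  have q: "0 \<le> t\<^sup>2 * ?a + 2 * t * ?b + ?c" for t
  proof -
    have "0 \<le> (LINT x|M. (t * f x + g x)\<^sup>2)" by simp
    also have "\<dots> = (LINT x|M. t\<^sup>2 * (f x)\<^sup>2 + 2 * t * (f x * g x) + (g x)\<^sup>2)"
      by (simp add: power2_eq_square algebra_simps)
    also have "\<dots> = t\<^sup>2 * ?a + 2 * t * ?b + ?c" using I by simp
    finally show ?thesis .
  qed
  have "?b\<^sup>2 \<le> ?a * ?c"
  proof (cases "?a = 0")
    case True
    have "?b = 0"
    proof (rule ccontr)
      assume b: "?b \<noteq> 0"
      have "0 \<le> 2 * (- (?c + 1) / (2 * ?b)) * ?b + ?c" using q[of "- (?c + 1) / (2 * ?b)"] True by simp
      with b show False by (simp add: field_simps)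
    qed
    then show ?thesis using nn by simp
  next
    case False
    then have "?a > 0" using nn by linarith
    then show ?thesis using q[of "- ?b / ?a"] by (simp add: power2_eq_square field_simps)
  qed
  then have "sqrt (?b\<^sup>2) \<le> sqrt (?a * ?c)" by (rule real_sqrt_le_mono)
  then show ?thesis by (simp add: real_sqrt_mult)
qed

lemma sqi_tendsto_mult:
  assumes fk: "\<And>k. square_integrable M (f k)" and f: "square_integrable M F" and g: "square_integrable M g"
    and lim: "(\<lambda>k. LINT x|M. (f k x - F x)\<^sup>2) \<longlonglongrightarrow> 0"
  shows "(\<lambda>k. LINT x|M. f k x * g x) \<longlonglongrightarrow> (LINT x|M. F x * g x)"
proof -
  have "(\<lambda>k. sqrt (LINT x|M. (f k x - F x)\<^sup>2) * sqrt (LINT x|M. (g x)\<^sup>2)) \<longlonglongrightarrow> 0"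
    using tendsto_mult_left_zero[OF tendsto_real_sqrt[OF lim, simplified]] by simp
  then have "(\<lambda>k. (LINT x|M. f k x * g x) - (LINT x|M. F x * g x)) \<longlonglongrightarrow> 0"
  proof (rule Lim_null_comparison[rotated], intro always_eventually allI)
    fix k
    have "(LINT x|M. f k x * g x) - (LINT x|M. F x * g x) = (LINT x|M. (f k x - F x) * g x)"
      using sqi_mult[OF fk g] sqi_mult[OF f g] by (simp add: left_diff_distrib)
    then show "norm ((LINT x|M. f k x * g x) - (LINT x|M. F x * g x))
      \<le> sqrt (LINT x|M. (f k x - F x)\<^sup>2) * sqrt (LINT x|M. (g x)\<^sup>2)"
      using sqi_Cauchy_Schwarz[OF sqi_diff[OF fk f] g] by simp
  qed
  then show ?thesis by (simp add: LIM_zero_iff)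
qed

section \<open>Bump functions and density of test functions\<close>

text \<open>The family \<open>P(1/t) exp(-1/t)\<close>, extended by zero to \<open>t \<le> 0\<close>, is closed under
  differentiation; this makes its members smooth.\<close>

definition flat :: "real poly \<Rightarrow> real \<Rightarrow> real" where
  "flat p t = (if t > 0 then poly p (1/t) * exp (- (1/t)) else 0)"

lemma poly_mult_exp_tendsto_0: "((\<lambda>s. poly p s / exp s) \<longlongrightarrow> (0::real)) at_top"
proof -
  have "((\<lambda>s. \<Sum>i\<le>degree p. coeff p i * (s ^ i / exp s)) \<longlongrightarrow> (\<Sum>i\<le>degree p. coeff p i * 0)) at_top"
    by (intro tendsto_sum tendsto_mult tendsto_const tendsto_power_div_exp_0)
  then show ?thesis by (simp add: poly_altdef sum_divide_distrib)
qed

lemma flat_has_derivative: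
  "(flat p has_real_derivative flat ([:0,0,1:] * (p - pderiv p)) t) (at t)"
proof (cases "t = 0")
  case False
  show ?thesis
  proof (cases "t > 0")
    case True
    have "((\<lambda>t. poly p (1/t) * exp (- (1/t))) has_real_derivative flat ([:0,0,1:] * (p - pderiv p)) t) (at t)"
      unfolding flat_def using True
      by (auto intro!: derivative_eq_intros DERIV_chain2[OF poly_DERIV] simp: field_simps power2_eq_square)
    moreover have "eventually (\<lambda>s. s \<in> {0<..}) (nhds t)"
      by (rule eventually_nhds_in_open) (use True in auto)
    then have "eventually (\<lambda>s. flat p s = poly p (1/s) * exp (- (1/s))) (nhds t)"
      by eventually_elim (auto simp: flat_def)
    then have "(flat p has_real_derivative D) (at t) \<longleftrightarrow>
        ((\<lambda>t. poly p (1/t) * exp (- (1/t))) has_real_derivative D) (at t)" for D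
      by (rule DERIV_cong_ev[OF refl _ refl])
    ultimately show ?thesis by simp
  next
    case False
    have "eventually (\<lambda>s. s \<in> {..<0}) (nhds t)"
      by (rule eventually_nhds_in_open) (use False \<open>t \<noteq> 0\<close> in auto)
    then have "eventually (\<lambda>s. flat p s = 0) (nhds t)"
      by eventually_elim (auto simp: flat_def)
    then have "(flat p has_real_derivative 0) (at t) \<longleftrightarrow> ((\<lambda>t. 0) has_real_derivative 0) (at t)"
      by (rule DERIV_cong_ev[OF refl _ refl])
    with False show ?thesis by (simp add: flat_def)
  qed
next
  case True
  have "((\<lambda>h. flat p h / h) \<longlongrightarrow> 0) (at_right 0)"
  proof -
    have "((\<lambda>s. poly ([:0,1:] * p) s / exp s) \<longlongrightarrow> 0) at_top" by (rule poly_mult_exp_tendsto_0)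
    then have "((\<lambda>h. poly ([:0,1:] * p) (inverse h) / exp (inverse h)) \<longlongrightarrow> 0) (at_right 0)"
      by (rule filterlim_compose[OF _ filterlim_inverse_at_top_right])
    moreover have "eventually (\<lambda>h. poly ([:0,1:] * p) (inverse h) / exp (inverse h) = flat p h / h) (at_right 0)"
      unfolding eventually_at_right_field
      by (intro exI[of _ 1]) (auto simp: flat_def exp_minus field_simps)
    ultimately show ?thesis by (rule Lim_transform_eventually)
  qed
  moreover have "((\<lambda>h. flat p h / h) \<longlongrightarrow> 0) (at_left 0)"
  proof -
    have "eventually (\<lambda>h. 0 = flat p h / h) (at_left 0)"
      unfolding eventually_at_left_field by (intro exI[of _ "-1"]) (auto simp: flat_def)
    then show ?thesis by (rule Lim_transform_eventually[OF tendsto_const])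
  qed
  ultimately have "((\<lambda>h. flat p h / h) \<longlongrightarrow> 0) (at 0)" by (simp add: filterlim_at_split)
  then show ?thesis using True by (simp add: DERIV_def flat_def)
qed

lemma smooth_flat: "smooth f \<Longrightarrow> smooth (\<lambda>x. flat p (f x))"
  using smooth_compose[where F = "\<lambda>n. flat (((\<lambda>p. [:0,0,1:] * (p - pderiv p)) ^^ n) p)" and n = 0, of f]
    flat_has_derivative by simp

lemma flat_1: "flat 1 t = (if t > 0 then exp (- (1/t)) else 0)"
  by (simp add: flat_def)

text \<open>Products of flat functions that vanish off a compact \<open>core\<close> of the box and tend to 1 pointwise in
  the box: multiplication with them turns smooth functions into test functions.\<close>

definition bump :: "real^3 \<Rightarrow> real^3 \<Rightarrow> nat \<Rightarrow> real^3 \<Rightarrow> real" where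
  "bump a b n x = (\<Prod>i\<in>UNIV. flat 1 (real (Suc n) * (x $ i - a $ i) - 1) * flat 1 (real (Suc n) * (b $ i - x $ i) - 1))"

definition core :: "real^3 \<Rightarrow> real^3 \<Rightarrow> nat \<Rightarrow> (real^3) set" where
  "core a b n = cbox (\<chi> i. a $ i + 1 / real (Suc n)) (\<chi> i. b $ i - 1 / real (Suc n))"

lemma core: "compact (core a b n)" "core a b n \<subseteq> box a b"
proof -
  show "core a b n \<subseteq> box a b"
  proof
    fix x assume x: "x \<in> core a b n"
    have "a $ i < x $ i \<and> x $ i < b $ i" for i
    proof -
      have "a $ i + 1 / real (Suc n) \<le> x $ i" "x $ i \<le> b $ i - 1 / real (Suc n)"
        using x by (auto simp: core_def mem_box_cart)
      moreover have "1 / real (Suc n) > 0" by simp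
      ultimately show ?thesis by linarith
    qed
    then show "x \<in> box a b" by (auto simp: mem_box_cart)
  qed
qed (auto simp: core_def)

lemma bump_smooth: "smooth (bump a b n)"
  unfolding bump_def[abs_def] by (intro smooth_prod smooth_mult smooth_flat smooth_diff smooth_const smooth_coord)

lemma flat_1_bounds: "0 \<le> flat 1 t" "flat 1 t \<le> 1"
  by (auto simp: flat_1)

lemma bump_bounds: "0 \<le> bump a b n x" "bump a b n x \<le> 1"
  unfolding bump_def by (auto intro!: prod_nonneg prod_le_1 mult_nonneg_nonneg mult_le_one flat_1_bounds)

lemma bump_outside: assumes "x \<notin> core a b n" shows "bump a b n x = 0"
proof -
  obtain i where i: "\<not> (a $ i + 1 / real (Suc n) \<le> x $ i \<and> x $ i \<le> b $ i - 1 / real (Suc n))"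
    using assms by (auto simp: core_def mem_box_cart)
  have p: "real (Suc n) > 0" by simp
  have "real (Suc n) * (x $ i - a $ i) - 1 \<le> 0 \<or> real (Suc n) * (b $ i - x $ i) - 1 \<le> 0"
  proof (cases "a $ i + 1 / real (Suc n) \<le> x $ i")
    case False
    then have "x $ i - a $ i \<le> 1 / real (Suc n)" by simp
    from mult_left_mono[OF this, of "real (Suc n)"] show ?thesis by simp
  next
    case True
    with i have "b $ i - x $ i \<le> 1 / real (Suc n)" by simp
    from mult_left_mono[OF this, of "real (Suc n)"] show ?thesis by simp
  qed
  then have "flat 1 (real (Suc n) * (x $ i - a $ i) - 1) * flat 1 (real (Suc n) * (b $ i - x $ i) - 1) = 0"
    by (auto simp: flat_1)
  then show ?thesis unfolding bump_def by (intro prod_zero) auto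
qed

lemma bump_tendsto:
  assumes "x \<in> box a b"
  shows "(\<lambda>n. bump a b n x) \<longlonglongrightarrow> 1"
proof -
  have *: "(\<lambda>n. flat 1 (real (Suc n) * c - 1)) \<longlonglongrightarrow> 1" if "c > 0" for c
  proof -
    have lim: "filterlim (\<lambda>n. real (Suc n) * c - 1) at_top sequentially"
    proof -
      have "filterlim (\<lambda>n. real (Suc n) * c) at_top sequentially"
        using that by (intro filterlim_at_top_mult_tendsto_pos[OF tendsto_const, of c]
          filterlim_compose[OF filterlim_real_sequentially filterlim_Suc]) 
      from filterlim_tendsto_add_at_top[OF tendsto_const this, of "-1"] show ?thesis
        by (simp add: algebra_simps)
    qed
    have "(\<lambda>n. exp (- (1 / (real (Suc n) * c - 1)))) \<longlonglongrightarrow> exp (- 0)"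
      using lim by (intro tendsto_intros tendsto_divide_0[OF tendsto_const] filterlim_at_top_imp_at_infinity)
    moreover have "eventually (\<lambda>n. exp (- (1 / (real (Suc n) * c - 1))) = flat 1 (real (Suc n) * c - 1)) sequentially"
      using filterlim_at_top_dense[THEN iffD1, OF lim, rule_format, of 0] by eventually_elim (simp add: flat_1)
    ultimately show ?thesis unfolding minus_zero exp_zero by (rule Lim_transform_eventually)
  qed
  have "(\<lambda>n. bump a b n x) \<longlonglongrightarrow> (\<Prod>i\<in>(UNIV::3 set). 1 * 1)"
    unfolding bump_def by (intro tendsto_prod tendsto_mult *) (use assms in \<open>auto simp: mem_box_cart\<close>)
  then show ?thesis by simp
qed

lemma test_function_bump:
  assumes "smooth p" shows "test_function (box a b) (\<lambda>x. bump a b n x * p x)"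
  unfolding test_function_def
proof (intro conjI exI[of _ "core a b n"] allI impI)
  show "smooth (\<lambda>x. bump a b n x * p x)" by (intro smooth_mult bump_smooth assms)
qed (simp_all add: core bump_outside)

lemma smooth_measurable_on [intro]: "smooth f \<Longrightarrow> f \<in> borel_measurable (lebesgue_on S)"
  by (intro measurable_restrict_space1 measurable_completion) (auto simp: measurable_lborel1)

text \<open>A measurable function is an almost everywhere limit of continuous functions. These are clamped to
  \<open>[-B, B]\<close> and then replaced by polynomials, by the theorem of Stone and Weierstrass; the error of
  the latter, at most 1, accounts for the bound \<open>B + 1\<close>.\<close>

lemma smooth_approximation:
  fixes s :: "real^3 \<Rightarrow> real"
  assumes s: "s \<in> borel_measurable (lebesgue_on (box a b))" and B: "\<And>x. \<bar>s x\<bar> \<le> B"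
  obtains p where "\<And>n::nat. smooth (p n)" "\<And>n x. x \<in> box a b \<Longrightarrow> \<bar>p n x\<bar> \<le> B + 1"
    "AE x in lebesgue_on (box a b). (\<lambda>n. p n x) \<longlonglongrightarrow> s x"
proof -
  have "s measurable_on (box a b)"
    using s by (simp add: measurable_on_iff_borel_measurable)
  then obtain N g where N: "negligible N" and g: "\<And>n. continuous_on UNIV (g n)"
    and lim: "\<And>x. x \<notin> N \<Longrightarrow> (\<lambda>n. g n x) \<longlonglongrightarrow> (if x \<in> box a b then s x else 0)"
    unfolding measurable_on_def by blast
  have B0: "B \<ge> 0" using B[of 0] by simp
  define c where "c n x = max (- B) (min B (g n x))" for n :: nat and x
  have "\<exists>p. real_polynomial_function p \<and> (\<forall>x\<in>cbox a b. \<bar>c n x - p x\<bar> < 1 / real (Suc n))" for n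
  proof -
    have "continuous_on (cbox a b) (c n)"
      unfolding c_def using continuous_on_subset[OF g] by (intro continuous_intros) auto
    from Stone_Weierstrass_real_polynomial_function[OF compact_cbox this, of "1 / real (Suc n)"]
    obtain g where "real_polynomial_function g" "\<And>x. x \<in> cbox a b \<Longrightarrow> \<bar>c n x - g x\<bar> < 1 / real (Suc n)"
      by auto
    then show ?thesis by blast
  qed
  then obtain p where p: "\<And>n. real_polynomial_function (p n)"
    "\<And>n x. x \<in> cbox a b \<Longrightarrow> \<bar>c n x - p n x\<bar> < 1 / real (Suc n)" by metis
  show ?thesis
  proof
    show "smooth (p n)" for n using p(1) by (rule smooth_real_polynomial_function)
    show "\<bar>p n x\<bar> \<le> B + 1" if "x \<in> box a b" for n x
    proof -
      have "\<bar>c n x - p n x\<bar> < 1 / real (Suc n)" using p(2) that box_subset_cbox by blast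
      moreover have "1 / real (Suc n) \<le> 1" by simp
      moreover have "\<bar>c n x\<bar> \<le> B" using B0 by (auto simp: c_def)
      ultimately show ?thesis by linarith
    qed
    have lim': "(\<lambda>n. p n x) \<longlonglongrightarrow> s x" if x: "x \<in> box a b" "x \<notin> N" for x
    proof -
      have "(\<lambda>n. c n x) \<longlonglongrightarrow> max (- B) (min B (s x))"
        unfolding c_def using lim[OF x(2)] x(1) by (intro tendsto_max tendsto_min tendsto_const) simp
      moreover have "max (- B) (min B (s x)) = s x" using B[of x] by linarith
      moreover have "(\<lambda>n. p n x - c n x) \<longlonglongrightarrow> 0"
      proof (rule Lim_null_comparison[OF always_eventually LIMSEQ_Suc[OF lim_1_over_n]], rule allI)
        fix n
        show "norm (p n x - c n x) \<le> 1 / real (Suc n)"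
          using p(2)[of x n] x box_subset_cbox[of a b] by (simp add: abs_minus_commute less_imp_le subset_iff)
      qed
      ultimately show ?thesis using tendsto_add[of "\<lambda>n. c n x" "s x" sequentially "\<lambda>n. p n x - c n x" 0] by simp
    qed
    have "AE x in lebesgue_on (box a b). x \<notin> N"
      using N by (auto simp: AE_restrict_space_iff negligible_iff_null_sets intro: AE_I' )
    moreover have "AE x in lebesgue_on (box a b). x \<in> box a b" by (rule AE_I2) simp
    ultimately show "AE x in lebesgue_on (box a b). (\<lambda>n. p n x) \<longlonglongrightarrow> s x"
      by eventually_elim (rule lim')
  qed
qed

lemma finite_measure_box: "finite_measure (lebesgue_on (box a b :: (real^3) set))"
  by (intro finite_measure_lebesgue_on) auto

lemma bounded_integrable_box:
  fixes f :: "real^3 \<Rightarrow> real"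
  assumes "f \<in> borel_measurable (lebesgue_on (box a b))" "\<And>x. x \<in> box a b \<Longrightarrow> \<bar>f x\<bar> \<le> B"
  shows "integrable (lebesgue_on (box a b)) f"
  by (rule finite_measure.integrable_const_bound[OF finite_measure_box, of _ B]) (use assms in \<open>auto intro!: AE_I2\<close>)

lemma bounded_sqi_box:
  fixes f :: "real^3 \<Rightarrow> real"
  assumes "f \<in> borel_measurable (lebesgue_on (box a b))" "\<And>x. x \<in> box a b \<Longrightarrow> \<bar>f x\<bar> \<le> B"
  shows "square_integrable (lebesgue_on (box a b)) f"
  unfolding square_integrable_def
proof
  have "\<bar>(f x)\<^sup>2\<bar> \<le> B\<^sup>2" if "x \<in> box a b" for x using power_mono[OF assms(2)[OF that], of 2] by simp
  then show "integrable (lebesgue_on (box a b)) (\<lambda>x. (f x)\<^sup>2)" using assms(1) by (intro bounded_integrable_box) auto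
qed fact

lemma smooth_bounded_box: 
  assumes "smooth f" obtains B where "\<And>x. x \<in> cbox a b \<Longrightarrow> \<bar>f x\<bar> \<le> B"
proof -
  have "bounded (f ` cbox a b)" by (intro compact_imp_bounded compact_continuous_image smooth_continuous assms compact_cbox)
  then show ?thesis using that unfolding bounded_iff by auto
qed

lemma smooth_sqi_box: "smooth f \<Longrightarrow> square_integrable (lebesgue_on (box a b)) f"
  by (rule smooth_bounded_box[of f a b]) (auto intro!: bounded_sqi_box smooth_measurable_on dest: subsetD[OF box_subset_cbox])

lemma sqi_smooth_mult:
  assumes "square_integrable (lebesgue_on (box a b)) f" "smooth h"
  shows "square_integrable (lebesgue_on (box a b)) (\<lambda>x. h x * f x)"
proof -
  obtain B where "\<And>x. x \<in> cbox a b \<Longrightarrow> \<bar>h x\<bar> \<le> B" using smooth_bounded_box assms(2) by blast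
  then show ?thesis using assms by (intro sqi_bounded_mult[of _ _ _ B]) (auto dest: subsetD[OF box_subset_cbox])
qed

lemma sqi_imp_integrable_box:
  assumes "square_integrable (lebesgue_on (box a b :: (real^3) set)) f"
  shows "integrable (lebesgue_on (box a b)) f"
  using sqi_mult[OF assms smooth_sqi_box[of "\<lambda>_. 1"]] by simp

text \<open>Testing with smooth approximations of a truncation of the function itself shows that the
  \<open>L\<^sup>2\<close> norm is the dual norm over test functions.\<close>

lemma L2_norm_le_by_duality:
  assumes g: "square_integrable (lebesgue_on (box a b)) g" and C: "C \<ge> 0"
    and dual: "\<And>\<phi>. test_function (box a b) \<phi> \<Longrightarrow>
      \<bar>LINT x|lebesgue_on (box a b). g x * \<phi> x\<bar> \<le> C * sqrt (LINT x|lebesgue_on (box a b). (\<phi> x)\<^sup>2)"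
  shows "(LINT x|lebesgue_on (box a b). (g x)\<^sup>2) \<le> C\<^sup>2"
proof -
  let ?M = "lebesgue_on (box a b)"
  define s where "s n x = (if \<bar>g x\<bar> \<le> real n then g x else 0)" for n x
  have gm [measurable]: "g \<in> borel_measurable ?M" using g by (rule sqi_measurable)
  have sm [measurable]: "s n \<in> borel_measurable ?M" for n unfolding s_def by measurable
  have bm [measurable]: "bump a b n \<in> borel_measurable ?M" for n by (intro smooth_measurable_on bump_smooth)
  have sb: "\<bar>s n x\<bar> \<le> real n" for n x by (simp add: s_def)
  have le: "(LINT x|?M. (bump a b n x * s n x)\<^sup>2) \<le> C\<^sup>2" for n
  proof -
    obtain p where p: "\<And>k::nat. smooth (p k)" "\<And>k x. x \<in> box a b \<Longrightarrow> \<bar>p k x\<bar> \<le> real n + 1"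
      "AE x in ?M. (\<lambda>k. p k x) \<longlonglongrightarrow> s n x"
      using smooth_approximation[OF sm sb] by blast
    have pm [measurable]: "p k \<in> borel_measurable ?M" for k using p(1) by (rule smooth_measurable_on)
    have pb: "\<bar>bump a b n x * p k x\<bar> \<le> real n + 1" if "x \<in> box a b" for k x
      using mult_mono[OF bump_bounds(2)[of a b n x] p(2)[OF that, of k]] bump_bounds(1)[of a b n x]
      by (simp add: abs_mult)
    have l1: "(\<lambda>k. LINT x|?M. g x * (bump a b n x * p k x)) \<longlonglongrightarrow> (LINT x|?M. g x * (bump a b n x * s n x))"
    proof (rule integral_dominated_convergence[where w = "\<lambda>x. (real n + 1) * \<bar>g x\<bar>"])
      show "integrable ?M (\<lambda>x. (real n + 1) * \<bar>g x\<bar>)" using sqi_imp_integrable_box[OF g] by simp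
      show "AE x in ?M. (\<lambda>k. g x * (bump a b n x * p k x)) \<longlonglongrightarrow> g x * (bump a b n x * s n x)"
        using p(3) by eventually_elim (intro tendsto_mult tendsto_power tendsto_const, assumption)
      show "AE x in ?M. norm (g x * (bump a b n x * p k x)) \<le> (real n + 1) * \<bar>g x\<bar>" for k
        using pb[of _ k] by (intro AE_I2) (auto simp: abs_mult mult.commute[of "\<bar>g _\<bar>"] intro: mult_right_mono)
    qed auto
    have l2: "(\<lambda>k. LINT x|?M. (bump a b n x * p k x)\<^sup>2) \<longlonglongrightarrow> (LINT x|?M. (bump a b n x * s n x)\<^sup>2)"
    proof (rule integral_dominated_convergence[where w = "\<lambda>x. (real n + 1)\<^sup>2"])
      show "integrable ?M (\<lambda>x. (real n + 1)\<^sup>2)" by (rule bounded_integrable_box) auto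
      show "AE x in ?M. (\<lambda>k. (bump a b n x * p k x)\<^sup>2) \<longlonglongrightarrow> (bump a b n x * s n x)\<^sup>2"
        using p(3) by eventually_elim (intro tendsto_mult tendsto_power tendsto_const, assumption)
      show "AE x in ?M. norm ((bump a b n x * p k x)\<^sup>2) \<le> (real n + 1)\<^sup>2" for k
        using power_mono[OF pb[of _ k], of _ 2] by (intro AE_I2) auto
    qed auto
    have "\<bar>LINT x|?M. g x * (bump a b n x * s n x)\<bar> \<le> C * sqrt (LINT x|?M. (bump a b n x * s n x)\<^sup>2)"
      by (rule tendsto_le[OF _ tendsto_mult[OF tendsto_const tendsto_real_sqrt[OF l2]] tendsto_rabs[OF l1]])
         (auto intro!: always_eventually dual test_function_bump p)
    moreover have "(LINT x|?M. (bump a b n x * s n x)\<^sup>2) \<le> (LINT x|?M. g x * (bump a b n x * s n x))"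
    proof (rule integral_mono)
      show "integrable ?M (\<lambda>x. (bump a b n x * s n x)\<^sup>2)"
        by (rule sqi_integrable, rule sqi_smooth_mult[OF _ bump_smooth], rule bounded_sqi_box[of _ _ _ "real n"]) (use sb in auto)
      show "integrable ?M (\<lambda>x. g x * (bump a b n x * s n x))"
        by (rule sqi_mult[OF g], rule sqi_smooth_mult[OF _ bump_smooth], rule bounded_sqi_box[of _ _ _ "real n"]) (use sb in auto)
      show "(bump a b n x * s n x)\<^sup>2 \<le> g x * (bump a b n x * s n x)" for x
        using mult_right_mono[OF mult_left_le[OF bump_bounds(2) bump_bounds(1), of a b n x a b n x], of "(g x)\<^sup>2"]
        by (auto simp: s_def power2_eq_square mult_ac)
    qed
    ultimately have *: "(LINT x|?M. (bump a b n x * s n x)\<^sup>2) \<le> C * sqrt (LINT x|?M. (bump a b n x * s n x)\<^sup>2)" by linarith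
    define r where "r = sqrt (LINT x|?M. (bump a b n x * s n x)\<^sup>2)"
    have r: "r \<ge> 0" "r\<^sup>2 = (LINT x|?M. (bump a b n x * s n x)\<^sup>2)" by (auto simp: r_def)
    have "r\<^sup>2 \<le> C * r" using * r by (simp add: r_def)
    then have "r \<le> C" using r(1) C by (cases "r = 0") (auto simp: power2_eq_square)
    then show ?thesis using r power_mono[of r C 2] by simp
  qed
  have "(\<lambda>n. LINT x|?M. (bump a b n x * s n x)\<^sup>2) \<longlonglongrightarrow> (LINT x|?M. (g x)\<^sup>2)"
  proof (rule integral_dominated_convergence[where w = "\<lambda>x. (g x)\<^sup>2"])
    show "integrable ?M (\<lambda>x. (g x)\<^sup>2)" using g by (rule sqi_integrable)
    show "AE x in ?M. (\<lambda>n. (bump a b n x * s n x)\<^sup>2) \<longlonglongrightarrow> (g x)\<^sup>2"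
    proof (rule AE_I2)
      fix x assume "x \<in> space ?M"
      then have x: "x \<in> box a b" by simp
      obtain m where m: "\<bar>g x\<bar> \<le> real m" using real_arch_simple by blast
      have "eventually (\<lambda>n. g x = s n x) sequentially"
        using eventually_ge_at_top[of m] by eventually_elim (use m in \<open>auto simp: s_def\<close>)
      then have "(\<lambda>n. s n x) \<longlonglongrightarrow> g x" by (rule Lim_transform_eventually[OF tendsto_const])
      from tendsto_power[OF tendsto_mult[OF bump_tendsto[OF x] this], of 2]
      show "(\<lambda>n. (bump a b n x * s n x)\<^sup>2) \<longlonglongrightarrow> (g x)\<^sup>2" by simp
    qed
    have "\<bar>bump a b n x * s n x\<bar> \<le> \<bar>g x\<bar>" for n x
      using mult_mono[OF bump_bounds(2), of "\<bar>s n x\<bar>" "\<bar>g x\<bar>" a b n x] bump_bounds(1)[of a b n x]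
      by (auto simp: s_def abs_mult)
    then show "AE x in ?M. norm ((bump a b n x * s n x)\<^sup>2) \<le> (g x)\<^sup>2" for n
      using abs_le_square_iff by (intro AE_I2) auto
  qed auto
  from LIMSEQ_le_const2[OF this] le show ?thesis by blast
qed

lemma integrable_supported:
  assumes K: "compact K" "K \<subseteq> S" "S \<in> sets lebesgue" and g: "integrable (lebesgue_on K) g"
  shows "integrable (lebesgue_on S) (\<lambda>x. indicator K x * g x :: real)"
proof -
  have K': "K \<in> sets lebesgue" using K by (simp add: lmeasurable_compact fmeasurableD)
  have "integrable lebesgue (\<lambda>x. indicator K x *\<^sub>R g x)"
    using g K' by (simp add: integrable_restrict_space)
  moreover have "(\<lambda>x. indicator S x *\<^sub>R (indicator K x * g x)) = (\<lambda>x. indicator K x *\<^sub>R g x)"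
    using K by (auto simp: indicator_def fun_eq_iff)
  ultimately show ?thesis using K by (simp add: integrable_restrict_space)
qed

text \<open>The lemma of du Bois-Reymond: testing with approximations of the sign of the function.\<close>

lemma AE_zero_if_orthogonal_to_tests:
  assumes g: "locally_integrable (box a b) g"
    and orth: "\<And>\<phi>. test_function (box a b) \<phi> \<Longrightarrow> (LINT x|lebesgue_on (box a b). g x * \<phi> x) = 0"
  shows "AE x in lebesgue_on (box a b). g x = 0"
proof -
  let ?M = "lebesgue_on (box a b)"
  have ae: "AE x in ?M. bump a b n x * g x = 0" for n
  proof -
    let ?g = "\<lambda>x. indicator (core a b n) x * g x"
    have gi: "integrable ?M ?g"
      using g core[of a b n] unfolding locally_integrable_def by (intro integrable_supported) auto
    then have gm [measurable]: "?g \<in> borel_measurable ?M" by auto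
    define s where "s x = sgn (?g x)" for x
    have sm [measurable]: "s \<in> borel_measurable ?M" unfolding s_def by measurable
    have bm [measurable]: "bump a b n \<in> borel_measurable ?M" for n by (intro smooth_measurable_on bump_smooth)
    have sb: "\<bar>s x\<bar> \<le> 1" for x by (simp add: s_def sgn_if)
    obtain p where p: "\<And>k::nat. smooth (p k)" "\<And>k x. x \<in> box a b \<Longrightarrow> \<bar>p k x\<bar> \<le> 1 + 1"
      "AE x in ?M. (\<lambda>k. p k x) \<longlonglongrightarrow> s x"
      using smooth_approximation[OF sm sb] by blast
    have pm [measurable]: "p k \<in> borel_measurable ?M" for k using p(1) by (rule smooth_measurable_on)
    have eq: "g x * (bump a b n x * t) = ?g x * (bump a b n x * t)" for x t
      using bump_outside[of x a b n] by (cases "x \<in> core a b n") auto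
    have "(\<lambda>k. LINT x|?M. ?g x * (bump a b n x * p k x)) \<longlonglongrightarrow> (LINT x|?M. ?g x * (bump a b n x * s x))"
    proof (rule integral_dominated_convergence[where w = "\<lambda>x. 2 * \<bar>?g x\<bar>"])
      show "integrable ?M (\<lambda>x. 2 * \<bar>?g x\<bar>)" using gi by simp
      show "AE x in ?M. (\<lambda>k. ?g x * (bump a b n x * p k x)) \<longlonglongrightarrow> ?g x * (bump a b n x * s x)"
        using p(3) by eventually_elim (intro tendsto_mult tendsto_power tendsto_const, assumption)
      have "\<bar>bump a b n x * p k x\<bar> \<le> 2" if "x \<in> box a b" for k x
        using mult_mono[OF bump_bounds(2)[of a b n x] p(2)[OF that, of k]] bump_bounds(1)[of a b n x]
        by (simp add: abs_mult)
      then show "AE x in ?M. norm (?g x * (bump a b n x * p k x)) \<le> 2 * \<bar>?g x\<bar>" for k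
        using mult_right_mono[of "\<bar>bump a b n _ * p k _\<bar>" 2 "\<bar>?g _\<bar>"] 
        by (intro AE_I2) (auto simp: abs_mult mult_ac)
    qed auto
    moreover have "(LINT x|?M. ?g x * (bump a b n x * p k x)) = 0" for k
      using orth[OF test_function_bump[OF p(1)], of n k] by (simp only: eq)
    ultimately have "(LINT x|?M. ?g x * (bump a b n x * s x)) = 0"
      by (simp add: LIMSEQ_const_iff)
    moreover have "(\<lambda>x. ?g x * (bump a b n x * s x)) = (\<lambda>x. bump a b n x * \<bar>?g x\<bar>)"
      by (auto simp: s_def sgn_if)
    ultimately have z: "(LINT x|?M. bump a b n x * \<bar>?g x\<bar>) = 0" by simp
    have i: "integrable ?M (\<lambda>x. bump a b n x * \<bar>?g x\<bar>)"
    proof (rule Bochner_Integration.integrable_bound[OF gi])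
      show "AE x in ?M. norm (bump a b n x * \<bar>?g x\<bar>) \<le> norm (?g x)"
        using bump_bounds by (intro AE_I2) (auto simp: abs_mult intro!: mult_left_le_one_le)
    qed measurable
    have "AE x in ?M. bump a b n x * \<bar>?g x\<bar> = 0"
      using z integral_nonneg_eq_0_iff_AE[OF i] bump_bounds by auto
    then show ?thesis
    proof eventually_elim
      case (elim x)
      then show ?case using bump_outside[of x a b n] by (cases "x \<in> core a b n") auto
    qed
  qed
  have "AE x in ?M. \<forall>n. bump a b n x * g x = 0" unfolding AE_all_countable using ae by blast
  moreover have "AE x in ?M. x \<in> box a b" by (rule AE_I2) simp
  ultimately show ?thesis
  proof eventually_elim
    case (elim x)
    have "(\<lambda>n. bump a b n x * g x) \<longlonglongrightarrow> 1 * g x" by (intro tendsto_intros bump_tendsto elim)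
    moreover have "(\<lambda>n. bump a b n x * g x) = (\<lambda>_. 0)" using elim by blast
    ultimately show ?case by (simp add: LIMSEQ_const_iff)
  qed
qed

section \<open>Integration over the cube\<close>

definition cube_lower :: "real \<Rightarrow> real^3" where "cube_lower A = (\<chi> i. - A)"
definition cube_upper :: "real \<Rightarrow> real \<Rightarrow> real^3" where
  "cube_upper A \<epsilon> = (\<chi> i. if i = 3 then A - \<epsilon> else A)"

lemma cube_box: "cube A = box (cube_lower A) (cube_upper A 0)"
  by (auto simp: cube_def cube_lower_def cube_upper_def mem_box_cart forall_3)

lemma subcube_box: "\<epsilon> \<ge> 0 \<Longrightarrow> subcube A \<epsilon> = box (cube_lower A) (cube_upper A \<epsilon>)"
  by (auto simp: subcube_def cube_def cube_lower_def cube_upper_def mem_box_cart forall_3)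

lemma square_box: "square A = box (\<chi> i. - A) (\<chi> i. A)"
  by (auto simp: square_def mem_box_cart)

lemma sets_cube [simp]: "cube A \<in> sets lebesgue" by (simp add: cube_box)
lemma sets_cube_borel [measurable]: "cube A \<in> sets borel" by (simp add: cube_box)
lemma sets_square_borel [measurable]: "square A \<in> sets borel" by (simp add: square_box)

text \<open>The coordinates of \<^typ>\<open>real^3\<close> split into the \<open>i\<close>-th one and the two others, in the
  cyclic order in which the faces of the cube are parametrized.\<close>

definition insert_coord :: "3 \<Rightarrow> real \<times> (real^2) \<Rightarrow> real^3" where
  "insert_coord i q = (\<chi> j. if j = i then fst q else if j = i + 1 then snd q $ 1 else snd q $ 2)"

lemma face_point_insert_coord: "face_point A (i, s) p = insert_coord i (s * A, p)"
  by (simp add: face_point_def insert_coord_def cong: if_cong)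

lemma three_distinct [simp]: "i + 1 \<noteq> (i::3)" "i + 2 \<noteq> (i::3)" "i + 1 \<noteq> i + (2::3)" "(i::3) \<noteq> i + 1" "(i::3) \<noteq> i + 2"
  by simp_all

lemma UNIV_3_shift: "(UNIV :: 3 set) = {i, i + 1, i + 2}"
proof -
  have "j \<in> {i, i + 1, i + 2}" for j
    using exhaust_3[of i] exhaust_3[of j] by auto
  then show ?thesis by auto
qed

lemma insert_coord_nth [simp]:
  "insert_coord i q $ i = fst q" "insert_coord i q $ (i + 1) = snd q $ 1" "insert_coord i q $ (i + 2) = snd q $ 2"
  by (simp_all add: insert_coord_def)

lemma all_3_shift: "(\<forall>j::3. P j) \<longleftrightarrow> P i \<and> P (i + 1) \<and> P (i + 2)"
  using UNIV_3_shift[of i] by (metis UNIV_I empty_iff insert_iff)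

lemma insert_coord_in_cube: "insert_coord i (t, p) \<in> cube A \<longleftrightarrow> - A < t \<and> t < A \<and> p \<in> square A"
  by (simp add: cube_def all_3_shift[of _ i] square_def forall_2)

lemma insert_coord_eq_axis:
  "insert_coord i (t, p) = insert_coord i (0, p) + t *\<^sub>R axis i 1"
  by (auto simp: Finite_Cartesian_Product.vec_eq_iff insert_coord_def axis_def)

lemma insert_coord_measurable [measurable]: "insert_coord i \<in> borel_measurable borel"
proof (rule borel_measurable_continuous_onI)
  show "continuous_on UNIV (insert_coord i)"
    unfolding insert_coord_def
  proof (rule continuous_on_vec_lambda)
    fix j show "continuous_on UNIV (\<lambda>q :: real \<times> (real^2). if j = i then fst q else if j = i + 1 then snd q $ 1 else snd q $ 2)"
      by (cases "j = i"; cases "j = i + 1") (auto intro!: continuous_intros)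
  qed
qed

lemma prod_Basis_cart: "(\<Prod>b\<in>(Basis :: (real^'n) set). v \<bullet> b) = (\<Prod>i\<in>UNIV. v $ i)"
proof -
  have B: "(Basis :: (real^'n) set) = range (\<lambda>i. axis i 1)" by (auto simp: Basis_vec_def)
  have "inj (\<lambda>i::'n. axis i (1::real))" by (auto simp: inj_on_def axis_eq_axis)
  then show ?thesis unfolding B by (subst prod.reindex) (simp_all add: cart_eq_inner_axis[symmetric])
qed

text \<open>This allows Fubini's theorem to be applied in coordinates adapted to a pair of opposite faces. It
  suffices to compare the measures of boxes.\<close>

lemma distr_insert_coord: "distr lborel borel (insert_coord i) = lborel"
proof (rule lborel_eqI[symmetric])
  fix l u :: "real^3"
  assume lu: "\<And>b. b \<in> Basis \<Longrightarrow> l \<bullet> b \<le> u \<bullet> b"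
  then have le: "l $ j \<le> u $ j" for j
    using lu[of "axis j 1"] by (simp add: cart_eq_inner_axis)
  let ?l = "vector [l $ (i + 1), l $ (i + 2)] :: real^2" and ?u = "vector [u $ (i + 1), u $ (i + 2)] :: real^2"
  have le2: "?l \<bullet> b \<le> ?u \<bullet> b" if "b \<in> Basis" for b
    using that le by (auto simp: Basis_vec_def inner_axis forall_2 axis_def inner_vec_def sum_2 vector_2)
  have eq: "insert_coord i -` box l u = {l $ i <..< u $ i} \<times> box ?l ?u"
    by (auto simp: mem_box_cart all_3_shift[of _ i] forall_2 vector_2)
  have "emeasure (distr lborel borel (insert_coord i)) (box l u)
      = emeasure (lborel \<Otimes>\<^sub>M lborel) ({l $ i <..< u $ i} \<times> box ?l ?u)"
    by (subst emeasure_distr) (simp_all add: eq lborel_prod)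
  also have "\<dots> = ennreal (u $ i - l $ i) * ennreal (\<Prod>b\<in>Basis. (?u - ?l) \<bullet> b)"
    by (subst lborel.emeasure_pair_measure_Times) (simp_all add: le le2 del: inner_diff_left)
  also have "\<dots> = ennreal ((u $ i - l $ i) * (\<Prod>b\<in>Basis. (?u - ?l) \<bullet> b))"
    by (rule ennreal_mult[symmetric]) (use le le2 in \<open>auto intro!: prod_nonneg simp: inner_diff_left\<close>)
  also have "(u $ i - l $ i) * (\<Prod>b\<in>Basis. (?u - ?l) \<bullet> b) = (\<Prod>b\<in>Basis. (u - l) \<bullet> b)"
    unfolding prod_Basis_cart UNIV_3_shift[of i] by (simp add: UNIV_2 vector_2)
  finally show "emeasure (distr lborel borel (insert_coord i)) (box l u) = ennreal (\<Prod>b\<in>Basis. (u - l) \<bullet> b)" .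
qed simp

lemma integral_lebesgue_on_borel:
  fixes f :: "'a::euclidean_space \<Rightarrow> real"
  assumes "S \<in> sets borel" "f \<in> borel_measurable borel"
  shows "(LINT x|lebesgue_on S. f x) = (LINT x|lborel. indicator S x * f x)"
    and "integrable (lebesgue_on S) f \<longleftrightarrow> integrable lborel (\<lambda>x. indicator S x * f x)"
  using assms by (simp_all add: integral_restrict_space integrable_restrict_space
    integral_completion integrable_completion)

lemma FTC_interval:
  fixes F :: "real \<Rightarrow> real"
  assumes "A > 0" "\<And>t. (F has_real_derivative f t) (at t)" "\<And>t. isCont f t"
  shows "(LINT t|lborel. indicator {-A<..<A} t * f t) = F A - F (- A)"
proof -
  have "(LINT t|lborel. indicator {-A<..<A} t * f t) = (LINT t|lborel. f t * indicator {-A..A} t)"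
  proof (rule integral_cong_AE)
    have "AE t in lborel. t \<noteq> A" "AE t in lborel. t \<noteq> -A" by (auto intro: AE_lborel_singleton)
    then show "AE t in lborel. indicator {-A<..<A} t * f t = f t * indicator {-A..A} t"
      by eventually_elim (auto simp: indicator_def)
    have [measurable]: "f \<in> borel_measurable borel"
      using assms(3) by (intro borel_measurable_continuous_onI) (simp add: continuous_on_eq_continuous_at)
    show "(\<lambda>t. indicator {-A<..<A} t * f t) \<in> borel_measurable lborel"
      "(\<lambda>t. f t * indicator {-A..A} t) \<in> borel_measurable lborel" by measurable
  qed
  also have "\<dots> = F A - F (- A)"
    by (rule integral_FTC_Icc_real) (use assms in auto)
  finally show ?thesis .
qed

text \<open>The divergence theorem on the cube, by Fubini's theorem and the fundamental theorem of
  calculus on each line parallel to a coordinate axis.\<close>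

lemma cube_FTC:
  assumes A: "A > 0" and W: "smooth W"
  shows "(LINT x|lebesgue_on (cube A). partial i W x) =
    (LINT p|lebesgue_on (square A). W (face_point A (i, 1) p)) -
    (LINT p|lebesgue_on (square A). W (face_point A (i, -1) p))"
proof -
  let ?D = "partial i W" and ?G = "insert_coord i"
  have D: "smooth ?D" using W by (rule smooth_partial)
  note [measurable] = smooth_measurable[OF D] smooth_measurable[OF W]
  have "integrable (lebesgue_on (cube A)) ?D"
    unfolding cube_box by (rule sqi_imp_integrable_box[OF smooth_sqi_box[OF D]])
  then have int: "integrable lborel (\<lambda>x. indicator (cube A) x * ?D x)"
    by (subst integral_lebesgue_on_borel(2)[symmetric]) auto
  have ind: "indicator (cube A) (?G (t, p)) = (indicator {-A<..<A} t * indicator (square A) p :: real)" for t p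
    by (auto simp: insert_coord_in_cube indicator_def)
  have eqf: "(\<lambda>(t, p). indicator (square A) p * (indicator {-A<..<A} t * ?D (?G (t, p)))) =
      (\<lambda>q. indicator (cube A) (?G q) * ?D (?G q))"
    by (auto simp: fun_eq_iff ind)
  have int2: "integrable (lborel \<Otimes>\<^sub>M lborel) (\<lambda>(t, p). indicator (square A) p * (indicator {-A<..<A} t * ?D (?G (t, p))))"
  proof -
    have "integrable (distr lborel borel ?G) (\<lambda>x. indicator (cube A) x * ?D x)" using int by (simp add: distr_insert_coord)
    then have "integrable lborel (\<lambda>q. indicator (cube A) (?G q) * ?D (?G q))"
      by (subst (asm) integrable_distr_eq) auto
    then show ?thesis unfolding eqf lborel_prod .
  qed
  have W2: "(\<lambda>p. W (face_point A (i, s) p)) \<in> borel_measurable borel" for s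
  proof -
    have "(\<lambda>p. insert_coord i (s * A, p)) \<in> borel_measurable borel" by measurable
    then show ?thesis unfolding face_point_insert_coord by measurable
  qed
  have FTC: "(LINT t|lborel. indicator {-A<..<A} t * ?D (?G (t, p))) = W (?G (A, p)) - W (?G (- A, p))" for p
  proof (rule FTC_interval[OF A])
    define g where "g = ?G (0, p)"
    have G: "?G (t, p) = g + t *\<^sub>R axis i 1" for t unfolding g_def by (rule insert_coord_eq_axis)
    show "((\<lambda>t. W (?G (t, p))) has_real_derivative ?D (?G (t, p))) (at t)" for t
      unfolding G by (rule partial_has_real_derivative[OF smooth_differentiable[OF W]])
    have "continuous_on UNIV (\<lambda>t. ?D (g + t *\<^sub>R axis i 1))"
      by (rule continuous_on_compose2[OF smooth_continuous[OF D, of UNIV]]) (auto intro!: continuous_intros)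
    then show "isCont (\<lambda>t. ?D (?G (t, p))) t" for t
      unfolding G by (simp add: continuous_on_eq_continuous_at)
  qed
  have b: "\<exists>B. \<forall>x\<in>cbox (\<chi> i. - A) (\<chi> i. A). \<bar>W x\<bar> \<le> B" using smooth_bounded_box[OF W] by metis
  then obtain B where B: "\<And>x. x \<in> cbox (\<chi> i. - A) (\<chi> i. A) \<Longrightarrow> \<bar>W x\<bar> \<le> B" by blast
  have Wi: "integrable (lebesgue_on (square A)) (\<lambda>p. W (face_point A (i, s) p))" if "s \<in> {1, -1}" for s
  proof (rule finite_measure.integrable_const_bound[of _ _ B])
    show "finite_measure (lebesgue_on (square A))" unfolding square_box by (intro finite_measure_lebesgue_on) auto
    have "face_point A (i, s) p \<in> cbox (\<chi> i. - A) (\<chi> i. A)" if "p \<in> square A" for p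
      using that \<open>s \<in> _\<close> A unfolding face_point_insert_coord mem_box_cart all_3_shift[of _ i]
      by (auto simp: square_def forall_2 less_imp_le)
    then show "AE p in lebesgue_on (square A). norm (W (face_point A (i, s) p)) \<le> B"
      by (intro AE_I2) (auto intro: B)
    show "(\<lambda>p. W (face_point A (i, s) p)) \<in> borel_measurable (lebesgue_on (square A))"
      using W2 by (intro measurable_restrict_space1 measurable_completion) (auto simp: measurable_lborel1)
  qed
  have "(LINT x|lebesgue_on (cube A). ?D x) = (LINT x|lborel. indicator (cube A) x * ?D x)"
    by (rule integral_lebesgue_on_borel) auto
  also have "\<dots> = (LINT x|distr lborel borel ?G. indicator (cube A) x * ?D x)" by (simp add: distr_insert_coord)
  also have "\<dots> = (LINT q|lborel. indicator (cube A) (?G q) * ?D (?G q))" by (rule integral_distr) auto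
  also have "\<dots> = integral\<^sup>L (lborel \<Otimes>\<^sub>M lborel) (\<lambda>(t, p). indicator (square A) p * (indicator {-A<..<A} t * ?D (?G (t, p))))"
    unfolding eqf lborel_prod ..
  also have "\<dots> = (LINT p|lborel. LINT t|lborel. indicator (square A) p * (indicator {-A<..<A} t * ?D (?G (t, p))))"
    by (rule lborel_pair.integral_snd[symmetric]) (use int2 in simp)
  also have "\<dots> = (LINT p|lborel. indicator (square A) p * (W (?G (A, p)) - W (?G (- A, p))))"
    by (simp add: FTC)
  also have "\<dots> = (LINT p|lebesgue_on (square A). W (face_point A (i, 1) p) - W (face_point A (i, -1) p))"
    by (subst integral_lebesgue_on_borel(1)) (use W2 in \<open>auto simp: face_point_insert_coord\<close>)
  also have "\<dots> = (LINT p|lebesgue_on (square A). W (face_point A (i, 1) p)) -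
    (LINT p|lebesgue_on (square A). W (face_point A (i, -1) p))"
    by (rule Bochner_Integration.integral_diff) (use Wi in auto)
  finally show ?thesis .
qed

section \<open>Weak derivatives\<close>

text \<open>Lebesgue measure is complete; \<open>wderiv\<close> is only determined up to null sets, so this supplies the
  measurability of functions built from it.\<close>

lemma AE_eq_measurable_lebesgue_on:
  fixes f g :: "'a::euclidean_space \<Rightarrow> real"
  assumes S: "S \<in> sets lebesgue" and ae: "AE x in lebesgue_on S. f x = g x"
    and f: "f \<in> borel_measurable (lebesgue_on S)"
  shows "g \<in> borel_measurable (lebesgue_on S)"
proof -
  have "AE x in lebesgue. x \<in> S \<longrightarrow> f x = g x"
    using ae S by (simp add: AE_restrict_space_iff)
  then obtain N where N: "N \<in> null_sets lebesgue" "{x. \<not> (x \<in> S \<longrightarrow> f x = g x)} \<subseteq> N"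
    unfolding eventually_ae_filter by auto
  have "g measurable_on S"
  proof (rule measurable_on_spike)
    show "f measurable_on S" using f S by (simp add: measurable_on_iff_borel_measurable)
    show "negligible N" using N(1) by (simp add: negligible_iff_null_sets)
    show "g x = f x" if "x \<in> S - N" for x using that N(2) by auto
  qed
  then show ?thesis using S by (simp add: measurable_on_iff_borel_measurable)
qed

lemma integrable_lebesgue_on_subset:
  fixes f :: "'a::euclidean_space \<Rightarrow> real"
  assumes "integrable (lebesgue_on S) f" "T \<subseteq> S" "T \<in> sets lebesgue" "S \<in> sets lebesgue"
  shows "integrable (lebesgue_on T) f"
proof -
  have "integrable lebesgue (\<lambda>x. indicator S x *\<^sub>R f x)" using assms by (simp add: integrable_restrict_space)
  then have "integrable lebesgue (\<lambda>x. indicator T x *\<^sub>R (indicator S x *\<^sub>R f x))"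
    using assms(3) by (intro integrable_mult_indicator[of T lebesgue "\<lambda>x. indicator S x *\<^sub>R f x"]) auto
  moreover have eq: "(\<lambda>x. indicator T x *\<^sub>R (indicator S x *\<^sub>R f x)) = (\<lambda>x. indicator T x *\<^sub>R f x)"
    using assms(2) by (auto simp: indicator_def fun_eq_iff)
  ultimately have "integrable lebesgue (\<lambda>x. indicator T x *\<^sub>R f x)" by (simp only: eq)
  then show ?thesis using assms(3) by (simp add: integrable_restrict_space)
qed

lemma integral_lebesgue_on_supported:
  fixes f :: "'a::euclidean_space \<Rightarrow> real"
  assumes "T \<subseteq> S" "T \<in> sets lebesgue" "S \<in> sets lebesgue" "\<And>x. x \<in> S - T \<Longrightarrow> f x = 0"
  shows "(LINT x|lebesgue_on S. f x) = (LINT x|lebesgue_on T. f x)"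
proof -
  have "(\<lambda>x. indicator S x *\<^sub>R f x) = (\<lambda>x. indicator T x *\<^sub>R f x)"
    using assms by (auto simp: indicator_def fun_eq_iff)
  then show ?thesis using assms by (simp add: integral_restrict_space)
qed

lemma sqi_subset:
  fixes f :: "'a::euclidean_space \<Rightarrow> real"
  assumes "square_integrable (lebesgue_on S) f" "T \<subseteq> S" "T \<in> sets lebesgue" "S \<in> sets lebesgue"
  shows "square_integrable (lebesgue_on T) f"
    and "(LINT x|lebesgue_on T. (f x)\<^sup>2) \<le> (LINT x|lebesgue_on S. (f x)\<^sup>2)"
proof -
  have i: "integrable (lebesgue_on T) (\<lambda>x. (f x)\<^sup>2)"
    using assms by (auto intro: integrable_lebesgue_on_subset[of S _ T] simp: square_integrable_def)
  have "f \<in> borel_measurable (lebesgue_on T)"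
    by (rule measurable_restrict_mono[OF sqi_measurable[OF assms(1)] assms(2)])
  with i show "square_integrable (lebesgue_on T) f" by (simp add: square_integrable_def)
  have "integrable lebesgue (\<lambda>x. indicator T x *\<^sub>R (f x)\<^sup>2)" "integrable lebesgue (\<lambda>x. indicator S x *\<^sub>R (f x)\<^sup>2)"
    using i assms by (auto simp: square_integrable_def integrable_restrict_space)
  then have "(LINT x|lebesgue. indicator T x *\<^sub>R (f x)\<^sup>2) \<le> (LINT x|lebesgue. indicator S x *\<^sub>R (f x)\<^sup>2)"
    using assms(2) by (intro integral_mono) (auto simp: indicator_def)
  then show "(LINT x|lebesgue_on T. (f x)\<^sup>2) \<le> (LINT x|lebesgue_on S. (f x)\<^sup>2)"
    using assms by (simp add: integral_restrict_space)
qed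

lemma partial_outside_support:
  assumes "closed K" "\<And>x. x \<notin> K \<Longrightarrow> \<phi> x = 0" "x \<notin> K"
  shows "partial i \<phi> x = 0"
proof -
  have "(\<phi> has_derivative (\<lambda>_. 0)) (at x)"
    by (rule has_derivative_transform_within_open[of "\<lambda>_. 0" _ _ _ "- K"]) (use assms in auto)
  from partial_eq[OF this] show ?thesis .
qed

lemma test_function_smooth: "test_function S \<phi> \<Longrightarrow> smooth \<phi>"
  by (simp add: test_function_def)

lemma test_function_partial: 
  assumes "test_function S \<phi>" shows "test_function S (partial i \<phi>)"
proof -
  obtain K where K: "smooth \<phi>" "compact K" "K \<subseteq> S" "\<And>x. x \<notin> K \<Longrightarrow> \<phi> x = 0"
    using assms by (auto simp: test_function_def)
  then have "partial i \<phi> x = 0" if "x \<notin> K" for x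
    using that by (intro partial_outside_support[of K]) (auto simp: compact_imp_closed)
  with K show ?thesis unfolding test_function_def by (intro conjI exI[of _ K]) auto
qed

lemma test_function_mpartial: "test_function S \<phi> \<Longrightarrow> test_function S (mpartial \<alpha> \<phi>)"
proof -
  have "test_function S \<psi> \<Longrightarrow> test_function S ((partial i ^^ n) \<psi>)" for i n \<psi>
    by (induction n) (auto intro: test_function_partial)
  then show "test_function S \<phi> \<Longrightarrow> test_function S (mpartial \<alpha> \<phi>)" by (simp add: mpartial_def)
qed

lemma test_function_mono: "test_function S \<phi> \<Longrightarrow> S \<subseteq> T \<Longrightarrow> test_function T \<phi>"
  unfolding test_function_def by (blast intro: order_trans)

lemma test_function_outside: "test_function S \<phi> \<Longrightarrow> x \<notin> S \<Longrightarrow> \<phi> x = 0"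
  unfolding test_function_def by blast

lemma locally_integrable_test:
  assumes g: "locally_integrable (box a b) g" and \<phi>: "test_function (box a b) \<phi>"
  shows "integrable (lebesgue_on (box a b)) (\<lambda>x. g x * \<phi> x)"
proof -
  obtain K where K: "smooth \<phi>" "compact K" "K \<subseteq> box a b" "\<And>x. x \<notin> K \<Longrightarrow> \<phi> x = 0"
    using \<phi> by (auto simp: test_function_def)
  obtain B where B: "\<And>x. x \<in> cbox a b \<Longrightarrow> \<bar>\<phi> x\<bar> \<le> B" using smooth_bounded_box[OF K(1)] by blast
  let ?g = "\<lambda>x. indicator K x * g x"
  have gi: "integrable (lebesgue_on (box a b)) ?g"
    using g K by (intro integrable_supported) (auto simp: locally_integrable_def)
  have "integrable (lebesgue_on (box a b)) (\<lambda>x. ?g x * \<phi> x)"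
  proof (rule Bochner_Integration.integrable_bound)
    show "integrable (lebesgue_on (box a b)) (\<lambda>x. B * ?g x)" using gi by simp
    show "(\<lambda>x. ?g x * \<phi> x) \<in> borel_measurable (lebesgue_on (box a b))"
      by (rule borel_measurable_times[OF borel_measurable_integrable[OF gi] smooth_measurable_on[OF K(1)]])
    show "AE x in lebesgue_on (box a b). norm (?g x * \<phi> x) \<le> norm (B * ?g x)"
    proof (rule AE_I2)
      fix x assume "x \<in> space (lebesgue_on (box a b))"
      then have "\<bar>\<phi> x\<bar> \<le> \<bar>B\<bar>" using B[of x] box_subset_cbox[of a b] by (auto intro: order_trans[OF _ abs_ge_self])
      then show "norm (?g x * \<phi> x) \<le> norm (B * ?g x)"
        by (simp add: abs_mult mult.commute[of _ "\<bar>\<phi> x\<bar>"] mult_right_mono)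
    qed
  qed
  moreover have "(\<lambda>x. ?g x * \<phi> x) = (\<lambda>x. g x * \<phi> x)"
    using K(4) by (auto simp: fun_eq_iff indicator_def)
  ultimately show ?thesis by simp
qed

lemma compact_sets_lebesgue: "compact K \<Longrightarrow> K \<in> sets (lebesgue :: 'a::euclidean_space measure)"
  by (simp add: lmeasurable_compact fmeasurableD)

lemma sqi_locally_integrable:
  assumes "square_integrable (lebesgue_on (box a b)) g"
  shows "locally_integrable (box a b) g"
  unfolding locally_integrable_def
  using integrable_lebesgue_on_subset[OF sqi_imp_integrable_box[OF assms]] compact_sets_lebesgue by auto

lemma locally_integrable_lincomb:
  "locally_integrable S f \<Longrightarrow> locally_integrable S g \<Longrightarrow> locally_integrable S (\<lambda>x. c * f x + d * g x)"
  by (auto simp: locally_integrable_def)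

lemma AE_lebesgue_on_subset:
  assumes "AE x in lebesgue_on S. P x" "T \<subseteq> S" "T \<in> sets lebesgue" "S \<in> sets lebesgue"
  shows "AE x in lebesgue_on T. P x"
proof -
  have "AE x in lebesgue. x \<in> S \<longrightarrow> P x" using assms(1,4) by (simp add: AE_restrict_space_iff)
  then have "AE x in lebesgue. x \<in> T \<longrightarrow> P x" by eventually_elim (use assms(2) in auto)
  then show ?thesis using assms(3) by (simp add: AE_restrict_space_iff)
qed

lemma locally_integrable_AE_cong:
  assumes "locally_integrable (box a b) f" "AE x in lebesgue_on (box a b). f x = g x"
  shows "locally_integrable (box a b) g"
  unfolding locally_integrable_def
proof (intro allI impI)
  fix K assume K: "compact K \<and> K \<subseteq> box a b"
  then have KS: "K \<in> sets lebesgue" by (simp add: compact_sets_lebesgue)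
  have fi: "integrable (lebesgue_on K) f" using assms(1) K by (simp add: locally_integrable_def)
  have ae: "AE x in lebesgue_on K. f x = g x"
    by (rule AE_lebesgue_on_subset[OF assms(2) _ KS]) (use K in simp_all)
  have "g \<in> borel_measurable (lebesgue_on K)"
    using AE_eq_measurable_lebesgue_on[OF KS ae] fi by auto
  then show "integrable (lebesgue_on K) g" using integrable_cong_AE[OF _ _ ae] fi by auto
qed

text \<open>The difference of two weak derivatives is orthogonal to all test functions.\<close>

lemma wd_unique:
  assumes "has_weak_derivative (box a b) \<alpha> u v" "has_weak_derivative (box a b) \<alpha> u w"
  shows "AE x in lebesgue_on (box a b). v x = w x"
proof -
  have l: "locally_integrable (box a b) v" "locally_integrable (box a b) w"
    using assms by (auto simp: has_weak_derivative_def)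
  have "AE x in lebesgue_on (box a b). 1 * v x + (-1) * w x = 0"
  proof (rule AE_zero_if_orthogonal_to_tests)
    show "locally_integrable (box a b) (\<lambda>x. 1 * v x + (-1) * w x)" using l by (rule locally_integrable_lincomb)
    fix \<phi> assume \<phi>: "test_function (box a b) \<phi>"
    let ?c = "(-1) ^ order_of \<alpha> :: real"
    have "(LINT x|lebesgue_on (box a b). u x * mpartial \<alpha> \<phi> x) = ?c * (LINT x|lebesgue_on (box a b). v x * \<phi> x)"
      "(LINT x|lebesgue_on (box a b). u x * mpartial \<alpha> \<phi> x) = ?c * (LINT x|lebesgue_on (box a b). w x * \<phi> x)"
      using assms \<phi> by (auto simp: has_weak_derivative_def)
    then have "(LINT x|lebesgue_on (box a b). v x * \<phi> x) = (LINT x|lebesgue_on (box a b). w x * \<phi> x)" by simp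
    then show "(LINT x|lebesgue_on (box a b). (1 * v x + - 1 * w x) * \<phi> x) = 0"
      using locally_integrable_test[OF l(1) \<phi>] locally_integrable_test[OF l(2) \<phi>]
      by (simp add: left_diff_distrib)
  qed
  then show ?thesis by eventually_elim simp
qed

lemma wd_AE_cong:
  assumes "has_weak_derivative (box a b) \<alpha> u v"
    and u: "AE x in lebesgue_on (box a b). u x = u' x" and v: "AE x in lebesgue_on (box a b). v x = v' x"
  shows "has_weak_derivative (box a b) \<alpha> u' v'"
proof -
  have l: "locally_integrable (box a b) u'" "locally_integrable (box a b) v'" "locally_integrable (box a b) u" "locally_integrable (box a b) v"
    using assms locally_integrable_AE_cong by (auto simp: has_weak_derivative_def)
  have "(LINT x|lebesgue_on (box a b). w x * \<phi> x) = (LINT x|lebesgue_on (box a b). w' x * \<phi> x)"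
    if "AE x in lebesgue_on (box a b). w x = w' x" "locally_integrable (box a b) w"
      "locally_integrable (box a b) w'" "test_function (box a b) \<phi>" for w w' \<phi>
  proof (rule integral_cong_AE)
    show "AE x in lebesgue_on (box a b). w x * \<phi> x = w' x * \<phi> x" using that(1) by eventually_elim simp
  qed (use locally_integrable_test[OF that(2,4)] locally_integrable_test[OF that(3,4)] in auto)
  note eq = this
  show ?thesis
    unfolding has_weak_derivative_def
  proof (intro conjI allI impI l)
    fix \<phi> assume \<phi>: "test_function (box a b) \<phi>"
    have "(LINT x|lebesgue_on (box a b). u x * mpartial \<alpha> \<phi> x) =
        (-1) ^ order_of \<alpha> * (LINT x|lebesgue_on (box a b). v x * \<phi> x)"
      using assms(1) \<phi> by (simp add: has_weak_derivative_def)
    then show "(LINT x|lebesgue_on (box a b). u' x * mpartial \<alpha> \<phi> x) =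
        (-1) ^ order_of \<alpha> * (LINT x|lebesgue_on (box a b). v' x * \<phi> x)"
      using eq[OF u l(3,1) test_function_mpartial[OF \<phi>]] eq[OF v l(4,2) \<phi>] by simp
  qed
qed

lemma wd_lincomb:
  assumes "has_weak_derivative (box a b) \<alpha> u v" "has_weak_derivative (box a b) \<alpha> u' v'"
  shows "has_weak_derivative (box a b) \<alpha> (\<lambda>x. c * u x + d * u' x) (\<lambda>x. c * v x + d * v' x)"
  unfolding has_weak_derivative_def
proof (intro conjI allI impI)
  have l: "locally_integrable (box a b) u" "locally_integrable (box a b) v" "locally_integrable (box a b) u'" "locally_integrable (box a b) v'"
    using assms by (auto simp: has_weak_derivative_def)
  then show "locally_integrable (box a b) (\<lambda>x. c * u x + d * u' x)" "locally_integrable (box a b) (\<lambda>x. c * v x + d * v' x)"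
    by (auto intro: locally_integrable_lincomb)
  fix \<phi> assume \<phi>: "test_function (box a b) \<phi>"
  note \<phi>' = test_function_mpartial[OF \<phi>, of \<alpha>]
  have lin: "(LINT x|lebesgue_on (box a b). (c * w x + d * w' x) * \<psi> x) =
     c * (LINT x|lebesgue_on (box a b). w x * \<psi> x) + d * (LINT x|lebesgue_on (box a b). w' x * \<psi> x)"
    if "locally_integrable (box a b) w" "locally_integrable (box a b) w'" "test_function (box a b) \<psi>" for w w' \<psi>
    using locally_integrable_test[OF that(1,3)] locally_integrable_test[OF that(2,3)]
    by (simp add: distrib_right mult.assoc)
  show "(LINT x|lebesgue_on (box a b). (c * u x + d * u' x) * mpartial \<alpha> \<phi> x) =
    (-1) ^ order_of \<alpha> * (LINT x|lebesgue_on (box a b). (c * v x + d * v' x) * \<phi> x)"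
    using assms \<phi> lin[OF l(1,3) \<phi>'] lin[OF l(2,4) \<phi>]
    by (simp add: has_weak_derivative_def algebra_simps)
qed

lemma wd_zero_order:
  assumes "locally_integrable (box a b) u"
  shows "has_weak_derivative (box a b) (\<lambda>_. 0) u u"
  using assms by (simp add: has_weak_derivative_def)

lemma mpartial_mpartial:
  assumes "smooth f" shows "mpartial \<alpha> (mpartial \<beta> f) = mpartial (\<lambda>i. \<alpha> i + \<beta> i) f"
  using assms
proof (induction "order_of \<beta>" arbitrary: \<beta> f)
  case 0
  then have "\<beta> = (\<lambda>_. 0)" by (simp add: order_0_iff)
  then show ?case by simp
next
  case (Suc n)
  then obtain i \<gamma> where g: "\<beta> = \<gamma>(i := Suc (\<gamma> i))" "order_of \<gamma> = n" using order_Suc_cases by metis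
  have eq: "(\<lambda>j. \<alpha> j + \<beta> j) = (\<lambda>j. \<alpha> j + \<gamma> j)(i := Suc ((\<lambda>j. \<alpha> j + \<gamma> j) i))" by (auto simp: g)
  have "mpartial \<beta> f = mpartial \<gamma> (partial i f)" unfolding g(1) by (rule mpartial_upd[OF Suc(3)])
  moreover have "mpartial (\<lambda>j. \<alpha> j + \<beta> j) f = mpartial (\<lambda>j. \<alpha> j + \<gamma> j) (partial i f)"
    unfolding eq by (rule mpartial_upd[OF Suc(3)])
  ultimately show ?case using Suc(1)[of \<gamma> "partial i f"] Suc(3) g(2) by (simp add: smooth_partial)
qed

lemma order_of_add: "order_of (\<lambda>i. \<alpha> i + \<beta> i) = order_of \<alpha> + order_of \<beta>"
  by (simp add: order_of_def sum.distrib)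

lemma wd_compose:
  assumes "has_weak_derivative S \<beta> u v" "has_weak_derivative S (\<lambda>i. \<alpha> i + \<beta> i) u w"
  shows "has_weak_derivative S \<alpha> v w"
  unfolding has_weak_derivative_def
proof (intro conjI allI impI)
  fix \<phi> assume \<phi>: "test_function S \<phi>"
  have "(-1) ^ order_of \<beta> * (LINT x|lebesgue_on S. v x * mpartial \<alpha> \<phi> x) = (LINT x|lebesgue_on S. u x * mpartial \<beta> (mpartial \<alpha> \<phi>) x)"
    using assms(1) test_function_mpartial[OF \<phi>, of \<alpha>] by (simp add: has_weak_derivative_def)
  also have "\<dots> = (LINT x|lebesgue_on S. u x * mpartial (\<lambda>i. \<alpha> i + \<beta> i) \<phi> x)"
    using test_function_smooth[OF \<phi>] by (simp add: mpartial_mpartial add.commute)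
  also have "\<dots> = (-1) ^ (order_of \<alpha> + order_of \<beta>) * (LINT x|lebesgue_on S. w x * \<phi> x)"
    using assms(2) \<phi> by (simp add: has_weak_derivative_def order_of_add)
  finally show "(LINT x|lebesgue_on S. v x * mpartial \<alpha> \<phi> x) = (-1) ^ order_of \<alpha> * (LINT x|lebesgue_on S. w x * \<phi> x)"
    by (simp add: power_add minus_one_power_iff split: if_splits)
qed (use assms in \<open>auto simp: has_weak_derivative_def\<close>)

lemma wd_subset:
  assumes wd: "has_weak_derivative S \<alpha> u v" and T: "T \<subseteq> S" "T \<in> sets lebesgue" "S \<in> sets lebesgue"
  shows "has_weak_derivative T \<alpha> u v"
  unfolding has_weak_derivative_def
proof (intro conjI allI impI)
  show "locally_integrable T u" "locally_integrable T v"
    using wd T(1) by (auto simp: has_weak_derivative_def locally_integrable_def)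
  fix \<phi> assume \<phi>: "test_function T \<phi>"
  have *: "(LINT x|lebesgue_on S. u x * mpartial \<alpha> \<phi> x) = (-1) ^ order_of \<alpha> * (LINT x|lebesgue_on S. v x * \<phi> x)"
    using wd test_function_mono[OF \<phi> T(1)] by (simp add: has_weak_derivative_def)
  have "(LINT x|lebesgue_on S. w x * \<psi> x) = (LINT x|lebesgue_on T. w x * \<psi> x)" if "test_function T \<psi>" for w \<psi>
    using test_function_outside[OF that] T by (intro integral_lebesgue_on_supported) auto
  note eq = this
  show "(LINT x|lebesgue_on T. u x * mpartial \<alpha> \<phi> x) = (-1) ^ order_of \<alpha> * (LINT x|lebesgue_on T. v x * \<phi> x)"
    using * eq[OF \<phi>, of v] eq[OF test_function_mpartial[OF \<phi>], of u \<alpha>] by simp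
qed

section \<open>Sobolev spaces on boxes\<close>

lemma in_H_wderiv:
  assumes "in_H k (box a b) u" "order_of \<alpha> \<le> k"
  shows "has_weak_derivative (box a b) \<alpha> u (wderiv (box a b) \<alpha> u)"
    and "square_integrable (lebesgue_on (box a b)) (wderiv (box a b) \<alpha> u)"
proof -
  obtain v where v: "has_weak_derivative (box a b) \<alpha> u v" "square_integrable (lebesgue_on (box a b)) v"
    using assms by (auto simp: in_H_def)
  show wd: "has_weak_derivative (box a b) \<alpha> u (wderiv (box a b) \<alpha> u)"
    using someI[of "has_weak_derivative (box a b) \<alpha> u", OF v(1)] by (simp add: wderiv_def)
  have ae: "AE x in lebesgue_on (box a b). v x = wderiv (box a b) \<alpha> u x" using v(1) wd by (rule wd_unique)
  show "square_integrable (lebesgue_on (box a b)) (wderiv (box a b) \<alpha> u)"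
    by (rule sqi_AE_cong(1)[OF ae AE_eq_measurable_lebesgue_on[OF _ ae] v(2)]) (use v(2) in \<open>auto intro: sqi_measurable\<close>)
qed

lemma wderiv_AE_eq:
  assumes "has_weak_derivative (box a b) \<alpha> u v"
  shows "AE x in lebesgue_on (box a b). wderiv (box a b) \<alpha> u x = v x"
  using someI[of "has_weak_derivative (box a b) \<alpha> u", OF assms] assms unfolding wderiv_def by (rule wd_unique)

lemma wderiv_integral_eq:
  assumes "has_weak_derivative (box a b) \<alpha> u v" "square_integrable (lebesgue_on (box a b)) v"
  shows "(LINT x|lebesgue_on (box a b). (wderiv (box a b) \<alpha> u x)\<^sup>2) = (LINT x|lebesgue_on (box a b). (v x)\<^sup>2)"
proof -
  have ae: "AE x in lebesgue_on (box a b). v x = wderiv (box a b) \<alpha> u x"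
    using wderiv_AE_eq[OF assms(1)] by eventually_elim simp
  show ?thesis
    by (rule sqi_AE_cong(2)[OF ae AE_eq_measurable_lebesgue_on[OF _ ae] assms(2)])
       (use assms(2) in \<open>auto intro: sqi_measurable\<close>)
qed

lemma in_H_sqi:
  assumes "in_H k (box a b) u"
  shows "square_integrable (lebesgue_on (box a b)) u"
    and "AE x in lebesgue_on (box a b). wderiv (box a b) (\<lambda>_. 0) u x = u x"
proof -
  have wd: "has_weak_derivative (box a b) (\<lambda>_. 0) u (wderiv (box a b) (\<lambda>_. 0) u)"
    and s: "square_integrable (lebesgue_on (box a b)) (wderiv (box a b) (\<lambda>_. 0) u)"
    using in_H_wderiv[OF assms] by auto
  have "has_weak_derivative (box a b) (\<lambda>_. 0) u u" using wd by (intro wd_zero_order) (auto simp: has_weak_derivative_def)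
  from wd_unique[OF wd this] show ae: "AE x in lebesgue_on (box a b). wderiv (box a b) (\<lambda>_. 0) u x = u x" .
  show "square_integrable (lebesgue_on (box a b)) u"
    by (rule sqi_AE_cong(1)[OF ae AE_eq_measurable_lebesgue_on[OF _ ae] s]) (use s in \<open>auto intro: sqi_measurable\<close>)
qed

lemma in_H_mono: "in_H k S u \<Longrightarrow> l \<le> k \<Longrightarrow> in_H l S u"
  by (auto simp: in_H_def)

lemma in_H_lincomb:
  assumes "in_H k (box a b) u" "in_H k (box a b) v"
  shows "in_H k (box a b) (\<lambda>x. c * u x + d * v x)"
  unfolding in_H_def
proof (intro allI impI)
  fix \<alpha> assume "order_of \<alpha> \<le> k"
  note wd = in_H_wderiv[OF assms(1) this] in_H_wderiv[OF assms(2) this]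
  show "\<exists>w. has_weak_derivative (box a b) \<alpha> (\<lambda>x. c * u x + d * v x) w \<and> square_integrable (lebesgue_on (box a b)) w"
    using wd_lincomb[OF wd(1,3)] sqi_add[OF sqi_cmult[OF wd(2)] sqi_cmult[OF wd(4)]] by blast
qed

lemma wderiv_lincomb:
  assumes "in_H k (box a b) u" "in_H k (box a b) v" "order_of \<alpha> \<le> k"
  shows "AE x in lebesgue_on (box a b). wderiv (box a b) \<alpha> (\<lambda>x. c * u x + d * v x) x
    = c * wderiv (box a b) \<alpha> u x + d * wderiv (box a b) \<alpha> v x"
  by (rule wderiv_AE_eq, rule wd_lincomb) (use assms in_H_wderiv in auto)

lemma in_H_wderiv_wd:
  assumes "in_H k (box a b) u" "order_of \<alpha> + order_of \<beta> \<le> k"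
  shows "has_weak_derivative (box a b) \<alpha> (wderiv (box a b) \<beta> u) (wderiv (box a b) (\<lambda>i. \<alpha> i + \<beta> i) u)"
  by (rule wd_compose[OF in_H_wderiv(1)[OF assms(1)] in_H_wderiv(1)[OF assms(1)]])
     (use assms(2) in \<open>simp_all add: order_of_add\<close>)

lemma in_H_wderiv_in_H:
  assumes "in_H k (box a b) u" "order_of \<beta> + l \<le> k"
  shows "in_H l (box a b) (wderiv (box a b) \<beta> u)"
  unfolding in_H_def
proof (intro allI impI)
  fix \<alpha> :: "3 \<Rightarrow> nat" assume "order_of \<alpha> \<le> l"
  then show "\<exists>v. has_weak_derivative (box a b) \<alpha> (wderiv (box a b) \<beta> u) v \<and> square_integrable (lebesgue_on (box a b)) v"
    using in_H_wderiv_wd[OF assms(1), of \<alpha> \<beta>] in_H_wderiv(2)[OF assms(1), of "\<lambda>i. \<alpha> i + \<beta> i"] assms(2)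
    by (auto simp: order_of_add)
qed

lemma in_H_AE_cong:
  assumes "in_H k (box a b) u" "AE x in lebesgue_on (box a b). u x = v x"
  shows "in_H k (box a b) v"
  unfolding in_H_def
proof (intro allI impI)
  fix \<alpha> assume "order_of \<alpha> \<le> k"
  note w = in_H_wderiv[OF assms(1) this]
  show "\<exists>w. has_weak_derivative (box a b) \<alpha> v w \<and> square_integrable (lebesgue_on (box a b)) w"
    using wd_AE_cong[OF w(1) assms(2) AE_I2[OF refl]] w(2) by blast
qed

lemma normH_sq: "(normH k S u)\<^sup>2 = (\<Sum>\<alpha> | order_of \<alpha> \<le> k. LINT x|lebesgue_on S. (wderiv S \<alpha> u x)\<^sup>2)"
  unfolding normH_def by (intro real_sqrt_pow2 sum_nonneg) simp

lemma normH_nonneg: "normH k S u \<ge> 0"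
  by (simp add: normH_def sum_nonneg)

lemma wderiv_le_normH:
  "order_of \<alpha> \<le> k \<Longrightarrow> (LINT x|lebesgue_on S. (wderiv S \<alpha> u x)\<^sup>2) \<le> (normH k S u)\<^sup>2"
  unfolding normH_sq by (rule member_le_sum) auto

lemma order_le_1_cases:
  assumes "order_of \<alpha> \<le> 1" obtains "\<alpha> = (\<lambda>_. 0)" | i where "\<alpha> = dir i"
proof (cases "order_of \<alpha>")
  case 0
  then show ?thesis using that(1) by (simp add: order_0_iff)
next
  case (Suc n)
  then obtain i \<beta> where "\<alpha> = \<beta>(i := Suc (\<beta> i))" "order_of \<beta> = n" using order_Suc_cases by blast
  moreover have "n = 0" using Suc assms by simp
  ultimately have "\<alpha> = dir i" by (simp add: order_0_iff dir_upd)
  then show ?thesis by (rule that(2))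
qed

text \<open>Test functions vanish near the faces, so the divergence theorem leaves no boundary term.\<close>

lemma smooth_weak_derivative:
  assumes A: "A > 0" and f: "smooth f"
  shows "has_weak_derivative (cube A) (dir i) f (partial i f)"
  unfolding has_weak_derivative_def
proof (intro conjI allI impI)
  show "locally_integrable (cube A) f" "locally_integrable (cube A) (partial i f)"
    using f unfolding cube_box by (auto intro!: sqi_locally_integrable smooth_sqi_box)
  fix \<phi> assume \<phi>: "test_function (cube A) \<phi>"
  have s: "smooth \<phi>" using \<phi> by (rule test_function_smooth)
  have z: "\<phi> (face_point A (i, s) p) = 0" if "s \<in> {1, -1}" for s p
    using test_function_outside[OF \<phi>] that A by (auto simp: face_point_insert_coord insert_coord_in_cube)
  have "(LINT x|lebesgue_on (cube A). partial i (\<lambda>x. f x * \<phi> x) x) = 0"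
    using cube_FTC[OF A, of "\<lambda>x. f x * \<phi> x" i] f s by (simp add: z smooth_mult)
  moreover have "partial i (\<lambda>x. f x * \<phi> x) = (\<lambda>x. partial i f x * \<phi> x + f x * partial i \<phi> x)"
    using f s by (rule partial_smooth_mult)
  moreover have "integrable (lebesgue_on (cube A)) (\<lambda>x. partial i f x * \<phi> x)" "integrable (lebesgue_on (cube A)) (\<lambda>x. f x * partial i \<phi> x)"
    using f s unfolding cube_box by (auto intro!: sqi_mult smooth_sqi_box)
  ultimately show "(LINT x|lebesgue_on (cube A). f x * mpartial (dir i) \<phi> x) =
      (-1) ^ order_of (dir i) * (LINT x|lebesgue_on (cube A). partial i f x * \<phi> x)"
    by (simp add: mpartial_dir[OF s])
qed

text \<open>Approximation by smooth functions in \<open>H\<^sup>1\<close>, in terms of \<open>L\<^sup>2\<close> norms only.\<close>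

definition H1_limit :: "real \<Rightarrow> (nat \<Rightarrow> real^3 \<Rightarrow> real) \<Rightarrow> (real^3 \<Rightarrow> real) \<Rightarrow> bool" where
  "H1_limit A \<phi> u \<longleftrightarrow> in_H 1 (cube A) u \<and> (\<forall>k. smooth (\<phi> k)) \<and>
    (\<lambda>k. LINT x|lebesgue_on (cube A). (\<phi> k x - u x)\<^sup>2) \<longlonglongrightarrow> 0 \<and>
    (\<forall>i. (\<lambda>k. LINT x|lebesgue_on (cube A). (partial i (\<phi> k) x - wderiv (cube A) (dir i) u x)\<^sup>2) \<longlonglongrightarrow> 0)"

lemma normH1_diff_sq:
  assumes A: "A > 0" and u: "in_H 1 (cube A) u" and \<phi>: "smooth \<phi>"
  shows "(normH 1 (cube A) (\<lambda>x. \<phi> x - u x))\<^sup>2 = (LINT x|lebesgue_on (cube A). (\<phi> x - u x)\<^sup>2) +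
    (\<Sum>i\<in>UNIV. LINT x|lebesgue_on (cube A). (partial i \<phi> x - wderiv (cube A) (dir i) u x)\<^sup>2)"
proof -
  note u' = u[unfolded cube_box]
  have "\<alpha> \<in> insert (\<lambda>_. 0) (range dir)" if "order_of \<alpha> \<le> 1" for \<alpha>
    using that by (cases rule: order_le_1_cases) auto
  then have "{\<alpha>. order_of \<alpha> \<le> 1} = insert (\<lambda>_. 0) (range dir)" by auto
  moreover have "(\<lambda>_. 0) \<notin> range dir" by (metis imageE order_dir(1) order_of_zero zero_neq_one)
  moreover have "inj dir"
  proof (rule injI)
    fix i j assume "dir i = dir j"
    then have "dir i i = dir j i" by simp
    then show "i = j" by (simp add: dir_def split: if_splits)
  qed
  ultimately have "(normH 1 (cube A) (\<lambda>x. \<phi> x - u x))\<^sup>2 =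
    (LINT x|lebesgue_on (cube A). (wderiv (cube A) (\<lambda>_. 0) (\<lambda>x. \<phi> x - u x) x)\<^sup>2) +
    (\<Sum>i\<in>UNIV. LINT x|lebesgue_on (cube A). (wderiv (cube A) (dir i) (\<lambda>x. \<phi> x - u x) x)\<^sup>2)"
    by (simp add: normH_sq sum.reindex)
  moreover have "(LINT x|lebesgue_on (cube A). (wderiv (cube A) (\<lambda>_. 0) (\<lambda>x. \<phi> x - u x) x)\<^sup>2) =
    (LINT x|lebesgue_on (cube A). (\<phi> x - u x)\<^sup>2)"
    unfolding cube_box
    by (intro wderiv_integral_eq wd_zero_order sqi_locally_integrable sqi_diff smooth_sqi_box \<phi> in_H_sqi(1)[OF u'])
  moreover have "(LINT x|lebesgue_on (cube A). (wderiv (cube A) (dir i) (\<lambda>x. \<phi> x - u x) x)\<^sup>2) =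
    (LINT x|lebesgue_on (cube A). (partial i \<phi> x - wderiv (cube A) (dir i) u x)\<^sup>2)" for i
  proof -
    have "has_weak_derivative (cube A) (dir i) (\<lambda>x. 1 * \<phi> x + (-1) * u x) (\<lambda>x. 1 * partial i \<phi> x + (-1) * wderiv (cube A) (dir i) u x)"
      unfolding cube_box by (intro wd_lincomb smooth_weak_derivative[OF A \<phi>, unfolded cube_box] in_H_wderiv(1)[OF u']) simp
    then have "has_weak_derivative (cube A) (dir i) (\<lambda>x. \<phi> x - u x) (\<lambda>x. partial i \<phi> x - wderiv (cube A) (dir i) u x)" by simp
    then show ?thesis unfolding cube_box
      by (intro wderiv_integral_eq sqi_diff smooth_sqi_box smooth_partial \<phi> in_H_wderiv(2)[OF u']) simp_all
  qed
  ultimately show ?thesis by simp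
qed

lemma H1_limitI:
  assumes A: "A > 0" and u: "in_H 1 (cube A) u" and \<phi>: "\<And>k. smooth (\<phi> k)"
    and lim: "(\<lambda>k. normH 1 (cube A) (\<lambda>x. \<phi> k x - u x)) \<longlonglongrightarrow> 0"
  shows "H1_limit A \<phi> u"
proof -
  have l: "(\<lambda>k. (normH 1 (cube A) (\<lambda>x. \<phi> k x - u x))\<^sup>2) \<longlonglongrightarrow> 0"
    using tendsto_power[OF lim, of 2] by simp
  have a: "(LINT x|lebesgue_on (cube A). (\<phi> k x - u x)\<^sup>2) \<le> (normH 1 (cube A) (\<lambda>x. \<phi> k x - u x))\<^sup>2" for k
    unfolding normH1_diff_sq[OF A u \<phi>] by (simp add: sum_nonneg)
  have b: "(LINT x|lebesgue_on (cube A). (partial i (\<phi> k) x - wderiv (cube A) (dir i) u x)\<^sup>2) \<le> (normH 1 (cube A) (\<lambda>x. \<phi> k x - u x))\<^sup>2" for k i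
  proof -
    have "(LINT x|lebesgue_on (cube A). (partial i (\<phi> k) x - wderiv (cube A) (dir i) u x)\<^sup>2) \<le>
      (\<Sum>i\<in>UNIV. LINT x|lebesgue_on (cube A). (partial i (\<phi> k) x - wderiv (cube A) (dir i) u x)\<^sup>2)"
      by (rule member_le_sum) auto
    then show ?thesis unfolding normH1_diff_sq[OF A u \<phi>] by (simp add: add_increasing)
  qed
  show ?thesis unfolding H1_limit_def
  proof (intro conjI allI u \<phi>)
    show "(\<lambda>k. LINT x|lebesgue_on (cube A). (\<phi> k x - u x)\<^sup>2) \<longlonglongrightarrow> 0"
      by (rule tendsto_sandwich[OF _ _ tendsto_const l], simp, rule always_eventually, rule allI, rule a)
    show "(\<lambda>k. LINT x|lebesgue_on (cube A). (partial i (\<phi> k) x - wderiv (cube A) (dir i) u x)\<^sup>2) \<longlonglongrightarrow> 0" for i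
      by (rule tendsto_sandwich[OF _ _ tendsto_const l], simp, rule always_eventually, rule allI, rule b)
  qed
qed

lemma H1_limit_normH:
  assumes A: "A > 0" and H: "H1_limit A \<phi> u"
  shows "(\<lambda>k. normH 1 (cube A) (\<lambda>x. \<phi> k x - u x)) \<longlonglongrightarrow> 0"
proof -
  let ?n = "\<lambda>k. normH 1 (cube A) (\<lambda>x. \<phi> k x - u x)"
  have "(\<lambda>k. (LINT x|lebesgue_on (cube A). (\<phi> k x - u x)\<^sup>2) +
    (\<Sum>i\<in>UNIV. LINT x|lebesgue_on (cube A). (partial i (\<phi> k) x - wderiv (cube A) (dir i) u x)\<^sup>2)) \<longlonglongrightarrow> 0 + (\<Sum>i\<in>(UNIV::3 set). 0)"
    using H unfolding H1_limit_def by (intro tendsto_add tendsto_sum) auto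
  moreover have "(?n k)\<^sup>2 = (LINT x|lebesgue_on (cube A). (\<phi> k x - u x)\<^sup>2) +
    (\<Sum>i\<in>UNIV. LINT x|lebesgue_on (cube A). (partial i (\<phi> k) x - wderiv (cube A) (dir i) u x)\<^sup>2)" for k
    using H by (intro normH1_diff_sq[OF A]) (simp_all add: H1_limit_def)
  ultimately have "(\<lambda>k. (?n k)\<^sup>2) \<longlonglongrightarrow> 0" by simp
  from tendsto_real_sqrt[OF this] have "(\<lambda>k. \<bar>?n k\<bar>) \<longlonglongrightarrow> 0" by (simp only: real_sqrt_abs real_sqrt_zero)
  then show ?thesis by (simp only: abs_of_nonneg[OF normH_nonneg])
qed

section \<open>Traces and integration by parts\<close>

lemma sqi_face:
  assumes A: "A > 0" and s: "s \<in> {1, -1}" and W: "smooth W"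
  shows "square_integrable (lebesgue_on (square A)) (\<lambda>p. W (face_point A (i, s) p))"
proof -
  obtain B where B: "\<And>x. x \<in> cbox (\<chi> i. - A) (\<chi> i. A) \<Longrightarrow> \<bar>W x\<bar> \<le> B"
    using smooth_bounded_box[OF W] by blast
  have m: "(\<lambda>p. W (face_point A (i, s) p)) \<in> borel_measurable (lebesgue_on (square A))"
  proof -
    note [measurable] = smooth_measurable[OF W]
    have "(\<lambda>p. insert_coord i (s * A, p)) \<in> borel_measurable borel" by measurable
    then have "(\<lambda>p. W (face_point A (i, s) p)) \<in> borel_measurable borel"
      unfolding face_point_insert_coord by measurable
    then show ?thesis
      by (intro measurable_restrict_space1 measurable_completion) (simp add: measurable_lborel1)
  qed
  have fin: "finite_measure (lebesgue_on (square A))" unfolding square_box by (intro finite_measure_lebesgue_on) auto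
  have "face_point A (i, s) p \<in> cbox (\<chi> i. - A) (\<chi> i. A)" if "p \<in> square A" for p
    using that s A unfolding face_point_insert_coord mem_box_cart all_3_shift[of _ i]
    by (auto simp: square_def forall_2 less_imp_le)
  then have "\<bar>W (face_point A (i, s) p)\<bar> \<le> B" if "p \<in> square A" for p using that B by blast
  then have b: "(W (face_point A (i, s) p))\<^sup>2 \<le> B\<^sup>2" if "p \<in> square A" for p
    using that power_mono[of "\<bar>W (face_point A (i, s) p)\<bar>" B 2] by simp
  show ?thesis unfolding square_integrable_def
  proof
    show "integrable (lebesgue_on (square A)) (\<lambda>p. (W (face_point A (i, s) p))\<^sup>2)"
      by (rule finite_measure.integrable_const_bound[OF fin, of _ "B\<^sup>2"]) (use m b in \<open>auto intro!: AE_I2\<close>)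
  qed (rule m)
qed

lemma L2_limit_lincomb:
  assumes "\<And>k. square_integrable M (\<lambda>x. f k x - F x)" "\<And>k. square_integrable M (\<lambda>x. g k x - G x)"
    and "(\<lambda>k::nat. LINT x|M. (f k x - F x)\<^sup>2) \<longlonglongrightarrow> 0" "(\<lambda>k. LINT x|M. (g k x - G x)\<^sup>2) \<longlonglongrightarrow> 0"
  shows "(\<lambda>k. LINT x|M. ((c * f k x + d * g k x) - (c * F x + d * G x))\<^sup>2) \<longlonglongrightarrow> 0"
proof (rule tendsto_sandwich[of "\<lambda>_. 0"])
  let ?b = "\<lambda>k. 2 * (c\<^sup>2 * (LINT x|M. (f k x - F x)\<^sup>2)) + 2 * (d\<^sup>2 * (LINT x|M. (g k x - G x)\<^sup>2))"
  have "(LINT x|M. ((c * f k x + d * g k x) - (c * F x + d * G x))\<^sup>2) \<le> ?b k" for k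
  proof -
    have e: "(c * f k x + d * g k x) - (c * F x + d * G x) = c * (f k x - F x) + d * (g k x - G x)" for x
      by (simp add: algebra_simps)
    have "(LINT x|M. (c * (f k x - F x) + d * (g k x - G x))\<^sup>2) \<le>
        2 * (LINT x|M. (c * (f k x - F x))\<^sup>2) + 2 * (LINT x|M. (d * (g k x - G x))\<^sup>2)"
      by (rule sqi_norm_add[OF sqi_cmult[OF assms(1)] sqi_cmult[OF assms(2)]])
    also have "\<dots> = ?b k" by (simp only: power_mult_distrib integral_mult_right_zero)
    finally show ?thesis unfolding e .
  qed
  then show "\<forall>\<^sub>F k in sequentially. (LINT x|M. ((c * f k x + d * g k x) - (c * F x + d * G x))\<^sup>2) \<le> ?b k"
    by (rule always_eventually[OF allI])
  have "?b \<longlonglongrightarrow> 2 * (c\<^sup>2 * 0) + 2 * (d\<^sup>2 * 0)" by (intro tendsto_intros assms)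
  then show "?b \<longlonglongrightarrow> 0" by simp
qed auto

lemma H1_limit_sqi:
  assumes "H1_limit A \<phi> u"
  shows "square_integrable (lebesgue_on (cube A)) u"
    and "square_integrable (lebesgue_on (cube A)) (wderiv (cube A) (dir i) u)"
    and "square_integrable (lebesgue_on (cube A)) (\<phi> k)"
    and "square_integrable (lebesgue_on (cube A)) (partial i (\<phi> k))"
proof -
  have u: "in_H 1 (box (cube_lower A) (cube_upper A 0)) u" and s: "smooth (\<phi> k)"
    using assms by (auto simp: H1_limit_def cube_box)
  show "square_integrable (lebesgue_on (cube A)) u" unfolding cube_box by (rule in_H_sqi(1)[OF u])
  show "square_integrable (lebesgue_on (cube A)) (wderiv (cube A) (dir i) u)"
    unfolding cube_box by (rule in_H_wderiv(2)[OF u]) simp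
  show "square_integrable (lebesgue_on (cube A)) (\<phi> k)"
    "square_integrable (lebesgue_on (cube A)) (partial i (\<phi> k))"
    unfolding cube_box by (intro smooth_sqi_box smooth_partial s)+
qed

lemma H1_limit_lincomb:
  assumes u: "H1_limit A \<phi> u" and v: "H1_limit A \<psi> v"
  shows "H1_limit A (\<lambda>k x. c * \<phi> k x + d * \<psi> k x) (\<lambda>x. c * u x + d * v x)"
  unfolding H1_limit_def
proof (intro conjI allI)
  have uv: "in_H 1 (box (cube_lower A) (cube_upper A 0)) u" "in_H 1 (box (cube_lower A) (cube_upper A 0)) v"
    and s: "\<And>k. smooth (\<phi> k)" "\<And>k. smooth (\<psi> k)"
    using assms by (auto simp: H1_limit_def cube_box)
  show "in_H 1 (cube A) (\<lambda>x. c * u x + d * v x)" unfolding cube_box by (rule in_H_lincomb[OF uv])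
  show "smooth (\<lambda>x. c * \<phi> k x + d * \<psi> k x)" for k using s by (intro smooth_add smooth_mult smooth_const)
  show "(\<lambda>k. LINT x|lebesgue_on (cube A). (c * \<phi> k x + d * \<psi> k x - (c * u x + d * v x))\<^sup>2) \<longlonglongrightarrow> 0"
    using u v by (intro L2_limit_lincomb sqi_diff H1_limit_sqi[OF u] H1_limit_sqi[OF v]) (auto simp: H1_limit_def)
  fix i
  have p: "partial i (\<lambda>x. c * \<phi> k x + d * \<psi> k x) = (\<lambda>x. c * partial i (\<phi> k) x + d * partial i (\<psi> k) x)" for k
    using s by (simp add: partial_smooth_add smooth_mult partial_scale)
  have w: "AE x in lebesgue_on (cube A). wderiv (cube A) (dir i) (\<lambda>x. c * u x + d * v x) x
    = c * wderiv (cube A) (dir i) u x + d * wderiv (cube A) (dir i) v x"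
    unfolding cube_box by (rule wderiv_lincomb[OF uv]) simp
  have uvw: "in_H 1 (box (cube_lower A) (cube_upper A 0)) (\<lambda>x. c * u x + d * v x)" by (rule in_H_lincomb[OF uv])
  have sw: "square_integrable (lebesgue_on (cube A)) (wderiv (cube A) (dir i) (\<lambda>x. c * u x + d * v x))"
    unfolding cube_box by (rule in_H_wderiv(2)[OF uvw]) simp
  have "(LINT x|lebesgue_on (cube A). (partial i (\<lambda>x. c * \<phi> k x + d * \<psi> k x) x - wderiv (cube A) (dir i) (\<lambda>x. c * u x + d * v x) x)\<^sup>2) =
    (LINT x|lebesgue_on (cube A). (c * partial i (\<phi> k) x + d * partial i (\<psi> k) x - (c * wderiv (cube A) (dir i) u x + d * wderiv (cube A) (dir i) v x))\<^sup>2)" for k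
  proof (rule integral_cong_AE)
    show "AE x in lebesgue_on (cube A). (partial i (\<lambda>x. c * \<phi> k x + d * \<psi> k x) x - wderiv (cube A) (dir i) (\<lambda>x. c * u x + d * v x) x)\<^sup>2 =
      (c * partial i (\<phi> k) x + d * partial i (\<psi> k) x - (c * wderiv (cube A) (dir i) u x + d * wderiv (cube A) (dir i) v x))\<^sup>2"
      using w by eventually_elim (simp add: p)
  qed (intro borel_measurable_power borel_measurable_diff borel_measurable_add borel_measurable_times borel_measurable_const
        sqi_measurable[OF sw] sqi_measurable[OF H1_limit_sqi(4)[OF u]] sqi_measurable[OF H1_limit_sqi(4)[OF v]]
        sqi_measurable[OF H1_limit_sqi(2)[OF u]] sqi_measurable[OF H1_limit_sqi(2)[OF v]]; simp only: p;
        intro borel_measurable_add borel_measurable_times borel_measurable_const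
        sqi_measurable[OF H1_limit_sqi(4)[OF u]] sqi_measurable[OF H1_limit_sqi(4)[OF v]])+
  moreover have "(\<lambda>k. LINT x|lebesgue_on (cube A). (c * partial i (\<phi> k) x + d * partial i (\<psi> k) x - (c * wderiv (cube A) (dir i) u x + d * wderiv (cube A) (dir i) v x))\<^sup>2) \<longlonglongrightarrow> 0"
    using u v by (intro L2_limit_lincomb sqi_diff H1_limit_sqi[OF u] H1_limit_sqi[OF v]) (auto simp: H1_limit_def)
  ultimately show "(\<lambda>k. LINT x|lebesgue_on (cube A). (partial i (\<lambda>x. c * \<phi> k x + d * \<psi> k x) x -
      wderiv (cube A) (dir i) (\<lambda>x. c * u x + d * v x) x)\<^sup>2) \<longlonglongrightarrow> 0" by simp
qed

lemma has_traceE: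
  assumes "A > 0" "has_trace A u F g"
  obtains \<phi> where "H1_limit A \<phi> u"
    "(\<lambda>k. LINT p|lebesgue_on (square A). (\<phi> k (face_point A F p) - g (face_point A F p))\<^sup>2) \<longlonglongrightarrow> 0"
proof -
  obtain \<phi> :: "nat \<Rightarrow> real^3 \<Rightarrow> real" where "in_H 1 (cube A) u" "\<And>k. smooth (\<phi> k)"
    "(\<lambda>k. normH 1 (cube A) (\<lambda>x. \<phi> k x - u x)) \<longlonglongrightarrow> 0"
    "(\<lambda>k. LINT p|lebesgue_on (square A). (\<phi> k (face_point A F p) - g (face_point A F p))\<^sup>2) \<longlonglongrightarrow> 0"
    using assms(2) unfolding has_trace_def by blast
  then show ?thesis using that H1_limitI[OF assms(1)] by blast
qed

lemma has_trace_lincomb: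
  assumes A: "A > 0" and s: "s \<in> {1, -1}" and u: "has_trace A u (i, s) g" and v: "has_trace A v (i, s) h"
  shows "has_trace A (\<lambda>x. c * u x + d * v x) (i, s) (\<lambda>x. c * g x + d * h x)"
proof -
  let ?S = "lebesgue_on (square A)" and ?f = "face_point A (i, s)"
  obtain \<phi> where \<phi>: "H1_limit A \<phi> u" "(\<lambda>k. LINT p|?S. (\<phi> k (?f p) - g (?f p))\<^sup>2) \<longlonglongrightarrow> 0"
    using has_traceE[OF A u] by blast
  obtain \<psi> where \<psi>: "H1_limit A \<psi> v" "(\<lambda>k. LINT p|?S. (\<psi> k (?f p) - h (?f p))\<^sup>2) \<longlonglongrightarrow> 0"
    using has_traceE[OF A v] by blast
  have sm: "smooth (\<phi> k)" "smooth (\<psi> k)" for k using \<phi>(1) \<psi>(1) by (auto simp: H1_limit_def)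
  have sq: "square_integrable ?S (\<lambda>p. g (?f p))" "square_integrable ?S (\<lambda>p. h (?f p))"
    using u v by (auto simp: has_trace_def)
  note H = H1_limit_lincomb[OF \<phi>(1) \<psi>(1), of c d]
  show ?thesis unfolding has_trace_def
  proof (intro conjI exI[of _ "\<lambda>k x. c * \<phi> k x + d * \<psi> k x"])
    show "in_H 1 (cube A) (\<lambda>x. c * u x + d * v x)" "\<forall>k. smooth (\<lambda>x. c * \<phi> k x + d * \<psi> k x)"
      using H by (auto simp: H1_limit_def)
    show "square_integrable ?S (\<lambda>p. c * g (?f p) + d * h (?f p))" using sq by (intro sqi_add sqi_cmult)
    show "(\<lambda>k. normH 1 (cube A) (\<lambda>x. c * \<phi> k x + d * \<psi> k x - (c * u x + d * v x))) \<longlonglongrightarrow> 0"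
      by (rule H1_limit_normH[OF A H])
    show "(\<lambda>k. LINT p|?S. (c * \<phi> k (?f p) + d * \<psi> k (?f p) - (c * g (?f p) + d * h (?f p)))\<^sup>2) \<longlonglongrightarrow> 0"
      using \<phi>(2) \<psi>(2) by (intro L2_limit_lincomb sqi_diff sqi_face A s sm sq)
  qed
qed

text \<open>The values agree at every point: both sides choose from the same set of weak derivatives.\<close>

lemma wderiv_AE_cong:
  assumes "AE x in lebesgue_on (box a b). u x = v x"
  shows "wderiv (box a b) \<alpha> u = wderiv (box a b) \<alpha> v"
proof -
  have "AE x in lebesgue_on (box a b). v x = u x" using assms by eventually_elim simp
  then have "has_weak_derivative (box a b) \<alpha> u w = has_weak_derivative (box a b) \<alpha> v w" for w
    using wd_AE_cong[OF _ assms AE_I2[OF refl]] wd_AE_cong[OF _ _ AE_I2[OF refl]] by blast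
  then show ?thesis by (simp add: wderiv_def)
qed

lemma has_trace_AE_cong:
  assumes A: "A > 0" and u: "has_trace A u (i, s) g" and ae: "AE x in lebesgue_on (cube A). u x = v x"
  shows "has_trace A v (i, s) g"
proof -
  have "in_H 1 (cube A) u" using u by (simp only: has_trace_def)
  then have v: "in_H 1 (cube A) v" unfolding cube_box by (rule in_H_AE_cong) (use ae in \<open>simp only: cube_box\<close>)
  have "AE x in lebesgue_on (cube A). \<phi> x - u x = \<phi> x - v x" for \<phi> using ae by eventually_elim simp
  then have "wderiv (cube A) \<alpha> (\<lambda>x. \<phi> x - u x) = wderiv (cube A) \<alpha> (\<lambda>x. \<phi> x - v x)" for \<alpha> \<phi>
    unfolding cube_box by (rule wderiv_AE_cong)
  then have "normH 1 (cube A) (\<lambda>x. \<phi> x - u x) = normH 1 (cube A) (\<lambda>x. \<phi> x - v x)" for \<phi>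
    by (simp add: normH_def)
  then show ?thesis using u v by (simp only: has_trace_def)
qed

text \<open>The integration by parts formula for all test functions of the form \<open>\<omega> w\<close> with smooth \<open>w\<close>;
  the weight \<open>\<omega>\<close> is used to kill boundary terms on faces where no boundary condition is known.\<close>

definition weak_IBP :: "real \<Rightarrow> 3 \<Rightarrow> (real^3 \<Rightarrow> real) \<Rightarrow> (real^3 \<Rightarrow> real) \<Rightarrow> (real^3 \<Rightarrow> real) \<Rightarrow> bool" where
  "weak_IBP A i \<omega> f f' \<longleftrightarrow> (\<forall>w. smooth w \<longrightarrow>
     (LINT x|lebesgue_on (cube A). f' x * (\<omega> x * w x)) = - (LINT x|lebesgue_on (cube A). f x * partial i (\<lambda>x. \<omega> x * w x) x))"

text \<open>The divergence theorem is applied to \<open>\<phi>\<^sub>k W\<close>. The boundary condition enters only through the limit of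
  the surface integrals, so it may come from the trace of \<open>f\<close> or from zeros of \<open>W\<close>.\<close>

lemma H1_limit_IBP:
  assumes A: "A > 0" and H: "H1_limit A \<phi> f" and W: "smooth W"
    and lim: "\<And>s. s \<in> {1, -1} \<Longrightarrow> (\<lambda>k. LINT p|lebesgue_on (square A). \<phi> k (face_point A (i, s) p) * W (face_point A (i, s) p)) \<longlonglongrightarrow> 0"
  shows "(LINT x|lebesgue_on (cube A). wderiv (cube A) (dir i) f x * W x) = - (LINT x|lebesgue_on (cube A). f x * partial i W x)"
proof -
  let ?M = "lebesgue_on (cube A)" and ?S = "lebesgue_on (square A)"
  have sm: "smooth (\<phi> k)" for k using H by (simp add: H1_limit_def)
  have sW: "square_integrable ?M W" "square_integrable ?M (partial i W)"
    unfolding cube_box using W by (auto intro: smooth_sqi_box)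
  have eq: "(LINT x|?M. partial i (\<phi> k) x * W x) + (LINT x|?M. \<phi> k x * partial i W x) =
    (LINT p|?S. \<phi> k (face_point A (i, 1) p) * W (face_point A (i, 1) p)) -
    (LINT p|?S. \<phi> k (face_point A (i, -1) p) * W (face_point A (i, -1) p))" for k
    using cube_FTC[OF A smooth_mult[OF sm W], of i k] sqi_mult[OF H1_limit_sqi(4)[OF H] sW(1)] sqi_mult[OF H1_limit_sqi(3)[OF H] sW(2)]
    by (simp add: partial_smooth_mult[OF sm W])
  have "(\<lambda>k. (LINT x|?M. partial i (\<phi> k) x * W x) + (LINT x|?M. \<phi> k x * partial i W x)) \<longlonglongrightarrow>
    (LINT x|?M. wderiv (cube A) (dir i) f x * W x) + (LINT x|?M. f x * partial i W x)"
    using H by (intro tendsto_add sqi_tendsto_mult H1_limit_sqi[OF H] sW) (auto simp: H1_limit_def)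
  moreover have "(\<lambda>k. (LINT x|?M. partial i (\<phi> k) x * W x) + (LINT x|?M. \<phi> k x * partial i W x)) \<longlonglongrightarrow> 0 - 0"
    unfolding eq using lim by (intro tendsto_diff) auto
  ultimately have "(LINT x|?M. wderiv (cube A) (dir i) f x * W x) + (LINT x|?M. f x * partial i W x) = 0"
    using LIMSEQ_unique by fastforce
  then show ?thesis by simp
qed

lemma face_point_nth: "face_point A (i, s) p $ i = s * A"
  by (simp add: face_point_insert_coord)

lemma IBP_vanishing:
  assumes A: "A > 0" and H: "H1_limit A \<phi> f" and W: "smooth W"
    and z: "\<And>x. x $ i = A \<or> x $ i = - A \<Longrightarrow> W x = 0"
  shows "(LINT x|lebesgue_on (cube A). wderiv (cube A) (dir i) f x * W x) = - (LINT x|lebesgue_on (cube A). f x * partial i W x)"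
proof (rule H1_limit_IBP[OF A H W])
  fix s :: real assume "s \<in> {1, -1}"
  then have "W (face_point A (i, s) p) = 0" for p using z[of "face_point A (i, s) p"] by (auto simp: face_point_nth)
  then show "(\<lambda>k. LINT p|lebesgue_on (square A). \<phi> k (face_point A (i, s) p) * W (face_point A (i, s) p)) \<longlonglongrightarrow> 0" by simp
qed

lemma IBP_one_face:
  assumes A: "A > 0" and s: "s \<in> {1, -1}" and tr: "has_trace A f (i, s) (\<lambda>_. 0)" and W: "smooth W"
    and z: "\<And>x. x $ i = - s * A \<Longrightarrow> W x = 0"
  shows "(LINT x|lebesgue_on (cube A). wderiv (cube A) (dir i) f x * W x) = - (LINT x|lebesgue_on (cube A). f x * partial i W x)"
proof -
  obtain \<phi> where \<phi>: "H1_limit A \<phi> f" "(\<lambda>k. LINT p|lebesgue_on (square A). (\<phi> k (face_point A (i, s) p) - 0)\<^sup>2) \<longlonglongrightarrow> 0"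
    using has_traceE[OF A tr] by blast
  show ?thesis
  proof (rule H1_limit_IBP[OF A \<phi>(1) W])
    fix r :: real assume r: "r \<in> {1, -1}"
    show "(\<lambda>k. LINT p|lebesgue_on (square A). \<phi> k (face_point A (i, r) p) * W (face_point A (i, r) p)) \<longlonglongrightarrow> 0"
    proof (cases "r = s")
      case True
      have "(\<lambda>k. LINT p|lebesgue_on (square A). \<phi> k (face_point A (i, s) p) * W (face_point A (i, s) p)) \<longlonglongrightarrow>
        (LINT p|lebesgue_on (square A). 0 * W (face_point A (i, s) p))"
        using \<phi> by (intro sqi_tendsto_mult sqi_face A s W sqi_zero) (auto simp: H1_limit_def)
      then show ?thesis using True by simp
    next
      case False
      then have "r = - s" using r s by auto
      then have "W (face_point A (i, r) p) = 0" for p using z[of "face_point A (i, r) p"] by (simp add: face_point_nth)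
      then show ?thesis by simp
    qed
  qed
qed

text \<open>The approximating sequences of the two traces may differ; an affine partition of unity in the
  \<open>i\<close>-th coordinate separates the faces.\<close>

lemma IBP_two_faces:
  assumes A: "A > 0" and tr: "has_trace A f (i, 1) (\<lambda>_. 0)" "has_trace A f (i, -1) (\<lambda>_. 0)" and W: "smooth W"
  shows "(LINT x|lebesgue_on (cube A). wderiv (cube A) (dir i) f x * W x) = - (LINT x|lebesgue_on (cube A). f x * partial i W x)"
proof -
  let ?M = "lebesgue_on (cube A)"
  define V where "V s x = (1/2 + s / (2 * A) * x $ i) * W x" for s x
  have V: "smooth (V s)" for s unfolding V_def by (intro smooth_add smooth_mult smooth_const smooth_coord W)
  obtain \<phi> where H: "H1_limit A \<phi> f" using has_traceE[OF A tr(1)] by blast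
  note sq = H1_limit_sqi(1)[OF H] H1_limit_sqi(2)[OF H, of i]
  have sV: "square_integrable ?M (V s)" "square_integrable ?M (partial i (V s))" for s
    unfolding cube_box using V by (auto intro: smooth_sqi_box)
  have e: "(LINT x|?M. wderiv (cube A) (dir i) f x * V s x) = - (LINT x|?M. f x * partial i (V s) x)" if "s \<in> {1, -1}" for s
    by (rule IBP_one_face[OF A that _ V]) (use that tr A in \<open>auto simp: V_def\<close>)
  have W': "W = (\<lambda>x. V 1 x + V (-1) x)" by (auto simp: V_def fun_eq_iff algebra_simps)
  have pW: "partial i W = (\<lambda>x. partial i (V 1) x + partial i (V (-1)) x)"
    unfolding W' by (rule partial_smooth_add[OF V V])
  have "(LINT x|?M. wderiv (cube A) (dir i) f x * W x) =
    (LINT x|?M. wderiv (cube A) (dir i) f x * V 1 x) + (LINT x|?M. wderiv (cube A) (dir i) f x * V (-1) x)"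
    unfolding W' using sqi_mult[OF sq(2) sV(1)] by (simp add: distrib_left)
  moreover have "(LINT x|?M. f x * partial i W x) = (LINT x|?M. f x * partial i (V 1) x) + (LINT x|?M. f x * partial i (V (-1)) x)"
    unfolding pW using sqi_mult[OF sq(1) sV(2)] by (simp add: distrib_left)
  ultimately show ?thesis using e[of 1] e[of "-1"] by simp
qed

text \<open>By density, the test function \<open>w\<close> in the integration by parts formula may be any function \<open>g\<close> that
  is an \<open>H\<^sup>1\<close> limit of smooth functions on the closed cube.\<close>

lemma weak_IBP_limit:
  assumes IBP: "weak_IBP A i \<omega> f f'" and \<omega>: "smooth \<omega>" and H: "H1_limit A h g"
    and f: "square_integrable (lebesgue_on (cube A)) f" "square_integrable (lebesgue_on (cube A)) f'"
  shows "(LINT x|lebesgue_on (cube A). \<omega> x * (f' x * g x)) =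
    - (LINT x|lebesgue_on (cube A). partial i \<omega> x * (f x * g x)) - (LINT x|lebesgue_on (cube A). \<omega> x * (f x * wderiv (cube A) (dir i) g x))"
proof -
  let ?M = "lebesgue_on (cube A)"
  have sm: "smooth (h k)" for k using H by (simp add: H1_limit_def)
  note f' = f[unfolded cube_box]
  have sf: "square_integrable ?M (\<lambda>x. \<omega> x * f' x)" "square_integrable ?M (\<lambda>x. partial i \<omega> x * f x)" "square_integrable ?M (\<lambda>x. \<omega> x * f x)"
    unfolding cube_box using f' \<omega> by (auto intro!: sqi_smooth_mult)
  have l1: "(\<lambda>k. LINT x|?M. h k x * (\<omega> x * f' x)) \<longlonglongrightarrow> (LINT x|?M. g x * (\<omega> x * f' x))"
    using H by (intro sqi_tendsto_mult H1_limit_sqi[OF H] sf) (simp add: H1_limit_def)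
  have l2: "(\<lambda>k. LINT x|?M. h k x * (partial i \<omega> x * f x)) \<longlonglongrightarrow> (LINT x|?M. g x * (partial i \<omega> x * f x))"
    using H by (intro sqi_tendsto_mult H1_limit_sqi[OF H] sf) (simp add: H1_limit_def)
  have l3: "(\<lambda>k. LINT x|?M. partial i (h k) x * (\<omega> x * f x)) \<longlonglongrightarrow> (LINT x|?M. wderiv (cube A) (dir i) g x * (\<omega> x * f x))"
    using H by (intro sqi_tendsto_mult H1_limit_sqi[OF H] sf) (simp add: H1_limit_def)
  have eq: "(LINT x|?M. h k x * (\<omega> x * f' x)) = - (LINT x|?M. h k x * (partial i \<omega> x * f x)) - (LINT x|?M. partial i (h k) x * (\<omega> x * f x))" for k
  proof -
    have "(LINT x|?M. f' x * (\<omega> x * h k x)) = - (LINT x|?M. f x * partial i (\<lambda>x. \<omega> x * h k x) x)"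
      using IBP sm by (simp add: weak_IBP_def)
    also have "(\<lambda>x. f x * partial i (\<lambda>x. \<omega> x * h k x) x) = (\<lambda>x. h k x * (partial i \<omega> x * f x) + partial i (h k) x * (\<omega> x * f x))"
      by (simp add: partial_smooth_mult[OF \<omega> sm] algebra_simps)
    finally show ?thesis
      using sqi_mult[OF H1_limit_sqi(3)[OF H] sf(2)] sqi_mult[OF H1_limit_sqi(4)[OF H] sf(3)] by (simp add: mult_ac)
  qed
  have "(\<lambda>k. LINT x|?M. h k x * (\<omega> x * f' x)) \<longlonglongrightarrow> - (LINT x|?M. g x * (partial i \<omega> x * f x)) - (LINT x|?M. wderiv (cube A) (dir i) g x * (\<omega> x * f x))"
    unfolding eq by (intro tendsto_intros l2 l3)
  from LIMSEQ_unique[OF l1 this] show ?thesis by (simp add: mult_ac)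
qed

lemma partial_vanishing_plane:
  assumes "\<And>y. y $ j = c \<Longrightarrow> f y = 0" "i \<noteq> j" "x $ j = c"
  shows "partial i f x = 0"
proof -
  have "(\<lambda>t. f (x + t *\<^sub>R axis i 1)) = (\<lambda>t. 0)"
    using assms by (intro ext assms(1)) (simp add: axis_def)
  then show ?thesis by (simp add: partial_def)
qed

lemma partial_indep:
  assumes "\<And>y t. f (y + t *\<^sub>R axis i 1) = f y"
  shows "partial i f x = 0"
  by (simp add: partial_def assms)

text \<open>A function with zero trace on the bottom has zero tangential derivatives there. Integrating by
  parts in the tangential direction requires a cut-off \<open>\<eta>\<close> in that direction, which disappears in
  the limit since the final formula contains no tangential derivative of \<open>\<eta>\<close>.\<close>

lemma weak_IBP_tangential:
  assumes A: "A > 0" and q: "has_trace A q (3, -1) (\<lambda>_. 0)"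
    and p: "H1_limit A \<phi> (wderiv (cube A) (dir 3) q)"
    and i: "i \<noteq> 3" and \<omega>: "smooth \<omega>" "\<And>x. x $ 3 = A \<Longrightarrow> \<omega> x = 0"
  shows "weak_IBP A 3 \<omega> (wderiv (cube A) (dir i) q) (wderiv (cube A) (dir i) (wderiv (cube A) (dir 3) q))"
  unfolding weak_IBP_def
proof (intro allI impI)
  fix w :: "real^3 \<Rightarrow> real" assume w: "smooth w"
  let ?M = "lebesgue_on (cube A)"
  let ?p = "wderiv (cube A) (dir 3) q" let ?qi = "wderiv (cube A) (dir i) q" let ?pi = "wderiv (cube A) (dir i) ?p"
  obtain \<psi> where H: "H1_limit A \<psi> q" using has_traceE[OF A q] by blast
  define W where "W x = \<omega> x * w x" for x
  have W: "smooth W" unfolding W_def using \<omega> w by (intro smooth_mult)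
  define \<eta> where "\<eta> k x = 1 - ((x $ i / A)\<^sup>2) ^ Suc k" for k and x :: "real^3"
  have \<eta>: "smooth (\<eta> k)" for k unfolding \<eta>_def divide_inverse by (intro smooth_diff smooth_power smooth_mult smooth_const smooth_coord)
  have \<eta>0: "\<eta> k x = 0" if "x $ i = A \<or> x $ i = - A" for k x
    using that A by (auto simp: \<eta>_def)
  have xi: "\<bar>x $ i\<bar> < A" if "x \<in> cube A" for x
  proof -
    have "- A < x $ i" "x $ i < A" using that by (auto simp: cube_def)
    then show ?thesis by linarith
  qed
  have \<eta>b: "\<bar>\<eta> k x\<bar> \<le> 1" if "x \<in> cube A" for k x
  proof -
    have "\<bar>x $ i / A\<bar> \<le> 1" using xi[OF that] A by simp
    then have "(x $ i / A)\<^sup>2 \<le> 1" by (simp only: abs_square_le_1)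
    then have "((x $ i / A)\<^sup>2) ^ Suc k \<le> 1" by (rule power_le_one[OF zero_le_power2])
    moreover have "0 \<le> ((x $ i / A)\<^sup>2) ^ Suc k" by (intro zero_le_power zero_le_power2)
    ultimately show ?thesis unfolding \<eta>_def by linarith
  qed
  have \<eta>lim: "(\<lambda>k. \<eta> k x) \<longlonglongrightarrow> 1" if "x \<in> cube A" for x
  proof -
    have "\<bar>x $ i / A\<bar> < 1" using xi[OF that] A by simp
    then have "(x $ i / A)\<^sup>2 < 1" by (simp only: abs_square_less_1)
    then have "(\<lambda>k. ((x $ i / A)\<^sup>2) ^ k) \<longlonglongrightarrow> 0" by (intro LIMSEQ_realpow_zero zero_le_power2)
    from tendsto_diff[OF tendsto_const LIMSEQ_Suc[OF this], of 1] show ?thesis unfolding \<eta>_def by (simp del: power_Suc)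
  qed
  have \<eta>3: "partial 3 (\<eta> k) x = 0" for k x
    using i by (intro partial_indep) (simp add: \<eta>_def axis_def)
  have key: "(LINT x|?M. ?pi x * (W x * \<eta> k x)) = - (LINT x|?M. ?qi x * (partial 3 W x * \<eta> k x))" for k
  proof -
    let ?V = "\<lambda>x. W x * \<eta> k x"
    have V: "smooth ?V" using W \<eta> by (intro smooth_mult)
    have "(LINT x|?M. ?pi x * ?V x) = - (LINT x|?M. ?p x * partial i ?V x)"
      by (rule IBP_vanishing[OF A p V]) (simp add: \<eta>0)
    also have "(LINT x|?M. ?p x * partial i ?V x) = - (LINT x|?M. q x * partial 3 (partial i ?V) x)"
    proof (rule IBP_one_face[OF A _ q smooth_partial[OF V]])
      fix x :: "real^3" assume "x $ 3 = - (-1) * A"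
      then show "partial i ?V x = 0" using i \<omega>(2)
        by (intro partial_vanishing_plane[of 3 A]) (auto simp: W_def)
    qed simp
    also have "partial 3 (partial i ?V) = partial i (partial 3 ?V)" by (rule partial_commute[OF V])
    also have "(LINT x|?M. q x * partial i (partial 3 ?V) x) = - (LINT x|?M. ?qi x * partial 3 ?V x)"
    proof -
      have z: "partial 3 ?V x = 0" if "x $ i = A \<or> x $ i = - A" for x
        using that i by (intro partial_vanishing_plane[of i "x $ i"]) (auto simp: \<eta>0)
      show ?thesis using IBP_vanishing[OF A H smooth_partial[OF V] z] by simp
    qed
    also have "partial 3 ?V = (\<lambda>x. partial 3 W x * \<eta> k x)"
      by (simp add: partial_smooth_mult[OF W \<eta>] \<eta>3)
    finally show ?thesis by simp
  qed
  have lim: "(\<lambda>k. LINT x|?M. f x * (V x * \<eta> k x)) \<longlonglongrightarrow> (LINT x|?M. f x * V x)"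
    if "square_integrable ?M f" "smooth V" for f V
  proof (rule integral_dominated_convergence[where w = "\<lambda>x. \<bar>f x * V x\<bar>"])
    have sV: "square_integrable ?M V" unfolding cube_box using that(2) by (rule smooth_sqi_box)
    note m = sqi_measurable[OF that(1)] sqi_measurable[OF sV]
    have me: "\<eta> k \<in> borel_measurable ?M" for k using \<eta> by (rule smooth_measurable_on)
    show "(\<lambda>x. f x * V x) \<in> borel_measurable ?M" using m by simp
    show "(\<lambda>x. f x * (V x * \<eta> k x)) \<in> borel_measurable ?M" for k using m me by simp
    show "integrable ?M (\<lambda>x. \<bar>f x * V x\<bar>)" using sqi_mult[OF that(1) sV] by simp
    show "AE x in ?M. (\<lambda>k. f x * (V x * \<eta> k x)) \<longlonglongrightarrow> f x * V x"
    proof (rule AE_I2)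
      fix x assume "x \<in> space ?M"
      then have "x \<in> cube A" by simp
      from tendsto_mult[OF tendsto_const tendsto_mult[OF tendsto_const \<eta>lim[OF this]], of "f x" "V x"]
      show "(\<lambda>k. f x * (V x * \<eta> k x)) \<longlonglongrightarrow> f x * V x" by simp
    qed
    show "AE x in ?M. norm (f x * (V x * \<eta> k x)) \<le> \<bar>f x * V x\<bar>" for k
    proof (rule AE_I2)
      fix x assume "x \<in> space ?M"
      then have "x \<in> cube A" by simp
      from mult_left_mono[OF \<eta>b[OF this, of k], of "\<bar>f x * V x\<bar>"]
      show "norm (f x * (V x * \<eta> k x)) \<le> \<bar>f x * V x\<bar>" by (simp add: abs_mult mult.assoc)
    qed
  qed
  have "(\<lambda>k. LINT x|?M. ?pi x * (W x * \<eta> k x)) \<longlonglongrightarrow> (LINT x|?M. ?pi x * W x)"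
    by (rule lim[OF H1_limit_sqi(2)[OF p] W])
  moreover have "(\<lambda>k. LINT x|?M. ?pi x * (W x * \<eta> k x)) \<longlonglongrightarrow> - (LINT x|?M. ?qi x * partial 3 W x)"
    unfolding key by (intro tendsto_minus lim[OF H1_limit_sqi(2)[OF H]] smooth_partial W)
  ultimately have "(LINT x|?M. ?pi x * W x) = - (LINT x|?M. ?qi x * partial 3 W x)" by (rule LIMSEQ_unique)
  then show "(LINT x|?M. ?pi x * (\<omega> x * w x)) = - (LINT x|?M. ?qi x * partial 3 (\<lambda>x. \<omega> x * w x) x)"
    by (simp add: W_def[abs_def])
qed

section \<open>The Carleman estimate for a scalar function\<close>

definition zweight :: "(real^3 \<Rightarrow> real) \<Rightarrow> bool" where
  "zweight \<omega> \<longleftrightarrow> smooth \<omega> \<and> (\<forall>i x. i \<noteq> 3 \<longrightarrow> partial i \<omega> x = 0)"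

lemma zweight_smooth: "zweight \<omega> \<Longrightarrow> smooth \<omega>"
  by (simp add: zweight_def)

lemma zweight_mult: "zweight f \<Longrightarrow> zweight g \<Longrightarrow> zweight (\<lambda>x. f x * g x)"
  by (auto simp: zweight_def partial_smooth_mult)

lemma zweight_const: "zweight (\<lambda>x. c)"
  by (simp add: zweight_def)

lemma zweight_compose:
  assumes "\<And>x. \<omega> x = f (x $ 3)" "smooth \<omega>"
  shows "zweight \<omega>"
  unfolding zweight_def using assms by (auto intro!: partial_indep simp: axis_def)

lemma zweight_partial: 
  assumes "zweight \<omega>" shows "zweight (partial 3 \<omega>)"
  unfolding zweight_def
proof (intro conjI allI impI)
  have s: "smooth \<omega>" using assms by (rule zweight_smooth)
  then show "smooth (partial 3 \<omega>)" by (rule smooth_partial)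
  fix i :: 3 and x assume "i \<noteq> 3"
  then have "partial i \<omega> = (\<lambda>x. 0)" using assms by (auto simp: zweight_def)
  then show "partial i (partial 3 \<omega>) x = 0" by (simp add: partial_commute[OF s, of i 3])
qed

lemma integrable_weighted:
  assumes "square_integrable (lebesgue_on (cube A)) f" "square_integrable (lebesgue_on (cube A)) g" "smooth \<omega>"
  shows "integrable (lebesgue_on (cube A)) (\<lambda>x. \<omega> x * (f x * g x))"
  using sqi_mult[OF sqi_smooth_mult[OF assms(1)[unfolded cube_box] assms(3)] assms(2)[unfolded cube_box]]
  by (simp add: cube_box mult.assoc)

text \<open>The outward normal derivative is the partial derivative up to the sign of the face, which does
  not matter for zero traces.\<close>

lemma in_H30bsc_facts:
  assumes A: "A > 0" and q: "in_H30bsc A q"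
  defines "g \<equiv> \<lambda>i. wderiv (cube A) (dir i) q"
  shows "in_H 3 (cube A) q"
    and "has_trace A q (3, -1) (\<lambda>_. 0)" "has_trace A (g 3) (3, -1) (\<lambda>_. 0)"
    and "i \<noteq> 3 \<Longrightarrow> has_trace A (g i) (i, 1) (\<lambda>_. 0)"
    and "i \<noteq> 3 \<Longrightarrow> has_trace A (g i) (i, -1) (\<lambda>_. 0)"
proof -
  have n: "has_trace A (g j) (j, s) (\<lambda>_. 0)" if "has_normal_trace A q (j, s) (\<lambda>_. 0)" "s \<in> {1, -1}" for j s
  proof -
    have "has_trace A (\<lambda>x. s * wderiv (cube A) (dir j) q x) (j, s) (\<lambda>_. 0)"
      using that(1) by (simp add: has_normal_trace_def)
    from has_trace_lincomb[OF A that(2) this this, of s 0]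
    have "has_trace A (\<lambda>x. (s * s) * wderiv (cube A) (dir j) q x) (j, s) (\<lambda>_. 0)" by (simp add: mult.assoc)
    moreover have "s * s = 1" using that(2) by auto
    ultimately show ?thesis by (simp add: g_def)
  qed
  have b: "has_normal_trace A q F (\<lambda>_. 0)" if "F \<in> insert S_bsc lateral" for F
    using q that unfolding in_H30bsc_def by blast
  show "in_H 3 (cube A) q" "has_trace A q (3, -1) (\<lambda>_. 0)"
    using q by (auto simp: in_H30bsc_def S_bsc_def)
  show "has_trace A (g 3) (3, -1) (\<lambda>_. 0)"
    using n[of 3 "-1"] b[of "(3, -1)"] by (simp add: S_bsc_def)
  have i12: "i \<in> {1, 2}" if "i \<noteq> 3" using that exhaust_3[of i] by auto
  show "has_trace A (g i) (i, 1) (\<lambda>_. 0)" if "i \<noteq> 3"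
    using n[of i 1] b[of "(i, 1)"] i12[OF that] by (simp add: lateral_def)
  show "has_trace A (g i) (i, -1) (\<lambda>_. 0)" if "i \<noteq> 3"
    using n[of i "-1"] b[of "(i, -1)"] i12[OF that] by (simp add: lateral_def)
qed

text \<open>These are the identities \<open>\<integral> \<partial>\<^sub>i (\<omega> f g) = 0\<close> that enter the Carleman estimate. The weights depend
  only on the third coordinate. The boundary terms vanish on the top face because of \<open>\<omega>\<close>, and on the
  bottom and lateral faces because of the boundary conditions. The fourth identity combines the
  tangential integration by parts \<open>\<integral> \<omega> \<partial>\<^sub>i\<^sub>i q \<partial>\<^sub>3 q = - \<integral> \<omega> \<partial>\<^sub>i q \<partial>\<^sub>i\<^sub>3 q\<close> with
  \<open>2 \<partial>\<^sub>i q \<partial>\<^sub>i\<^sub>3 q = \<partial>\<^sub>3 (\<partial>\<^sub>i q)\<^sup>2\<close>.\<close>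

lemma null_integrals:
  fixes q :: "real^3 \<Rightarrow> real"
  assumes A: "A > 0" and q: "in_H30bsc A q"
    and \<omega>: "zweight \<omega>" "\<And>x. x $ 3 = A \<Longrightarrow> \<omega> x = 0"
  defines "g \<equiv> \<lambda>i. wderiv (cube A) (dir i) q"
  defines "h \<equiv> \<lambda>i. wderiv (cube A) (dir i) (g i)"
  shows "has_bochner_integral (lebesgue_on (cube A)) (\<lambda>x. 2 * \<omega> x * (q x * g 3 x) + partial 3 \<omega> x * (q x)\<^sup>2) 0"
    and "has_bochner_integral (lebesgue_on (cube A)) (\<lambda>x. 2 * \<omega> x * (g 3 x * h 3 x) + partial 3 \<omega> x * (g 3 x)\<^sup>2) 0"
    and "has_bochner_integral (lebesgue_on (cube A)) (\<lambda>x. \<omega> x * (q x * h 3 x) + partial 3 \<omega> x * (q x * g 3 x) + \<omega> x * (g 3 x)\<^sup>2) 0"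
    and "i \<noteq> 3 \<Longrightarrow> has_bochner_integral (lebesgue_on (cube A)) (\<lambda>x. 2 * \<omega> x * (h i x * g 3 x) - partial 3 \<omega> x * (g i x)\<^sup>2) 0"
    and "i \<noteq> 3 \<Longrightarrow> has_bochner_integral (lebesgue_on (cube A)) (\<lambda>x. \<omega> x * (q x * h i x) + \<omega> x * (g i x)\<^sup>2) 0"
proof -
  let ?M = "lebesgue_on (cube A)"
  have g': "wderiv (cube A) (dir i) q = g i" for i by (simp add: g_def)
  note F = in_H30bsc_facts[OF A q, unfolded g']
  have q3: "in_H 3 (box (cube_lower A) (cube_upper A 0)) q" using F(1) by (simp add: cube_box)
  have sm: "smooth \<omega>" "smooth (partial 3 \<omega>)" using \<omega>(1) zweight_smooth smooth_partial by auto
  have ti: "partial i \<omega> = (\<lambda>x. 0)" if "i \<noteq> 3" for i using \<omega>(1) that by (auto simp: zweight_def)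
  have sq: "square_integrable ?M q" unfolding cube_box by (rule in_H_sqi(1)[OF q3])
  have sg: "square_integrable ?M (g i)" for i unfolding g_def cube_box by (rule in_H_wderiv(2)[OF q3]) simp
  have gH: "in_H 2 (box (cube_lower A) (cube_upper A 0)) (g i)" for i
    unfolding g_def cube_box by (rule in_H_wderiv_in_H[OF q3]) simp
  have sh: "square_integrable ?M (wderiv (cube A) (dir j) (g i))" for i j
    unfolding cube_box by (rule in_H_wderiv(2)[OF gH]) simp
  obtain \<phi> where \<phi>: "H1_limit A \<phi> q" using has_traceE[OF A F(2)] by blast
  have ex: "\<exists>\<psi>. H1_limit A \<psi> f" if "has_trace A f F' f'" for f F' f' using has_traceE[OF A that] by blast
  have "\<exists>\<psi>. H1_limit A \<psi> (g i)" for i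
    by (cases "i = 3") (auto intro: ex[OF F(3)] ex[OF F(4)])
  then obtain \<psi> where \<psi>: "\<And>i. H1_limit A (\<psi> i) (g i)" by metis
  note lim = weak_IBP_limit[OF _ sm(1)]
  note int = integrable_weighted[OF _ _ sm(1)] integrable_weighted[OF _ _ sm(2)]
  have B: "weak_IBP A 3 \<omega> f (wderiv (cube A) (dir 3) f)" if "has_trace A f (3, -1) (\<lambda>_. 0)" for f
    unfolding weak_IBP_def
  proof (intro allI impI)
    fix w :: "real^3 \<Rightarrow> real" assume w: "smooth w"
    show "(LINT x|?M. wderiv (cube A) (dir 3) f x * (\<omega> x * w x)) = - (LINT x|?M. f x * partial 3 (\<lambda>x. \<omega> x * w x) x)"
      by (rule IBP_one_face[OF A _ that smooth_mult[OF sm(1) w]]) (simp_all add: \<omega>(2))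
  qed
  have B0: "weak_IBP A 3 \<omega> q (g 3)" using B[OF F(2)] by (simp add: g_def)
  have B3: "weak_IBP A 3 \<omega> (g 3) (h 3)" using B[OF F(3)] by (simp add: h_def)
  have Bi: "weak_IBP A i \<omega> (g i) (h i)" if "i \<noteq> 3" for i
    unfolding weak_IBP_def h_def
  proof (intro allI impI)
    fix w :: "real^3 \<Rightarrow> real" assume w: "smooth w"
    show "(LINT x|?M. wderiv (cube A) (dir i) (g i) x * (\<omega> x * w x)) = - (LINT x|?M. g i x * partial i (\<lambda>x. \<omega> x * w x) x)"
      by (rule IBP_two_faces[OF A F(4,5)[OF that] smooth_mult[OF sm(1) w]])
  qed
  have Ti: "weak_IBP A 3 \<omega> (g i) (wderiv (cube A) (dir i) (g 3))" if "i \<noteq> 3" for i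
    unfolding g_def by (rule weak_IBP_tangential[OF A F(2) \<psi>[unfolded g_def] that sm(1) \<omega>(2)])
  have comm: "AE x in ?M. wderiv (cube A) (dir 3) (g i) x = wderiv (cube A) (dir i) (g 3) x" for i
  proof -
    have o: "order_of (dir 3) + order_of (dir i) \<le> 3" "order_of (dir i) + order_of (dir 3) \<le> 3" by simp_all
    have e: "(\<lambda>j. dir 3 j + dir i j) = (\<lambda>j. dir i j + dir 3 j)" by (simp add: add.commute)
    have "AE x in ?M. wderiv (cube A) (dir 3) (g i) x = wderiv (cube A) (\<lambda>j. dir 3 j + dir i j) q x"
      unfolding g_def cube_box by (rule wderiv_AE_eq[OF in_H_wderiv_wd[OF q3 o(1)]])
    moreover have "AE x in ?M. wderiv (cube A) (dir i) (g 3) x = wderiv (cube A) (\<lambda>j. dir i j + dir 3 j) q x"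
      unfolding g_def cube_box by (rule wderiv_AE_eq[OF in_H_wderiv_wd[OF q3 o(2)]])
    ultimately show ?thesis unfolding e by eventually_elim simp
  qed
  have hb: "has_bochner_integral M f 0" if "integrable M f" "integral\<^sup>L M f = 0" for M :: "(real^3) measure" and f :: "real^3 \<Rightarrow> real"
    using that by (simp add: has_bochner_integral_iff)
  note i1 = integrable_weighted[OF _ _ sm(1)] and i2 = integrable_weighted[OF _ _ sm(2)]
  have g3: "wderiv (cube A) (dir 3) q = g 3" "wderiv (cube A) (dir 3) (g 3) = h 3" by (simp_all add: g_def h_def)
  have shh: "square_integrable ?M (h i)" for i unfolding h_def by (rule sh)
  show "has_bochner_integral ?M (\<lambda>x. 2 * \<omega> x * (q x * g 3 x) + partial 3 \<omega> x * (q x)\<^sup>2) 0"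
    using lim[OF B0 \<phi> sq sg] i1[OF sq sg[of 3]] i2[OF sq sq]
    by (intro hb) (simp_all add: g3 power2_eq_square mult.assoc mult.commute[of "g 3 _" "q _"])
  show "has_bochner_integral ?M (\<lambda>x. 2 * \<omega> x * (g 3 x * h 3 x) + partial 3 \<omega> x * (g 3 x)\<^sup>2) 0"
    using lim[OF B3 \<psi>[of 3] sg shh] i1[OF sg[of 3] shh[of 3]] i2[OF sg[of 3] sg[of 3]]
    by (intro hb) (simp_all add: g3 power2_eq_square mult.assoc mult.commute[of "h 3 _" "g 3 _"])
  show "has_bochner_integral ?M (\<lambda>x. \<omega> x * (q x * h 3 x) + partial 3 \<omega> x * (q x * g 3 x) + \<omega> x * (g 3 x)\<^sup>2) 0"
    using lim[OF B3 \<phi> sg shh] i1[OF sq shh[of 3]] i2[OF sq sg[of 3]] i1[OF sg[of 3] sg[of 3]]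
    by (intro hb) (simp_all add: g3 power2_eq_square mult.commute[of "h 3 _" "q _"] mult.commute[of "g 3 _" "q _"])
  show "has_bochner_integral ?M (\<lambda>x. \<omega> x * (q x * h i x) + \<omega> x * (g i x)\<^sup>2) 0" if "i \<noteq> 3"
    using lim[OF Bi[OF that] \<phi> sg shh] i1[OF sq shh[of i]] i1[OF sg[of i] sg[of i]]
    by (intro hb) (simp_all add: ti[OF that] g' power2_eq_square mult.commute[of "h i _" "q _"])
  show "has_bochner_integral ?M (\<lambda>x. 2 * \<omega> x * (h i x * g 3 x) - partial 3 \<omega> x * (g i x)\<^sup>2) 0" if i: "i \<noteq> 3"
  proof (rule hb)
    have a: "(LINT x|?M. \<omega> x * (h i x * g 3 x)) = - (LINT x|?M. \<omega> x * (g i x * wderiv (cube A) (dir i) (g 3) x))"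
      using lim[OF Bi[OF i] \<psi>[of 3] sg shh] by (simp add: ti[OF i])
    have "(LINT x|?M. \<omega> x * (g i x * wderiv (cube A) (dir 3) (g i) x)) = (LINT x|?M. \<omega> x * (g i x * wderiv (cube A) (dir i) (g 3) x))"
    proof (rule integral_cong_AE)
      show "AE x in ?M. \<omega> x * (g i x * wderiv (cube A) (dir 3) (g i) x) = \<omega> x * (g i x * wderiv (cube A) (dir i) (g 3) x)"
        using comm[of i] by eventually_elim simp
    qed (rule borel_measurable_integrable[OF i1[OF sg sh]])+
    then have b: "2 * (LINT x|?M. \<omega> x * (g i x * wderiv (cube A) (dir i) (g 3) x)) = - (LINT x|?M. partial 3 \<omega> x * (g i x * g i x))"
      using lim[OF Ti[OF i] \<psi>[of i] sg sh] by (simp add: mult.commute[of "wderiv (cube A) (dir i) (g 3) _" "g i _"])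
    show "integrable ?M (\<lambda>x. 2 * \<omega> x * (h i x * g 3 x) - partial 3 \<omega> x * (g i x)\<^sup>2)"
      using i1[OF shh[of i] sg[of 3]] i2[OF sg[of i] sg[of i]] by (simp add: power2_eq_square mult.assoc)
    show "(LINT x|?M. 2 * \<omega> x * (h i x * g 3 x) - partial 3 \<omega> x * (g i x)\<^sup>2) = 0"
      using a b i1[OF shh[of i] sg[of 3]] i2[OF sg[of i] sg[of i]] by (simp add: power2_eq_square mult.assoc)
  qed
qed

text \<open>Multiplication with \<open>\<chi> = (A - z)\<^sup>2\<close> removes the restriction on the weights: the function
  \<open>\<chi> q\<close> and its normal derivative vanish on the top face as well.\<close>

definition top_factor :: "real \<Rightarrow> real^3 \<Rightarrow> real" where "top_factor A x = (A - x $ 3)\<^sup>2"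

lemma zweight_mult_top:
  assumes "zweight f"
  shows "zweight (\<lambda>x. f x * (A - x $ 3))"
    and "partial 3 (\<lambda>x. f x * (A - x $ 3)) = (\<lambda>x. partial 3 f x * (A - x $ 3) - f x)"
proof -
  let ?z = "\<lambda>x :: real^3. A - x $ 3"
  have z: "zweight ?z" by (rule zweight_compose[where f = "\<lambda>t. A - t"]) (auto intro: smooth_diff)
  have pz: "partial 3 ?z = (\<lambda>x. -1)" by (simp add: partial_smooth_diff partial_coord)
  show "zweight (\<lambda>x. f x * ?z x)" using assms z by (rule zweight_mult)
  show "partial 3 (\<lambda>x. f x * ?z x) = (\<lambda>x. partial 3 f x * ?z x - f x)"
    by (simp add: partial_smooth_mult[OF zweight_smooth[OF assms] zweight_smooth[OF z]] pz)
qed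

lemma null_integral_top_factor:
  fixes q :: "real^3 \<Rightarrow> real"
  assumes A: "A > 0" and q: "in_H30bsc A q" and \<omega>: "zweight \<omega>"
  defines "g \<equiv> wderiv (cube A) (dir 3) q"
  shows "has_bochner_integral (lebesgue_on (cube A)) (\<lambda>x. 2 * \<omega> x * ((top_factor A x * q x) *
    (top_factor A x * g x - 2 * (A - x $ 3) * q x)) + partial 3 \<omega> x * (top_factor A x * q x)\<^sup>2) 0"
proof -
  let ?M = "lebesgue_on (cube A)"
  let ?z = "\<lambda>x :: real^3. A - x $ 3"
  note m = zweight_mult_top(1)[of _ A] and pm = zweight_mult_top(2)[of _ A]
  define w1 where "w1 x = \<omega> x * ?z x" for x
  define w2 where "w2 x = w1 x * ?z x" for x
  define w3 where "w3 x = w2 x * ?z x" for x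
  define w4 where "w4 x = w3 x * ?z x" for x
  have Z: "zweight w1" "zweight w2" "zweight w3" "zweight w4"
    unfolding w4_def[abs_def] w3_def[abs_def] w2_def[abs_def] w1_def[abs_def] by (intro m \<omega>)+
  have p1: "partial 3 w1 x = partial 3 \<omega> x * ?z x - \<omega> x" for x unfolding w1_def[abs_def] by (simp add: pm[OF \<omega>])
  have p2: "partial 3 w2 x = partial 3 w1 x * ?z x - w1 x" for x unfolding w2_def[abs_def] by (simp add: pm[OF Z(1)])
  have p3: "partial 3 w3 x = partial 3 w2 x * ?z x - w2 x" for x unfolding w3_def[abs_def] by (simp add: pm[OF Z(2)])
  have p4: "partial 3 w4 x = partial 3 w3 x * ?z x - w3 x" for x unfolding w4_def[abs_def] by (simp add: pm[OF Z(3)])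
  have t: "w1 x = 0" "w2 x = 0" "w3 x = 0" "w4 x = 0" if "x $ 3 = A" for x
    using that by (simp_all add: w4_def w3_def w2_def w1_def)
  have "has_bochner_integral ?M (\<lambda>x. 2 * w4 x * (q x * g x) + partial 3 w4 x * (q x)\<^sup>2) 0"
    unfolding g_def by (rule null_integrals(1)[OF A q Z(4) t(4)])
  moreover have e: "2 * w4 x * (q x * g x) + partial 3 w4 x * (q x)\<^sup>2 = 2 * \<omega> x * ((top_factor A x * q x) *
    (top_factor A x * g x - 2 * (A - x $ 3) * q x)) + partial 3 \<omega> x * (top_factor A x * q x)\<^sup>2" for x
    by (simp add: top_factor_def p4 p3 p2 p1 w4_def w3_def w2_def w1_def power2_eq_square algebra_simps)
  ultimately show ?thesis by (simp only: e)
qed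

text \<open>The functions \<open>u\<close>, \<open>v\<close>, \<open>w\<close> are \<open>\<chi> q\<close> and its first two derivatives in \<open>z\<close>, written out by the product
  rule. Each identity is a linear combination of the previous ones with the weights \<open>(A - z)\<^sup>k \<omega>\<close>,
  \<open>k = 2, 3, 4\<close>, which vanish on the top face for every \<open>\<omega>\<close>.\<close>

lemma null_integrals_top_factor:
  fixes q :: "real^3 \<Rightarrow> real"
  assumes A: "A > 0" and q: "in_H30bsc A q" and \<omega>: "zweight \<omega>"
  defines "g \<equiv> \<lambda>i. wderiv (cube A) (dir i) q"
  defines "h \<equiv> \<lambda>i. wderiv (cube A) (dir i) (g i)"
  defines "u \<equiv> \<lambda>x. top_factor A x * q x"
  defines "v \<equiv> \<lambda>x. top_factor A x * g 3 x - 2 * (A - x $ 3) * q x"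
  defines "w \<equiv> \<lambda>x. top_factor A x * h 3 x - 4 * (A - x $ 3) * g 3 x + 2 * q x"
  shows "has_bochner_integral (lebesgue_on (cube A)) (\<lambda>x. 2 * \<omega> x * (u x * v x) + partial 3 \<omega> x * (u x)\<^sup>2) 0"
    and "has_bochner_integral (lebesgue_on (cube A)) (\<lambda>x. 2 * \<omega> x * (v x * w x) + partial 3 \<omega> x * (v x)\<^sup>2) 0"
    and "has_bochner_integral (lebesgue_on (cube A)) (\<lambda>x. 2 * \<omega> x * (u x * w x) + 2 * \<omega> x * (v x)\<^sup>2 - partial 3 (partial 3 \<omega>) x * (u x)\<^sup>2) 0"
    and "i \<noteq> 3 \<Longrightarrow> has_bochner_integral (lebesgue_on (cube A)) (\<lambda>x. 2 * \<omega> x * ((top_factor A x * h i x) * v x) - partial 3 \<omega> x * (top_factor A x * g i x)\<^sup>2) 0"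
    and "i \<noteq> 3 \<Longrightarrow> has_bochner_integral (lebesgue_on (cube A)) (\<lambda>x. \<omega> x * (u x * (top_factor A x * h i x)) + \<omega> x * (top_factor A x * g i x)\<^sup>2) 0"
proof -
  let ?M = "lebesgue_on (cube A)"
  let ?z = "\<lambda>x :: real^3. A - x $ 3"
  note m = zweight_mult_top(1)[of _ A] and pm = zweight_mult_top(2)[of _ A]
  define w1 where "w1 x = \<omega> x * ?z x" for x
  define w2 where "w2 x = w1 x * ?z x" for x
  define w3 where "w3 x = w2 x * ?z x" for x
  define w4 where "w4 x = w3 x * ?z x" for x
  have Z: "zweight w1" "zweight w2" "zweight w3" "zweight w4"
    unfolding w4_def[abs_def] w3_def[abs_def] w2_def[abs_def] w1_def[abs_def] by (intro m \<omega>)+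
  have p1: "partial 3 w1 x = partial 3 \<omega> x * ?z x - \<omega> x" for x unfolding w1_def[abs_def] by (simp add: pm[OF \<omega>])
  have p2: "partial 3 w2 x = partial 3 w1 x * ?z x - w1 x" for x unfolding w2_def[abs_def] by (simp add: pm[OF Z(1)])
  have p3: "partial 3 w3 x = partial 3 w2 x * ?z x - w2 x" for x unfolding w3_def[abs_def] by (simp add: pm[OF Z(2)])
  have p4: "partial 3 w4 x = partial 3 w3 x * ?z x - w3 x" for x unfolding w4_def[abs_def] by (simp add: pm[OF Z(3)])
  have t: "w1 x = 0" "w2 x = 0" "w3 x = 0" "w4 x = 0" if "x $ 3 = A" for x
    using that by (simp_all add: w4_def w3_def w2_def w1_def)
  have g': "wderiv (cube A) (dir i) q = g i" for i by (simp add: g_def)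
  have h': "wderiv (cube A) (dir i) (g i) = h i" for i by (simp add: h_def)
  note K = null_integrals[OF A q, unfolded g', unfolded h']
  define z where "z x = A - x $ 3" for x :: "real^3"
  have zz: "A - x $ 3 = z x" for x by (simp add: z_def)
  note defs = u_def v_def w_def top_factor_def w4_def w3_def w2_def w1_def
  note add = has_bochner_integral_add[where x = "0::real" and y = 0, simplified]
  note mult = has_bochner_integral_mult_right[where x = "0::real", simplified]
  have eqI: "has_bochner_integral ?M f 0" if "has_bochner_integral ?M f' 0" "\<And>x. f x = f' x" for f f' :: "real^3 \<Rightarrow> real"
  proof -
    have "f = f'" using that(2) by (rule ext)
    then show ?thesis using that(1) by simp
  qed
  show "has_bochner_integral ?M (\<lambda>x. 2 * \<omega> x * (u x * v x) + partial 3 \<omega> x * (u x)\<^sup>2) 0"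
    unfolding u_def v_def g_def by (rule null_integral_top_factor[OF A q \<omega>])
  show "has_bochner_integral ?M (\<lambda>x. 2 * \<omega> x * (v x * w x) + partial 3 \<omega> x * (v x)\<^sup>2) 0"
    by (rule eqI[OF add[OF add[OF K(2)[OF Z(4) t(4)] mult[OF K(3)[OF Z(3) t(3)], of "-4"]] mult[OF K(1)[OF Z(2) t(2)], of 4]]], assumption+)
      (simp only: p4 p3 p2 p1, simp only: defs, simp only: zz, simp add: power2_eq_square algebra_simps)
  have L1': "has_bochner_integral ?M (\<lambda>x. 2 * partial 3 \<omega> x * (u x * v x) + partial 3 (partial 3 \<omega>) x * (u x)\<^sup>2) 0"
    unfolding u_def v_def g_def by (rule null_integral_top_factor[OF A q zweight_partial[OF \<omega>]])
  show "has_bochner_integral ?M (\<lambda>x. 2 * \<omega> x * (u x * w x) + 2 * \<omega> x * (v x)\<^sup>2 - partial 3 (partial 3 \<omega>) x * (u x)\<^sup>2) 0"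
    by (rule eqI[OF add[OF mult[OF add[OF K(3)[OF Z(4) t(4)] mult[OF K(1)[OF Z(3) t(3)], of "-2"]], of 2] mult[OF L1', of "-1"]]], assumption+)
      (simp only: p4 p3 p2 p1, simp only: defs, simp only: zz, simp add: power2_eq_square algebra_simps)
  show "has_bochner_integral ?M (\<lambda>x. 2 * \<omega> x * ((top_factor A x * h i x) * v x) - partial 3 \<omega> x * (top_factor A x * g i x)\<^sup>2) 0" if "i \<noteq> 3"
    by (rule eqI[OF add[OF K(4)[OF Z(4) t(4) that] mult[OF K(5)[OF Z(3) t(3) that], of "-4"]]], assumption+)
      (simp only: p4 p3 p2 p1, simp only: defs, simp only: zz, simp add: power2_eq_square algebra_simps)
  show "has_bochner_integral ?M (\<lambda>x. \<omega> x * (u x * (top_factor A x * h i x)) + \<omega> x * (top_factor A x * g i x)\<^sup>2) 0" if "i \<noteq> 3"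
    by (rule eqI[OF K(5)[OF Z(4) t(4) that]], assumption) (simp only: defs, simp only: zz, simp add: power2_eq_square algebra_simps)
qed

text \<open>The weight is the exponential of \<open>2\<lambda>\<psi>\<close> with \<open>\<psi> = z\<^sup>2/2 - 2Az\<close>, which is decreasing and strictly
  convex in \<open>z\<close>: \<open>\<psi>' = s = z - 2A\<close> and \<open>\<psi>'' = 1\<close>.\<close>

definition carleman_weight :: "real \<Rightarrow> real \<Rightarrow> real^3 \<Rightarrow> real" where
  "carleman_weight A l x = exp (l * ((x $ 3)\<^sup>2 - 4 * A * x $ 3))"

lemma smooth_poly: "smooth f \<Longrightarrow> smooth (\<lambda>x. poly p (f x))"
  by (rule smooth_compose[where F = "\<lambda>n. poly ((pderiv ^^ n) p)" and n = 0, simplified]) (auto simp: poly_DERIV)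

lemma carleman_weight_poly:
  shows "zweight (\<lambda>x. carleman_weight A l x * poly p (x $ 3 - 2 * A))" (is "zweight ?w")
    and "partial 3 (\<lambda>x. carleman_weight A l x * poly p (x $ 3 - 2 * A)) =
      (\<lambda>x. carleman_weight A l x * poly ([:0, 2 * l:] * p + pderiv p) (x $ 3 - 2 * A))"
proof -
  have s1: "smooth (carleman_weight A l)" unfolding carleman_weight_def[abs_def]
    by (intro smooth_exp smooth_mult smooth_const smooth_diff smooth_power smooth_coord)
  have s2: "smooth (\<lambda>x. poly p (x $ 3 - 2 * A))"
    by (intro smooth_poly smooth_diff smooth_coord smooth_const)
  show "zweight ?w"
    by (rule zweight_compose[where f = "\<lambda>t. exp (l * (t\<^sup>2 - 4 * A * t)) * poly p (t - 2 * A)"])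
       (use smooth_mult[OF s1 s2] in \<open>simp_all add: carleman_weight_def\<close>)
  have "((\<lambda>t. exp (l * (t\<^sup>2 - 4 * A * t)) * poly p (t - 2 * A)) has_real_derivative
      exp (l * (t\<^sup>2 - 4 * A * t)) * poly ([:0, 2 * l:] * p + pderiv p) (t - 2 * A)) (at t)" for t
    by (auto intro!: derivative_eq_intros DERIV_chain2[OF poly_DERIV] simp: algebra_simps)
  from partial_compose[OF this smooth_coord[of 3], of 3]
  show "partial 3 ?w = (\<lambda>x. carleman_weight A l x * poly ([:0, 2 * l:] * p + pderiv p) (x $ 3 - 2 * A))"
    by (simp add: carleman_weight_def partial_coord)
qed

text \<open>With \<open>l = \<lambda>\<close> and \<open>U = exp (\<lambda>\<psi>) u\<close>, the conjugated Laplacian \<open>exp (\<lambda>\<psi>) \<Delta> (exp (- \<lambda>\<psi>) U)\<close> is the sum of a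
  symmetric part \<open>S U\<close> and an antisymmetric part \<open>K U\<close>, where
  \<open>K U = - exp (\<lambda>\<psi>) (2\<lambda>s u\<^sub>z + (2\<lambda>\<^sup>2s\<^sup>2 + \<lambda>) u)\<close>. The integral of \<open>S U K U\<close> is that of the quadratic form
  \<open>2\<lambda> (U\<^sub>z)\<^sup>2 + 2\<lambda>\<^sup>3s\<^sup>2 U\<^sup>2\<close>, since all tangential terms cancel. The identity is the pointwise form of this
  computation: the letters \<open>v\<close>, \<open>w\<close> stand for \<open>u\<^sub>z\<close>, \<open>u\<^sub>z\<^sub>z\<close>, further \<open>p\<close>, \<open>q\<close> for the tangential first and
  \<open>a\<close>, \<open>b\<close> for the tangential second derivatives of \<open>u\<close>, and every summand on the right has integral
  zero.\<close>

lemma carleman_identity: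
  fixes E l s u v w a b p q :: real
  shows "E * (- (a + b + w) * (2 * l * s * v + (2 * l\<^sup>2 * s\<^sup>2 + l) * u) - (2 * l * s * v + (2 * l\<^sup>2 * s\<^sup>2 + l) * u)\<^sup>2
      - 2 * l * (v + l * s * u)\<^sup>2 - 2 * l ^ 3 * s\<^sup>2 * u\<^sup>2) =
    - (1/2) * (2 * (E * (2 * l * s)) * (v * w) + E * (4 * l\<^sup>2 * s\<^sup>2 + 2 * l) * v\<^sup>2)
    + (- (1/2) * (2 * (E * (2 * l * s)) * (a * v) - E * (4 * l\<^sup>2 * s\<^sup>2 + 2 * l) * p\<^sup>2)
    + (- (1/2) * (2 * (E * (2 * l * s)) * (b * v) - E * (4 * l\<^sup>2 * s\<^sup>2 + 2 * l) * q\<^sup>2)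
    + (- (1/2) * (2 * (E * (2 * l\<^sup>2 * s\<^sup>2 + l)) * (u * w) + 2 * (E * (2 * l\<^sup>2 * s\<^sup>2 + l)) * v\<^sup>2 - E * (8 * l ^ 4 * s ^ 4 + 24 * l ^ 3 * s\<^sup>2 + 6 * l\<^sup>2) * u\<^sup>2)
    + (- 1 * (E * (2 * l\<^sup>2 * s\<^sup>2 + l) * (u * a) + E * (2 * l\<^sup>2 * s\<^sup>2 + l) * p\<^sup>2)
    + (- 1 * (E * (2 * l\<^sup>2 * s\<^sup>2 + l) * (u * b) + E * (2 * l\<^sup>2 * s\<^sup>2 + l) * q\<^sup>2)
    + - 1 * (2 * (E * (4 * l ^ 3 * s ^ 3 + 4 * l\<^sup>2 * s)) * (u * v) + E * (8 * l ^ 4 * s ^ 4 + 20 * l ^ 3 * s\<^sup>2 + 4 * l\<^sup>2) * u\<^sup>2))))))"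
  by (simp add: power2_eq_square power3_eq_cube power4_eq_xxxx algebra_simps)

lemma weighted_Young:
  fixes l u d :: real
  assumes l: "l > 0"
  shows "- (u * d) \<le> 1 / (2 * l) * d\<^sup>2 + l / 2 * u\<^sup>2"
proof -
  have "0 \<le> (d + l * u)\<^sup>2" by simp
  then have "2 * l * - (u * d) \<le> 2 * l * (1 / (2 * l) * d\<^sup>2 + l / 2 * u\<^sup>2)"
    using l by (simp add: power2_eq_square algebra_simps)
  then show ?thesis by (rule mult_left_le_imp_le) (use l in simp)
qed

text \<open>Let \<open>D\<close> be the Laplacian of \<open>u = \<chi> q\<close>. The product of the symmetric and the antisymmetric part is at
  most \<open>D\<^sup>2/4\<close> with weight \<open>E\<close>, so the preceding identity yields \<open>8 l\<^sup>3 A\<^sup>2 \<integral> E u\<^sup>2 \<le> \<integral> E D\<^sup>2\<close>. Integrating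
  \<open>E u D\<close> by parts then bounds the gradient of \<open>u\<close>. The lower bound for \<open>l\<close> in terms of \<open>A\<close> allows
  lower powers of \<open>l\<close> to be estimated by higher ones.\<close>

lemma carleman_estimate:
  fixes q :: "real^3 \<Rightarrow> real"
  assumes A: "A > 0" and q: "in_H30bsc A q" and l: "l \<ge> 1" "l \<ge> 1 / A\<^sup>2"
  defines "g \<equiv> \<lambda>i. wderiv (cube A) (dir i) q"
  defines "h \<equiv> \<lambda>i. wderiv (cube A) (dir i) (g i)"
  defines "u \<equiv> \<lambda>x. top_factor A x * q x"
  defines "v \<equiv> \<lambda>x. top_factor A x * g 3 x - 2 * (A - x $ 3) * q x"
  defines "w \<equiv> \<lambda>x. top_factor A x * h 3 x - 4 * (A - x $ 3) * g 3 x + 2 * q x"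
  defines "D \<equiv> \<lambda>x. top_factor A x * h 1 x + top_factor A x * h 2 x + w x"
  shows "integrable (lebesgue_on (cube A)) (\<lambda>x. carleman_weight A l x * (D x)\<^sup>2)"
    and "integrable (lebesgue_on (cube A)) (\<lambda>x. carleman_weight A l x *
      ((top_factor A x * g 1 x)\<^sup>2 + (top_factor A x * g 2 x)\<^sup>2 + (v x)\<^sup>2 + (u x)\<^sup>2))"
    and "l * (LINT x|lebesgue_on (cube A). carleman_weight A l x *
      ((top_factor A x * g 1 x)\<^sup>2 + (top_factor A x * g 2 x)\<^sup>2 + (v x)\<^sup>2 + (u x)\<^sup>2))
      \<le> (3 + 1 / (8 * A\<^sup>2)) * (LINT x|lebesgue_on (cube A). carleman_weight A l x * (D x)\<^sup>2)"
proof -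
  let ?M = "lebesgue_on (cube A)" and ?E = "carleman_weight A l"
  define a where "a x = top_factor A x * h 1 x" for x
  define b where "b x = top_factor A x * h 2 x" for x
  define p where "p x = top_factor A x * g 1 x" for x
  define r where "r x = top_factor A x * g 2 x" for x
  define s where "s x = x $ 3 - 2 * A" for x :: "real^3"
  have l0: "l > 0" using l by simp
  have q3: "in_H 3 (box (cube_lower A) (cube_upper A 0)) q" using in_H30bsc_facts(1)[OF A q] by (simp add: cube_box)
  have sq: "square_integrable ?M q" unfolding cube_box by (rule in_H_sqi(1)[OF q3])
  have sg: "square_integrable ?M (g i)" for i unfolding g_def cube_box by (rule in_H_wderiv(2)[OF q3]) simp
  have gH: "in_H 2 (box (cube_lower A) (cube_upper A 0)) (g i)" for i
    unfolding g_def cube_box by (rule in_H_wderiv_in_H[OF q3]) simp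
  have sh: "square_integrable ?M (h i)" for i
    unfolding h_def cube_box by (rule in_H_wderiv(2)[OF gH]) simp
  have sc: "smooth (top_factor A)" "smooth (\<lambda>x :: real^3. 4 * (A - x $ 3))" "smooth (\<lambda>x :: real^3. 2 * (A - x $ 3))"
    unfolding top_factor_def[abs_def] by (intro smooth_power smooth_mult smooth_diff smooth_const smooth_coord)+
  note sm = sqi_smooth_mult[of "cube_lower A" "cube_upper A 0", folded cube_box]
  have su: "square_integrable ?M u" "square_integrable ?M v" "square_integrable ?M w" "square_integrable ?M p"
    "square_integrable ?M r" "square_integrable ?M a" "square_integrable ?M b"
    unfolding u_def v_def w_def p_def[abs_def] r_def[abs_def] a_def[abs_def] b_def[abs_def]
    by (intro sqi_add sqi_diff sm sqi_cmult sc sq sg sh)+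
  have Dd: "D x = a x + b x + w x" for x by (simp add: D_def a_def b_def)
  have sD: "square_integrable ?M D" unfolding Dd[abs_def] by (intro sqi_add su)
  have sE: "smooth ?E" using zweight_smooth[OF carleman_weight_poly(1)[of A l 1]] by simp
  note int = integrable_weighted[OF _ _ sE]
  have iD: "integrable ?M (\<lambda>x. ?E x * (D x)\<^sup>2)" using int[OF sD sD] by (simp add: power2_eq_square)
  have iu: "integrable ?M (\<lambda>x. ?E x * (u x)\<^sup>2)" using int[OF su(1) su(1)] by (simp add: power2_eq_square)
  have iG: "integrable ?M (\<lambda>x. ?E x * ((p x)\<^sup>2 + (r x)\<^sup>2 + (v x)\<^sup>2))"
    using int[OF su(4) su(4)] int[OF su(5) su(5)] int[OF su(2) su(2)] by (simp add: power2_eq_square distrib_left)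
  show "integrable ?M (\<lambda>x. ?E x * (D x)\<^sup>2)" by (rule iD)
  have iGu: "integrable ?M (\<lambda>x. ?E x * ((p x)\<^sup>2 + (r x)\<^sup>2 + (v x)\<^sup>2 + (u x)\<^sup>2))"
    using Bochner_Integration.integrable_add[OF iG iu] by (simp add: distrib_left)
  then show "integrable ?M (\<lambda>x. ?E x * ((top_factor A x * g 1 x)\<^sup>2 + (top_factor A x * g 2 x)\<^sup>2 + (v x)\<^sup>2 + (u x)\<^sup>2))"
    by (simp add: p_def r_def)
  have g': "wderiv (cube A) (dir i) q = g i" for i by (simp add: g_def)
  have h': "wderiv (cube A) (dir i) (g i) = h i" for i by (simp add: h_def)
  define W where "W P x = ?E x * poly P (s x)" for P x
  have ZW: "zweight (W P)" for P unfolding W_def[abs_def] s_def by (rule carleman_weight_poly(1))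
  have pW: "partial 3 (W P) = W ([:0, 2 * l:] * P + pderiv P)" for P
    unfolding W_def[abs_def] s_def by (rule carleman_weight_poly(2))
  have N1: "has_bochner_integral ?M (\<lambda>x. 2 * W P x * (u x * v x) + W ([:0, 2 * l:] * P + pderiv P) x * (u x)\<^sup>2) 0" for P
    using null_integrals_top_factor(1)[OF A q ZW[of P]] by (simp only: g' h' pW u_def v_def)
  have N2: "has_bochner_integral ?M (\<lambda>x. 2 * W P x * (v x * w x) + W ([:0, 2 * l:] * P + pderiv P) x * (v x)\<^sup>2) 0" for P
    using null_integrals_top_factor(2)[OF A q ZW[of P]] by (simp only: g' h' pW v_def w_def)
  have N3: "has_bochner_integral ?M (\<lambda>x. 2 * W P x * (u x * w x) + 2 * W P x * (v x)\<^sup>2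
      - W ([:0, 2 * l:] * ([:0, 2 * l:] * P + pderiv P) + pderiv ([:0, 2 * l:] * P + pderiv P)) x * (u x)\<^sup>2) 0" for P
    using null_integrals_top_factor(3)[OF A q ZW[of P]] by (simp only: g' h' pW u_def v_def w_def)
  have N4: "has_bochner_integral ?M (\<lambda>x. 2 * W P x * (a x * v x) - W ([:0, 2 * l:] * P + pderiv P) x * (p x)\<^sup>2) 0"
    "has_bochner_integral ?M (\<lambda>x. 2 * W P x * (b x * v x) - W ([:0, 2 * l:] * P + pderiv P) x * (r x)\<^sup>2) 0" for P
    using null_integrals_top_factor(4)[OF A q ZW[of P], of 1] null_integrals_top_factor(4)[OF A q ZW[of P], of 2]
    by (simp_all only: g' h' pW v_def a_def b_def p_def r_def) simp_all
  have N5: "has_bochner_integral ?M (\<lambda>x. W P x * (u x * a x) + W P x * (p x)\<^sup>2) 0"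
    "has_bochner_integral ?M (\<lambda>x. W P x * (u x * b x) + W P x * (r x)\<^sup>2) 0" for P
    using null_integrals_top_factor(5)[OF A q ZW[of P], of 1] null_integrals_top_factor(5)[OF A q ZW[of P], of 2]
    by (simp_all only: g' h' pW u_def a_def b_def p_def r_def) simp_all
  note add = has_bochner_integral_add[where x = "0::real" and y = 0, simplified]
  note mult = has_bochner_integral_mult_right[where x = "0::real", simplified]
  have eqI: "has_bochner_integral ?M f 0" if "has_bochner_integral ?M f' 0" "\<And>x. f x = f' x" for f f' :: "real^3 \<Rightarrow> real"
  proof -
    have "f = f'" using that(2) by (rule ext)
    then show ?thesis using that(1) by simp
  qed
  \<comment> \<open>The weights of the null integrals are \<open>E\<close> times the polynomials \<open>2ls\<close>, \<open>2l\<^sup>2s\<^sup>2 + l\<close> and \<open>4l\<^sup>3s\<^sup>3 + 4l\<^sup>2s\<close>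
    in \<open>s\<close>: the coefficients of \<open>v\<close> and \<open>u\<close> in the antisymmetric part and the product of both.\<close>
  let ?pa = "[:0, 2 * l:]" and ?pb = "[:l, 0, 2 * l\<^sup>2:]" and ?pc = "[:0, 4 * l\<^sup>2, 0, 4 * l ^ 3:]"
  let ?y = "\<lambda>x. 2 * l * s x * v x + (2 * l\<^sup>2 * (s x)\<^sup>2 + l) * u x"
  let ?T1 = "\<lambda>x. ?E x * (- (a x + b x + w x) * ?y x - (?y x)\<^sup>2 - 2 * l * (v x + l * s x * u x)\<^sup>2 - 2 * l ^ 3 * (s x)\<^sup>2 * (u x)\<^sup>2)"
  have W1: "W ?pa x = ?E x * (2 * l * s x)" "W ?pb x = ?E x * (2 * l\<^sup>2 * (s x)\<^sup>2 + l)" "W ?pc x = ?E x * (4 * l ^ 3 * (s x) ^ 3 + 4 * l\<^sup>2 * s x)"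
    "W ([:0, 2 * l:] * ?pa + pderiv ?pa) x = ?E x * (4 * l\<^sup>2 * (s x)\<^sup>2 + 2 * l)"
    "W ([:0, 2 * l:] * ?pc + pderiv ?pc) x = ?E x * (8 * l ^ 4 * (s x) ^ 4 + 20 * l ^ 3 * (s x)\<^sup>2 + 4 * l\<^sup>2)"
    "W ([:0, 2 * l:] * ([:0, 2 * l:] * ?pb + pderiv ?pb) + pderiv ([:0, 2 * l:] * ?pb + pderiv ?pb)) x =
      ?E x * (8 * l ^ 4 * (s x) ^ 4 + 24 * l ^ 3 * (s x)\<^sup>2 + 6 * l\<^sup>2)" for x
    by (simp_all add: W_def pderiv_pCons power2_eq_square power3_eq_cube power4_eq_xxxx algebra_simps)
  have T1: "has_bochner_integral ?M ?T1 0"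
    by (rule eqI[OF add[OF mult[OF N2[of ?pa], of "- (1/2)"] add[OF mult[OF N4(1)[of ?pa], of "- (1/2)"]
        add[OF mult[OF N4(2)[of ?pa], of "- (1/2)"] add[OF mult[OF N3[of ?pb], of "- (1/2)"]
        add[OF mult[OF N5(1)[of ?pb], of "- 1"] add[OF mult[OF N5(2)[of ?pb], of "- 1"] mult[OF N1[of ?pc], of "- 1"]]]]]]]])
       (unfold W1, rule carleman_identity)
  have W2: "W 1 x = ?E x" "W ([:0, 2 * l:] * ([:0, 2 * l:] * 1 + pderiv 1) + pderiv ([:0, 2 * l:] * 1 + pderiv 1)) x =
     ?E x * (4 * l\<^sup>2 * (s x)\<^sup>2 + 2 * l)" for x
    by (simp_all add: W_def pderiv_pCons power2_eq_square algebra_simps)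
  \<comment> \<open>Integration of \<open>E u D\<close> by parts.\<close>
  let ?T2 = "\<lambda>x. ?E x * (u x * D x + (p x)\<^sup>2 + (r x)\<^sup>2 + (v x)\<^sup>2 - (2 * l\<^sup>2 * (s x)\<^sup>2 + l) * (u x)\<^sup>2)"
  have T2: "has_bochner_integral ?M ?T2 0"
    by (rule eqI[OF add[OF N5(1)[of 1] add[OF N5(2)[of 1] mult[OF N3[of 1], of "1/2"]]]])
       (unfold W2 Dd, simp add: power2_eq_square algebra_simps)
  have s2: "A\<^sup>2 \<le> (s x)\<^sup>2" "(s x)\<^sup>2 \<le> 9 * A\<^sup>2" if "x \<in> cube A" for x
  proof -
    have x: "- A < x $ 3" "x $ 3 < A" using that by (auto simp: cube_def)
    then show "A\<^sup>2 \<le> (s x)\<^sup>2" using A abs_le_square_iff[of A "s x"] by (simp add: s_def)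
    have "\<bar>s x\<bar> \<le> \<bar>3 * A\<bar>" using x A by (simp add: s_def)
    from this[unfolded abs_le_square_iff] show "(s x)\<^sup>2 \<le> 9 * A\<^sup>2" by (simp add: power_mult_distrib)
  qed
  have E0: "?E x > 0" for x by (simp add: carleman_weight_def)
  let ?ID = "LINT x|?M. ?E x * (D x)\<^sup>2" and ?Iu = "LINT x|?M. ?E x * (u x)\<^sup>2"
  have "(LINT x|?M. ?T1 x) \<le> (LINT x|?M. 1/4 * (?E x * (D x)\<^sup>2) - 2 * l ^ 3 * A\<^sup>2 * (?E x * (u x)\<^sup>2))"
  proof (rule integral_mono)
    show "integrable ?M ?T1" using T1 by (rule integrable.intros)
    show "integrable ?M (\<lambda>x. 1/4 * (?E x * (D x)\<^sup>2) - 2 * l ^ 3 * A\<^sup>2 * (?E x * (u x)\<^sup>2))"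
      using iD iu by simp
    fix x assume "x \<in> space ?M"
    then have x: "x \<in> cube A" by simp
    have sq: "- d * y - y\<^sup>2 \<le> 1/4 * d\<^sup>2" for d y :: real
      using zero_le_power2[of "d / 2 + y"] by (simp add: power2_eq_square field_simps)
    have h1: "- (a x + b x + w x) * ?y x - (?y x)\<^sup>2 \<le> 1/4 * (D x)\<^sup>2"
      using sq[of "D x" "?y x"] unfolding Dd .
    have h2: "0 \<le> 2 * l * (v x + l * s x * u x)\<^sup>2" using l0 by simp
    have h3: "2 * l ^ 3 * A\<^sup>2 * (u x)\<^sup>2 \<le> 2 * l ^ 3 * (s x)\<^sup>2 * (u x)\<^sup>2"
      using l0 by (intro mult_right_mono mult_left_mono s2(1)[OF x]) auto
    have "- (a x + b x + w x) * ?y x - (?y x)\<^sup>2 - 2 * l * (v x + l * s x * u x)\<^sup>2 - 2 * l ^ 3 * (s x)\<^sup>2 * (u x)\<^sup>2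
      \<le> 1/4 * (D x)\<^sup>2 - 2 * l ^ 3 * A\<^sup>2 * (u x)\<^sup>2"
      by (rule diff_mono[OF order_trans[OF diff_left_mono[OF h2] order_trans[OF _ h1]] h3]) simp
    from mult_left_mono[OF this less_imp_le[OF E0[of x]]]
    have "?T1 x \<le> ?E x * (1/4 * (D x)\<^sup>2 - 2 * l ^ 3 * A\<^sup>2 * (u x)\<^sup>2)" .
    also have "\<dots> = 1/4 * (?E x * (D x)\<^sup>2) - 2 * l ^ 3 * A\<^sup>2 * (?E x * (u x)\<^sup>2)"
      by (simp add: right_diff_distrib)
    finally show "?T1 x \<le> 1/4 * (?E x * (D x)\<^sup>2) - 2 * l ^ 3 * A\<^sup>2 * (?E x * (u x)\<^sup>2)" .
  qed
  then have I1: "8 * l ^ 3 * A\<^sup>2 * ?Iu \<le> ?ID"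
    using has_bochner_integral_integral_eq[OF T1] iD iu by simp
  have "(LINT x|?M. ?E x * ((p x)\<^sup>2 + (r x)\<^sup>2 + (v x)\<^sup>2)) \<le>
    (LINT x|?M. ?T2 x + (1 / (2 * l) * (?E x * (D x)\<^sup>2) + (18 * l\<^sup>2 * A\<^sup>2 + 2 * l) * (?E x * (u x)\<^sup>2)))"
  proof (rule integral_mono[OF iG])
    show "integrable ?M (\<lambda>x. ?T2 x + (1 / (2 * l) * (?E x * (D x)\<^sup>2) + (18 * l\<^sup>2 * A\<^sup>2 + 2 * l) * (?E x * (u x)\<^sup>2)))"
      using T2 iD iu by (intro Bochner_Integration.integrable_add integrable.intros[OF T2] integrable_mult_right) auto
    fix x assume "x \<in> space ?M"
    then have x: "x \<in> cube A" by simp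
    have y: "- (u x * D x) \<le> 1 / (2 * l) * (D x)\<^sup>2 + l / 2 * (u x)\<^sup>2"
      by (rule weighted_Young[OF l0])
    have "l\<^sup>2 * (s x)\<^sup>2 * (u x)\<^sup>2 \<le> l\<^sup>2 * (9 * A\<^sup>2) * (u x)\<^sup>2"
      using s2(2)[OF x] by (intro mult_right_mono mult_left_mono) auto
    moreover have "l / 2 * (u x)\<^sup>2 \<le> l * (u x)\<^sup>2" using l0 by (intro mult_right_mono) auto
    ultimately have "(p x)\<^sup>2 + (r x)\<^sup>2 + (v x)\<^sup>2 \<le>
      (u x * D x + (p x)\<^sup>2 + (r x)\<^sup>2 + (v x)\<^sup>2 - (2 * l\<^sup>2 * (s x)\<^sup>2 + l) * (u x)\<^sup>2) + (1 / (2 * l) * (D x)\<^sup>2 + (18 * l\<^sup>2 * A\<^sup>2 + 2 * l) * (u x)\<^sup>2)"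
      using y by (simp add: distrib_right left_diff_distrib mult.assoc)
    from mult_left_mono[OF this less_imp_le[OF E0[of x]]]
    show "?E x * ((p x)\<^sup>2 + (r x)\<^sup>2 + (v x)\<^sup>2) \<le> ?T2 x + (1 / (2 * l) * (?E x * (D x)\<^sup>2) + (18 * l\<^sup>2 * A\<^sup>2 + 2 * l) * (?E x * (u x)\<^sup>2))"
      by (simp only: distrib_left mult.left_commute mult.assoc)
  qed
  also have "\<dots> = 1 / (2 * l) * ?ID + (18 * l\<^sup>2 * A\<^sup>2 + 2 * l) * ?Iu"
    using has_bochner_integral_integral_eq[OF T2] integrable.intros[OF T2] iD iu by simp
  finally have I2: "(LINT x|?M. ?E x * ((p x)\<^sup>2 + (r x)\<^sup>2 + (v x)\<^sup>2)) \<le> 1 / (2 * l) * ?ID + (18 * l\<^sup>2 * A\<^sup>2 + 2 * l) * ?Iu" .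
  have Iu0: "?Iu \<ge> 0" using E0 by (intro integral_nonneg_AE AE_I2) (simp add: less_imp_le)
  have lA: "1 \<le> l * A\<^sup>2" using l(2) A by (simp add: field_simps)
  have "l * ((18 * l\<^sup>2 * A\<^sup>2 + 2 * l) * ?Iu) \<le> 20 * l ^ 3 * A\<^sup>2 * ?Iu"
  proof -
    have "l * (2 * l) \<le> l * (2 * l) * (l * A\<^sup>2)" using mult_left_mono[OF lA, of "l * (2 * l)"] l0 by simp
    then have "l * (18 * l\<^sup>2 * A\<^sup>2 + 2 * l) \<le> 20 * l ^ 3 * A\<^sup>2" by (simp add: power2_eq_square power3_eq_cube algebra_simps)
    from mult_right_mono[OF this Iu0] show ?thesis by (simp add: mult.assoc)
  qed
  moreover have "l * (1 / (2 * l) * ?ID) = 1/2 * ?ID" using l0 by simp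
  ultimately have G: "l * (LINT x|?M. ?E x * ((p x)\<^sup>2 + (r x)\<^sup>2 + (v x)\<^sup>2)) \<le> 3 * ?ID"
    using mult_left_mono[OF I2, of l] l0 I1 by (simp add: distrib_left)
  have "l * ?Iu \<le> 1 / (8 * A\<^sup>2) * ?ID"
  proof -
    have "l * 1 \<le> l * l\<^sup>2" using l by (intro mult_left_mono) auto
    then have "8 * A\<^sup>2 * (l * ?Iu) \<le> 8 * A\<^sup>2 * (l ^ 3 * ?Iu)"
      using Iu0 by (intro mult_left_mono mult_right_mono) (auto simp: power3_eq_cube power2_eq_square)
    also have "\<dots> \<le> ?ID" using I1 by (simp add: mult_ac)
    finally show ?thesis using A by (simp add: field_simps)
  qed
  with G have "l * (LINT x|?M. ?E x * ((p x)\<^sup>2 + (r x)\<^sup>2 + (v x)\<^sup>2)) + l * ?Iu \<le> (3 + 1 / (8 * A\<^sup>2)) * ?ID"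
    by (simp add: distrib_right)
  moreover have "(LINT x|?M. ?E x * ((p x)\<^sup>2 + (r x)\<^sup>2 + (v x)\<^sup>2 + (u x)\<^sup>2)) = (LINT x|?M. ?E x * ((p x)\<^sup>2 + (r x)\<^sup>2 + (v x)\<^sup>2)) + ?Iu"
    using Bochner_Integration.integral_add[OF iG iu] by (simp add: distrib_left)
  ultimately show "l * (LINT x|?M. ?E x * ((top_factor A x * g 1 x)\<^sup>2 + (top_factor A x * g 2 x)\<^sup>2 + (v x)\<^sup>2 + (u x)\<^sup>2))
      \<le> (3 + 1 / (8 * A\<^sup>2)) * ?ID"
    unfolding p_def r_def by (simp add: distrib_left)
qed

section \<open>Interpolation between a function and its second derivative\<close>

lemma has_real_derivative_if_quadratic_error:
  fixes F :: "real \<Rightarrow> real"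
  assumes "\<And>t. \<bar>F (s + t) - F s - t * D\<bar> \<le> K * t\<^sup>2"
  shows "(F has_real_derivative D) (at s)"
  unfolding DERIV_def
proof (rule LIM_zero_cancel, rule Lim_null_comparison)
  have "(\<lambda>t::real. K * \<bar>t\<bar>) \<midarrow>0\<rightarrow> K * \<bar>0\<bar>" by (intro tendsto_intros)
  then show "(\<lambda>t::real. K * \<bar>t\<bar>) \<midarrow>0\<rightarrow> 0" by simp
  show "\<forall>\<^sub>F t in at 0. norm ((F (s + t) - F s) / t - D) \<le> K * \<bar>t\<bar>"
    unfolding eventually_at
  proof (intro exI[of _ 1] conjI ballI impI)
    fix t :: real assume "t \<noteq> 0 \<and> dist t 0 < 1"
    then have t: "t \<noteq> 0" by simp
    then have "norm ((F (s + t) - F s) / t - D) = \<bar>F (s + t) - F s - t * D\<bar> / \<bar>t\<bar>"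
      by (simp add: abs_divide[symmetric] diff_divide_distrib)
    also have "\<dots> \<le> K * t\<^sup>2 / \<bar>t\<bar>" by (intro divide_right_mono assms) simp
    also have "\<dots> = K * \<bar>t\<bar>" using t by (simp add: power2_eq_square abs_if)
    finally show "norm ((F (s + t) - F s) / t - D) \<le> K * \<bar>t\<bar>" .
  qed simp
qed

lemma test_function_bounded:
  assumes "test_function S \<phi>" obtains C where "C \<ge> 0" "\<And>x. \<bar>\<phi> x\<bar> \<le> C"
proof -
  obtain K where K: "smooth \<phi>" "compact K" "\<And>x. x \<notin> K \<Longrightarrow> \<phi> x = 0"
    using assms by (auto simp: test_function_def)
  have "bounded (\<phi> ` K)" using K by (intro compact_imp_bounded compact_continuous_image smooth_continuous)
  then obtain C where C: "\<And>x. x \<in> K \<Longrightarrow> \<bar>\<phi> x\<bar> \<le> C" unfolding bounded_iff by auto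
  have "\<bar>\<phi> x\<bar> \<le> \<bar>C\<bar>" for x using C[of x] K(3)[of x] by (cases "x \<in> K") auto
  then show ?thesis using that[of "\<bar>C\<bar>"] by simp
qed

lemma first_order_error:
  assumes \<phi>: "smooth \<phi>" and C: "\<And>x. \<bar>partial i (partial i \<phi>) x\<bar> \<le> C"
  shows "\<bar>\<phi> (y + t *\<^sub>R axis i 1) - \<phi> y - t * partial i \<phi> y\<bar> \<le> C * t\<^sup>2"
proof (cases "t = 0")
  case False
  define F where "F r = \<phi> (y + r *\<^sub>R axis i 1)" for r
  define F' where "F' r = partial i \<phi> (y + r *\<^sub>R axis i 1)" for r
  have F: "(F has_real_derivative F' r) (at r)" for r
    unfolding F_def F'_def by (rule partial_has_real_derivative[OF smooth_differentiable[OF \<phi>]])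
  have F': "(F' has_real_derivative partial i (partial i \<phi>) (y + r *\<^sub>R axis i 1)) (at r)" for r
    unfolding F'_def by (rule partial_has_real_derivative[OF smooth_differentiable[OF smooth_partial[OF \<phi>]]])
  have lip: "\<bar>F' r - F' 0\<bar> \<le> C * \<bar>r\<bar>" for r
    using field_differentiable_bound[OF convex_UNIV, of F' "\<lambda>r. partial i (partial i \<phi>) (y + r *\<^sub>R axis i 1)" C 0 r]
      F' C by auto
  have dG: "((\<lambda>r. F r - r * F' 0) has_real_derivative F' r - F' 0) (at r)" for r
    by (auto intro!: derivative_eq_intros F)
  have "\<bar>(F t - t * F' 0) - (F 0 - 0 * F' 0)\<bar> \<le> (C * \<bar>t\<bar>) * \<bar>t - 0\<bar>"
  proof -
    have "norm ((\<lambda>r. F r - r * F' 0) t - (\<lambda>r. F r - r * F' 0) 0) \<le> (C * \<bar>t\<bar>) * norm (t - 0)"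
    proof (rule field_differentiable_bound[of "closed_segment 0 t"])
      show "convex (closed_segment 0 t)" by simp
      fix r assume r: "r \<in> closed_segment 0 t"
      show "((\<lambda>r. F r - r * F' 0) has_field_derivative F' r - F' 0) (at r within closed_segment 0 t)"
        using dG by (rule DERIV_subset) simp
      have "\<bar>r\<bar> \<le> \<bar>t\<bar>" using r by (auto simp: closed_segment_eq_real_ivl split: if_splits)
      moreover have "C \<ge> 0" using C[of y] by simp
      ultimately have "C * \<bar>r\<bar> \<le> C * \<bar>t\<bar>" by (intro mult_left_mono)
      with lip[of r] show "norm (F' r - F' 0) \<le> C * \<bar>t\<bar>" by simp
    qed auto
    then show ?thesis by simp
  qed
  moreover have "F 0 = \<phi> y" "F' 0 = partial i \<phi> y" by (simp_all add: F_def F'_def)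
  moreover have "(C * \<bar>t\<bar>) * \<bar>t - 0\<bar> = C * t\<^sup>2" by (simp add: power2_eq_square mult.assoc)
  moreover have "F t = \<phi> (y + t *\<^sub>R axis i 1)" by (simp add: F_def)
  ultimately show ?thesis by (simp add: algebra_simps power2_eq_square)
qed simp

text \<open>Differentiation under the integral sign: Taylor's formula with the bounded second derivative of \<open>\<phi>\<close>
  gives a quadratic error uniformly in the point.\<close>

lemma translation_derivative:
  assumes f: "integrable (lebesgue_on T) f" and \<phi>: "test_function S \<phi>" and T: "T \<in> sets lebesgue"
  shows "((\<lambda>s. LINT x|lebesgue_on T. f x * \<phi> (x + (c * s) *\<^sub>R axis i 1)) has_real_derivative
    c * (LINT x|lebesgue_on T. f x * partial i \<phi> (x + (c * s) *\<^sub>R axis i 1))) (at s)"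
proof -
  let ?M = "lebesgue_on T"
  have s\<phi>: "smooth \<phi>" using \<phi> by (rule test_function_smooth)
  obtain C where C: "C \<ge> 0" "\<And>x. \<bar>partial i (partial i \<phi>) x\<bar> \<le> C"
    using test_function_bounded[OF test_function_partial[OF test_function_partial[OF \<phi>]]] by metis
  have int: "integrable ?M (\<lambda>x. f x * \<psi> (x + v))" if "test_function S \<psi>" for \<psi> v
  proof -
    obtain B where B: "B \<ge> 0" "\<And>x. \<bar>\<psi> x\<bar> \<le> B" using test_function_bounded[OF \<open>test_function S \<psi>\<close>] by metis
    have "smooth (\<lambda>x. \<psi> (x + v))" using smooth_translate[OF test_function_smooth[OF \<open>test_function S \<psi>\<close>]] .
    then have m: "(\<lambda>x. \<psi> (x + v)) \<in> borel_measurable ?M" by (rule smooth_measurable_on)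
    show ?thesis
    proof (rule Bochner_Integration.integrable_bound)
      show "integrable ?M (\<lambda>x. B * f x)" using f by simp
      show "(\<lambda>x. f x * \<psi> (x + v)) \<in> borel_measurable ?M" using f m by simp
      have "\<bar>f x\<bar> * \<bar>\<psi> (x + v)\<bar> \<le> B * \<bar>f x\<bar>" for x
        using mult_left_mono[OF B(2)[of "x + v"], of "\<bar>f x\<bar>"] by (simp add: mult.commute)
      then show "AE x in ?M. norm (f x * \<psi> (x + v)) \<le> norm (B * f x)" using B(1) by (intro AE_I2) (simp add: abs_mult)
    qed
  qed
  show ?thesis
  proof (rule has_real_derivative_if_quadratic_error)
    fix t
    let ?v = "(c * s) *\<^sub>R axis i 1 :: real^3" and ?w = "(c * (s + t)) *\<^sub>R axis i 1 :: real^3"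
    have w: "x + ?w = (x + ?v) + (c * t) *\<^sub>R axis i 1" for x :: "real^3"
      by (simp add: distrib_left scaleR_add_left)
    have i: "integrable ?M (\<lambda>x. f x * \<phi> (x + ?w))" "integrable ?M (\<lambda>x. f x * \<phi> (x + ?v))" "integrable ?M (\<lambda>x. f x * partial i \<phi> (x + ?v))"
      by (intro int \<phi> test_function_partial)+
    have e: "(LINT x|?M. f x * \<phi> (x + ?w)) - (LINT x|?M. f x * \<phi> (x + ?v)) - t * (c * (LINT x|?M. f x * partial i \<phi> (x + ?v)))
      = (LINT x|?M. f x * (\<phi> (x + ?w) - \<phi> (x + ?v) - (c * t) * partial i \<phi> (x + ?v)))"
    proof -
      have "(LINT x|?M. f x * (\<phi> (x + ?w) - \<phi> (x + ?v) - (c * t) * partial i \<phi> (x + ?v))) =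
        (LINT x|?M. f x * \<phi> (x + ?w) - f x * \<phi> (x + ?v) - (t * c) * (f x * partial i \<phi> (x + ?v)))"
        by (rule Bochner_Integration.integral_cong) (simp_all add: algebra_simps)
      also have "\<dots> = (LINT x|?M. f x * \<phi> (x + ?w)) - (LINT x|?M. f x * \<phi> (x + ?v)) - (t * c) * (LINT x|?M. f x * partial i \<phi> (x + ?v))"
        using i by (simp del: mult.assoc)
      finally show ?thesis by (simp add: mult.assoc)
    qed
    have "\<bar>LINT x|?M. f x * (\<phi> (x + ?w) - \<phi> (x + ?v) - (c * t) * partial i \<phi> (x + ?v))\<bar> \<le> (LINT x|?M. \<bar>f x\<bar> * (C * (c * t)\<^sup>2))"
    proof -
      have "norm (LINT x|?M. f x * (\<phi> (x + ?w) - \<phi> (x + ?v) - c * t * partial i \<phi> (x + ?v))) \<le> (LINT x|?M. \<bar>f x\<bar> * (C * (c * t)\<^sup>2))"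
      proof (rule Bochner_Integration.integral_norm_bound_integral)
        have "integrable ?M (\<lambda>x. f x * \<phi> (x + ?w) - f x * \<phi> (x + ?v) - c * t * (f x * partial i \<phi> (x + ?v)))"
          by (intro Bochner_Integration.integrable_diff integrable_mult_right i)
        then show "integrable ?M (\<lambda>x. f x * (\<phi> (x + ?w) - \<phi> (x + ?v) - c * t * partial i \<phi> (x + ?v)))"
          by (simp only: right_diff_distrib mult.left_commute)
        show "integrable ?M (\<lambda>x. \<bar>f x\<bar> * (C * (c * t)\<^sup>2))" using f by simp
        fix x
        show "norm (f x * (\<phi> (x + ?w) - \<phi> (x + ?v) - c * t * partial i \<phi> (x + ?v))) \<le> \<bar>f x\<bar> * (C * (c * t)\<^sup>2)"
          unfolding w abs_mult[of "f x"] real_norm_def by (intro mult_left_mono first_order_error[OF s\<phi> C(2)]) simp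
      qed
      then show ?thesis unfolding real_norm_def .
    qed
    also have "\<dots> = (LINT x|?M. \<bar>f x\<bar>) * (C * (c * t)\<^sup>2)" by (rule integral_mult_left_zero)
    also have "\<dots> = ((LINT x|?M. \<bar>f x\<bar>) * C * c\<^sup>2) * t\<^sup>2" unfolding power_mult_distrib by (simp only: mult.assoc)
    finally show "\<bar>(LINT x|?M. f x * \<phi> (x + ?w)) - (LINT x|?M. f x * \<phi> (x + ?v)) - t * (c * (LINT x|?M. f x * partial i \<phi> (x + ?v)))\<bar>
      \<le> ((LINT x|?M. \<bar>f x\<bar>) * C * c\<^sup>2) * t\<^sup>2" unfolding e .
  qed
qed

lemma test_function_translate:
  assumes "test_function S \<phi>" "\<And>x. x \<in> S \<Longrightarrow> x - v \<in> T"
  shows "test_function T (\<lambda>x. \<phi> (x + v))"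
proof -
  obtain K where K: "smooth \<phi>" "compact K" "K \<subseteq> S" "\<And>x. x \<notin> K \<Longrightarrow> \<phi> x = 0"
    using assms by (auto simp: test_function_def)
  show ?thesis unfolding test_function_def
  proof (intro conjI exI[of _ "(\<lambda>x. x - v) ` K"] allI impI)
    show "smooth (\<lambda>x. \<phi> (x + v))" using K(1) by (rule smooth_translate)
    show "compact ((\<lambda>x. x - v) ` K)" using K(2) by (intro compact_continuous_image continuous_intros)
    show "(\<lambda>x. x - v) ` K \<subseteq> T" using K(3) assms(2) by auto
    show "\<phi> (x + v) = 0" if "x \<notin> (\<lambda>x. x - v) ` K" for x
    proof (rule K(4))
      show "x + v \<notin> K"
      proof
        assume "x + v \<in> K"
        then have "(x + v) - v \<in> (\<lambda>x. x - v) ` K" by (rule imageI)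
        with that show False by simp
      qed
    qed
  qed
qed

lemma test_function_integral_UNIV:
  assumes "test_function (box a b) \<phi>"
  shows "(LINT x|lebesgue_on (box a b). (\<phi> x)\<^sup>2) = (LINT x|lborel. (\<phi> x)\<^sup>2)"
proof -
  have "(\<lambda>x. (\<phi> x)\<^sup>2) \<in> borel_measurable borel"
    using smooth_measurable[OF test_function_smooth[OF assms]] by simp
  then have "(LINT x|lebesgue_on (box a b). (\<phi> x)\<^sup>2) = (LINT x|lborel. indicator (box a b) x * (\<phi> x)\<^sup>2)"
    by (intro integral_lebesgue_on_borel) auto
  also have "(\<lambda>x. indicator (box a b) x * (\<phi> x)\<^sup>2) = (\<lambda>x. (\<phi> x)\<^sup>2)"
    using test_function_outside[OF assms] by (auto simp: fun_eq_iff indicator_def)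
  finally show ?thesis .
qed

text \<open>The pairing \<open>G(s)\<close> of \<open>f\<close> with the translates of a test function is twice differentiable, and
  its derivatives are the pairings with the weak derivatives of \<open>f\<close>. Taylor's formula on \<open>[0,h]\<close>
  bounds \<open>G'(0)\<close>. Translating towards the interior of the larger box makes boundary conditions
  unnecessary.\<close>

lemma L2_interpolation:
  fixes f :: "real^3 \<Rightarrow> real"
  assumes h: "h > 0" and \<sigma>: "\<sigma> \<in> {1, -1}"
    and ST: "box a b \<subseteq> box a' b'" "\<And>x s. x \<in> box a b \<Longrightarrow> 0 \<le> s \<Longrightarrow> s \<le> h \<Longrightarrow> x + (\<sigma> * s) *\<^sub>R axis i 1 \<in> box a' b'"
    and f: "square_integrable (lebesgue_on (box a' b')) f" "square_integrable (lebesgue_on (box a' b')) f1" "square_integrable (lebesgue_on (box a' b')) f2"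
    and f1: "has_weak_derivative (box a' b') (dir i) f f1" and f2: "has_weak_derivative (box a' b') (dir2 i) f f2"
  shows "(LINT x|lebesgue_on (box a b). (f1 x)\<^sup>2) \<le>
    (2 / h * sqrt (LINT x|lebesgue_on (box a' b'). (f x)\<^sup>2) + h / 2 * sqrt (LINT x|lebesgue_on (box a' b'). (f2 x)\<^sup>2))\<^sup>2"
proof (rule L2_norm_le_by_duality)
  let ?S = "lebesgue_on (box a b)" and ?T = "lebesgue_on (box a' b')"
  let ?n = "sqrt (LINT x|?T. (f x)\<^sup>2)" and ?n2 = "sqrt (LINT x|?T. (f2 x)\<^sup>2)"
  show "square_integrable ?S f1" by (rule sqi_subset(1)[OF f(2) ST(1)]) auto
  show "0 \<le> 2 / h * ?n + h / 2 * ?n2" using h by (intro add_nonneg_nonneg mult_nonneg_nonneg) auto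
  fix \<phi> assume \<phi>: "test_function (box a b) \<phi>"
  \<comment> \<open>The support of the test function moves in the direction \<open>\<sigma>\<close> when its argument moves in the
    direction \<open>- \<sigma>\<close>.\<close>
  define c where "c = - \<sigma>"
  have c: "c * c = 1" "\<bar>c\<bar> = 1" using \<sigma> by (auto simp: c_def)
  define G where "G \<psi> s = (LINT x|?T. f x * \<psi> (x + (c * s) *\<^sub>R axis i 1))" for \<psi> s
  let ?m = "sqrt (LINT x|?S. (\<phi> x)\<^sup>2)"
  have s\<phi>: "smooth \<phi>" using \<phi> by (rule test_function_smooth)
  have tt: "test_function (box a' b') (\<lambda>x. \<phi> (x + (c * s) *\<^sub>R axis i 1))" if "0 \<le> s" "s \<le> h" for s
    by (rule test_function_translate[OF \<phi>]) (use ST(2)[OF _ that] in \<open>simp add: c_def\<close>)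
  have nrm: "sqrt (LINT x|?T. (\<phi> (x + (c * s) *\<^sub>R axis i 1))\<^sup>2) = ?m" if "0 \<le> s" "s \<le> h" for s
  proof -
    let ?v = "(c * s) *\<^sub>R axis i 1 :: real^3"
    have m: "(\<lambda>x. (\<phi> x)\<^sup>2) \<in> borel_measurable borel" using smooth_measurable[OF s\<phi>] by simp
    have "(LINT x|?T. (\<phi> (x + ?v))\<^sup>2) = (LINT x|lborel. (\<phi> (?v + x))\<^sup>2)"
      using test_function_integral_UNIV[OF tt[OF that]] by (simp add: add.commute)
    also have "\<dots> = (LINT x|distr lborel borel ((+) ?v). (\<phi> x)\<^sup>2)"
      by (rule integral_distr[symmetric]) (use m in auto)
    also have "\<dots> = (LINT x|?S. (\<phi> x)\<^sup>2)"
      using test_function_integral_UNIV[OF \<phi>] by (simp add: lborel_distr_plus)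
    finally show ?thesis by simp
  qed
  have fi: "integrable ?T f" using f(1) by (rule sqi_imp_integrable_box)
  have d: "(G \<psi> has_real_derivative c * G (partial i \<psi>) s) (at s)" if "test_function (box a b) \<psi>" for \<psi> s
    unfolding G_def[abs_def] by (rule translation_derivative[OF fi that]) simp
  have G0: "\<bar>G \<phi> s\<bar> \<le> ?n * ?m" if "0 \<le> s" "s \<le> h" for s
  proof -
    have "square_integrable ?T (\<lambda>x. \<phi> (x + (c * s) *\<^sub>R axis i 1))"
      by (rule smooth_sqi_box[OF smooth_translate[OF s\<phi>]])
    from sqi_Cauchy_Schwarz[OF f(1) this] show ?thesis unfolding G_def nrm[OF that] .
  qed
  have G2: "\<bar>G (partial i (partial i \<phi>)) s\<bar> \<le> ?n2 * ?m" if "0 \<le> s" "s \<le> h" for s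
  proof -
    let ?\<phi> = "\<lambda>x. \<phi> (x + (c * s) *\<^sub>R axis i 1)"
    have sm: "smooth ?\<phi>" by (rule smooth_translate[OF s\<phi>])
    have "mpartial (dir2 i) ?\<phi> = partial i (partial i ?\<phi>)"
      using mpartial_upd[OF sm, of "dir i" i] mpartial_dir[OF smooth_partial[OF sm], of i i] by (simp add: dir2_upd)
    also have "\<dots> = (\<lambda>x. partial i (partial i \<phi>) (x + (c * s) *\<^sub>R axis i 1))" by (simp add: partial_translate)
    finally have mp: "mpartial (dir2 i) ?\<phi> = (\<lambda>x. partial i (partial i \<phi>) (x + (c * s) *\<^sub>R axis i 1))" .
    have "(LINT x|?T. f x * mpartial (dir2 i) ?\<phi> x) = (LINT x|?T. f2 x * ?\<phi> x)"
      using f2 tt[OF that] by (simp add: has_weak_derivative_def)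
    then have "G (partial i (partial i \<phi>)) s = (LINT x|?T. f2 x * ?\<phi> x)"
      unfolding mp G_def .
    moreover have "square_integrable ?T ?\<phi>" by (rule smooth_sqi_box[OF sm])
    from sqi_Cauchy_Schwarz[OF f(3) this] have "\<bar>LINT x|?T. f2 x * ?\<phi> x\<bar> \<le> ?n2 * ?m" unfolding nrm[OF that] .
    ultimately show ?thesis by simp
  qed
  define dG where "dG m = (if m = 0 then G \<phi> else if m = 1 then (\<lambda>s. c * G (partial i \<phi>) s) else G (partial i (partial i \<phi>)))" for m :: nat
  have "\<exists>t. 0 < t \<and> t < h \<and> G \<phi> h = (\<Sum>m<2. dG m 0 / fact m * h ^ m) + dG 2 t / fact 2 * h ^ 2"
  proof (rule Maclaurin[OF h])
    show "dG 0 = G \<phi>" by (simp add: dG_def)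
    show "\<forall>m t. m < 2 \<and> 0 \<le> t \<and> t \<le> h \<longrightarrow> (dG m has_real_derivative dG (Suc m) t) (at t)"
    proof (intro allI impI)
      fix m :: nat and t assume "m < 2 \<and> 0 \<le> t \<and> t \<le> h"
      then consider "m = 0" | "m = 1" by linarith
      then show "(dG m has_real_derivative dG (Suc m) t) (at t)"
      proof cases
        case 1
        then show ?thesis using d[OF \<phi>] by (simp add: dG_def)
      next
        case 2
        have "((\<lambda>s. c * G (partial i \<phi>) s) has_real_derivative c * (c * G (partial i (partial i \<phi>)) t)) (at t)"
          by (intro DERIV_cmult d test_function_partial \<phi>)
        moreover have "c * (c * G (partial i (partial i \<phi>)) t) = G (partial i (partial i \<phi>)) t"
          using c(1) by (simp add: mult.assoc[symmetric])
        ultimately show ?thesis using 2 by (simp add: dG_def)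
      qed
    qed
  qed simp
  then obtain t where t: "0 < t" "t < h" "G \<phi> h = G \<phi> 0 + c * G (partial i \<phi>) 0 * h + G (partial i (partial i \<phi>)) t / 2 * h\<^sup>2"
    by (auto simp: dG_def numeral_2_eq_2)
  have "h * \<bar>G (partial i \<phi>) 0\<bar> = \<bar>c * G (partial i \<phi>) 0 * h\<bar>" using h c(2) by (simp add: abs_mult)
  also have "\<dots> = \<bar>G \<phi> h - G \<phi> 0 - G (partial i (partial i \<phi>)) t / 2 * h\<^sup>2\<bar>" using t by simp
  also have "\<dots> \<le> \<bar>G \<phi> h\<bar> + \<bar>G \<phi> 0\<bar> + \<bar>G (partial i (partial i \<phi>)) t / 2 * h\<^sup>2\<bar>" by linarith
  also have "\<dots> \<le> ?n * ?m + ?n * ?m + ?n2 * ?m / 2 * h\<^sup>2"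
  proof -
    have "\<bar>G (partial i (partial i \<phi>)) t / 2 * h\<^sup>2\<bar> = \<bar>G (partial i (partial i \<phi>)) t\<bar> / 2 * h\<^sup>2" by (simp add: abs_mult)
    also have "\<dots> \<le> ?n2 * ?m / 2 * h\<^sup>2" using G2[of t] t by (intro mult_right_mono divide_right_mono) auto
    finally show ?thesis
      using G0[OF less_imp_le[OF h] order_refl] G0[OF order_refl less_imp_le[OF h]] by linarith
  qed
  also have "\<dots> = h * ((2 / h * ?n + h / 2 * ?n2) * ?m)" using h by (simp add: field_simps power2_eq_square)
  finally have "\<bar>G (partial i \<phi>) 0\<bar> \<le> (2 / h * ?n + h / 2 * ?n2) * ?m" using h by (rule mult_left_le_imp_le)
  moreover have "(LINT x|?T. f x * mpartial (dir i) \<phi> x) = - (LINT x|?T. f1 x * \<phi> x)"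
    using f1 test_function_mono[OF \<phi> ST(1)] by (simp add: has_weak_derivative_def)
  then have "G (partial i \<phi>) 0 = - (LINT x|?T. f1 x * \<phi> x)"
    unfolding mpartial_dir[OF s\<phi>] by (simp add: G_def)
  moreover have "(LINT x|?T. f1 x * \<phi> x) = (LINT x|?S. f1 x * \<phi> x)"
    using test_function_outside[OF \<phi>] ST(1) by (intro integral_lebesgue_on_supported) auto
  ultimately show "\<bar>LINT x|?S. f1 x * \<phi> x\<bar> \<le> (2 / h * ?n + h / 2 * ?n2) * ?m" by simp
qed

lemma integral_square_Un_le:
  fixes f :: "real^3 \<Rightarrow> real"
  assumes "square_integrable (lebesgue_on S) f" "S = T \<union> U" "T \<in> sets lebesgue" "U \<in> sets lebesgue"
  shows "(LINT x|lebesgue_on S. (f x)\<^sup>2) \<le> (LINT x|lebesgue_on T. (f x)\<^sup>2) + (LINT x|lebesgue_on U. (f x)\<^sup>2)"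
proof -
  have S: "S \<in> sets lebesgue" using assms by auto
  have i: "integrable lebesgue (\<lambda>x. indicator V x *\<^sub>R (f x)\<^sup>2)" if "V \<subseteq> S" "V \<in> sets lebesgue" for V
    using integrable_lebesgue_on_subset[OF sqi_integrable[OF assms(1)] that S] that(2) by (simp add: integrable_restrict_space)
  have "(LINT x|lebesgue. indicator S x *\<^sub>R (f x)\<^sup>2) \<le> (LINT x|lebesgue. indicator T x *\<^sub>R (f x)\<^sup>2 + indicator U x *\<^sub>R (f x)\<^sup>2)"
    by (intro integral_mono Bochner_Integration.integrable_add i) (use assms S in \<open>auto simp: indicator_def\<close>)
  also have "\<dots> = (LINT x|lebesgue. indicator T x *\<^sub>R (f x)\<^sup>2) + (LINT x|lebesgue. indicator U x *\<^sub>R (f x)\<^sup>2)"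
    by (intro Bochner_Integration.integral_add i) (use assms in auto)
  finally show ?thesis using assms S by (simp add: integral_restrict_space)
qed

text \<open>In the vertical direction there is a layer of height \<open>\<epsilon>/2\<close> above the subcube for upward translations.
  In a horizontal direction the subcube is the union of two overlapping boxes, each of which can be
  translated inwards by \<open>h \<le> A/2\<close>; they account for the factor 2.\<close>

lemma subcube_interpolation:
  assumes A: "A > 0" and \<epsilon>: "0 < \<epsilon>" "\<epsilon> < A" and h: "0 < h" "h \<le> \<epsilon> / 2"
    and f: "square_integrable (lebesgue_on (cube A)) f" "square_integrable (lebesgue_on (cube A)) f1" "square_integrable (lebesgue_on (cube A)) f2"
    and f1: "has_weak_derivative (cube A) (dir i) f f1" and f2: "has_weak_derivative (cube A) (dir2 i) f f2"
  shows "(LINT x|lebesgue_on (subcube A \<epsilon>). (f1 x)\<^sup>2) \<le>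
    2 * (2 / h * sqrt (LINT x|lebesgue_on (subcube A (\<epsilon>/2)). (f x)\<^sup>2) + h / 2 * sqrt (LINT x|lebesgue_on (cube A). (f2 x)\<^sup>2))\<^sup>2"
proof -
  let ?T = "subcube A (\<epsilon>/2)"
  let ?B = "2 / h * sqrt (LINT x|lebesgue_on ?T. (f x)\<^sup>2) + h / 2 * sqrt (LINT x|lebesgue_on (cube A). (f2 x)\<^sup>2)"
  have T: "?T = box (cube_lower A) (cube_upper A (\<epsilon>/2))" using \<epsilon> by (intro subcube_box) simp
  have S: "subcube A \<epsilon> = box (cube_lower A) (cube_upper A \<epsilon>)" using \<epsilon> by (intro subcube_box) simp
  have sub: "?T \<subseteq> cube A" "subcube A \<epsilon> \<subseteq> cube A" by (auto simp: subcube_def)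
  have Tm: "?T \<in> sets lebesgue" "subcube A \<epsilon> \<in> sets lebesgue" by (simp_all add: T S)
  note fT = sqi_subset(1)[OF f(1) sub(1) Tm(1) sets_cube] sqi_subset(1)[OF f(2) sub(1) Tm(1) sets_cube]
    sqi_subset(1)[OF f(3) sub(1) Tm(1) sets_cube]
  note wT = wd_subset[OF f1 sub(1) Tm(1) sets_cube] wd_subset[OF f2 sub(1) Tm(1) sets_cube]
  have step: "(LINT x|lebesgue_on (box a b). (f1 x)\<^sup>2) \<le> ?B\<^sup>2"
    if \<sigma>: "\<sigma> \<in> {1, -1}" and ab: "box a b \<subseteq> ?T" "\<And>x s. x \<in> box a b \<Longrightarrow> 0 \<le> s \<Longrightarrow> s \<le> h \<Longrightarrow> x + (\<sigma> * s) *\<^sub>R axis i 1 \<in> ?T" for \<sigma> a b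
  proof -
    have "(LINT x|lebesgue_on (box a b). (f1 x)\<^sup>2) \<le>
      (2 / h * sqrt (LINT x|lebesgue_on ?T. (f x)\<^sup>2) + h / 2 * sqrt (LINT x|lebesgue_on ?T. (f2 x)\<^sup>2))\<^sup>2"
      unfolding T by (rule L2_interpolation[OF h(1) \<sigma>]) (use ab fT wT in \<open>simp_all only: T\<close>)
    also have "\<dots> \<le> ?B\<^sup>2"
      using h sqi_subset(2)[OF f(3) sub(1) Tm(1) sets_cube]
      by (intro power_mono add_left_mono mult_left_mono real_sqrt_le_mono add_nonneg_nonneg mult_nonneg_nonneg) auto
    finally show ?thesis .
  qed
  show ?thesis
  proof (cases "i = 3")
    case True
    have "(LINT x|lebesgue_on (subcube A \<epsilon>). (f1 x)\<^sup>2) \<le> ?B\<^sup>2"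
      unfolding S
    proof (rule step[of 1])
      show "box (cube_lower A) (cube_upper A \<epsilon>) \<subseteq> ?T" unfolding S[symmetric] using \<epsilon> by (auto simp: subcube_def)
      show "x + (1 * s) *\<^sub>R axis i 1 \<in> ?T" if "x \<in> box (cube_lower A) (cube_upper A \<epsilon>)" "0 \<le> s" "s \<le> h" for x s
        using that h \<epsilon> True unfolding S[symmetric] by (auto simp: subcube_def cube_def forall_3 axis_def)
    qed simp
    then show ?thesis using zero_le_power2[of ?B] by linarith
  next
    case False
    let ?L = "box (cube_lower A) (\<chi> j. if j = i then A / 2 else cube_upper A \<epsilon> $ j)"
    let ?R = "box (\<chi> j. if j = i then - A / 2 else - A) (cube_upper A \<epsilon>)"
    have i: "i = 1 \<or> i = 2" using False exhaust_3[of i] by auto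
    note box_simps = mem_box_cart forall_3 cube_lower_def cube_upper_def axis_def
    have U: "subcube A \<epsilon> = ?L \<union> ?R"
    proof (rule Set.set_eqI)
      fix x
      have halves: "- A < t \<and> t < A \<longleftrightarrow> (- A < t \<and> t < A / 2) \<or> (- (A / 2) < t \<and> t < A)" for t
        using A by argo
      from i show "x \<in> subcube A \<epsilon> \<longleftrightarrow> x \<in> ?L \<union> ?R"
        unfolding S using halves[of "x $ i"] by (elim disjE) (simp add: box_simps, argo)+
    qed
    have "(LINT x|lebesgue_on ?L. (f1 x)\<^sup>2) \<le> ?B\<^sup>2"
    proof (rule step[of 1])
      show "?L \<subseteq> ?T" unfolding T using i A \<epsilon> by (elim disjE) (simp add: subset_iff box_simps)+
      show "x + (1 * s) *\<^sub>R axis i 1 \<in> ?T" if "x \<in> ?L" "0 \<le> s" "s \<le> h" for x s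
        using that h \<epsilon> i A unfolding T by (elim disjE) (simp add: box_simps)+
    qed simp
    moreover have "(LINT x|lebesgue_on ?R. (f1 x)\<^sup>2) \<le> ?B\<^sup>2"
    proof (rule step[of "-1"])
      show "?R \<subseteq> ?T" unfolding T using i A \<epsilon> by (elim disjE) (simp add: subset_iff box_simps)+
      show "x + (-1 * s) *\<^sub>R axis i 1 \<in> ?T" if "x \<in> ?R" "0 \<le> s" "s \<le> h" for x s
        using that h \<epsilon> i A unfolding T by (elim disjE) (simp add: box_simps)+
    qed simp
    moreover have "(LINT x|lebesgue_on (subcube A \<epsilon>). (f1 x)\<^sup>2) \<le> (LINT x|lebesgue_on ?L. (f1 x)\<^sup>2) + (LINT x|lebesgue_on ?R. (f1 x)\<^sup>2)"
      by (rule integral_square_Un_le[OF sqi_subset(1)[OF f(2) sub(2) Tm(2) sets_cube] U]) auto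
    ultimately show ?thesis by simp
  qed
qed

section \<open>The coefficients of the operator\<close>

text \<open>This form of the orthonormal functions makes the coefficients of \<open>L\<close> integrals of explicit continuous
  functions.\<close>

lemma Psi_poly_exp: "\<exists>p. \<forall>t. Psi d n t = poly p t * exp t"
proof (induction n rule: less_induct)
  case (less n)
  then have "\<forall>k. \<exists>p. k < n \<longrightarrow> (\<forall>t. Psi d k t = poly p t * exp t)" by blast
  then obtain P where P: "\<And>k t. k < n \<Longrightarrow> Psi d k t = poly (P k) t * exp t" by metis
  define c where "c k = L2_inner d (\<lambda>s. s ^ n * exp s) (Psi d k)" for k
  define w where "w t = t ^ n * exp t - (\<Sum>k<n. c k * Psi d k t)" for t
  define q where "q = monom 1 n - (\<Sum>k<n. Polynomial.smult (c k) (P k))"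
  have w: "w t = poly q t * exp t" for t
    by (simp add: w_def q_def P poly_monom poly_sum left_diff_distrib sum_distrib_right mult.assoc)
  have "Psi d n t = w t / sqrt (L2_inner d w w)" for t
    unfolding Psi.simps[of d n] Let_def w_def[abs_def] c_def by simp
  then have "Psi d n t = poly (Polynomial.smult (1 / sqrt (L2_inner d w w)) q) t * exp t" for t
    by (simp add: w)
  then show ?case by blast
qed

lemma rvec_norm_sq: "(norm (rvec A b x t))\<^sup>2 = (x $ 1 - t)\<^sup>2 + (x $ 2)\<^sup>2 + (x $ 3 + A + b)\<^sup>2"
  by (simp add: norm_vec_def L2_set_def sum_3 rvec_def vector_3 algebra_simps)

text \<open>A common form of the integrals for \<open>D\<^sub>j\<close> and \<open>D\<^sub>0\<close>: only the first component of \<open>r\<close> depends on the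
  integration variable, so all numerators are affine in it. The denominators stay away from zero
  because the third component of \<open>r\<close> is at least \<open>b\<close>.\<close>

lemma coefficient_integral:
  fixes \<alpha> :: "real^3 \<Rightarrow> real" and \<beta> d :: real and m n :: nat
  assumes A: "A > 0" and b: "b > 0" and \<alpha>: "continuous_on UNIV \<alpha>"
  defines "c \<equiv> \<lambda>x. LBINT t:{-d<..<d}. deriv (\<lambda>s. (\<alpha> x + \<beta> * s) * Psi d n s / (norm (rvec A b x s))\<^sup>2) t * Psi d m t"
  shows "c \<in> borel_measurable (lebesgue_on (cube A))"
    and "\<exists>B. \<forall>x\<in>cube A. \<bar>c x\<bar> \<le> B"
proof -
  obtain p where p: "\<And>t. Psi d n t = poly p t * exp t" using Psi_poly_exp[of d n] by blast
  obtain q where q: "\<And>t. Psi d m t = poly q t * exp t" using Psi_poly_exp[of d m] by blast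
  define \<rho> where "\<rho> z = (fst z $ 1 - snd z)\<^sup>2 + (fst z $ 2)\<^sup>2 + (fst z $ 3 + A + b)\<^sup>2" for z :: "(real^3) \<times> real"
  define P where "P t = poly p t * exp t" for t
  define P' where "P' t = poly (p + pderiv p) t * exp t" for t
  define Q where "Q t = poly q t * exp t" for t
  define K where "K z = ((\<beta> * P (snd z) + (\<alpha> (fst z) + \<beta> * snd z) * P' (snd z)) / \<rho> z
     + (\<alpha> (fst z) + \<beta> * snd z) * P (snd z) * (2 * (fst z $ 1 - snd z)) / (\<rho> z)\<^sup>2) * Q (snd z)" for z
  have dP: "(P has_real_derivative P' t) (at t)" for t
    unfolding P_def P'_def by (auto intro!: derivative_eq_intros DERIV_chain2[OF poly_DERIV] simp: algebra_simps)
  have cP: "continuous_on UNIV P" "continuous_on UNIV P'" "continuous_on UNIV Q"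
    unfolding P_def P'_def Q_def by (intro continuous_intros)+
  have c\<rho>: "continuous_on UNIV \<rho>" unfolding \<rho>_def by (intro continuous_intros)
  have c2: "continuous_on UNIV (\<lambda>z::(real^3) \<times> real. g (snd z))" if "continuous_on UNIV g" for g :: "real \<Rightarrow> real"
    by (rule continuous_on_compose2[OF that continuous_on_snd[OF continuous_on_id]]) simp
  have c1: "continuous_on UNIV (\<lambda>z::(real^3) \<times> real. \<alpha> (fst z))"
    by (rule continuous_on_compose2[OF \<alpha> continuous_on_fst[OF continuous_on_id]]) simp
  have c3: "continuous_on UNIV (\<lambda>z::(real^3) \<times> real. fst z $ 1)" by (intro continuous_intros)
  have \<rho>pos: "\<rho> z > 0" if "fst z $ 3 \<ge> - A" for z
  proof -
    have "0 < (fst z $ 3 + A + b)\<^sup>2" using that b by (intro zero_less_power) simp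
    then show ?thesis unfolding \<rho>_def by (simp add: add_nonneg_pos)
  qed
  have deriv: "deriv (\<lambda>s. (\<alpha> x + \<beta> * s) * Psi d n s / (norm (rvec A b x s))\<^sup>2) t * Psi d m t = K (x, t)"
    if "x $ 3 \<ge> - A" for x t
  proof -
    have r: "\<rho> (x, t) \<noteq> 0" using \<rho>pos[of "(x, t)"] that by simp
    have d\<rho>: "((\<lambda>s. \<rho> (x, s)) has_real_derivative - (2 * (x $ 1 - t))) (at t)"
      unfolding \<rho>_def by (auto intro!: derivative_eq_intros)
    have "((\<lambda>s. (\<alpha> x + \<beta> * s) * P s) has_real_derivative \<beta> * P t + (\<alpha> x + \<beta> * t) * P' t) (at t)"
      by (auto intro!: derivative_eq_intros dP)
    from DERIV_divide[OF this d\<rho> r]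
    have "((\<lambda>s. (\<alpha> x + \<beta> * s) * P s / \<rho> (x, s)) has_real_derivative
      (\<beta> * P t + (\<alpha> x + \<beta> * t) * P' t) / \<rho> (x, t) + (\<alpha> x + \<beta> * t) * P t * (2 * (x $ 1 - t)) / (\<rho> (x, t))\<^sup>2) (at t)"
      by (rule DERIV_cong) (use r in \<open>simp add: field_simps power2_eq_square\<close>)
    moreover have "(\<lambda>s. (\<alpha> x + \<beta> * s) * Psi d n s / (norm (rvec A b x s))\<^sup>2) = (\<lambda>s. (\<alpha> x + \<beta> * s) * P s / \<rho> (x, s))"
      by (simp add: p P_def rvec_norm_sq \<rho>_def)
    ultimately show ?thesis by (simp add: DERIV_imp_deriv K_def q Q_def)
  qed
  have mK: "K \<in> borel_measurable borel"
  proof -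
    note [measurable] = borel_measurable_continuous_onI[OF c1] borel_measurable_continuous_onI[OF c\<rho>]
      borel_measurable_continuous_onI[OF c2[OF cP(1)]] borel_measurable_continuous_onI[OF c2[OF cP(2)]]
      borel_measurable_continuous_onI[OF c2[OF cP(3)]] borel_measurable_continuous_onI[OF c3]
      borel_measurable_continuous_onI[OF c2[OF continuous_on_id]]
    show ?thesis unfolding K_def by measurable
  qed
  have cK: "c x = (LINT t|lborel. indicator {-d<..<d} t * K (x, t))" if "x \<in> cube A" for x
    unfolding c_def set_lebesgue_integral_def using deriv[of x] that by (simp add: cube_def less_imp_le)
  have "(\<lambda>x. LINT t|lborel. indicator {-d<..<d} t * K (x, t)) \<in> borel_measurable lborel"
  proof (rule sigma_finite_measure.borel_measurable_lebesgue_integral[OF lborel.sigma_finite_measure_axioms])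
    have "(\<lambda>z. indicator {-d<..<d} (snd z) * K z) \<in> borel_measurable (borel :: ((real^3) \<times> real) measure)"
    proof -
      have "(snd :: (real^3) \<times> real \<Rightarrow> real) \<in> borel_measurable borel"
        by (intro borel_measurable_continuous_onI continuous_intros)
      then show ?thesis using mK by measurable
    qed
    then have "(\<lambda>z. indicator {-d<..<d} (snd z) * K z) \<in> borel_measurable (lborel \<Otimes>\<^sub>M lborel)"
      by (simp add: lborel_prod)
    then show "(\<lambda>(x, t). indicator {-d<..<d} t * K (x, t)) \<in> borel_measurable (lborel \<Otimes>\<^sub>M lborel)"
      by (simp add: case_prod_beta')
  qed
  then have m: "(\<lambda>x. LINT t|lborel. indicator {-d<..<d} t * K (x, t)) \<in> borel_measurable (lebesgue_on (cube A))"
    by (intro measurable_restrict_space1 measurable_completion)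
  show "c \<in> borel_measurable (lebesgue_on (cube A))"
    by (rule measurable_cong[THEN iffD1, OF _ m]) (simp add: cK)
  define C where "C = (cbox (\<chi> i. - A) (\<chi> i. A) :: (real^3) set) \<times> {-d..d}"
  have "compact C" unfolding C_def by (intro compact_Times compact_cbox compact_Icc)
  moreover have "continuous_on C K"
  proof -
    have pos: "\<rho> z \<noteq> 0" "(\<rho> z)\<^sup>2 \<noteq> 0" if "z \<in> C" for z
      using \<rho>pos[of z] that by (auto simp: C_def mem_box_cart)
    note cs = continuous_on_subset[OF c1] continuous_on_subset[OF c\<rho>] continuous_on_subset[OF c2[OF cP(1)]]
      continuous_on_subset[OF c2[OF cP(2)]] continuous_on_subset[OF c2[OF cP(3)]] continuous_on_subset[OF c3]
      continuous_on_subset[OF c2[OF continuous_on_id]]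
    show ?thesis unfolding K_def using pos
      by (intro continuous_on_mult continuous_on_add continuous_on_divide continuous_on_diff continuous_on_power continuous_on_const cs) auto
  qed
  ultimately have "bounded (K ` C)" by (intro compact_imp_bounded compact_continuous_image)
  then obtain B where B: "\<And>z. z \<in> C \<Longrightarrow> \<bar>K z\<bar> \<le> B" unfolding bounded_iff by auto
  have "\<bar>c x\<bar> \<le> \<bar>B\<bar> * measure lborel {-d<..<d}" if x: "x \<in> cube A" for x
  proof -
    have "norm (LINT t|lborel. indicator {-d<..<d} t * K (x, t)) \<le> (LINT t|lborel. \<bar>B\<bar> * indicator {-d<..<d} t)"
    proof (cases "integrable lborel (\<lambda>t. indicator {-d<..<d} t * K (x, t))")
      case True
      show ?thesis
      proof (rule Bochner_Integration.integral_norm_bound_integral[OF True])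
        show "integrable lborel (\<lambda>t. \<bar>B\<bar> * indicator {-d<..<d} t)"
          using emeasure_bounded_finite[OF bounded_box[of "-d" d]] by (intro integrable_mult_right integrable_real_indicator) (simp_all add: box_real)
        fix t
        have "\<bar>K (x, t)\<bar> \<le> \<bar>B\<bar>" if "t \<in> {-d<..<d}"
          using B[of "(x, t)"] that x by (auto simp: C_def mem_box_cart cube_def less_imp_le)
        then show "norm (indicator {-d<..<d} t * K (x, t)) \<le> \<bar>B\<bar> * indicator {-d<..<d} t"
          by (auto simp: indicator_def)
      qed
    next
      case False
      then show ?thesis by (simp add: not_integrable_integral_eq)
    qed
    then show ?thesis using cK[OF x] by simp
  qed
  then show "\<exists>B. \<forall>x\<in>cube A. \<bar>c x\<bar> \<le> B" by (intro exI ballI)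
qed

lemma D_coeff_regular:
  assumes A: "A > 0" and b: "b > 0"
  shows "D_coeff A b d j m n \<in> borel_measurable (lebesgue_on (cube A)) \<and> (\<exists>B. \<forall>x\<in>cube A. \<bar>D_coeff A b d j m n x\<bar> \<le> B)"
    and "D0_coeff A b d m n \<in> borel_measurable (lebesgue_on (cube A)) \<and> (\<exists>B. \<forall>x\<in>cube A. \<bar>D0_coeff A b d m n x\<bar> \<le> B)"
proof -
  define \<alpha> where "\<alpha> x = 2 * (x $ j - vector [0, 0, - A - b] $ j)" for x :: "real^3"
  define \<beta> :: real where "\<beta> = (if j = 1 then - 2 else 0)"
  have e: "2 * (rvec A b x s $ j) = \<alpha> x + \<beta> * s" for x s
    using exhaust_3[of j] by (auto simp: \<alpha>_def \<beta>_def rvec_def vector_3)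
  have c: "continuous_on UNIV \<alpha>" unfolding \<alpha>_def by (intro continuous_intros)
  let ?c = "\<lambda>x. LBINT t:{-d<..<d}. deriv (\<lambda>s. (\<alpha> x + \<beta> * s) * Psi d n s / (norm (rvec A b x s))\<^sup>2) t * Psi d m t"
  have D: "D_coeff A b d j m n = (\<lambda>x. - ?c x)"
    unfolding D_coeff_def[abs_def] e ..
  show "D_coeff A b d j m n \<in> borel_measurable (lebesgue_on (cube A)) \<and> (\<exists>B. \<forall>x\<in>cube A. \<bar>D_coeff A b d j m n x\<bar> \<le> B)"
    unfolding D using coefficient_integral[OF A b c, of d \<beta> n m] by auto
  have D0: "D0_coeff A b d m n = (\<lambda>x. LBINT t:{-d<..<d}. deriv (\<lambda>s. (4 + 0 * s) * Psi d n s / (norm (rvec A b x s))\<^sup>2) t * Psi d m t)"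
    unfolding D0_coeff_def[abs_def] by simp
  show "D0_coeff A b d m n \<in> borel_measurable (lebesgue_on (cube A)) \<and> (\<exists>B. \<forall>x\<in>cube A. \<bar>D0_coeff A b d m n x\<bar> \<le> B)"
    unfolding D0 using coefficient_integral[OF A b continuous_on_const[of UNIV 4], of d 0 n m] by auto
qed

lemma regular_sum:
  fixes f :: "'i \<Rightarrow> 'a \<Rightarrow> real"
  assumes "finite I" "\<And>k. k \<in> I \<Longrightarrow> f k \<in> borel_measurable M \<and> (\<exists>B. \<forall>x\<in>S. \<bar>f k x\<bar> \<le> B)"
  shows "(\<lambda>x. \<Sum>k\<in>I. c k * f k x) \<in> borel_measurable M \<and> (\<exists>B. \<forall>x\<in>S. \<bar>\<Sum>k\<in>I. c k * f k x\<bar> \<le> B)"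
proof
  have m: "f k \<in> borel_measurable M" if "k \<in> I" for k using assms(2)[OF that] by (rule conjunct1)
  show "(\<lambda>x. \<Sum>k\<in>I. c k * f k x) \<in> borel_measurable M"
    by (intro borel_measurable_sum borel_measurable_times borel_measurable_const m)
  have "\<forall>k\<in>I. \<exists>B. \<forall>x\<in>S. \<bar>f k x\<bar> \<le> B" using assms(2) by blast
  from bchoice[OF this] obtain B where B: "\<forall>k\<in>I. \<forall>x\<in>S. \<bar>f k x\<bar> \<le> B k" ..
  have "\<bar>\<Sum>k\<in>I. c k * f k x\<bar> \<le> (\<Sum>k\<in>I. \<bar>c k\<bar> * B k)" if x: "x \<in> S" for x
  proof -
    have "\<bar>\<Sum>k\<in>I. c k * f k x\<bar> \<le> (\<Sum>k\<in>I. \<bar>c k * f k x\<bar>)" by (rule sum_abs)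
    also have "\<dots> \<le> (\<Sum>k\<in>I. \<bar>c k\<bar> * B k)"
    proof (rule sum_mono)
      fix k assume k: "k \<in> I"
      have "\<bar>f k x\<bar> \<le> B k" using B k x by blast
      then show "\<bar>c k * f k x\<bar> \<le> \<bar>c k\<bar> * B k" unfolding abs_mult by (rule mult_left_mono) simp
    qed
    finally show ?thesis .
  qed
  then show "\<exists>B. \<forall>x\<in>S. \<bar>\<Sum>k\<in>I. c k * f k x\<bar> \<le> B" by (intro exI ballI)
qed

lemma A_coeff_regular:
  assumes A: "A > 0" and b: "b > 0"
  shows "A_coeff A b d N j m n \<in> borel_measurable (lebesgue_on (cube A))"
    and "A0_coeff A b d N m n \<in> borel_measurable (lebesgue_on (cube A))"
    and "\<exists>B. \<forall>x\<in>cube A. \<bar>A_coeff A b d N j m n x\<bar> \<le> B"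
    and "\<exists>B. \<forall>x\<in>cube A. \<bar>A0_coeff A b d N m n x\<bar> \<le> B"
proof -
  let ?R = "\<lambda>g :: real^3 \<Rightarrow> real. g \<in> borel_measurable (lebesgue_on (cube A)) \<and> (\<exists>B. \<forall>x\<in>cube A. \<bar>g x\<bar> \<le> B)"
  have 1: "?R (\<lambda>x. \<Sum>k<N. c k * D_coeff A b d j k n x)" for c
    by (rule regular_sum) (simp, rule D_coeff_regular(1)[OF A b])
  have 2: "?R (\<lambda>x. \<Sum>k<N. c k * D0_coeff A b d k n x)" for c
    by (rule regular_sum) (simp, rule D_coeff_regular(2)[OF A b])
  show "A_coeff A b d N j m n \<in> borel_measurable (lebesgue_on (cube A))"
    unfolding A_coeff_def[abs_def] by (rule conjunct1[OF 1])
  show "A0_coeff A b d N m n \<in> borel_measurable (lebesgue_on (cube A))"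
    unfolding A0_coeff_def[abs_def] by (rule conjunct1[OF 2])
  show "\<exists>B. \<forall>x\<in>cube A. \<bar>A_coeff A b d N j m n x\<bar> \<le> B"
    unfolding A_coeff_def by (rule conjunct2[OF 1])
  show "\<exists>B. \<forall>x\<in>cube A. \<bar>A0_coeff A b d N m n x\<bar> \<le> B"
    unfolding A0_coeff_def by (rule conjunct2[OF 2])
qed

lemma coefficient_bound:
  assumes A: "A > 0" and b: "b > 0"
  obtains B where "B \<ge> 0" "\<And>j m n x. m < N \<Longrightarrow> n < N \<Longrightarrow> x \<in> cube A \<Longrightarrow> \<bar>A_coeff A b d N j m n x\<bar> \<le> B"
    "\<And>m n x. m < N \<Longrightarrow> n < N \<Longrightarrow> x \<in> cube A \<Longrightarrow> \<bar>A0_coeff A b d N m n x\<bar> \<le> B"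
proof -
  obtain B1 where B1: "\<And>j m n x. x \<in> cube A \<Longrightarrow> \<bar>A_coeff A b d N j m n x\<bar> \<le> B1 j m n"
    using A_coeff_regular(3)[OF A b] by metis
  obtain B2 where B2: "\<And>m n x. x \<in> cube A \<Longrightarrow> \<bar>A0_coeff A b d N m n x\<bar> \<le> B2 m n"
    using A_coeff_regular(4)[OF A b] by metis
  define B where "B = (\<Sum>j\<in>UNIV. \<Sum>m<N. \<Sum>n<N. \<bar>B1 j m n\<bar>) + (\<Sum>m<N. \<Sum>n<N. \<bar>B2 m n\<bar>)"
  have s1: "\<bar>B1 j m n\<bar> \<le> (\<Sum>j\<in>UNIV. \<Sum>m<N. \<Sum>n<N. \<bar>B1 j m n\<bar>)" if "m < N" "n < N" for j m n
  proof -
    have "\<bar>B1 j m n\<bar> \<le> (\<Sum>n<N. \<bar>B1 j m n\<bar>)" using that by (intro member_le_sum) auto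
    also have "\<dots> \<le> (\<Sum>m<N. \<Sum>n<N. \<bar>B1 j m n\<bar>)" using that by (intro member_le_sum[of m]) (auto intro: sum_nonneg)
    also have "\<dots> \<le> (\<Sum>j\<in>UNIV. \<Sum>m<N. \<Sum>n<N. \<bar>B1 j m n\<bar>)" by (intro member_le_sum[of j]) (auto intro!: sum_nonneg)
    finally show ?thesis .
  qed
  have s2: "\<bar>B2 m n\<bar> \<le> (\<Sum>m<N. \<Sum>n<N. \<bar>B2 m n\<bar>)" if "m < N" "n < N" for m n
  proof -
    have "\<bar>B2 m n\<bar> \<le> (\<Sum>n<N. \<bar>B2 m n\<bar>)" using that by (intro member_le_sum) auto
    also have "\<dots> \<le> (\<Sum>m<N. \<Sum>n<N. \<bar>B2 m n\<bar>)" using that by (intro member_le_sum[of m]) (auto intro: sum_nonneg)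
    finally show ?thesis .
  qed
  have nn: "(\<Sum>j\<in>UNIV. \<Sum>m<N. \<Sum>n<N. \<bar>B1 j m n\<bar>) \<ge> 0" "(\<Sum>m<N. \<Sum>n<N. \<bar>B2 m n\<bar>) \<ge> 0"
    by (intro sum_nonneg abs_ge_zero)+
  show ?thesis
  proof
    show "B \<ge> 0" unfolding B_def using nn by simp
    show "\<bar>A_coeff A b d N j m n x\<bar> \<le> B" if "m < N" "n < N" "x \<in> cube A" for j m n x
      using B1[OF that(3), of j m n] s1[OF that(1,2), of j] nn unfolding B_def by linarith
    show "\<bar>A0_coeff A b d N m n x\<bar> \<le> B" if "m < N" "n < N" "x \<in> cube A" for m n x
      using B2[OF that(3), of m n] s2[OF that(1,2)] nn unfolding B_def by linarith
  qed
qed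

section \<open>The operator on Sobolev spaces\<close>

abbreviation weakD :: "real \<Rightarrow> (3 \<Rightarrow> nat) \<Rightarrow> (real^3 \<Rightarrow> real) \<Rightarrow> real^3 \<Rightarrow> real" where
  "weakD A \<alpha> u \<equiv> wderiv (cube A) \<alpha> u"

definition laplacian :: "real \<Rightarrow> (real^3 \<Rightarrow> real) \<Rightarrow> real^3 \<Rightarrow> real" where
  "laplacian A u x = (\<Sum>i\<in>UNIV. weakD A (dir2 i) u x)"

definition energy :: "real \<Rightarrow> (real^3 \<Rightarrow> real) \<Rightarrow> real^3 \<Rightarrow> real" where
  "energy A u x = (u x)\<^sup>2 + (\<Sum>j\<in>UNIV. (weakD A (dir j) u x)\<^sup>2)"

definition lower_order :: "real \<Rightarrow> real \<Rightarrow> real \<Rightarrow> nat \<Rightarrow> vfun \<Rightarrow> nat \<Rightarrow> real^3 \<Rightarrow> real" where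
  "lower_order A b d N U m x = (\<Sum>j\<in>UNIV. \<Sum>n<N. A_coeff A b d N j m n x * weakD A (dir j) (U n) x) + (\<Sum>n<N. A0_coeff A b d N m n x * U n x)"

lemma L_op_split: "L_op A b d N U m x = laplacian A (U m) x + lower_order A b d N U m x"
  by (simp add: L_op_def laplacian_def lower_order_def)

lemma energy_nonneg: "energy A u x \<ge> 0"
  by (simp add: energy_def sum_nonneg)

lemma lower_order_bound:
  assumes A: "A > 0" and b: "b > 0"
  obtains C where "C \<ge> 0" "\<And>U m x. m < N \<Longrightarrow> x \<in> cube A \<Longrightarrow> (lower_order A b d N U m x)\<^sup>2 \<le> C * (\<Sum>n<N. energy A (U n) x)"
proof -
  obtain B where B: "B \<ge> 0" "\<And>j m n x. m < N \<Longrightarrow> n < N \<Longrightarrow> x \<in> cube A \<Longrightarrow> \<bar>A_coeff A b d N j m n x\<bar> \<le> B"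
    "\<And>m n x. m < N \<Longrightarrow> n < N \<Longrightarrow> x \<in> cube A \<Longrightarrow> \<bar>A0_coeff A b d N m n x\<bar> \<le> B"
    using coefficient_bound[OF A b] by metis
  show ?thesis
  proof (rule that[of "(real N * (4 * B))\<^sup>2"])
    fix U :: vfun and m x assume m: "m < N" and x: "x \<in> cube A"
    define R where "R = sqrt (\<Sum>n<N. energy A (U n) x)"
    have R0: "R \<ge> 0" "R\<^sup>2 = (\<Sum>n<N. energy A (U n) x)" unfolding R_def by (simp_all add: sum_nonneg energy_nonneg)
    have e: "energy A (U n) x \<le> R\<^sup>2" if "n < N" for n
      unfolding R0(2) using that by (intro member_le_sum) (auto simp: energy_nonneg)
    have t1: "\<bar>weakD A (dir j) (U n) x\<bar> \<le> R" if "n < N" for n j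
    proof -
      have "(weakD A (dir j) (U n) x)\<^sup>2 \<le> (\<Sum>j\<in>UNIV. (weakD A (dir j) (U n) x)\<^sup>2)" by (rule member_le_sum) auto
      then have "(weakD A (dir j) (U n) x)\<^sup>2 \<le> R\<^sup>2" using e[OF that] zero_le_power2[of "U n x"] unfolding energy_def by linarith
      then show ?thesis using R0(1) abs_le_square_iff[of "weakD A (dir j) (U n) x" R] by simp
    qed
    have t2: "\<bar>U n x\<bar> \<le> R" if "n < N" for n
    proof -
      have "0 \<le> (\<Sum>j\<in>UNIV. (weakD A (dir j) (U n) x)\<^sup>2)" by (rule sum_nonneg) simp
      then have "(U n x)\<^sup>2 \<le> R\<^sup>2" using e[OF that] unfolding energy_def by linarith
      then show ?thesis using R0(1) abs_le_square_iff[of "U n x" R] by simp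
    qed
    have s1: "\<bar>\<Sum>n<N. A_coeff A b d N j m n x * weakD A (dir j) (U n) x\<bar> \<le> real N * (B * R)" for j
    proof -
      have "\<bar>\<Sum>n<N. A_coeff A b d N j m n x * weakD A (dir j) (U n) x\<bar> \<le> (\<Sum>n<N. \<bar>A_coeff A b d N j m n x * weakD A (dir j) (U n) x\<bar>)"
        by (rule sum_abs)
      also have "\<dots> \<le> (\<Sum>n<N. B * R)"
        by (rule sum_mono) (simp only: abs_mult, intro mult_mono B t1 m x; simp add: B(1))
      finally show ?thesis by simp
    qed
    have s2: "\<bar>\<Sum>n<N. A0_coeff A b d N m n x * U n x\<bar> \<le> real N * (B * R)"
    proof -
      have "\<bar>\<Sum>n<N. A0_coeff A b d N m n x * U n x\<bar> \<le> (\<Sum>n<N. \<bar>A0_coeff A b d N m n x * U n x\<bar>)"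
        by (rule sum_abs)
      also have "\<dots> \<le> (\<Sum>n<N. B * R)"
        by (rule sum_mono) (simp only: abs_mult, intro mult_mono B t2 m x; simp add: B(1))
      finally show ?thesis by simp
    qed
    have "\<bar>lower_order A b d N U m x\<bar> \<le> real N * (4 * B) * R"
      using s1[of 1] s1[of 2] s1[of 3] s2 unfolding lower_order_def sum_3 by simp
    then have "\<bar>lower_order A b d N U m x\<bar> \<le> \<bar>real N * (4 * B) * R\<bar>" using B(1) R0(1) by simp
    then show "(lower_order A b d N U m x)\<^sup>2 \<le> (real N * (4 * B))\<^sup>2 * (\<Sum>n<N. energy A (U n) x)"
      unfolding abs_le_square_iff R0(2)[symmetric] by (simp add: power_mult_distrib)
  qed simp
qed

lemma in_HN_D: "in_HN N k S U \<Longrightarrow> m < N \<Longrightarrow> in_H k S (U m)"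
  by (simp add: in_HN_def)

lemma weakD_sqi:
  assumes "in_H k (cube A) u"
  shows "square_integrable (lebesgue_on (cube A)) u"
    and "order_of \<alpha> \<le> k \<Longrightarrow> square_integrable (lebesgue_on (cube A)) (weakD A \<alpha> u)"
  using in_H_sqi(1)[OF assms[unfolded cube_box]] in_H_wderiv(2)[OF assms[unfolded cube_box]] by (auto simp: cube_box)

lemma laplacian_sqi: "in_H 2 (cube A) u \<Longrightarrow> square_integrable (lebesgue_on (cube A)) (laplacian A u)"
  unfolding laplacian_def[abs_def] by (intro sqi_sum weakD_sqi(2)) auto

lemma lower_order_sqi:
  assumes A: "A > 0" and b: "b > 0" and U: "in_HN N 1 (cube A) U" and m: "m < N"
  shows "square_integrable (lebesgue_on (cube A)) (lower_order A b d N U m)"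
proof -
  obtain B where B: "B \<ge> 0" "\<And>j m n x. m < N \<Longrightarrow> n < N \<Longrightarrow> x \<in> cube A \<Longrightarrow> \<bar>A_coeff A b d N j m n x\<bar> \<le> B"
    "\<And>m n x. m < N \<Longrightarrow> n < N \<Longrightarrow> x \<in> cube A \<Longrightarrow> \<bar>A0_coeff A b d N m n x\<bar> \<le> B"
    using coefficient_bound[OF A b] by metis
  show ?thesis unfolding lower_order_def[abs_def]
  proof (intro sqi_add sqi_sum)
    fix j n assume "n \<in> {..<N}"
    then show "square_integrable (lebesgue_on (cube A)) (\<lambda>x. A_coeff A b d N j m n x * weakD A (dir j) (U n) x)"
      using B(2)[OF m, of n] by (intro sqi_bounded_mult[of _ _ _ B] weakD_sqi(2)[OF in_HN_D[OF U]] A_coeff_regular(1)[OF A b]) auto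
  next
    fix n assume "n \<in> {..<N}"
    then show "square_integrable (lebesgue_on (cube A)) (\<lambda>x. A0_coeff A b d N m n x * U n x)"
      using B(3)[OF m, of n] by (intro sqi_bounded_mult[of _ _ _ B] weakD_sqi(1)[OF in_HN_D[OF U]] A_coeff_regular(2)[OF A b]) auto
  qed
qed

lemma in_HN_mono: "in_HN N k S U \<Longrightarrow> l \<le> k \<Longrightarrow> in_HN N l S U"
  by (auto simp: in_HN_def intro: in_H_mono)

lemma L_op_sqi:
  assumes "A > 0" "b > 0" "in_HN N 2 (cube A) U" "m < N"
  shows "square_integrable (lebesgue_on (cube A)) (L_op A b d N U m)"
proof -
  have "square_integrable (lebesgue_on (cube A)) (\<lambda>x. laplacian A (U m) x + lower_order A b d N U m x)"
    using assms in_HN_mono[OF assms(3), of 1] by (intro sqi_add laplacian_sqi in_HN_D lower_order_sqi) auto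
  then show ?thesis by (simp add: L_op_split[abs_def])
qed

lemma in_HN_lincomb:
  assumes "in_HN N k (cube A) U" "in_HN N k (cube A) V"
  shows "in_HN N k (cube A) (\<lambda>n x. c * U n x + d * V n x)"
  using assms in_H_lincomb unfolding in_HN_def cube_box by blast

lemma L_op_lincomb:
  assumes U: "in_HN N 2 (cube A) U" and V: "in_HN N 2 (cube A) V" and m: "m < N"
  shows "AE x in lebesgue_on (cube A). L_op A b d N (\<lambda>n x. c * U n x + e * V n x) m x = c * L_op A b d N U m x + e * L_op A b d N V m x"
proof -
  have w: "AE x in lebesgue_on (cube A). weakD A \<alpha> (\<lambda>x. c * U n x + e * V n x) x = c * weakD A \<alpha> (U n) x + e * weakD A \<alpha> (V n) x"
    if "n < N" "order_of \<alpha> \<le> 2" for n \<alpha>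
    unfolding cube_box
    by (rule wderiv_lincomb[OF in_HN_D[OF U[unfolded cube_box] that(1)] in_HN_D[OF V[unfolded cube_box] that(1)] that(2)])
  have "AE x in lebesgue_on (cube A). \<forall>i. weakD A (dir2 i) (\<lambda>x. c * U m x + e * V m x) x = c * weakD A (dir2 i) (U m) x + e * weakD A (dir2 i) (V m) x"
    unfolding AE_all_countable using w[OF m] by simp
  moreover have "AE x in lebesgue_on (cube A). \<forall>n\<in>{..<N}. \<forall>j. weakD A (dir j) (\<lambda>x. c * U n x + e * V n x) x = c * weakD A (dir j) (U n) x + e * weakD A (dir j) (V n) x"
    by (rule AE_finite_allI) (simp, unfold AE_all_countable, use w in simp)
  ultimately show ?thesis
  proof eventually_elim
    case (elim x)
    then show ?case
      by (simp add: L_op_def sum.distrib sum_distrib_left algebra_simps)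
  qed
qed

section \<open>Norms of vector functions\<close>

lemma normHN_sq: "(normHN N k S U)\<^sup>2 = (\<Sum>m<N. (normH k S (U m))\<^sup>2)"
  unfolding normHN_def by (intro real_sqrt_pow2 sum_nonneg) simp

lemma normHN_nonneg: "normHN N k S U \<ge> 0"
  by (simp add: normHN_def sum_nonneg)

lemma wderiv_le_normHN:
  assumes "m < N" "order_of \<alpha> \<le> k"
  shows "(LINT x|lebesgue_on S. (wderiv S \<alpha> (U m) x)\<^sup>2) \<le> (normHN N k S U)\<^sup>2"
proof -
  have "(normH k S (U m))\<^sup>2 \<le> (\<Sum>m<N. (normH k S (U m))\<^sup>2)" using assms(1) by (intro member_le_sum) auto
  then show ?thesis using wderiv_le_normH[OF assms(2), of S "U m"] by (simp add: normHN_sq)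
qed

lemma value_le_normHN:
  assumes "in_HN N k (cube A) U" "m < N"
  shows "(LINT x|lebesgue_on (cube A). (U m x)\<^sup>2) \<le> (normHN N k (cube A) U)\<^sup>2"
proof -
  note u = in_HN_D[OF assms, unfolded cube_box]
  have "(LINT x|lebesgue_on (cube A). (weakD A (\<lambda>_. 0) (U m) x)\<^sup>2) = (LINT x|lebesgue_on (cube A). (U m x)\<^sup>2)"
    unfolding cube_box
    by (rule wderiv_integral_eq[OF wd_zero_order[OF sqi_locally_integrable] in_H_sqi(1)]) (rule in_H_sqi(1)[OF u] u)+
  then show ?thesis using wderiv_le_normHN[OF assms(2), of "\<lambda>_. 0" k "cube A" U] by simp
qed

lemma normHN_add_sq:
  assumes "in_HN N k (box a b) U" "in_HN N k (box a b) V"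
  shows "(normHN N k (box a b) (\<lambda>m x. c * U m x + d * V m x))\<^sup>2 \<le>
    2 * c\<^sup>2 * (normHN N k (box a b) U)\<^sup>2 + 2 * d\<^sup>2 * (normHN N k (box a b) V)\<^sup>2"
proof -
  let ?M = "lebesgue_on (box a b)"
  have "(LINT x|?M. (wderiv (box a b) \<alpha> (\<lambda>x. c * U m x + d * V m x) x)\<^sup>2) \<le>
      2 * c\<^sup>2 * (LINT x|?M. (wderiv (box a b) \<alpha> (U m) x)\<^sup>2) + 2 * d\<^sup>2 * (LINT x|?M. (wderiv (box a b) \<alpha> (V m) x)\<^sup>2)"
    if m: "m < N" and \<alpha>: "order_of \<alpha> \<le> k" for m \<alpha>
  proof -
    note u = in_HN_D[OF assms(1) m] and v = in_HN_D[OF assms(2) m]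
    note s = sqi_cmult[OF in_H_wderiv(2)[OF u \<alpha>], of c] sqi_cmult[OF in_H_wderiv(2)[OF v \<alpha>], of d]
    have "(LINT x|?M. (wderiv (box a b) \<alpha> (\<lambda>x. c * U m x + d * V m x) x)\<^sup>2) =
      (LINT x|?M. (c * wderiv (box a b) \<alpha> (U m) x + d * wderiv (box a b) \<alpha> (V m) x)\<^sup>2)"
      by (rule wderiv_integral_eq[OF wd_lincomb sqi_add[OF s]]) (rule in_H_wderiv(1)[OF u \<alpha>] in_H_wderiv(1)[OF v \<alpha>])+
    also have "\<dots> \<le> 2 * (LINT x|?M. (c * wderiv (box a b) \<alpha> (U m) x)\<^sup>2) + 2 * (LINT x|?M. (d * wderiv (box a b) \<alpha> (V m) x)\<^sup>2)"
      by (rule sqi_norm_add[OF s])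
    finally show ?thesis by (simp add: power_mult_distrib)
  qed
  then have "(\<Sum>m<N. \<Sum>\<alpha> | order_of \<alpha> \<le> k. LINT x|?M. (wderiv (box a b) \<alpha> (\<lambda>x. c * U m x + d * V m x) x)\<^sup>2) \<le>
    (\<Sum>m<N. \<Sum>\<alpha> | order_of \<alpha> \<le> k. 2 * c\<^sup>2 * (LINT x|?M. (wderiv (box a b) \<alpha> (U m) x)\<^sup>2) + 2 * d\<^sup>2 * (LINT x|?M. (wderiv (box a b) \<alpha> (V m) x)\<^sup>2))"
    by (intro sum_mono) auto
  then show ?thesis by (simp add: normHN_sq normH_sq sum.distrib sum_distrib_left)
qed

lemma subcube_sub: "subcube A \<epsilon> \<subseteq> cube A" by (auto simp: subcube_def)

lemma sets_subcube: "\<epsilon> \<ge> 0 \<Longrightarrow> subcube A \<epsilon> \<in> sets lebesgue" by (simp add: subcube_box)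

text \<open>The norm on the subcube is defined by weak derivatives on the subcube; these are the restrictions
  of the weak derivatives on the cube.\<close>

lemma normHN_subcube_sq:
  assumes \<epsilon>: "\<epsilon> \<ge> 0" and U: "in_HN N k (cube A) U"
  shows "(normHN N k (subcube A \<epsilon>) U)\<^sup>2 = (\<Sum>m<N. \<Sum>\<alpha> | order_of \<alpha> \<le> k. LINT x|lebesgue_on (subcube A \<epsilon>). (weakD A \<alpha> (U m) x)\<^sup>2)"
  unfolding normHN_sq normH_sq
proof (intro sum.cong refl)
  fix m \<alpha> assume "m \<in> {..<N}" "\<alpha> \<in> {\<alpha>. order_of \<alpha> \<le> k}"
  then have m: "in_H k (cube A) (U m)" "order_of \<alpha> \<le> k" using U by (auto intro: in_HN_D)
  have "has_weak_derivative (subcube A \<epsilon>) \<alpha> (U m) (weakD A \<alpha> (U m))"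
    using in_H_wderiv(1)[OF m(1)[unfolded cube_box] m(2)]
    by (intro wd_subset[OF _ subcube_sub sets_subcube[OF \<epsilon>] sets_cube]) (simp add: cube_box)
  moreover have "square_integrable (lebesgue_on (subcube A \<epsilon>)) (weakD A \<alpha> (U m))"
    by (rule sqi_subset(1)[OF weakD_sqi(2)[OF m] subcube_sub sets_subcube[OF \<epsilon>] sets_cube])
  ultimately show "(LINT x|lebesgue_on (subcube A \<epsilon>). (wderiv (subcube A \<epsilon>) \<alpha> (U m) x)\<^sup>2) = (LINT x|lebesgue_on (subcube A \<epsilon>). (weakD A \<alpha> (U m) x)\<^sup>2)"
    unfolding subcube_box[OF \<epsilon>] by (rule wderiv_integral_eq)
qed

lemma in_HN_subcube:
  assumes \<epsilon>: "\<epsilon> \<ge> 0" and U: "in_HN N k (cube A) U"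
  shows "in_HN N k (subcube A \<epsilon>) U"
  unfolding in_HN_def in_H_def
proof (intro allI impI)
  fix m \<alpha> assume "m < N" "order_of \<alpha> \<le> k"
  note m = in_HN_D[OF U this(1)] this(2)
  have "has_weak_derivative (subcube A \<epsilon>) \<alpha> (U m) (weakD A \<alpha> (U m))"
    using in_H_wderiv(1)[OF m(1)[unfolded cube_box] m(2)]
    by (intro wd_subset[OF _ subcube_sub sets_subcube[OF \<epsilon>] sets_cube]) (simp add: cube_box)
  moreover have "square_integrable (lebesgue_on (subcube A \<epsilon>)) (weakD A \<alpha> (U m))"
    by (rule sqi_subset(1)[OF weakD_sqi(2)[OF m] subcube_sub sets_subcube[OF \<epsilon>] sets_cube])
  ultimately show "\<exists>v. has_weak_derivative (subcube A \<epsilon>) \<alpha> (U m) v \<and> square_integrable (lebesgue_on (subcube A \<epsilon>)) v" by blast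
qed

lemma normHN_subcube_le:
  assumes \<epsilon>: "\<epsilon> \<ge> 0" and U: "in_HN N k (cube A) U"
  shows "(normHN N k (subcube A \<epsilon>) U)\<^sup>2 \<le> (normHN N k (cube A) U)\<^sup>2"
  unfolding normHN_subcube_sq[OF assms] normHN_sq[of N k "cube A"] normH_sq
  by (intro sum_mono sqi_subset(2)[OF weakD_sqi(2)[OF in_HN_D[OF U]] subcube_sub sets_subcube[OF \<epsilon>] sets_cube]) auto

lemma energy_integrable: "in_H 1 (cube A) u \<Longrightarrow> integrable (lebesgue_on (cube A)) (energy A u)"
  unfolding energy_def[abs_def]
  by (intro Bochner_Integration.integrable_add Bochner_Integration.integrable_sum sqi_integrable weakD_sqi) auto

lemma energy_integral_le:
  assumes U: "in_HN N k (cube A) U" and k: "k \<ge> 1" and m: "m < N"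
  shows "(LINT x|lebesgue_on (cube A). energy A (U m) x) \<le> 4 * (normHN N k (cube A) U)\<^sup>2"
proof -
  let ?M = "lebesgue_on (cube A)"
  note u = in_HN_D[OF U m]
  have "(LINT x|?M. energy A (U m) x) = (LINT x|?M. (U m x)\<^sup>2) + (\<Sum>j\<in>UNIV. LINT x|?M. (weakD A (dir j) (U m) x)\<^sup>2)"
    unfolding energy_def using k by (simp add: sqi_integrable weakD_sqi[OF u])
  also have "\<dots> \<le> (normHN N k (cube A) U)\<^sup>2 + (\<Sum>j\<in>(UNIV::3 set). (normHN N k (cube A) U)\<^sup>2)"
    using k by (intro add_mono sum_mono value_le_normHN[OF U m] wderiv_le_normHN[OF m]) simp
  finally show ?thesis by simp
qed

lemma laplacian_integral_le:
  assumes U: "in_HN N k (cube A) U" and k: "k \<ge> 2" and m: "m < N"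
  shows "(LINT x|lebesgue_on (cube A). (laplacian A (U m) x)\<^sup>2) \<le> 9 * (normHN N k (cube A) U)\<^sup>2"
proof -
  let ?M = "lebesgue_on (cube A)"
  note u = in_HN_D[OF U m]
  have i: "integrable ?M (\<lambda>x. (weakD A (dir2 i) (U m) x)\<^sup>2)" for i using k by (intro sqi_integrable weakD_sqi(2)[OF u]) simp
  have u2: "in_H 2 (cube A) (U m)" by (rule in_H_mono[OF u k])
  have "(LINT x|?M. (laplacian A (U m) x)\<^sup>2) \<le> (LINT x|?M. 3 * (\<Sum>i\<in>UNIV. (weakD A (dir2 i) (U m) x)\<^sup>2))"
  proof (rule integral_mono)
    show "integrable ?M (\<lambda>x. (laplacian A (U m) x)\<^sup>2)" by (rule sqi_integrable[OF laplacian_sqi[OF u2]])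
    show "integrable ?M (\<lambda>x. 3 * (\<Sum>i\<in>UNIV. (weakD A (dir2 i) (U m) x)\<^sup>2))" using i by simp
    have "(p + q + r)\<^sup>2 \<le> 3 * (p\<^sup>2 + q\<^sup>2 + r\<^sup>2)" for p q r :: real
      using zero_le_power2[of "p - q"] zero_le_power2[of "q - r"] zero_le_power2[of "p - r"]
      by (simp add: power2_eq_square algebra_simps)
    then show "(laplacian A (U m) x)\<^sup>2 \<le> 3 * (\<Sum>i\<in>UNIV. (weakD A (dir2 i) (U m) x)\<^sup>2)" for x
      unfolding laplacian_def sum_3 .
  qed
  also have "\<dots> = 3 * (\<Sum>i\<in>UNIV. LINT x|?M. (weakD A (dir2 i) (U m) x)\<^sup>2)" using i by simp
  also have "\<dots> \<le> 3 * (\<Sum>i\<in>(UNIV::3 set). (normHN N k (cube A) U)\<^sup>2)"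
    using k by (intro mult_left_mono sum_mono wderiv_le_normHN[OF m]) auto
  finally show ?thesis by simp
qed

lemma L_op_integral_bound:
  assumes A: "A > 0" and b: "b > 0"
  obtains C where "C \<ge> 0" "\<And>U m. in_HN N 2 (cube A) U \<Longrightarrow> m < N \<Longrightarrow>
    (LINT x|lebesgue_on (cube A). (L_op A b d N U m x)\<^sup>2) \<le> C * (normHN N 2 (cube A) U)\<^sup>2"
proof -
  obtain C where C: "C \<ge> 0" "\<And>U m x. m < N \<Longrightarrow> x \<in> cube A \<Longrightarrow> (lower_order A b d N U m x)\<^sup>2 \<le> C * (\<Sum>n<N. energy A (U n) x)"
    using lower_order_bound[OF A b] by metis
  show ?thesis
  proof (rule that[of "18 + 8 * C * real N"])
    show "0 \<le> 18 + 8 * C * real N" using C(1) by simp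
    fix U m assume U: "in_HN N 2 (cube A) U" and m: "m < N"
    let ?M = "lebesgue_on (cube A)" and ?Y = "(normHN N 2 (cube A) U)\<^sup>2"
    have U1: "in_HN N 1 (cube A) U" using U by (rule in_HN_mono) simp
    have ei: "integrable ?M (\<lambda>x. C * (\<Sum>n<N. energy A (U n) x))"
      using energy_integrable[OF in_HN_D[OF U1]] by (intro integrable_mult_right Bochner_Integration.integrable_sum) auto
    have "(LINT x|?M. (lower_order A b d N U m x)\<^sup>2) \<le> (LINT x|?M. C * (\<Sum>n<N. energy A (U n) x))"
      by (rule integral_mono[OF sqi_integrable[OF lower_order_sqi[OF A b U1 m]] ei]) (simp add: C(2)[OF m])
    also have "\<dots> = C * (\<Sum>n<N. LINT x|?M. energy A (U n) x)"
      using energy_integrable[OF in_HN_D[OF U1]] by simp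
    also have "\<dots> \<le> C * (\<Sum>n<N. 4 * ?Y)"
      using C(1) energy_integral_le[OF U] by (intro mult_left_mono sum_mono) auto
    finally have low: "(LINT x|?M. (lower_order A b d N U m x)\<^sup>2) \<le> 4 * C * real N * ?Y" by (simp add: mult_ac)
    have "(LINT x|?M. (L_op A b d N U m x)\<^sup>2) \<le> 2 * (LINT x|?M. (laplacian A (U m) x)\<^sup>2) + 2 * (LINT x|?M. (lower_order A b d N U m x)\<^sup>2)"
      unfolding L_op_split by (rule sqi_norm_add[OF laplacian_sqi[OF in_HN_D[OF U m]] lower_order_sqi[OF A b U1 m]])
    also have "\<dots> \<le> (18 + 8 * C * real N) * ?Y"
      using low laplacian_integral_le[OF U order_refl m] by (simp add: distrib_right)
    finally show "(LINT x|?M. (L_op A b d N U m x)\<^sup>2) \<le> (18 + 8 * C * real N) * ?Y" .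
  qed
qed

section \<open>The Carleman estimate for the system\<close>

text \<open>The quantities \<open>|\<nabla>u|\<^sup>2 + u\<^sup>2\<close> and \<open>\<Delta>u\<close> for \<open>u = (A - z)\<^sup>2 q\<close>, by the product rule.\<close>

definition top_energy :: "real \<Rightarrow> (real^3 \<Rightarrow> real) \<Rightarrow> real^3 \<Rightarrow> real" where
  "top_energy A q x = (top_factor A x * weakD A (dir 1) q x)\<^sup>2 + (top_factor A x * weakD A (dir 2) q x)\<^sup>2 +
    (top_factor A x * weakD A (dir 3) q x - 2 * (A - x $ 3) * q x)\<^sup>2 + (top_factor A x * q x)\<^sup>2"

definition top_laplacian :: "real \<Rightarrow> (real^3 \<Rightarrow> real) \<Rightarrow> real^3 \<Rightarrow> real" where
  "top_laplacian A q x = top_factor A x * laplacian A q x - 4 * (A - x $ 3) * weakD A (dir 3) q x + 2 * q x"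

lemma top_energy_nonneg: "top_energy A q x \<ge> 0"
  by (simp add: top_energy_def)

lemma carleman_estimate_component:
  assumes A: "A > 0" and q: "in_H30bsc A q" and l: "l \<ge> 1" "l \<ge> 1 / A\<^sup>2"
  shows "integrable (lebesgue_on (cube A)) (\<lambda>x. carleman_weight A l x * (top_laplacian A q x)\<^sup>2)"
    and "integrable (lebesgue_on (cube A)) (\<lambda>x. carleman_weight A l x * top_energy A q x)"
    and "l * (LINT x|lebesgue_on (cube A). carleman_weight A l x * top_energy A q x)
      \<le> (3 + 1 / (8 * A\<^sup>2)) * (LINT x|lebesgue_on (cube A). carleman_weight A l x * (top_laplacian A q x)\<^sup>2)"
proof -
  let ?M = "lebesgue_on (cube A)"
  let ?h = "\<lambda>i. weakD A (dir i) (weakD A (dir i) q)"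
  let ?D = "\<lambda>x. top_factor A x * ?h 1 x + top_factor A x * ?h 2 x + (top_factor A x * ?h 3 x - 4 * (A - x $ 3) * weakD A (dir 3) q x + 2 * q x)"
  note C = carleman_estimate[OF A q l]
  have q3: "in_H 3 (box (cube_lower A) (cube_upper A 0)) q" using in_H30bsc_facts(1)[OF A q] by (simp add: cube_box)
  have h: "AE x in ?M. ?h i x = weakD A (dir2 i) q x" for i
  proof -
    have e: "(\<lambda>j. dir i j + dir i j) = dir2 i" by (auto simp: dir_def dir2_def)
    have o: "order_of (dir i) + order_of (dir i) \<le> 3" by simp
    show ?thesis unfolding cube_box by (rule wderiv_AE_eq[OF in_H_wderiv_wd[OF q3 o, unfolded e]])
  qed
  have ae: "AE x in ?M. ?D x = top_laplacian A q x"
    using h[of 1] h[of 2] h[of 3]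
    by eventually_elim (simp add: top_laplacian_def laplacian_def sum_3 algebra_simps)
  have ae2: "AE x in ?M. carleman_weight A l x * (?D x)\<^sup>2 = carleman_weight A l x * (top_laplacian A q x)\<^sup>2"
    using ae by eventually_elim simp
  have m1: "(\<lambda>x. carleman_weight A l x * (?D x)\<^sup>2) \<in> borel_measurable ?M" using C(1) by auto
  have m2: "(\<lambda>x. carleman_weight A l x * (top_laplacian A q x)\<^sup>2) \<in> borel_measurable ?M"
    by (rule AE_eq_measurable_lebesgue_on[OF sets_cube ae2 m1])
  show "integrable ?M (\<lambda>x. carleman_weight A l x * (top_laplacian A q x)\<^sup>2)"
    using C(1) integrable_cong_AE[OF m1 m2 ae2] by simp
  show "integrable ?M (\<lambda>x. carleman_weight A l x * top_energy A q x)"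
    using C(2) by (simp add: top_energy_def)
  show "l * (LINT x|?M. carleman_weight A l x * top_energy A q x)
      \<le> (3 + 1 / (8 * A\<^sup>2)) * (LINT x|?M. carleman_weight A l x * (top_laplacian A q x)\<^sup>2)"
    using C(3) unfolding integral_cong_AE[OF m1 m2 ae2, symmetric] top_energy_def .
qed

lemma carleman_weight_bounds:
  assumes A: "A > 0" and l: "l \<ge> 0" and x: "x \<in> cube A"
  shows "carleman_weight A l x \<le> exp (l * (5 * A\<^sup>2))"
    and "r \<le> A \<Longrightarrow> x $ 3 \<ge> r \<Longrightarrow> carleman_weight A l x \<le> exp (l * (r\<^sup>2 - 4 * A * r))"
    and "r \<le> A \<Longrightarrow> x $ 3 \<le> r \<Longrightarrow> exp (l * (r\<^sup>2 - 4 * A * r)) \<le> carleman_weight A l x"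
proof -
  let ?t = "x $ 3"
  have t: "- A < ?t" "?t < A" using x by (auto simp: cube_def)
  have dec: "v\<^sup>2 - 4 * A * v \<le> u\<^sup>2 - 4 * A * u" if "u \<le> v" "v \<le> A" "u \<le> A" for u v
  proof -
    have "(v - u) * (u + v - 4 * A) \<le> 0" using that A by (intro mult_nonneg_nonpos) auto
    then show ?thesis by (simp add: power2_eq_square algebra_simps)
  qed
  show "carleman_weight A l x \<le> exp (l * (5 * A\<^sup>2))"
    unfolding carleman_weight_def using dec[of "- A" ?t] t l A
    by (simp, intro mult_left_mono) (simp_all add: power2_eq_square)
  show "carleman_weight A l x \<le> exp (l * (r\<^sup>2 - 4 * A * r))" if "r \<le> A" "?t \<ge> r"
    unfolding carleman_weight_def using dec[of r ?t] t that l by (simp add: mult_left_mono)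
  show "exp (l * (r\<^sup>2 - 4 * A * r)) \<le> carleman_weight A l x" if "r \<le> A" "?t \<le> r"
    unfolding carleman_weight_def using dec[of ?t r] t that l by (simp add: mult_left_mono)
qed

lemma top_laplacian_sq_le:
  fixes q :: "real^3 \<Rightarrow> real"
  assumes A: "A > 0" and x: "x \<in> cube A"
  shows "(top_laplacian A q x)\<^sup>2 \<le> (48 * A ^ 4 + 192 * A\<^sup>2 + 12) * ((laplacian A q x)\<^sup>2 + energy A q x)"
proof -
  define z where "z = A - x $ 3"
  have "- A < x $ 3" "x $ 3 < A" using x by (auto simp: cube_def)
  then have z: "0 < z" "z < 2 * A" by (simp_all add: z_def)
  let ?L = "laplacian A q x" and ?g = "weakD A (dir 3) q x" and ?q = "q x"
  have three: "(s + t + r)\<^sup>2 \<le> 3 * (s\<^sup>2 + t\<^sup>2 + r\<^sup>2)" for s t r :: real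
    using zero_le_power2[of "s - t"] zero_le_power2[of "t - r"] zero_le_power2[of "s - r"]
    by (simp add: power2_eq_square algebra_simps)
  have e: "?g\<^sup>2 \<le> energy A q x" "?q\<^sup>2 \<le> energy A q x"
  proof -
    have "?g\<^sup>2 \<le> (\<Sum>j\<in>UNIV. (weakD A (dir j) q x)\<^sup>2)" by (rule member_le_sum) auto
    then show "?g\<^sup>2 \<le> energy A q x" unfolding energy_def using zero_le_power2[of ?q] by linarith
    have "0 \<le> (\<Sum>j\<in>UNIV. (weakD A (dir j) q x)\<^sup>2)" by (rule sum_nonneg) simp
    then show "?q\<^sup>2 \<le> energy A q x" unfolding energy_def by linarith
  qed
  have z2: "z\<^sup>2 \<le> 4 * A\<^sup>2" using z power_mono[of z "2 * A" 2] by (simp add: power_mult_distrib)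
  have z4: "z ^ 4 \<le> 16 * A ^ 4" using z power_mono[of z "2 * A" 4] by (simp add: power_mult_distrib)
  have "(top_laplacian A q x)\<^sup>2 = (z\<^sup>2 * ?L + (- 4 * z * ?g) + 2 * ?q)\<^sup>2"
    unfolding top_laplacian_def top_factor_def z_def[symmetric] by simp
  also have "\<dots> \<le> 3 * ((z\<^sup>2 * ?L)\<^sup>2 + (- 4 * z * ?g)\<^sup>2 + (2 * ?q)\<^sup>2)" by (rule three)
  also have "\<dots> = 3 * z ^ 4 * ?L\<^sup>2 + 48 * z\<^sup>2 * ?g\<^sup>2 + 12 * ?q\<^sup>2"
    by (simp add: power_mult_distrib power_mult[symmetric])
  also have "\<dots> \<le> 48 * A ^ 4 * ?L\<^sup>2 + 192 * A\<^sup>2 * energy A q x + 12 * energy A q x"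
  proof (intro add_mono)
    show "3 * z ^ 4 * ?L\<^sup>2 \<le> 48 * A ^ 4 * ?L\<^sup>2" using z4 by (intro mult_right_mono) auto
    have "48 * z\<^sup>2 * ?g\<^sup>2 \<le> 192 * A\<^sup>2 * ?g\<^sup>2" using z2 by (intro mult_right_mono) auto
    also have "\<dots> \<le> 192 * A\<^sup>2 * energy A q x" by (intro mult_left_mono e) auto
    finally show "48 * z\<^sup>2 * ?g\<^sup>2 \<le> 192 * A\<^sup>2 * energy A q x" .
  qed (use e in simp)
  also have "\<dots> \<le> (48 * A ^ 4 + 192 * A\<^sup>2 + 12) * (?L\<^sup>2 + energy A q x)"
    using energy_nonneg[of A q x] by (simp add: algebra_simps)
  finally show ?thesis .
qed

text \<open>Away from the top face the factor \<open>(A - z)\<^sup>2\<close> can be divided out.\<close>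

lemma energy_le_top_energy:
  assumes \<epsilon>: "\<epsilon> > 0" and x: "x $ 3 < A - \<epsilon>"
  shows "energy A q x \<le> (3 / \<epsilon> ^ 4 + 8 / \<epsilon> ^ 6) * top_energy A q x"
proof -
  define z where "z = A - x $ 3"
  have z: "z > \<epsilon>" using x by (simp add: z_def)
  define a where "a = weakD A (dir 1) q x" define b where "b = weakD A (dir 2) q x"
  define g where "g = weakD A (dir 3) q x" define y where "y = q x"
  define v where "v = z\<^sup>2 * g - 2 * z * y"
  let ?T = "top_energy A q x"
  have T: "?T = (z\<^sup>2 * a)\<^sup>2 + (z\<^sup>2 * b)\<^sup>2 + v\<^sup>2 + (z\<^sup>2 * y)\<^sup>2"
    by (simp add: top_energy_def top_factor_def z_def a_def b_def g_def y_def v_def)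
  have z4: "\<epsilon> ^ 4 \<le> z ^ 4" and z2: "\<epsilon>\<^sup>2 \<le> z\<^sup>2" using z \<epsilon> by (auto intro!: power_mono)
  have sc: "\<epsilon> ^ 4 * p\<^sup>2 \<le> (z\<^sup>2 * p)\<^sup>2" for p
    using mult_right_mono[OF z4, of "p\<^sup>2"] by (simp add: power_mult_distrib power_mult[symmetric])
  have "\<epsilon> ^ 4 * (a\<^sup>2 + b\<^sup>2 + y\<^sup>2) + v\<^sup>2 \<le> ?T"
    unfolding T distrib_left using sc[of a] sc[of b] sc[of y] by linarith
  moreover have "\<epsilon> ^ 4 * g\<^sup>2 \<le> 2 * v\<^sup>2 + 8 * (z * y)\<^sup>2"
  proof -
    have "\<epsilon> ^ 4 * g\<^sup>2 \<le> (z\<^sup>2 * g)\<^sup>2" by (rule sc)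
    also have "z\<^sup>2 * g = v + 2 * z * y" by (simp add: v_def)
    also have "(v + 2 * z * y)\<^sup>2 \<le> 2 * v\<^sup>2 + 2 * (2 * z * y)\<^sup>2"
      using sum_squares_bound[of v "2 * z * y"] by (simp add: power2_sum)
    finally show ?thesis by (simp add: power_mult_distrib)
  qed
  moreover have "\<epsilon>\<^sup>2 * (z * y)\<^sup>2 \<le> ?T"
  proof -
    have "\<epsilon>\<^sup>2 * (z * y)\<^sup>2 \<le> z\<^sup>2 * (z * y)\<^sup>2" by (intro mult_right_mono z2) simp
    also have "\<dots> = (z\<^sup>2 * y)\<^sup>2" by (simp add: power2_eq_square)
    also have "\<dots> \<le> ?T" unfolding T by simp
    finally show ?thesis .
  qed
  then have "(z * y)\<^sup>2 \<le> ?T / \<epsilon>\<^sup>2" using \<epsilon> by (simp add: field_simps)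
  moreover have "v\<^sup>2 \<le> ?T" unfolding T by simp
  moreover have "0 \<le> v\<^sup>2" by simp
  moreover define u where "u = ?T / \<epsilon>\<^sup>2"
  moreover have "\<epsilon> ^ 4 * (a\<^sup>2 + b\<^sup>2 + g\<^sup>2 + y\<^sup>2) = \<epsilon> ^ 4 * (a\<^sup>2 + b\<^sup>2 + y\<^sup>2) + \<epsilon> ^ 4 * g\<^sup>2"
    by (simp add: distrib_left)
  ultimately have "\<epsilon> ^ 4 * (a\<^sup>2 + b\<^sup>2 + g\<^sup>2 + y\<^sup>2) \<le> 3 * ?T + 8 * u"
    by linarith
  moreover have "\<epsilon> ^ 4 * ((3 / \<epsilon> ^ 4 + 8 / \<epsilon> ^ 6) * ?T) = 3 * ?T + 8 * u"
  proof -
    have "\<epsilon> ^ 6 = \<epsilon> ^ 4 * \<epsilon>\<^sup>2" by (simp add: power_add[symmetric])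
    then show ?thesis using \<epsilon> by (simp add: u_def field_simps)
  qed
  moreover have "energy A q x = a\<^sup>2 + b\<^sup>2 + g\<^sup>2 + y\<^sup>2"
    by (simp add: energy_def sum_3 a_def b_def g_def y_def)
  ultimately have "\<epsilon> ^ 4 * energy A q x \<le> \<epsilon> ^ 4 * ((3 / \<epsilon> ^ 4 + 8 / \<epsilon> ^ 6) * ?T)" by simp
  then show ?thesis by (rule mult_left_le_imp_le) (use \<epsilon> in simp)
qed

lemma integral_subset_le:
  fixes f g :: "real^3 \<Rightarrow> real"
  assumes f: "integrable (lebesgue_on S) f" and g: "integrable (lebesgue_on S) g" and T: "T \<subseteq> S" "T \<in> sets lebesgue" "S \<in> sets lebesgue"
    and le: "\<And>x. x \<in> T \<Longrightarrow> f x \<le> g x" and g0: "\<And>x. x \<in> S \<Longrightarrow> 0 \<le> g x"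
  shows "(LINT x|lebesgue_on T. f x) \<le> (LINT x|lebesgue_on S. g x)"
proof -
  have "(LINT x|lebesgue. indicator T x *\<^sub>R f x) \<le> (LINT x|lebesgue. indicator S x *\<^sub>R g x)"
  proof (rule integral_mono)
    show "integrable lebesgue (\<lambda>x. indicator T x *\<^sub>R f x)"
      using integrable_lebesgue_on_subset[OF f T] T by (simp add: integrable_restrict_space)
    show "integrable lebesgue (\<lambda>x. indicator S x *\<^sub>R g x)" using g T by (simp add: integrable_restrict_space)
    show "indicator T x *\<^sub>R f x \<le> indicator S x *\<^sub>R g x" for x
      using le[of x] g0[of x] T(1) by (auto simp: indicator_def)
  qed
  then show ?thesis using T by (simp add: integral_restrict_space)
qed

lemma absorb_half:
  fixes s t u v :: real
  assumes "s \<le> t" "2 * u \<le> t" "t \<le> v + u + w"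
  shows "s \<le> 2 * (v + w)"
  using assms by (simp add: algebra_simps)

text \<open>Let \<open>r\<^sub>1 = A - \<epsilon>\<close> and \<open>r\<^sub>2 = A - 2\<epsilon>\<close>. Below \<open>r\<^sub>1\<close>, the Laplacian of a component is estimated by \<open>L\<close> and
  lower order terms, which are bounded by the energies of all components and absorbed into the left
  side for large \<open>l\<close>. Above \<open>r\<^sub>1\<close>, the weight is at most its value at \<open>r\<^sub>1\<close>, which is exponentially smaller
  than its minimum below \<open>r\<^sub>2\<close>; this yields the decay rate \<open>Q\<close>. The growth rate \<open>P\<close> compares the maximum
  of the weight with that minimum.\<close>

lemma system_carleman:
  assumes A: "A > 0" and b: "b > 0" and \<epsilon>: "0 < \<epsilon>" "\<epsilon> < A"
  obtains C l0 P Q where "C > 0" "l0 > 0" "P > 0" "Q > 0"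
    "\<And>V l. in_H30bscN A N V \<Longrightarrow> l \<ge> l0 \<Longrightarrow>
      (LINT x|lebesgue_on (subcube A (2 * \<epsilon>)). (\<Sum>n<N. energy A (V n) x)) \<le>
      C * (exp (l * P) * (\<Sum>m<N. LINT x|lebesgue_on (cube A). (L_op A b d N V m x)\<^sup>2) + exp (- (l * Q)) * (normHN N 3 (cube A) V)\<^sup>2)"
proof -
  obtain B where B: "B \<ge> 0" "\<And>U m x. m < N \<Longrightarrow> x \<in> cube A \<Longrightarrow> (lower_order A b d N U m x)\<^sup>2 \<le> B * (\<Sum>n<N. energy A (U n) x)"
    by (rule lower_order_bound[OF A b, where N = N and d = d]) blast
  define c1 where "c1 = 3 + 1 / (8 * A\<^sup>2)"
  define c3 where "c3 = 48 * A ^ 4 + 192 * A\<^sup>2 + 12"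
  define K where "K = 3 / \<epsilon> ^ 4 + 8 / \<epsilon> ^ 6"
  define c4 where "c4 = c1 * (real N * (c3 * (2 * B + 1) * K))"
  define r1 where "r1 = A - \<epsilon>" define r2 where "r2 = A - 2 * \<epsilon>"
  define h1 where "h1 = r1\<^sup>2 - 4 * A * r1" define h2 where "h2 = r2\<^sup>2 - 4 * A * r2"
  define P where "P = 5 * A\<^sup>2 - h2" define Q where "Q = h2 - h1"
  define R where "R = real N * (9 + 4 * real N)"
  have pos: "c1 > 0" "c3 > 0" "K > 0" "c4 \<ge> 0" "R \<ge> 0"
    using A \<epsilon> B(1) by (simp_all add: c1_def c3_def K_def c4_def R_def add_pos_nonneg add_nonneg_pos)
  have P: "P > 0"
  proof -
    have "0 < (5 * A - r2) * (A + r2)" using A \<epsilon> unfolding r2_def by (intro mult_pos_pos) auto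
    then show ?thesis by (simp add: P_def h2_def power2_eq_square algebra_simps)
  qed
  have Q: "Q > 0"
  proof -
    have "Q = \<epsilon> * (2 * A + 3 * \<epsilon>)" by (simp add: Q_def h1_def h2_def r1_def r2_def power2_eq_square algebra_simps)
    then show ?thesis using A \<epsilon> by simp
  qed
  show ?thesis
  proof (rule that[of "2 * K * c1 * c3 * (2 + R)" "max 1 (max (1 / A\<^sup>2) (2 * c4))" P Q])
    show "2 * K * c1 * c3 * (2 + R) > 0" using pos by simp
    show "max 1 (max (1 / A\<^sup>2) (2 * c4)) > 0" by simp
    show "P > 0" "Q > 0" by fact+
    fix V :: vfun and l :: real
    assume V: "in_H30bscN A N V" and "l \<ge> max 1 (max (1 / A\<^sup>2) (2 * c4))"
    then have l: "l \<ge> 1" "l \<ge> 1 / A\<^sup>2" "l \<ge> 2 * c4" by auto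
    let ?M = "lebesgue_on (cube A)" and ?E = "carleman_weight A l"
    have V': "in_H30bsc A (V m)" if "m < N" for m using V that by (simp add: in_H30bscN_def)
    have V3: "in_HN N 3 (cube A) V" using V' by (simp add: in_HN_def in_H30bsc_def)
    have V2: "in_HN N 2 (cube A) V" and V1: "in_HN N 1 (cube A) V" using in_HN_mono[OF V3] by auto
    define X where "X m = (LINT x|?M. (L_op A b d N V m x)\<^sup>2)" for m
    define Y where "Y = (normHN N 3 (cube A) V)\<^sup>2"
    define et where "et x = (\<Sum>n<N. energy A (V n) x)" for x
    define S where "S n = (LINT x|?M. ?E x * top_energy A (V n) x)" for n
    have E0: "?E x > 0" for x by (simp add: carleman_weight_def)
    note T = carleman_estimate_component[OF A V' l(1,2)]
    have iet: "integrable ?M et"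
      unfolding et_def by (intro Bochner_Integration.integrable_sum energy_integrable in_HN_D[OF V1]) simp
    have et0: "et x \<ge> 0" for x unfolding et_def by (intro sum_nonneg energy_nonneg)
    have iS: "integrable ?M (\<lambda>x. \<Sum>n<N. ?E x * top_energy A (V n) x)"
      by (intro Bochner_Integration.integrable_sum T(2)) simp
    have good: "et x \<le> K * (\<Sum>n<N. top_energy A (V n) x)" if "x $ 3 < r1" for x
      unfolding et_def sum_distrib_left K_def using that
      by (intro sum_mono energy_le_top_energy[OF \<epsilon>(1)]) (simp add: r1_def)
    have ID: "(LINT x|?M. ?E x * (top_laplacian A (V m) x)\<^sup>2) \<le>
      2 * c3 * exp (l * (5 * A\<^sup>2)) * X m + c3 * (2 * B + 1) * K * (\<Sum>n<N. S n) + c3 * exp (l * h1) * ((9 + 4 * real N) * Y)"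
      if m: "m < N" for m
    proof -
      let ?f = "\<lambda>x. 2 * c3 * exp (l * (5 * A\<^sup>2)) * (L_op A b d N V m x)\<^sup>2 + c3 * (2 * B + 1) * K * (\<Sum>n<N. ?E x * top_energy A (V n) x)
        + c3 * exp (l * h1) * ((laplacian A (V m) x)\<^sup>2 + et x)"
      have iL: "integrable ?M (\<lambda>x. (L_op A b d N V m x)\<^sup>2)" by (rule sqi_integrable[OF L_op_sqi[OF A b V2 m]])
      have iLap: "integrable ?M (\<lambda>x. (laplacian A (V m) x)\<^sup>2)" by (rule sqi_integrable[OF laplacian_sqi[OF in_HN_D[OF V2 m]]])
      have "(LINT x|?M. ?E x * (top_laplacian A (V m) x)\<^sup>2) \<le> (LINT x|?M. ?f x)"
      proof (rule integral_mono[OF T(1)[OF m]])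
        show "integrable ?M ?f" by (intro Bochner_Integration.integrable_add integrable_mult_right iL iS iLap iet)
        fix x assume "x \<in> space ?M"
        then have x: "x \<in> cube A" by simp
        have em: "energy A (V m) x \<le> et x" unfolding et_def using m by (intro member_le_sum) (auto simp: energy_nonneg)
        have "(top_laplacian A (V m) x)\<^sup>2 \<le> c3 * ((laplacian A (V m) x)\<^sup>2 + energy A (V m) x)"
          unfolding c3_def by (rule top_laplacian_sq_le[OF A x])
        also have "\<dots> \<le> c3 * ((laplacian A (V m) x)\<^sup>2 + et x)" using em pos by (intro mult_left_mono) auto
        finally have tl: "(top_laplacian A (V m) x)\<^sup>2 \<le> c3 * ((laplacian A (V m) x)\<^sup>2 + et x)" .
        have nnL: "0 \<le> c3 * exp (l * (5 * A\<^sup>2)) * (L_op A b d N V m x)\<^sup>2" using pos by simp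
        have nnT: "0 \<le> (\<Sum>n<N. ?E x * top_energy A (V n) x)" by (intro sum_nonneg mult_nonneg_nonneg top_energy_nonneg less_imp_le[OF E0])
        show "?E x * (top_laplacian A (V m) x)\<^sup>2 \<le> ?f x"
        proof (cases "x $ 3 < r1")
          case True
          have "(laplacian A (V m) x)\<^sup>2 \<le> 2 * (L_op A b d N V m x)\<^sup>2 + 2 * (lower_order A b d N V m x)\<^sup>2"
          proof -
            have "laplacian A (V m) x = L_op A b d N V m x + - lower_order A b d N V m x" by (simp add: L_op_split)
            then show ?thesis using sum_squares_bound[of "L_op A b d N V m x" "- lower_order A b d N V m x"] by (simp add: power2_sum power2_diff)
          qed
          also have "\<dots> \<le> 2 * (L_op A b d N V m x)\<^sup>2 + 2 * (B * et x)"
            using B(2)[OF m x, of V] by (simp add: et_def)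
          finally have "(laplacian A (V m) x)\<^sup>2 + et x \<le> 2 * (L_op A b d N V m x)\<^sup>2 + (2 * B + 1) * et x"
            by (simp add: distrib_right)
          also have "\<dots> \<le> 2 * (L_op A b d N V m x)\<^sup>2 + (2 * B + 1) * (K * (\<Sum>n<N. top_energy A (V n) x))"
            using good[OF True] B(1) by (intro add_left_mono mult_left_mono) auto
          finally have a: "(top_laplacian A (V m) x)\<^sup>2 \<le> c3 * (2 * (L_op A b d N V m x)\<^sup>2 + (2 * B + 1) * (K * (\<Sum>n<N. top_energy A (V n) x)))"
            using tl pos(2) by (meson less_imp_le mult_left_mono order_trans)
          have "?E x * (top_laplacian A (V m) x)\<^sup>2 \<le> ?E x * (c3 * (2 * (L_op A b d N V m x)\<^sup>2 + (2 * B + 1) * (K * (\<Sum>n<N. top_energy A (V n) x))))"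
            by (rule mult_left_mono[OF a less_imp_le[OF E0]])
          also have "\<dots> = ?E x * (2 * c3 * (L_op A b d N V m x)\<^sup>2) + c3 * (2 * B + 1) * K * (\<Sum>n<N. ?E x * top_energy A (V n) x)"
            unfolding sum_distrib_left[symmetric] by (simp add: algebra_simps)
          also have "\<dots> \<le> exp (l * (5 * A\<^sup>2)) * (2 * c3 * (L_op A b d N V m x)\<^sup>2) + c3 * (2 * B + 1) * K * (\<Sum>n<N. ?E x * top_energy A (V n) x)"
            using carleman_weight_bounds(1)[OF A _ x, of l] l pos by (intro add_right_mono mult_right_mono) auto
          also have "\<dots> \<le> ?f x"
            using pos et0[of x] by (simp add: mult_ac)
          finally show ?thesis .
        next
          case False
          have "?E x * (top_laplacian A (V m) x)\<^sup>2 \<le> exp (l * h1) * (c3 * ((laplacian A (V m) x)\<^sup>2 + et x))"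
            using carleman_weight_bounds(2)[OF A _ x, of l r1] l False \<epsilon> tl
            by (intro mult_mono) (auto simp: h1_def r1_def)
          also have "\<dots> \<le> ?f x" using nnL nnT pos B(1) by (simp add: mult_ac)
          finally show ?thesis .
        qed
      qed
      also have "\<dots> = 2 * c3 * exp (l * (5 * A\<^sup>2)) * X m + c3 * (2 * B + 1) * K * (\<Sum>n<N. S n)
        + c3 * exp (l * h1) * ((LINT x|?M. (laplacian A (V m) x)\<^sup>2) + (LINT x|?M. et x))"
        using iL iS iLap iet T(2) by (simp add: X_def S_def)
      also have "\<dots> \<le> 2 * c3 * exp (l * (5 * A\<^sup>2)) * X m + c3 * (2 * B + 1) * K * (\<Sum>n<N. S n)
        + c3 * exp (l * h1) * ((9 + 4 * real N) * Y)"
      proof -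
        have "(LINT x|?M. et x) = (\<Sum>n<N. LINT x|?M. energy A (V n) x)"
          unfolding et_def using energy_integrable[OF in_HN_D[OF V1]] by simp
        also have "\<dots> \<le> (\<Sum>n<N. 4 * Y)" unfolding Y_def using energy_integral_le[OF V3] by (intro sum_mono) auto
        finally have "(LINT x|?M. (laplacian A (V m) x)\<^sup>2) + (LINT x|?M. et x) \<le> (9 + 4 * real N) * Y"
          using laplacian_integral_le[OF V3 _ m] by (simp add: Y_def algebra_simps)
        then show ?thesis using pos by (intro add_left_mono mult_left_mono) auto
      qed
      finally show ?thesis .
    qed
    define St where "St = (\<Sum>n<N. S n)"
    define Xt where "Xt = (\<Sum>m<N. X m)"
    have St0: "St \<ge> 0" unfolding St_def S_def
      by (intro sum_nonneg integral_nonneg_AE AE_I2 mult_nonneg_nonneg top_energy_nonneg less_imp_le[OF E0])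
    have "l * S m \<le> c1 * (2 * c3 * exp (l * (5 * A\<^sup>2)) * X m + c3 * (2 * B + 1) * K * St + c3 * exp (l * h1) * ((9 + 4 * real N) * Y))" if "m < N" for m
      using T(3)[OF that] mult_left_mono[OF ID[OF that] less_imp_le[OF pos(1)]] unfolding S_def[symmetric] c1_def[symmetric] St_def by linarith
    then have "(\<Sum>m<N. l * S m) \<le> (\<Sum>m<N. c1 * (2 * c3 * exp (l * (5 * A\<^sup>2)) * X m + c3 * (2 * B + 1) * K * St + c3 * exp (l * h1) * ((9 + 4 * real N) * Y)))"
      by (intro sum_mono) simp
    also have "\<dots> = (\<Sum>m<N. c1 * (2 * c3 * exp (l * (5 * A\<^sup>2))) * X m + c1 * (c3 * (2 * B + 1) * K * St + c3 * exp (l * h1) * ((9 + 4 * real N) * Y)))"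
      by (intro sum.cong) (simp_all add: algebra_simps)
    also have "\<dots> = c1 * (2 * c3 * exp (l * (5 * A\<^sup>2))) * Xt + real N * (c1 * (c3 * (2 * B + 1) * K * St + c3 * exp (l * h1) * ((9 + 4 * real N) * Y)))"
      unfolding sum.distrib Xt_def sum_distrib_left[symmetric] by (simp add: algebra_simps)
    also have "\<dots> = c1 * (2 * c3 * exp (l * (5 * A\<^sup>2)) * Xt) + c4 * St + c1 * c3 * exp (l * h1) * R * Y"
      by (simp add: c4_def R_def algebra_simps)
    finally have lS: "l * St \<le> c1 * (2 * c3 * exp (l * (5 * A\<^sup>2)) * Xt) + c4 * St + c1 * c3 * exp (l * h1) * R * Y"
      by (simp add: St_def sum_distrib_left)
    have "St \<le> l * St" "2 * (c4 * St) \<le> l * St"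
      using mult_right_mono[OF l(1) St0] mult_right_mono[OF l(3) St0] by (simp_all add: mult.assoc)
    from absorb_half[OF this lS] have St: "St \<le> 2 * (c1 * (2 * c3 * exp (l * (5 * A\<^sup>2)) * Xt) + c1 * c3 * exp (l * h1) * R * Y)" .
    have "(LINT x|lebesgue_on (subcube A (2 * \<epsilon>)). et x) \<le> (LINT x|?M. K * exp (- (l * h2)) * (\<Sum>n<N. ?E x * top_energy A (V n) x))"
    proof (rule integral_subset_le[OF iet _ subcube_sub sets_subcube sets_cube])
      show "0 \<le> 2 * \<epsilon>" using \<epsilon> by simp
      show "integrable ?M (\<lambda>x. K * exp (- (l * h2)) * (\<Sum>n<N. ?E x * top_energy A (V n) x))" by (intro integrable_mult_right iS)
      show "0 \<le> K * exp (- (l * h2)) * (\<Sum>n<N. ?E x * top_energy A (V n) x)" for x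
        using pos by (intro mult_nonneg_nonneg sum_nonneg top_energy_nonneg less_imp_le[OF E0]) auto
      fix x assume x: "x \<in> subcube A (2 * \<epsilon>)"
      then have x3: "x $ 3 < r2" "x \<in> cube A" by (auto simp: subcube_def r2_def)
      have s0: "0 \<le> (\<Sum>n<N. top_energy A (V n) x)" by (intro sum_nonneg top_energy_nonneg)
      have "et x \<le> K * (\<Sum>n<N. top_energy A (V n) x)" using x3(1) \<epsilon> by (intro good) (simp add: r1_def r2_def)
      also have "\<dots> \<le> K * (exp (- (l * h2)) * (?E x * (\<Sum>n<N. top_energy A (V n) x)))"
      proof (rule mult_left_mono)
        have "exp (l * h2) \<le> ?E x"
          using carleman_weight_bounds(3)[OF A _ x3(2), of l r2] x3 l \<epsilon> by (simp add: h2_def r2_def)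
        then have "1 \<le> exp (- (l * h2)) * ?E x" by (simp add: exp_minus field_simps)
        from mult_right_mono[OF this s0] show "(\<Sum>n<N. top_energy A (V n) x) \<le> exp (- (l * h2)) * (?E x * (\<Sum>n<N. top_energy A (V n) x))"
          by (simp add: mult.assoc)
      qed (use pos in simp)
      finally show "et x \<le> K * exp (- (l * h2)) * (\<Sum>n<N. ?E x * top_energy A (V n) x)"
        by (simp add: sum_distrib_left mult.assoc)
    qed
    also have "\<dots> = K * exp (- (l * h2)) * St" using T(2) by (simp add: St_def S_def)
    also have "\<dots> \<le> K * exp (- (l * h2)) * (2 * (c1 * (2 * c3 * exp (l * (5 * A\<^sup>2)) * Xt) + c1 * c3 * exp (l * h1) * R * Y))"
      using pos by (intro mult_left_mono St) auto
    also have "\<dots> = 2 * K * c1 * c3 * (2 * (exp (l * P) * Xt) + R * (exp (- (l * Q)) * Y))"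
    proof -
      have "exp (l * P) = exp (- (l * h2)) * exp (l * (5 * A\<^sup>2))" by (simp add: P_def exp_add[symmetric] algebra_simps)
      moreover have "exp (- (l * Q)) = exp (- (l * h2)) * exp (l * h1)" by (simp add: Q_def exp_add[symmetric] algebra_simps)
      ultimately show ?thesis by (simp add: algebra_simps)
    qed
    also have "\<dots> \<le> 2 * K * c1 * c3 * ((2 + R) * (exp (l * P) * Xt + exp (- (l * Q)) * Y))"
    proof (rule mult_left_mono)
      have "0 \<le> exp (l * P) * Xt" "0 \<le> exp (- (l * Q)) * Y" by (simp_all add: Xt_def X_def Y_def sum_nonneg)
      then show "2 * (exp (l * P) * Xt) + R * (exp (- (l * Q)) * Y) \<le> (2 + R) * (exp (l * P) * Xt + exp (- (l * Q)) * Y)"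
        using pos(5) by (simp add: distrib_left distrib_right)
    qed (use pos in simp)
    finally show "(LINT x|lebesgue_on (subcube A (2 * \<epsilon>)). (\<Sum>n<N. energy A (V n) x)) \<le>
      2 * K * c1 * c3 * (2 + R) * (exp (l * P) * (\<Sum>m<N. LINT x|?M. (L_op A b d N V m x)\<^sup>2) + exp (- (l * Q)) * (normHN N 3 (cube A) V)\<^sup>2)"
      by (simp add: et_def Xt_def X_def Y_def mult.assoc)
  qed
qed

section \<open>Second derivatives by interpolation\<close>

text \<open>A second derivative \<open>\<partial>\<^sub>i\<partial>\<^sub>j u\<close> is the first derivative of \<open>f = \<partial>\<^sub>j u\<close> in direction \<open>i\<close>, and is interpolated
  between \<open>f\<close> and the third derivative \<open>\<partial>\<^sub>i\<^sub>i f\<close>.\<close>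

lemma H2_subcube_le_H1:
  assumes A: "A > 0" and \<epsilon>: "0 < \<epsilon>" "\<epsilon> < A" and h: "0 < h" "h \<le> \<epsilon> / 2" and U: "in_HN N 3 (cube A) U"
  shows "(normHN N 2 (subcube A \<epsilon>) U)\<^sup>2 \<le> real (N * card {\<alpha>. order_of \<alpha> \<le> 2}) *
    ((1 + 16 / h\<^sup>2) * (LINT x|lebesgue_on (subcube A (\<epsilon> / 2)). (\<Sum>n<N. energy A (U n) x)) + h\<^sup>2 * (normHN N 3 (cube A) U)\<^sup>2)"
proof -
  let ?M = "lebesgue_on (cube A)" and ?S = "lebesgue_on (subcube A \<epsilon>)" and ?T = "lebesgue_on (subcube A (\<epsilon> / 2))"
  define Z where "Z = (LINT x|?T. (\<Sum>n<N. energy A (U n) x))"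
  define Y where "Y = (normHN N 3 (cube A) U)\<^sup>2"
  have U1: "in_HN N 1 (cube A) U" and U2: "in_HN N 2 (cube A) U" using in_HN_mono[OF U] by auto
  have e: "0 \<le> \<epsilon> / 2" "0 \<le> \<epsilon>" using \<epsilon> by auto
  have ei: "integrable ?M (\<lambda>x. \<Sum>n<N. energy A (U n) x)"
    by (intro Bochner_Integration.integrable_sum energy_integrable in_HN_D[OF U1]) simp
  have eT: "integrable ?T (\<lambda>x. \<Sum>n<N. energy A (U n) x)"
    by (rule integrable_lebesgue_on_subset[OF ei subcube_sub sets_subcube[OF e(1)] sets_cube])
  have first: "(LINT x|?T. (f x)\<^sup>2) \<le> Z"
    if "square_integrable ?M f" "\<And>x. (f x)\<^sup>2 \<le> energy A (U m) x" "m < N" for f m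
    unfolding Z_def
  proof (rule integral_mono[OF integrable_lebesgue_on_subset[OF sqi_integrable[OF that(1)] subcube_sub sets_subcube[OF e(1)] sets_cube] eT])
    fix x
    have "energy A (U m) x \<le> (\<Sum>n<N. energy A (U n) x)" using that(3) by (intro member_le_sum) (auto simp: energy_nonneg)
    then show "(f x)\<^sup>2 \<le> (\<Sum>n<N. energy A (U n) x)" using that(2)[of x] by simp
  qed
  have ST: "(LINT x|?S. (f x)\<^sup>2) \<le> (LINT x|?T. (f x)\<^sup>2)" if "square_integrable ?M f" for f
  proof (rule sqi_subset(2)[OF sqi_subset(1)[OF that subcube_sub sets_subcube[OF e(1)] sets_cube] _ sets_subcube[OF e(2)] sets_subcube[OF e(1)]])
    show "subcube A \<epsilon> \<subseteq> subcube A (\<epsilon> / 2)" using \<epsilon> by (auto simp: subcube_def)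
  qed
  have val: "(U m x)\<^sup>2 \<le> energy A (U m) x" for m x by (simp add: energy_def sum_nonneg)
  have grad: "(weakD A (dir i) (U m) x)\<^sup>2 \<le> energy A (U m) x" for i m x
  proof -
    have "(weakD A (dir i) (U m) x)\<^sup>2 \<le> (\<Sum>j\<in>UNIV. (weakD A (dir j) (U m) x)\<^sup>2)" by (rule member_le_sum) auto
    then show ?thesis unfolding energy_def using zero_le_power2[of "U m x"] by linarith
  qed
  have Z0: "Z \<ge> 0" unfolding Z_def by (intro integral_nonneg_AE AE_I2 sum_nonneg energy_nonneg)
  have Y0: "Y \<ge> 0" unfolding Y_def by simp
  have bound: "(LINT x|?S. (weakD A \<alpha> (U m) x)\<^sup>2) \<le> (1 + 16 / h\<^sup>2) * Z + h\<^sup>2 * Y" if m: "m < N" and \<alpha>: "order_of \<alpha> \<le> 2" for m \<alpha>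
  proof -
    note u = in_HN_D[OF U m]
    note u' = u[unfolded cube_box]
    have ZY: "Z \<le> (1 + 16 / h\<^sup>2) * Z + h\<^sup>2 * Y" "16 / h\<^sup>2 * Z + h\<^sup>2 * Y \<le> (1 + 16 / h\<^sup>2) * Z + h\<^sup>2 * Y"
      using Z0 Y0 by (simp_all add: distrib_right)
    consider "order_of \<alpha> = 0" | "order_of \<alpha> = Suc 0" | "order_of \<alpha> = Suc (Suc 0)" using \<alpha> by linarith
    then show ?thesis
    proof cases
      case 1
      then have z: "\<alpha> = (\<lambda>_. 0)" by (simp add: order_0_iff)
      have "AE x in ?M. weakD A \<alpha> (U m) x = U m x" unfolding z cube_box
        by (rule wderiv_AE_eq[OF wd_zero_order[OF sqi_locally_integrable]]) (rule in_H_sqi(1)[OF u'])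
      from AE_lebesgue_on_subset[OF this subcube_sub sets_subcube[OF e(2)] sets_cube]
      have ae: "AE x in ?S. (weakD A \<alpha> (U m) x)\<^sup>2 = (U m x)\<^sup>2" by eventually_elim simp
      have sq: "square_integrable ?M (U m)" "square_integrable ?M (weakD A \<alpha> (U m))"
        using weakD_sqi(1)[OF u] weakD_sqi(2)[OF u, of \<alpha>] 1 by auto
      have ms: "(\<lambda>x. (f x)\<^sup>2) \<in> borel_measurable ?S" if "square_integrable ?M f" for f
        using sqi_integrable[OF sqi_subset(1)[OF that subcube_sub sets_subcube[OF e(2)] sets_cube]] by (rule borel_measurable_integrable)
      have "(LINT x|?S. (weakD A \<alpha> (U m) x)\<^sup>2) = (LINT x|?S. (U m x)\<^sup>2)"
        by (rule integral_cong_AE[OF ms[OF sq(2)] ms[OF sq(1)] ae])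
      also have "\<dots> \<le> Z" by (rule order_trans[OF ST[OF sq(1)] first[OF sq(1) val m]])
      finally show ?thesis using ZY(1) by linarith
    next
      case 2
      then obtain i \<beta> where "\<alpha> = \<beta>(i := Suc (\<beta> i))" "order_of \<beta> = 0" by (rule order_Suc_cases)
      then have a: "\<alpha> = dir i" by (simp add: order_0_iff dir_upd)
      have sq: "square_integrable ?M (weakD A \<alpha> (U m))" by (rule weakD_sqi(2)[OF u]) (simp add: a)
      have "(LINT x|?S. (weakD A \<alpha> (U m) x)\<^sup>2) \<le> Z"
        by (rule order_trans[OF ST[OF sq] first[OF sq _ m]]) (unfold a, rule grad)
      then show ?thesis using ZY(1) by linarith
    next
      case 3
      then obtain i \<beta> where ab: "\<alpha> = \<beta>(i := Suc (\<beta> i))" and b1: "order_of \<beta> = Suc 0" by (rule order_Suc_cases)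
      from b1 obtain j \<gamma> where "\<beta> = \<gamma>(j := Suc (\<gamma> j))" "order_of \<gamma> = 0" by (rule order_Suc_cases)
      then have b: "\<beta> = dir j" by (simp add: order_0_iff dir_upd)
      let ?f = "weakD A (dir j) (U m)" and ?f2 = "weakD A (\<lambda>k. dir2 i k + dir j k) (U m)"
      have a: "\<alpha> = (\<lambda>k. dir i k + dir j k)" unfolding ab b by (auto simp: dir_def)
      have o3: "order_of (\<lambda>k. dir2 i k + dir j k) = 3" by (simp add: order_of_add)
      have sq: "square_integrable ?M ?f" "square_integrable ?M (weakD A \<alpha> (U m))" "square_integrable ?M ?f2"
        using \<alpha> o3 by (intro weakD_sqi(2)[OF u]; simp)+
      have w1: "has_weak_derivative (cube A) (dir i) ?f (weakD A \<alpha> (U m))"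
        unfolding a cube_box by (rule in_H_wderiv_wd[OF u']) simp
      have w2: "has_weak_derivative (cube A) (dir2 i) ?f ?f2"
        unfolding cube_box by (rule in_H_wderiv_wd[OF u']) simp
      define p where "p = 2 / h * sqrt (LINT x|?T. (?f x)\<^sup>2)"
      define r where "r = h / 2 * sqrt (LINT x|?M. (?f2 x)\<^sup>2)"
      have "(LINT x|?T. (?f x)\<^sup>2) \<ge> 0" "(LINT x|?M. (?f2 x)\<^sup>2) \<ge> 0" by simp_all
      then have p: "p\<^sup>2 = 4 / h\<^sup>2 * (LINT x|?T. (?f x)\<^sup>2)" and r: "r\<^sup>2 = h\<^sup>2 / 4 * (LINT x|?M. (?f2 x)\<^sup>2)"
        by (simp_all add: p_def r_def power_mult_distrib power_divide)
      have pl: "p\<^sup>2 \<le> 4 / h\<^sup>2 * Z" unfolding p by (intro mult_left_mono first[OF sq(1) grad m]) simp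
      have rl: "r\<^sup>2 \<le> h\<^sup>2 / 4 * Y" unfolding r Y_def by (intro mult_left_mono wderiv_le_normHN[OF m]) (simp_all add: o3)
      have "(LINT x|?S. (weakD A \<alpha> (U m) x)\<^sup>2) \<le> 2 * (p + r)\<^sup>2"
        unfolding p_def r_def by (rule subcube_interpolation[OF A \<epsilon> h sq w1 w2])
      also have "\<dots> \<le> 4 * p\<^sup>2 + 4 * r\<^sup>2" using sum_squares_bound[of p r] by (simp add: power2_sum)
      also have "\<dots> \<le> 4 * (4 / h\<^sup>2 * Z) + 4 * (h\<^sup>2 / 4 * Y)" using pl rl by (intro add_mono mult_left_mono) auto
      also have "\<dots> = 16 / h\<^sup>2 * Z + h\<^sup>2 * Y" by simp
      finally show ?thesis using ZY(2) by linarith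
    qed
  qed
  have "(normHN N 2 (subcube A \<epsilon>) U)\<^sup>2 \<le> (\<Sum>m<N. \<Sum>\<alpha> | order_of \<alpha> \<le> 2. (1 + 16 / h\<^sup>2) * Z + h\<^sup>2 * Y)"
    unfolding normHN_subcube_sq[OF e(2) U2] by (intro sum_mono bound) auto
  also have "\<dots> = real (N * card {\<alpha>. order_of \<alpha> \<le> 2}) * ((1 + 16 / h\<^sup>2) * Z + h\<^sup>2 * Y)" by simp
  finally show ?thesis unfolding Z_def Y_def .
qed

section \<open>The exact solution as a competitor\<close>

lemma has_normal_trace_lincomb:
  assumes A: "A > 0" and s: "s \<in> {1, -1}" and u: "in_H 3 (cube A) u" "has_normal_trace A u (i, s) g"
    and v: "in_H 3 (cube A) v" "has_normal_trace A v (i, s) h"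
  shows "has_normal_trace A (\<lambda>x. c * u x + d * v x) (i, s) (\<lambda>x. c * g x + d * h x)"
proof -
  have t: "has_trace A (\<lambda>x. c * (s * weakD A (dir i) u x) + d * (s * weakD A (dir i) v x)) (i, s) (\<lambda>x. c * g x + d * h x)"
    using u(2) v(2) by (intro has_trace_lincomb[OF A s]) (simp_all add: has_normal_trace_def)
  have "AE x in lebesgue_on (cube A). weakD A (dir i) (\<lambda>x. c * u x + d * v x) x = c * weakD A (dir i) u x + d * weakD A (dir i) v x"
    unfolding cube_box by (rule wderiv_lincomb[OF u(1)[unfolded cube_box] v(1)[unfolded cube_box]]) simp
  then have "AE x in lebesgue_on (cube A). c * (s * weakD A (dir i) u x) + d * (s * weakD A (dir i) v x) = s * weakD A (dir i) (\<lambda>x. c * u x + d * v x) x"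
    by eventually_elim (simp add: algebra_simps)
  from has_trace_AE_cong[OF A t this] show ?thesis by (simp add: has_normal_trace_def)
qed

lemma in_H30bsc_diff:
  assumes A: "A > 0" and u: "in_H 3 (cube A) u" and v: "in_H 3 (cube A) v"
    and bsc: "has_trace A u S_bsc g" "has_trace A v S_bsc g" "has_normal_trace A u S_bsc h" "has_normal_trace A v S_bsc h"
    and lat: "\<And>F. F \<in> lateral \<Longrightarrow> has_normal_trace A u F (\<lambda>_. 0)" "\<And>F. F \<in> lateral \<Longrightarrow> has_normal_trace A v F (\<lambda>_. 0)"
  shows "in_H30bsc A (\<lambda>x. u x - v x)"
proof -
  have d: "(\<lambda>x. u x - v x) = (\<lambda>x. 1 * u x + -1 * v x)" by simp
  have s: "-1 \<in> {1, -1::real}" by simp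
  have "in_H 3 (cube A) (\<lambda>x. u x - v x)" unfolding d cube_box
    by (rule in_H_lincomb) (use u v in \<open>simp_all add: cube_box\<close>)
  moreover have "has_trace A (\<lambda>x. u x - v x) S_bsc (\<lambda>_. 0)"
    using has_trace_lincomb[OF A s bsc(1,2)[unfolded S_bsc_def], of 1 "-1"] by (simp add: S_bsc_def)
  moreover have "has_normal_trace A (\<lambda>x. u x - v x) F (\<lambda>_. 0)" if F: "F \<in> insert S_bsc lateral" for F
  proof (cases "F = S_bsc")
    case True
    show ?thesis unfolding True S_bsc_def
      using has_normal_trace_lincomb[OF A s u bsc(3)[unfolded S_bsc_def] v bsc(4)[unfolded S_bsc_def], of 1 "-1"] by simp
  next
    case False
    then have F: "F \<in> lateral" using F by simp
    then obtain i s where Fis: "F = (i, s)" and s: "s \<in> {1, -1::real}" by (auto simp: lateral_def)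
    show ?thesis unfolding Fis
      using has_normal_trace_lincomb[OF A s u lat(1)[OF F, unfolded Fis] v lat(2)[OF F, unfolded Fis], of 1 "-1"] by simp
  qed
  ultimately show ?thesis unfolding in_H30bsc_def by blast
qed

lemma in_H30bscN_diff:
  assumes A: "A > 0" and "in_H30bscN A N U" "in_H30bscN A N V"
  shows "in_H30bscN A N (\<lambda>m x. U m x - V m x)"
  unfolding in_H30bscN_def
proof (intro allI impI)
  fix m assume "m < N"
  then have "in_H30bsc A (U m)" "in_H30bsc A (V m)" using assms by (auto simp: in_H30bscN_def)
  then show "in_H30bsc A (\<lambda>x. U m x - V m x)" unfolding in_H30bsc_def[of A "U m"] in_H30bsc_def[of A "V m"]
    by (intro in_H30bsc_diff[OF A, where g = "\<lambda>_. 0" and h = "\<lambda>_. 0"]) auto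
qed

lemma boundary_conditions_diff:
  assumes A: "A > 0" and U: "in_HN N 3 (cube A) U" "boundary_conditions A N U g h"
    and V: "in_HN N 3 (cube A) V" "boundary_conditions A N V g h"
  shows "in_H30bscN A N (\<lambda>m x. U m x - V m x)"
  unfolding in_H30bscN_def
proof (intro allI impI)
  fix m assume m: "m < N"
  show "in_H30bsc A (\<lambda>x. U m x - V m x)"
    using in_HN_D[OF U(1) m] in_HN_D[OF V(1) m] U(2) V(2) m unfolding boundary_conditions_def
    by (intro in_H30bsc_diff[OF A, where g = "g m" and h = "h m"]) auto
qed

lemma J_fun_eq:
  assumes A: "A > 0" and b: "b > 0" and V: "in_HN N 3 (cube A) V" and F: "in_HN N 3 (cube A) F"
  shows "J_fun A b d N F \<gamma> V = (\<Sum>m<N. LINT x|lebesgue_on (cube A). (L_op A b d N (\<lambda>n y. V n y + F n y) m x)\<^sup>2) + \<gamma> * (normHN N 3 (cube A) V)\<^sup>2"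
proof -
  have "in_HN N 2 (cube A) (\<lambda>n x. V n x + F n x)"
    using in_HN_mono[OF in_HN_lincomb[OF V F, of 1 1], of 2] by simp
  then have "integrable (lebesgue_on (cube A)) (\<lambda>x. (L_op A b d N (\<lambda>n y. V n y + F n y) m x)\<^sup>2)" if "m < N" for m
    using sqi_integrable[OF L_op_sqi[OF A b _ that]] by blast
  then show ?thesis by (simp add: J_fun_def)
qed

text \<open>Comparison of the minimizer with \<open>U\<^sup>* - F\<^sup>*\<close>. The value of the functional bounds both the squared
  residual, by \<open>O(\<delta>\<^sup>2)\<close>, and \<open>\<delta>\<^sup>2\<close> times the squared \<open>H\<^sup>3\<close> norm.\<close>

lemma minimizer_error:
  assumes A: "A > 0" and b: "b > 0" and \<delta>: "\<delta> > 0"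
    and U: "in_HN N 3 (cube A) Us" "AE x in lebesgue_on (cube A). \<forall>m<N. L_op A b d N Us m x = 0"
    and Fs: "in_HN N 3 (cube A) Fs" and comp: "in_H30bscN A N (\<lambda>m x. Us m x - Fs m x)"
    and F: "in_HN N 3 (cube A) F" "normHN N 2 (cube A) (\<lambda>m x. F m x - Fs m x) \<le> \<delta>"
    and V: "is_arg_min (J_fun A b d N F (\<delta>\<^sup>2)) (in_H30bscN A N) V"
    and C: "C \<ge> 0" "\<And>U m. in_HN N 2 (cube A) U \<Longrightarrow> m < N \<Longrightarrow>
      (LINT x|lebesgue_on (cube A). (L_op A b d N U m x)\<^sup>2) \<le> C * (normHN N 2 (cube A) U)\<^sup>2"
  defines "q \<equiv> \<lambda>m x. V m x - (Us m x - Fs m x)"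
    and "K \<equiv> 4 * (real N * C + (normHN N 3 (cube A) (\<lambda>m x. Us m x - Fs m x))\<^sup>2)"
  shows "in_H30bscN A N q"
    and "(\<Sum>m<N. LINT x|lebesgue_on (cube A). (L_op A b d N q m x)\<^sup>2) \<le> K * \<delta>\<^sup>2"
    and "(normHN N 3 (cube A) q)\<^sup>2 \<le> K"
proof -
  let ?M = "lebesgue_on (cube A)"
  define Vs where "Vs = (\<lambda>m x. Us m x - Fs m x)"
  define G where "G = (\<lambda>m x. F m x - Fs m x)"
  define X where "X W = (\<Sum>m<N. LINT x|?M. (L_op A b d N (\<lambda>n y. W n y + F n y) m x)\<^sup>2)" for W
  define Y where "Y = (normHN N 3 (cube A) Vs)\<^sup>2"
  have Vb: "in_H30bscN A N V" using V by (simp add: is_arg_min_def)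
  have Vsb: "in_H30bscN A N Vs" using comp by (simp add: Vs_def)
  have H3: "in_HN N 3 (cube A) W" if "in_H30bscN A N W" for W
    using that by (simp add: in_HN_def in_H30bscN_def in_H30bsc_def)
  have G3: "in_HN N 3 (cube A) G" using in_HN_lincomb[OF F(1) Fs, of 1 "-1"] by (simp add: G_def)
  have X0: "X W \<ge> 0" for W unfolding X_def by (simp add: sum_nonneg)
  show qb: "in_H30bscN A N q" unfolding q_def by (rule in_H30bscN_diff[OF A Vb comp])
  \<comment> \<open>The competitor has the form exact solution plus data error, and \<open>L\<close> kills the first part.\<close>
  have "X Vs \<le> real N * C * \<delta>\<^sup>2"
  proof -
    have "(LINT x|?M. (L_op A b d N (\<lambda>n y. Vs n y + F n y) m x)\<^sup>2) \<le> C * \<delta>\<^sup>2" if m: "m < N" for m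
    proof -
      have eq: "(\<lambda>n y. Vs n y + F n y) = (\<lambda>n y. 1 * Us n y + 1 * G n y)" by (simp add: Vs_def G_def fun_eq_iff)
      have U2: "in_HN N 2 (cube A) Us" and G2: "in_HN N 2 (cube A) G" using in_HN_mono[OF U(1)] in_HN_mono[OF G3] by auto
      have i: "square_integrable ?M (L_op A b d N (\<lambda>n y. Vs n y + F n y) m)"
        unfolding eq by (rule L_op_sqi[OF A b in_HN_lincomb[OF U2 G2] m])
      have ae: "AE x in ?M. (L_op A b d N (\<lambda>n y. Vs n y + F n y) m x)\<^sup>2 = (L_op A b d N G m x)\<^sup>2"
        using L_op_lincomb[OF U2 G2 m, of b d 1 1] U(2) unfolding eq
      proof eventually_elim
        case (elim x)
        then show ?case using m by simp
      qed
      have "(LINT x|?M. (L_op A b d N (\<lambda>n y. Vs n y + F n y) m x)\<^sup>2) = (LINT x|?M. (L_op A b d N G m x)\<^sup>2)"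
        by (rule integral_cong_AE[OF borel_measurable_integrable[OF sqi_integrable[OF i]]
            borel_measurable_integrable[OF sqi_integrable[OF L_op_sqi[OF A b G2 m]]] ae])
      also have "\<dots> \<le> C * (normHN N 2 (cube A) G)\<^sup>2" by (rule C(2)[OF G2 m])
      also have "\<dots> \<le> C * \<delta>\<^sup>2" using F(2) C(1) by (intro mult_left_mono power_mono) (auto simp: G_def normHN_nonneg)
      finally show ?thesis .
    qed
    then have "X Vs \<le> (\<Sum>m<N. C * \<delta>\<^sup>2)" unfolding X_def by (intro sum_mono) simp
    then show ?thesis by simp
  qed
  then have XVs: "X Vs + \<delta>\<^sup>2 * Y \<le> K / 4 * \<delta>\<^sup>2" by (simp add: K_def Y_def Vs_def algebra_simps)
  have "J_fun A b d N F (\<delta>\<^sup>2) V \<le> J_fun A b d N F (\<delta>\<^sup>2) Vs"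
    using V Vsb by (auto simp: is_arg_min_def not_less)
  then have XV: "X V + \<delta>\<^sup>2 * (normHN N 3 (cube A) V)\<^sup>2 \<le> K / 4 * \<delta>\<^sup>2"
    using XVs unfolding J_fun_eq[OF A b H3[OF Vb] F(1)] J_fun_eq[OF A b H3[OF Vsb] F(1)] X_def Y_def by linarith
  have "\<delta>\<^sup>2 * (normHN N 3 (cube A) V)\<^sup>2 \<le> \<delta>\<^sup>2 * (K / 4)" using XV X0[of V] by (simp add: mult.commute)
  then have nV: "(normHN N 3 (cube A) V)\<^sup>2 \<le> K / 4" using \<delta> by simp
  have nVs: "Y \<le> K / 4" using C(1) by (simp add: K_def Y_def Vs_def)
  have q_eq: "q = (\<lambda>n x. 1 * V n x + -1 * Vs n x)" by (simp add: q_def Vs_def fun_eq_iff)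
  have "(normHN N 3 (cube A) q)\<^sup>2 \<le> 2 * (normHN N 3 (cube A) V)\<^sup>2 + 2 * Y"
    using normHN_add_sq[OF H3[OF Vb, unfolded cube_box] H3[OF Vsb, unfolded cube_box], of 1 "-1"]
    unfolding q_eq Y_def cube_box by simp
  then show "(normHN N 3 (cube A) q)\<^sup>2 \<le> K" using nV nVs by linarith
  have "(LINT x|?M. (L_op A b d N q m x)\<^sup>2) \<le> 2 * (LINT x|?M. (L_op A b d N (\<lambda>n y. V n y + F n y) m x)\<^sup>2)
      + 2 * (LINT x|?M. (L_op A b d N (\<lambda>n y. Vs n y + F n y) m x)\<^sup>2)" if m: "m < N" for m
  proof -
    let ?f = "L_op A b d N (\<lambda>n y. V n y + F n y) m" and ?g = "L_op A b d N (\<lambda>n y. Vs n y + F n y) m"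
    have in2: "in_HN N 2 (cube A) (\<lambda>n y. W n y + F n y)" if "in_H30bscN A N W" for W
      using in_HN_mono[OF in_HN_lincomb[OF H3[OF that] F(1), of 1 1], of 2] by simp
    note a = in2[OF Vb] and c = in2[OF Vsb]
    have sq: "square_integrable ?M ?f" "square_integrable ?M (\<lambda>x. - 1 * ?g x)"
      using L_op_sqi[OF A b a m] sqi_cmult[OF L_op_sqi[OF A b c m], of "-1"] by auto
    have qe: "q = (\<lambda>n x. 1 * (V n x + F n x) + -1 * (Vs n x + F n x))" by (simp add: q_eq)
    have ae: "AE x in ?M. (L_op A b d N q m x)\<^sup>2 = (?f x + - 1 * ?g x)\<^sup>2"
      using L_op_lincomb[OF a c m, of b d 1 "-1"] unfolding qe[symmetric] by eventually_elim simp
    have q2: "in_HN N 2 (cube A) q" by (rule in_HN_mono[OF H3[OF qb]]) simp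
    have "(LINT x|?M. (L_op A b d N q m x)\<^sup>2) = (LINT x|?M. (?f x + - 1 * ?g x)\<^sup>2)"
      by (rule integral_cong_AE[OF borel_measurable_integrable[OF sqi_integrable[OF L_op_sqi[OF A b q2 m]]]
          borel_measurable_integrable[OF sqi_integrable[OF sqi_add[OF sq]]] ae])
    also have "\<dots> \<le> 2 * (LINT x|?M. (?f x)\<^sup>2) + 2 * (LINT x|?M. (- 1 * ?g x)\<^sup>2)" by (rule sqi_norm_add[OF sq])
    finally show ?thesis by simp
  qed
  then have "(\<Sum>m<N. LINT x|?M. (L_op A b d N q m x)\<^sup>2) \<le> (\<Sum>m<N. 2 * (LINT x|?M. (L_op A b d N (\<lambda>n y. V n y + F n y) m x)\<^sup>2)
      + 2 * (LINT x|?M. (L_op A b d N (\<lambda>n y. Vs n y + F n y) m x)\<^sup>2))"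
    by (intro sum_mono) simp
  also have "\<dots> = 2 * X V + 2 * X Vs" by (simp add: X_def sum.distrib sum_distrib_left)
  also have "\<dots> \<le> K * \<delta>\<^sup>2"
  proof -
    have "0 \<le> \<delta>\<^sup>2 * Y" "0 \<le> \<delta>\<^sup>2 * (normHN N 3 (cube A) V)\<^sup>2" by (simp_all add: Y_def)
    moreover have "0 \<le> K * \<delta>\<^sup>2" using C(1) by (simp add: K_def)
    ultimately show ?thesis using XV XVs by linarith
  qed
  finally show "(\<Sum>m<N. LINT x|?M. (L_op A b d N q m x)\<^sup>2) \<le> K * \<delta>\<^sup>2" .
qed

section \<open>The convergence rate\<close>

text \<open>Here \<open>X\<close>, \<open>Y\<close> and \<open>Z\<close> stand for the squared residual, the squared \<open>H\<^sup>3\<close> norm and the squared \<open>H\<^sup>1\<close> norm on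
  the subcube. With \<open>exp (l P) = 1/\<delta>\<close> and \<open>\<beta> = min 1 (Q/P)\<close> one gets \<open>Z = O(\<delta>\<^sup>\<beta>)\<close>. The step
  \<open>h\<close> of order \<open>\<delta> powr (\<beta>/4)\<close> balances \<open>Z/h\<^sup>2\<close> and \<open>h\<^sup>2\<close> at \<open>\<delta> powr (\<beta>/2)\<close>. Half of this exponent is given
  up in order to absorb the constants for small \<open>\<delta>\<close>, and the square root of the rest is
  \<open>\<delta> powr (\<beta>/8)\<close>.\<close>

lemma rate_choice:
  fixes l0 :: real
  assumes C: "C > 0" and K: "K \<ge> 0" and k: "k \<ge> 0" and P: "P > 0" and Q: "Q > 0" and \<epsilon>: "\<epsilon> > 0"
  obtains \<delta>0 \<alpha> where "0 < \<delta>0" "\<delta>0 < 1" "0 < \<alpha>" "\<alpha> < 1/2"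
    "\<And>\<delta>. 0 < \<delta> \<Longrightarrow> \<delta> < \<delta>0 \<Longrightarrow> \<exists>l h. l \<ge> l0 \<and> 0 < h \<and> h \<le> \<epsilon> / 2 \<and>
      (\<forall>X Y Z. X \<le> K * \<delta>\<^sup>2 \<and> Y \<le> K \<and> Z \<le> C * (exp (l * P) * X + exp (- (l * Q)) * Y) \<longrightarrow>
        2 * (k * ((1 + 16 / h\<^sup>2) * Z + h\<^sup>2 * Y)) + 2 * \<delta>\<^sup>2 \<le> (\<delta> powr \<alpha>)\<^sup>2)"
proof -
  define \<beta> where "\<beta> = min 1 (Q / P)"
  have \<beta>: "0 < \<beta>" "\<beta> \<le> 1" "\<beta> \<le> Q / P" using P Q by (auto simp: \<beta>_def)
  define D where "D = 2 * (k * ((1 + 64 / \<epsilon>\<^sup>2) * (2 * C * K) + \<epsilon>\<^sup>2 / 4 * K)) + 2"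
  have D: "D \<ge> 2" using C K k by (simp add: D_def)
  define \<delta>0 where "\<delta>0 = min (1/2) (min (exp (- (l0 * P))) (D powr (- (4 / \<beta>))))"
  have \<delta>0: "0 < \<delta>0" "\<delta>0 < 1" using D by (auto simp: \<delta>0_def)
  show ?thesis
  proof (rule that[OF \<delta>0, of "\<beta> / 8"])
    show "0 < \<beta> / 8" "\<beta> / 8 < 1/2" using \<beta> by auto
    fix \<delta> :: real assume \<delta>: "0 < \<delta>" "\<delta> < \<delta>0"
    then have \<delta>1: "\<delta> < 1" "\<delta> \<le> exp (- (l0 * P))" "\<delta> \<le> D powr (- (4 / \<beta>))" by (auto simp: \<delta>0_def)
    have dec: "\<delta> powr s \<le> \<delta> powr t" if "t \<le> s" for s t using \<delta> \<delta>1 that by (intro powr_mono') auto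
    define l where "l = - ln \<delta> / P"
    define h where "h = \<epsilon> / 2 * \<delta> powr (\<beta> / 4)"
    have lP: "exp (l * P) = \<delta> powr (-1)" using P \<delta> by (simp add: l_def powr_def)
    have lQ: "exp (- (l * Q)) = \<delta> powr (Q / P)" using \<delta> by (simp add: l_def powr_def field_simps)
    have "ln \<delta> \<le> - (l0 * P)" using \<delta>1(2) \<delta> by (simp add: ln_le_cancel_iff[symmetric, of \<delta> "exp (- (l0 * P))"])
    then have l: "l \<ge> l0" using P by (simp add: l_def field_simps)
    have "\<delta> powr (\<beta> / 4) \<le> 1" using dec[of 0 "\<beta> / 4"] \<beta> \<delta> by simp
    then have h: "0 < h" "h \<le> \<epsilon> / 2" using \<epsilon> \<delta> by (auto simp: h_def)
    have h2: "h\<^sup>2 = \<epsilon>\<^sup>2 / 4 * \<delta> powr (\<beta> / 2)"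
      by (simp add: h_def power_mult_distrib power_divide power2_eq_square[of "\<delta> powr _"] powr_add[symmetric])
    have main: "2 * (k * ((1 + 16 / h\<^sup>2) * Z + h\<^sup>2 * Y)) + 2 * \<delta>\<^sup>2 \<le> (\<delta> powr (\<beta> / 8))\<^sup>2"
      if X: "X \<le> K * \<delta>\<^sup>2" and Y: "Y \<le> K" and Z: "Z \<le> C * (exp (l * P) * X + exp (- (l * Q)) * Y)" for X Y Z
    proof -
      have "exp (l * P) * X + exp (- (l * Q)) * Y \<le> \<delta> powr (-1) * (K * \<delta>\<^sup>2) + \<delta> powr (Q / P) * K"
        unfolding lP lQ using X Y by (intro add_mono mult_left_mono) auto
      also have "\<delta> powr (-1) * (K * \<delta>\<^sup>2) = K * \<delta> powr 1"
        using \<delta> by (simp add: powr_minus power2_eq_square field_simps)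
      also have "K * \<delta> powr 1 + \<delta> powr (Q / P) * K \<le> K * \<delta> powr \<beta> + \<delta> powr \<beta> * K"
        using K \<beta> by (intro add_mono mult_left_mono mult_right_mono dec) auto
      finally have "C * (exp (l * P) * X + exp (- (l * Q)) * Y) \<le> C * (2 * K * \<delta> powr \<beta>)"
        using C by (intro mult_left_mono) auto
      with Z have Z': "Z \<le> 2 * C * K * \<delta> powr \<beta>" by (simp add: mult_ac)
      have "(1 + 16 / h\<^sup>2) * Z \<le> (1 + 16 / h\<^sup>2) * (2 * C * K * \<delta> powr \<beta>)"
        by (rule mult_left_mono[OF Z']) (simp add: add_nonneg_nonneg)
      also have "\<dots> = 2 * C * K * \<delta> powr \<beta> + 64 / \<epsilon>\<^sup>2 * (2 * C * K) * \<delta> powr (\<beta> / 2)"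
      proof -
        have "\<delta> powr \<beta> = \<delta> powr (\<beta> / 2) * \<delta> powr (\<beta> / 2)" by (simp add: powr_add[symmetric])
        moreover have "\<delta> powr (\<beta> / 2) > 0" using \<delta> by simp
        ultimately have "16 / h\<^sup>2 * \<delta> powr \<beta> = 64 / \<epsilon>\<^sup>2 * \<delta> powr (\<beta> / 2)"
          unfolding h2 using \<epsilon> by (simp add: field_simps)
        note e = this
        have "(1 + 16 / h\<^sup>2) * (2 * C * K * \<delta> powr \<beta>) = 2 * C * K * \<delta> powr \<beta> + 2 * C * K * (16 / h\<^sup>2 * \<delta> powr \<beta>)"
          by (simp add: algebra_simps)
        then show ?thesis unfolding e by (simp add: mult_ac)
      qed
      also have "\<dots> \<le> 2 * C * K * \<delta> powr (\<beta> / 2) + 64 / \<epsilon>\<^sup>2 * (2 * C * K) * \<delta> powr (\<beta> / 2)"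
        using C K \<beta> by (intro add_right_mono mult_left_mono dec) auto
      finally have a: "(1 + 16 / h\<^sup>2) * Z \<le> (1 + 64 / \<epsilon>\<^sup>2) * (2 * C * K) * \<delta> powr (\<beta> / 2)"
        by (simp add: algebra_simps)
      have b: "h\<^sup>2 * Y \<le> \<epsilon>\<^sup>2 / 4 * K * \<delta> powr (\<beta> / 2)"
        using mult_left_mono[OF Y, of "h\<^sup>2"] unfolding h2 by (simp add: mult_ac)
      have "\<delta>\<^sup>2 = \<delta> powr 2" using \<delta> by simp
      then have c: "\<delta>\<^sup>2 \<le> \<delta> powr (\<beta> / 2)" using dec[of "\<beta> / 2" 2] \<beta> by simp
      have "2 * (k * ((1 + 16 / h\<^sup>2) * Z + h\<^sup>2 * Y)) + 2 * \<delta>\<^sup>2 \<le>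
        2 * (k * ((1 + 64 / \<epsilon>\<^sup>2) * (2 * C * K) * \<delta> powr (\<beta> / 2) + \<epsilon>\<^sup>2 / 4 * K * \<delta> powr (\<beta> / 2))) + 2 * \<delta> powr (\<beta> / 2)"
        using k by (intro add_mono mult_left_mono a b c) auto
      also have "\<dots> = D * \<delta> powr (\<beta> / 2)" by (simp add: D_def algebra_simps)
      also have "\<dots> = (D * \<delta> powr (\<beta> / 4)) * \<delta> powr (\<beta> / 4)" by (simp add: powr_add[symmetric])
      also have "\<dots> \<le> 1 * \<delta> powr (\<beta> / 4)"
      proof (rule mult_right_mono)
        have "\<delta> powr (\<beta> / 4) \<le> (D powr (- (4 / \<beta>))) powr (\<beta> / 4)"
          using \<delta>1(3) \<delta> \<beta> by (intro powr_mono2) auto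
        also have "\<dots> = D powr -1"
        proof -
          have "- (4 / \<beta>) * (\<beta> / 4) = -1" using \<beta> by simp
          then show ?thesis by (simp only: powr_powr)
        qed
        also have "\<dots> = 1 / D" using D by (simp add: powr_minus divide_inverse)
        finally show "D * \<delta> powr (\<beta> / 4) \<le> 1" using D by (simp add: field_simps)
      qed simp
      also have "1 * \<delta> powr (\<beta> / 4) = (\<delta> powr (\<beta> / 8))\<^sup>2" by (simp add: power2_eq_square powr_add[symmetric])
      finally show ?thesis .
    qed
    show "\<exists>l h. l \<ge> l0 \<and> 0 < h \<and> h \<le> \<epsilon> / 2 \<and>
      (\<forall>X Y Z. X \<le> K * \<delta>\<^sup>2 \<and> Y \<le> K \<and> Z \<le> C * (exp (l * P) * X + exp (- (l * Q)) * Y) \<longrightarrow>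
        2 * (k * ((1 + 16 / h\<^sup>2) * Z + h\<^sup>2 * Y)) + 2 * \<delta>\<^sup>2 \<le> (\<delta> powr (\<beta> / 8))\<^sup>2)"
      using l h main by blast
  qed
qed

lemma convergence_rate:
  assumes A: "A > 0" and b: "b > 0" and \<epsilon>: "0 < \<epsilon>" "\<epsilon> < A"
    and U: "in_HN N 3 (cube A) Us" "AE x in lebesgue_on (cube A). \<forall>m<N. L_op A b d N Us m x = 0"
    and Fs: "in_HN N 3 (cube A) Fs" and comp: "in_H30bscN A N (\<lambda>m x. Us m x - Fs m x)"
  obtains \<delta>0 \<alpha> where "0 < \<delta>0" "\<delta>0 < 1" "0 < \<alpha>" "\<alpha> < 1/2"
    "\<And>\<delta> F V. 0 < \<delta> \<Longrightarrow> \<delta> < \<delta>0 \<Longrightarrow> in_HN N 3 (cube A) F \<Longrightarrow>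
      normHN N 2 (cube A) (\<lambda>m x. F m x - Fs m x) \<le> \<delta> \<Longrightarrow>
      is_arg_min (J_fun A b d N F (\<delta>\<^sup>2)) (in_H30bscN A N) V \<Longrightarrow>
      normHN N 2 (subcube A \<epsilon>) (\<lambda>m x. V m x + F m x - Us m x) \<le> \<delta> powr \<alpha>"
proof -
  \<comment> \<open>The interpolation needs the first order estimate on the larger subcube with the parameter \<open>\<epsilon>/2\<close>.\<close>
  obtain C l0 P Q where C: "C > 0" "l0 > 0" "P > 0" "Q > 0"
    "\<And>V l. in_H30bscN A N V \<Longrightarrow> l \<ge> l0 \<Longrightarrow>
      (LINT x|lebesgue_on (subcube A (2 * (\<epsilon> / 4))). (\<Sum>n<N. energy A (V n) x)) \<le>
      C * (exp (l * P) * (\<Sum>m<N. LINT x|lebesgue_on (cube A). (L_op A b d N V m x)\<^sup>2) + exp (- (l * Q)) * (normHN N 3 (cube A) V)\<^sup>2)"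
    by (rule system_carleman[OF A b, of "\<epsilon> / 4" N d]) (use \<epsilon> in auto)
  obtain CL where CL: "CL \<ge> 0" "\<And>U m. in_HN N 2 (cube A) U \<Longrightarrow> m < N \<Longrightarrow>
    (LINT x|lebesgue_on (cube A). (L_op A b d N U m x)\<^sup>2) \<le> CL * (normHN N 2 (cube A) U)\<^sup>2"
    by (rule L_op_integral_bound[OF A b, where N = N and d = d]) blast
  define K where "K = 4 * (real N * CL + (normHN N 3 (cube A) (\<lambda>m x. Us m x - Fs m x))\<^sup>2)"
  define k where "k = real (N * card {\<alpha>. order_of \<alpha> \<le> 2})"
  have K0: "K \<ge> 0" and k0: "k \<ge> 0" using CL(1) by (simp_all add: K_def k_def)
  obtain \<delta>0 \<alpha> where r: "0 < \<delta>0" "\<delta>0 < 1" "0 < \<alpha>" "\<alpha> < 1/2"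
    "\<And>\<delta>. 0 < \<delta> \<Longrightarrow> \<delta> < \<delta>0 \<Longrightarrow> \<exists>l h. l \<ge> l0 \<and> 0 < h \<and> h \<le> \<epsilon> / 2 \<and>
      (\<forall>X Y Z. X \<le> K * \<delta>\<^sup>2 \<and> Y \<le> K \<and> Z \<le> C * (exp (l * P) * X + exp (- (l * Q)) * Y) \<longrightarrow>
        2 * (k * ((1 + 16 / h\<^sup>2) * Z + h\<^sup>2 * Y)) + 2 * \<delta>\<^sup>2 \<le> (\<delta> powr \<alpha>)\<^sup>2)"
    by (rule rate_choice[OF C(1) K0 k0 C(3,4) \<epsilon>(1), of l0]) blast
  show ?thesis
  proof (rule that[OF r(1-4)])
    fix \<delta> F V assume \<delta>: "0 < \<delta>" "\<delta> < \<delta>0" and F: "in_HN N 3 (cube A) F" "normHN N 2 (cube A) (\<lambda>m x. F m x - Fs m x) \<le> \<delta>"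
      and V: "is_arg_min (J_fun A b d N F (\<delta>\<^sup>2)) (in_H30bscN A N) V"
    define q where "q = (\<lambda>m x. V m x - (Us m x - Fs m x))"
    define G where "G = (\<lambda>m x. F m x - Fs m x)"
    note err = minimizer_error[OF A b \<delta>(1) U Fs comp F V CL, folded q_def K_def]
    obtain l h where lh: "l \<ge> l0" "0 < h" "h \<le> \<epsilon> / 2"
      "\<forall>X Y Z. X \<le> K * \<delta>\<^sup>2 \<and> Y \<le> K \<and> Z \<le> C * (exp (l * P) * X + exp (- (l * Q)) * Y) \<longrightarrow>
        2 * (k * ((1 + 16 / h\<^sup>2) * Z + h\<^sup>2 * Y)) + 2 * \<delta>\<^sup>2 \<le> (\<delta> powr \<alpha>)\<^sup>2"
      using r(5)[OF \<delta>] by (elim exE conjE) (rule that)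
    have q3: "in_HN N 3 (cube A) q"
      using err(1) by (simp add: in_HN_def in_H30bscN_def in_H30bsc_def)
    have G3: "in_HN N 3 (cube A) G" using in_HN_lincomb[OF F(1) Fs, of 1 "-1"] by (simp add: G_def)
    have q2: "in_HN N 2 (subcube A \<epsilon>) q" and G2: "in_HN N 2 (cube A) G" and G2': "in_HN N 2 (subcube A \<epsilon>) G"
      using \<epsilon> in_HN_subcube[OF _ in_HN_mono[OF q3, of 2]] in_HN_subcube[OF _ in_HN_mono[OF G3, of 2]] in_HN_mono[OF G3, of 2] by auto
    have sb: "subcube A \<epsilon> = box (cube_lower A) (cube_upper A \<epsilon>)" using \<epsilon> by (intro subcube_box) simp
    have e: "2 * (\<epsilon> / 4) = \<epsilon> / 2" by simp
    have "(normHN N 2 (subcube A \<epsilon>) G)\<^sup>2 \<le> (normHN N 2 (cube A) G)\<^sup>2"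
      using \<epsilon> by (intro normHN_subcube_le G2) simp
    also have "\<dots> \<le> \<delta>\<^sup>2" using F(2) by (intro power_mono) (auto simp: G_def normHN_nonneg)
    finally have G\<delta>: "(normHN N 2 (subcube A \<epsilon>) G)\<^sup>2 \<le> \<delta>\<^sup>2" .
    have split: "(\<lambda>m x. V m x + F m x - Us m x) = (\<lambda>m x. 1 * q m x + 1 * G m x)" by (simp add: q_def G_def fun_eq_iff)
    have "(normHN N 2 (subcube A \<epsilon>) (\<lambda>m x. V m x + F m x - Us m x))\<^sup>2 \<le>
      2 * (normHN N 2 (subcube A \<epsilon>) q)\<^sup>2 + 2 * (normHN N 2 (subcube A \<epsilon>) G)\<^sup>2"
      using normHN_add_sq[OF q2[unfolded sb] G2'[unfolded sb], of 1 1] unfolding split sb by simp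
    also have "\<dots> \<le> 2 * (k * ((1 + 16 / h\<^sup>2) * (LINT x|lebesgue_on (subcube A (\<epsilon> / 2)). (\<Sum>n<N. energy A (q n) x)) + h\<^sup>2 * (normHN N 3 (cube A) q)\<^sup>2)) + 2 * \<delta>\<^sup>2"
      using G\<delta> H2_subcube_le_H1[OF A \<epsilon> lh(2,3) q3, folded k_def] by (intro add_mono mult_left_mono) auto
    also have "\<dots> \<le> (\<delta> powr \<alpha>)\<^sup>2"
      using lh(4) err(2,3) C(5)[OF err(1) lh(1), unfolded e] by blast
    finally show "normHN N 2 (subcube A \<epsilon>) (\<lambda>m x. V m x + F m x - Us m x) \<le> \<delta> powr \<alpha>"
      by (rule power2_le_imp_le) simp
  qed
qed

theorem theorem7p2:
  shows "\<exists>B :: real \<Rightarrow> real \<Rightarrow> real \<Rightarrow> real. (\<forall>A R K. B A R K > 0) \<and>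
    (\<forall>(A::real) (b::real) (d::real) (N::nat) (R::real) (\<epsilon>::real)
        (Ustar::vfun) (Fstar::vfun) (\<phi>0star::vfun) (\<phi>1star::vfun).
      A > 0 \<and> b > 0 \<and> d > 0 \<and> N > 1 \<and> R > A \<and> 0 < \<epsilon> \<and> \<epsilon> < A \<and>
      in_HN N 3 (cube A) Ustar \<and>
      (AE x in lebesgue_on (cube A). \<forall>m<N. L_op A b d N Ustar m x = 0) \<and>
      boundary_conditions A N Ustar \<phi>0star \<phi>1star \<and>
      in_HN N 3 (cube A) Fstar \<and>
      boundary_conditions A N Fstar \<phi>0star \<phi>1star \<longrightarrow>
      (\<exists>\<delta>0 \<alpha> :: real. 0 < \<delta>0 \<and> \<delta>0 < 1 \<and> 0 < \<alpha> \<and> \<alpha> < 1/2 \<and>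
        (\<forall>\<delta>. 0 < \<delta> \<and> \<delta> < \<delta>0 \<longrightarrow>
          (\<forall>(F::vfun) (\<phi>0::vfun) (\<phi>1::vfun) (Vmin::vfun).
            in_HN N 3 (cube A) F \<and>
            boundary_conditions A N F \<phi>0 \<phi>1 \<and>
            normHN N 2 (cube A) (\<lambda>m x. F m x - Fstar m x) \<le> \<delta> \<and>
            is_arg_min (J_fun A b d N F (\<delta>\<^sup>2)) (in_H30bscN A N) Vmin \<longrightarrow>
            normHN N 2 (subcube A \<epsilon>) (\<lambda>m x. Vmin m x + F m x - Ustar m x)
              \<le> B A R (coeff_norm A b d N) *
                 (1 + normHN N 3 (cube A) Ustar + normHN N 3 (cube A) Fstar) * \<delta> powr \<alpha>))))"
proof (intro exI[of _ "\<lambda>_ _ _. 1"] conjI allI impI)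
  fix A R K :: real show "(0::real) < 1" by simp
next
  fix A b d :: real and N and R \<epsilon> and Ustar Fstar \<phi>0star \<phi>1star
  assume H: "A > 0 \<and> b > 0 \<and> d > 0 \<and> N > 1 \<and> R > A \<and> 0 < \<epsilon> \<and> \<epsilon> < A \<and>
      in_HN N 3 (cube A) Ustar \<and>
      (AE x in lebesgue_on (cube A). \<forall>m<N. L_op A b d N Ustar m x = 0) \<and>
      boundary_conditions A N Ustar \<phi>0star \<phi>1star \<and>
      in_HN N 3 (cube A) Fstar \<and>
      boundary_conditions A N Fstar \<phi>0star \<phi>1star"
  then have A: "A > 0" and b: "b > 0" and \<epsilon>: "0 < \<epsilon>" "\<epsilon> < A"
    and U: "in_HN N 3 (cube A) Ustar" "AE x in lebesgue_on (cube A). \<forall>m<N. L_op A b d N Ustar m x = 0"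
    and Fs: "in_HN N 3 (cube A) Fstar" by auto
  have comp: "in_H30bscN A N (\<lambda>m x. Ustar m x - Fstar m x)"
    using H by (intro boundary_conditions_diff[OF A, where g = \<phi>0star and h = \<phi>1star]) auto
  obtain \<delta>0 \<alpha> where r: "0 < \<delta>0" "\<delta>0 < 1" "0 < \<alpha>" "\<alpha> < 1/2"
    and rate: "\<And>\<delta> F V. 0 < \<delta> \<Longrightarrow> \<delta> < \<delta>0 \<Longrightarrow> in_HN N 3 (cube A) F \<Longrightarrow>
      normHN N 2 (cube A) (\<lambda>m x. F m x - Fstar m x) \<le> \<delta> \<Longrightarrow>
      is_arg_min (J_fun A b d N F (\<delta>\<^sup>2)) (in_H30bscN A N) V \<Longrightarrow>
      normHN N 2 (subcube A \<epsilon>) (\<lambda>m x. V m x + F m x - Ustar m x) \<le> \<delta> powr \<alpha>"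
    by (rule convergence_rate[OF A b \<epsilon> U Fs comp]) blast
  let ?n = "1 + normHN N 3 (cube A) Ustar + normHN N 3 (cube A) Fstar"
  have n1: "?n \<ge> 1" using normHN_nonneg[of N 3 "cube A" Ustar] normHN_nonneg[of N 3 "cube A" Fstar] by linarith
  show "\<exists>\<delta>0 \<alpha> :: real. 0 < \<delta>0 \<and> \<delta>0 < 1 \<and> 0 < \<alpha> \<and> \<alpha> < 1/2 \<and>
        (\<forall>\<delta>. 0 < \<delta> \<and> \<delta> < \<delta>0 \<longrightarrow>
          (\<forall>(F::vfun) (\<phi>0::vfun) (\<phi>1::vfun) (Vmin::vfun).
            in_HN N 3 (cube A) F \<and>
            boundary_conditions A N F \<phi>0 \<phi>1 \<and>
            normHN N 2 (cube A) (\<lambda>m x. F m x - Fstar m x) \<le> \<delta> \<and>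
            is_arg_min (J_fun A b d N F (\<delta>\<^sup>2)) (in_H30bscN A N) Vmin \<longrightarrow>
            normHN N 2 (subcube A \<epsilon>) (\<lambda>m x. Vmin m x + F m x - Ustar m x)
              \<le> 1 * ?n * \<delta> powr \<alpha>))"
  proof (rule exI[of _ \<delta>0], rule exI[of _ \<alpha>], intro conjI allI impI r)
    fix \<delta> :: real and F \<phi>0 \<phi>1 Vmin :: vfun
    assume \<delta>: "0 < \<delta> \<and> \<delta> < \<delta>0" and h: "in_HN N 3 (cube A) F \<and> boundary_conditions A N F \<phi>0 \<phi>1 \<and>
      normHN N 2 (cube A) (\<lambda>m x. F m x - Fstar m x) \<le> \<delta> \<and> is_arg_min (J_fun A b d N F (\<delta>\<^sup>2)) (in_H30bscN A N) Vmin"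
    have "normHN N 2 (subcube A \<epsilon>) (\<lambda>m x. Vmin m x + F m x - Ustar m x) \<le> \<delta> powr \<alpha>"
      using \<delta> h by (intro rate) auto
    also have "\<dots> \<le> 1 * ?n * \<delta> powr \<alpha>" using mult_right_mono[OF n1, of "\<delta> powr \<alpha>"] by simp
    finally show "normHN N 2 (subcube A \<epsilon>) (\<lambda>m x. Vmin m x + F m x - Ustar m x) \<le> 1 * ?n * \<delta> powr \<alpha>" .
  qed
qed

end
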